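(* Let $k$ be an algebraically closed field and $R=k[s,t,u,v]$ with $\deg s=\deg t=(1,0)$, $\deg u=\deg v=(0,1)$. Assume that the bihomogeneous ideal $G=(g_1,\dots,g_n)\subseteq R$ has a Hilbert–Burch resolution with $n\times(n-1)$ syzygy matrix $\varphi$. Let $\mathbb F=(F_0,F_1,F_2)\subseteq T$, where $F_i=\sum_{j=1}^nH_{ji}g_j$ are the generic elements of $G$ of bidegrees $(a_i,b_i)$, and let $\Psi=[H_{ji}]$. Suppose that for every $\mathfrak p\in\mathrm{Spec}(R)\setminus\mathcal B$ with $\mathrm{ht}(\mathfrak p)=2$ there is an equality $\mathbb F_{\mathfrak p}=G_{\mathfrak p}$. Then the Eagon–Northcott complex $EN(\varphi\oplus\Psi)$ is a virtual resolution of the $T$-module $T/I_n(\varphi\oplus\Psi)$.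
   Context: $B=(s,t)\cap(u,v)$; $\mathcal B=\{\mathfrak p\in\mathrm{Spec}(R):B\subseteq\mathfrak p\}$. Hilbert–Burch resolution: $G$ has a bigraded free resolution $0\to\bigoplus_{i=1}^{n-1}R(-c_i,-d_i)\xrightarrow{\varphi}\bigoplus_{j=1}^{n}R(-k_j,-l_j)\xrightarrow{(g_1\cdots g_n)}G\to 0$, where $\deg g_j=(k_j,l_j)$ and $g_1,\dots,g_n$ are, up to sign and a unit, the maximal minors of $\varphi$. Generic elements: $(a_i,b_i)\in\mathbb N^2$ with $(a_i,b_i)\ge(k_j,l_j)$ entrywise for all $i,j$. $C=k[C_{ij}^\alpha]$ is the polynomial ring in indeterminates $C_{ij}^\alpha$ ($0\le i\le2$, $1\le j\le n$), where for each $i,j$ the index $\alpha$ enumerates the monomials $m_\alpha$ of a monomial basis of $R_{(a_i-k_j,b_i-l_j)}$; $T=R\otimes_kC$, bigraded by the grading of $R$ (elements of $C$ have bidegree $(0,0)$); $H_{ji}=\sum_\alpha C_{ij}^\alpha m_\alpha$. For $\mathfrak p\in\mathrm{Spec}(R)$, $\mathbb F_{\mathfrak p}$ and $G_{\mathfrak p}$ denote the ideals generated by $\mathbb F$ and $G$ in the localization of $T$ at the prime ideal $\mathfrak pT$. $\varphi\oplus\Psi$ is the $n\times(n+2)$ matrix concatenating the columns of $\varphi$ and $\Psi$; $I_n(\cdot)$ is the ideal of $n\times n$ minors. Eagon–Northcott complex: for a bigraded map of free modules $\alpha=(a_{ij}):\mathcal F\to\mathcal H$ with $\mathrm{rank}\,\mathcal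 F=r\ge q=\mathrm{rank}\,\mathcal H$, bases $X_1,\dots,X_r$ of $\mathcal F$ and $Y_1,\dots,Y_q$ indexing a basis of $\mathcal H$, $EN(\alpha)$ is $$0\to\textstyle\bigwedge^r\mathcal F\otimes S_{r-q}\to\cdots\to\bigwedge^{q+1}\mathcal F\otimes S_1\to\bigwedge^q\mathcal F\to T$$ (with bigraded twists making all maps of bidegree $(0,0)$), where $S_j$ is the free module on monomials of degree $j$ in $Y_1,\dots,Y_q$, the last map sends $X_{i_1}\wedge\cdots\wedge X_{i_q}$ to the maximal minor of $\alpha$ on columns $i_1,\dots,i_q$, and the other differentials send $\omega\otimes Y_1^{\nu_1}\cdots Y_q^{\nu_q}$ to $\sum_{j:\nu_j>0}\Delta_j(\omega)\otimes Y_1^{\nu_1}\cdots Y_j^{\nu_j-1}\cdots Y_q^{\nu_q}$, with $\Delta_j(X_{i_1}\wedge\cdots\wedge X_{i_m})=\sum_p(-1)^{p+1}a_{ji_p}X_{i_1}\wedge\cdots\widehat{X_{i_p}}\cdots\wedge X_{i_m}$. Virtual resolution: a bigraded complex $\mathbf F$ of free $T$-modules is a virtual resolution of a $T$-module $M$ if $H_0(\mathbf F)^{\mathrm{sat}}\cong M^{\mathrm{sat}}$ (saturation with respect to $BT$, i.e. global sections of the associated sheaf; this holds in particular when $H_0(\mathbf F)\cong M$) and for each $i>0$ the module $H_i(\mathbf F)$ is annihilated by a power of $BT$. *)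

theory Defs
  imports
    "HOL-Library.Poly_Mapping"
    "HOL-Library.Product_Plus"
    "HOL-Library.Extended_Nat"
    "HOL-Computational_Algebra.Polynomial"
    "HOL-Algebra.Ideal_Product"
    "Jordan_Normal_Form.Determinant"
    "Jordan_Normal_Form.DL_Submatrix"
begin

section \<open>Bigraded modules over a commutative ring\<close>

text \<open>
  A module record with a family of homogeneous pieces indexed by \<open>\<int>\<^sup>2\<close>.  A bigraded ring is
  represented by its regular module, where \<open>smult = mult\<close>, so that the same record serves as a
  ring (for ideals, prime ideals, ...) and as a module over itself.
\<close>

type_synonym bideg = "int \<times> int"

record ('a, 'm) bg_module = "('a, 'm) module" +
  piece :: "bideg \<Rightarrow> 'm set"

definition quot_mod :: "('a, 'm) bg_module \<Rightarrow> 'm set \<Rightarrow> ('a, 'm set) bg_module" where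
  "quot_mod M N =
    \<lparr> carrier = a_rcosets\<^bsub>M\<^esub> N, monoid.mult = undefined, one = undefined,
      zero = N, add = set_add M,
      module.smult = (\<lambda>r X. \<Union>x\<in>X. N +>\<^bsub>M\<^esub> (r \<odot>\<^bsub>M\<^esub> x)),
      piece = (\<lambda>d. (\<lambda>x. N +>\<^bsub>M\<^esub> x) ` piece M d) \<rparr>"

definition bg_iso :: "('a, 'c) ring_scheme \<Rightarrow> ('a, 'm) bg_module \<Rightarrow> ('a, 'n) bg_module \<Rightarrow> bool" where
  "bg_iso A M N \<longleftrightarrow>
    (\<exists>h. bij_betw h (carrier M) (carrier N)
      \<and> (\<forall>x\<in>carrier M. \<forall>y\<in>carrier M. h (x \<oplus>\<^bsub>M\<^esub> y) = h x \<oplus>\<^bsub>N\<^esub> h y)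
      \<and> (\<forall>r\<in>carrier A. \<forall>x\<in>carrier M. h (r \<odot>\<^bsub>M\<^esub> x) = r \<odot>\<^bsub>N\<^esub> h x)
      \<and> (\<forall>d. h ` piece M d = piece N d))"


section \<open>Localization and height\<close>

text \<open>
  \<open>fraction A S M m s\<close> is the fraction \<open>m / s\<close> in \<open>S\<^sup>-\<^sup>1M\<close>, as a class of pairs in
  \<open>carrier M \<times> S\<close>; \<open>S\<close> is a multiplicative subset of \<open>A\<close>.
\<close>

definition fraction :: "('a, 'c) ring_scheme \<Rightarrow> 'a set \<Rightarrow> ('a, 'm, 'd) module_scheme \<Rightarrow> 'm \<Rightarrow> 'a
    \<Rightarrow> ('m \<times> 'a) set" where
  "fraction A S M m s = {(m', s'). m' \<in> carrier M \<and> s' \<in> S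
      \<and> (\<exists>w\<in>S. w \<odot>\<^bsub>M\<^esub> (s' \<odot>\<^bsub>M\<^esub> m) = w \<odot>\<^bsub>M\<^esub> (s \<odot>\<^bsub>M\<^esub> m'))}"

definition fraction_add :: "('a, 'c) ring_scheme \<Rightarrow> 'a set \<Rightarrow> ('a, 'm, 'd) module_scheme
    \<Rightarrow> ('m \<times> 'a) set \<Rightarrow> ('m \<times> 'a) set \<Rightarrow> ('m \<times> 'a) set" where
  "fraction_add A S M X Y = (\<Union>(m, s)\<in>X. \<Union>(m', s')\<in>Y.
      fraction A S M (s' \<odot>\<^bsub>M\<^esub> m \<oplus>\<^bsub>M\<^esub> s \<odot>\<^bsub>M\<^esub> m') (s \<otimes>\<^bsub>A\<^esub> s'))"

text \<open>The localization of the ring \<open>A\<close> (given as its regular module) at the prime ideal \<open>P\<close>.\<close>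

definition loc_prime :: "('a, 'a, 'd) module_scheme \<Rightarrow> 'a set \<Rightarrow> ('a \<times> 'a) set ring" where
  "loc_prime A P = (let S = carrier A - P in
    \<lparr> carrier = {fraction A S A x s | x s. x \<in> carrier A \<and> s \<in> S},
      monoid.mult = (\<lambda>X Y. \<Union>(x, s)\<in>X. \<Union>(y, s')\<in>Y. fraction A S A (x \<otimes>\<^bsub>A\<^esub> y) (s \<otimes>\<^bsub>A\<^esub> s')),
      one = fraction A S A \<one>\<^bsub>A\<^esub> \<one>\<^bsub>A\<^esub>,
      zero = fraction A S A \<zero>\<^bsub>A\<^esub> \<one>\<^bsub>A\<^esub>,
      add = fraction_add A S A \<rparr>)"

definition loc_ideal :: "('a, 'a, 'd) module_scheme \<Rightarrow> 'a set \<Rightarrow> 'a set \<Rightarrow> ('a \<times> 'a) set set" where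
  "loc_ideal A P J = genideal (loc_prime A P) ((\<lambda>x. fraction A (carrier A - P) A x \<one>\<^bsub>A\<^esub>) ` J)"

definition powers :: "('a, 'c) ring_scheme \<Rightarrow> 'a \<Rightarrow> 'a set" where
  "powers A f = {f [^]\<^bsub>A\<^esub> k | k :: nat. True}"

text \<open>The bigraded module \<open>M\<^sub>f\<close> for an element \<open>f\<close> of bidegree \<open>(1, 1)\<close>.\<close>

definition loc_elem :: "('a, 'c) ring_scheme \<Rightarrow> 'a \<Rightarrow> ('a, 'm) bg_module
    \<Rightarrow> ('a, ('m \<times> 'a) set) bg_module" where
  "loc_elem A f M = (let S = powers A f in
    \<lparr> carrier = {fraction A S M m s | m s. m \<in> carrier M \<and> s \<in> S},
      monoid.mult = undefined, one = undefined,
      zero = fraction A S M \<zero>\<^bsub>M\<^esub> \<one>\<^bsub>A\<^esub>,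
      add = fraction_add A S M,
      module.smult = (\<lambda>r X. \<Union>(m, s)\<in>X. fraction A S M (r \<odot>\<^bsub>M\<^esub> m) s),
      piece = (\<lambda>d. {fraction A S M m (f [^]\<^bsub>A\<^esub> k) | m (k :: nat). m \<in> piece M (d + (int k, int k))}) \<rparr>)"

definition ht :: "('a, 'c) ring_scheme \<Rightarrow> 'a set \<Rightarrow> enat" where
  "ht A P = Sup {enat m | m. \<exists>c :: nat \<Rightarrow> 'a set.
      (\<forall>i\<le>m. primeideal (c i) A) \<and> (\<forall>i<m. c i \<subset> c (Suc i)) \<and> c m = P}"

definition ideal_pow :: "('a, 'c) ring_scheme \<Rightarrow> 'a set \<Rightarrow> nat \<Rightarrow> 'a set" where
  "ideal_pow A J N = (ideal_prod A J ^^ N) (carrier A)"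


section \<open>The polynomial rings \<open>R\<close> and \<open>T\<close>\<close>

datatype rvar = Vs | Vt | Vu | Vv

type_synonym rmon = "rvar \<Rightarrow>\<^sub>0 nat"
type_synonym 'k rpoly = "rmon \<Rightarrow>\<^sub>0 'k"

definition X :: "rvar \<Rightarrow> 'k::comm_ring_1 rpoly" where
  "X x = Poly_Mapping.single (Poly_Mapping.single x 1) 1"

definition mon_deg :: "rmon \<Rightarrow> bideg" where
  "mon_deg m = (int (Poly_Mapping.lookup m Vs + Poly_Mapping.lookup m Vt), int (Poly_Mapping.lookup m Vu + Poly_Mapping.lookup m Vv))"

definition R_piece :: "bideg \<Rightarrow> 'k::comm_ring_1 rpoly set" where
  "R_piece d = {f. \<forall>m\<in>Poly_Mapping.keys f. mon_deg m = d}"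

definition R_ring :: "('k::comm_ring_1 rpoly, 'k rpoly) bg_module" where
  "R_ring = \<lparr> carrier = UNIV, monoid.mult = (*), one = 1, zero = 0, add = (+), module.smult = (*),
      piece = R_piece \<rparr>"

definition B_ideal :: "'k::comm_ring_1 rpoly set" where
  "B_ideal = genideal R_ring {X Vs, X Vt} \<inter> genideal R_ring {X Vu, X Vv}"

text \<open>
  \<open>CV i j \<alpha>\<close> is the indeterminate \<open>C\<^sub>i\<^sub>j\<^sup>\<alpha>\<close>, where \<open>\<alpha>\<close> is a monomial of \<open>R\<close>; the indices \<open>i\<close> and
  \<open>j\<close> start at \<open>0\<close>.  Since \<open>R \<otimes>\<^sub>k k[C\<^sub>i\<^sub>j\<^sup>\<alpha>] = R[C\<^sub>i\<^sub>j\<^sup>\<alpha>]\<close>, elements of \<open>T\<close> are polynomials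
  in the \<open>C\<^sub>i\<^sub>j\<^sup>\<alpha>\<close> with coefficients in \<open>R\<close>.  The set of indeterminates that really occur depends
  on \<open>n\<close> and the bidegrees \<open>kl j = (k\<^sub>j, l\<^sub>j)\<close>, \<open>ab i = (a\<^sub>i, b\<^sub>i)\<close>; hence \<open>T\<close> is a subring of a type.
\<close>

datatype cvar = CV nat nat rmon

type_synonym 'k tpoly = "(cvar \<Rightarrow>\<^sub>0 nat) \<Rightarrow>\<^sub>0 'k rpoly"

definition zdeg :: "nat \<times> nat \<Rightarrow> bideg" where
  "zdeg d = (int (fst d), int (snd d))"

definition gen_mons :: "(nat \<Rightarrow> nat \<times> nat) \<Rightarrow> (nat \<Rightarrow> nat \<times> nat) \<Rightarrow> nat \<Rightarrow> nat \<Rightarrow> rmon set" where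
  "gen_mons kl ab i j = {\<alpha>. mon_deg \<alpha> = zdeg (ab i) - zdeg (kl j)}"

definition T_vars :: "nat \<Rightarrow> (nat \<Rightarrow> nat \<times> nat) \<Rightarrow> (nat \<Rightarrow> nat \<times> nat) \<Rightarrow> cvar set" where
  "T_vars n kl ab = {CV i j \<alpha> | i j \<alpha>. i < 3 \<and> j < n \<and> \<alpha> \<in> gen_mons kl ab i j}"

definition T_carrier :: "nat \<Rightarrow> (nat \<Rightarrow> nat \<times> nat) \<Rightarrow> (nat \<Rightarrow> nat \<times> nat)
    \<Rightarrow> 'k::comm_ring_1 tpoly set" where
  "T_carrier n kl ab = {f. \<forall>m\<in>Poly_Mapping.keys f. Poly_Mapping.keys m \<subseteq> T_vars n kl ab}"

definition T_ring :: "nat \<Rightarrow> (nat \<Rightarrow> nat \<times> nat) \<Rightarrow> (nat \<Rightarrow> nat \<times> nat)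
    \<Rightarrow> ('k::comm_ring_1 tpoly, 'k tpoly) bg_module" where
  "T_ring n kl ab = \<lparr> carrier = T_carrier n kl ab,
      monoid.mult = (*), one = 1, zero = 0, add = (+), module.smult = (*),
      piece = (\<lambda>d. {f \<in> T_carrier n kl ab. \<forall>m. Poly_Mapping.lookup f m \<in> R_piece d}) \<rparr>"

definition emb :: "'k::comm_ring_1 rpoly \<Rightarrow> 'k tpoly" where
  "emb f = Poly_Mapping.single 0 f"

definition ext_ideal :: "('k::comm_ring_1 tpoly, 'c) ring_scheme \<Rightarrow> 'k rpoly set \<Rightarrow> 'k tpoly set" where
  "ext_ideal A J = genideal A (emb ` J)"


section \<open>Hilbert--Burch resolution and generic elements\<close>

text \<open>
  \<open>0 \<rightarrow> \<Oplus>\<^sub>i R(-cd i) \<rightarrow> \<Oplus>\<^sub>j R(-kl j) \<rightarrow> G \<rightarrow> 0\<close> is a bigraded free resolution with maps \<open>\<phi>\<close>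
  and \<open>(g\<^sub>0, ..., g\<^sub>n\<^sub>-\<^sub>1)\<close>, and the \<open>g\<^sub>j\<close> are the maximal minors of \<open>\<phi>\<close> up to signs and a common unit.
  Exactness at \<open>G\<close> holds by definition of \<open>G\<close>.
\<close>

definition hilbert_burch :: "nat \<Rightarrow> 'k::comm_ring_1 rpoly mat \<Rightarrow> (nat \<Rightarrow> 'k rpoly)
    \<Rightarrow> (nat \<Rightarrow> nat \<times> nat) \<Rightarrow> (nat \<Rightarrow> bideg) \<Rightarrow> bool" where
  "hilbert_burch n \<phi> g kl cd \<longleftrightarrow>
    n \<ge> 1 \<and> \<phi> \<in> carrier_mat n (n - 1)
    \<and> (\<forall>j<n. g j \<in> R_piece (zdeg (kl j)))
    \<and> (\<forall>j<n. \<forall>i<n - 1. \<phi> $$ (j, i) \<in> R_piece (cd i - zdeg (kl j)))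
    \<and> (\<forall>v\<in>carrier_vec (n - 1). \<phi> *\<^sub>v v = 0\<^sub>v n \<longrightarrow> v = 0\<^sub>v (n - 1))
    \<and> (\<forall>w\<in>carrier_vec n. (\<Sum>j<n. g j * w $ j) = 0 \<longleftrightarrow> (\<exists>v\<in>carrier_vec (n - 1). w = \<phi> *\<^sub>v v))
    \<and> (\<exists>e. e dvd 1 \<and> (\<forall>j<n. \<exists>\<epsilon>\<in>{1, -1}. g j = \<epsilon> * e * det (submatrix \<phi> (- {j}) UNIV)))"

definition G_ideal :: "nat \<Rightarrow> (nat \<Rightarrow> 'k::comm_ring_1 rpoly) \<Rightarrow> 'k rpoly set" where
  "G_ideal n g = genideal R_ring (g ` {..<n})"

definition H :: "(nat \<Rightarrow> nat \<times> nat) \<Rightarrow> (nat \<Rightarrow> nat \<times> nat) \<Rightarrow> nat \<Rightarrow> nat \<Rightarrow> 'k::comm_ring_1 tpoly" where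
  "H kl ab j i = (\<Sum>\<alpha>\<in>gen_mons kl ab i j.
      Poly_Mapping.single (Poly_Mapping.single (CV i j \<alpha>) 1) 1 * emb (Poly_Mapping.single \<alpha> 1))"

definition generic_elem :: "nat \<Rightarrow> (nat \<Rightarrow> 'k::comm_ring_1 rpoly) \<Rightarrow> (nat \<Rightarrow> nat \<times> nat)
    \<Rightarrow> (nat \<Rightarrow> nat \<times> nat) \<Rightarrow> nat \<Rightarrow> 'k tpoly" where
  "generic_elem n g kl ab i = (\<Sum>j<n. H kl ab j i * emb (g j))"

definition FF_ideal :: "nat \<Rightarrow> (nat \<Rightarrow> 'k::comm_ring_1 rpoly) \<Rightarrow> (nat \<Rightarrow> nat \<times> nat)
    \<Rightarrow> (nat \<Rightarrow> nat \<times> nat) \<Rightarrow> 'k tpoly set" where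
  "FF_ideal n g kl ab = genideal (T_ring n kl ab) (generic_elem n g kl ab ` {..<3})"

definition Psi :: "nat \<Rightarrow> (nat \<Rightarrow> nat \<times> nat) \<Rightarrow> (nat \<Rightarrow> nat \<times> nat) \<Rightarrow> 'k::comm_ring_1 tpoly mat" where
  "Psi n kl ab = mat n 3 (\<lambda>(j, i). H kl ab j i)"

definition concat_cols :: "'a mat \<Rightarrow> 'a mat \<Rightarrow> 'a mat" where
  "concat_cols P Q = mat (dim_row P) (dim_col P + dim_col Q)
    (\<lambda>(j, i). if i < dim_col P then P $$ (j, i) else Q $$ (j, i - dim_col P))"

definition phi_Psi :: "nat \<Rightarrow> 'k::comm_ring_1 rpoly mat \<Rightarrow> (nat \<Rightarrow> nat \<times> nat)
    \<Rightarrow> (nat \<Rightarrow> nat \<times> nat) \<Rightarrow> 'k tpoly mat" where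
  "phi_Psi n \<phi> kl ab = concat_cols (map_mat emb \<phi>) (Psi n kl ab)"

definition phi_Psi_deg :: "nat \<Rightarrow> (nat \<Rightarrow> bideg) \<Rightarrow> (nat \<Rightarrow> nat \<times> nat) \<Rightarrow> nat \<Rightarrow> bideg" where
  "phi_Psi_deg n cd ab i = (if i < n - 1 then cd i else zdeg (ab (i - (n - 1))))"

definition max_minor :: "'a::comm_ring_1 mat \<Rightarrow> nat set \<Rightarrow> 'a" where
  "max_minor \<alpha> I = det (submatrix \<alpha> UNIV I)"

definition max_minors_ideal :: "('a::comm_ring_1, 'c) ring_scheme \<Rightarrow> 'a mat \<Rightarrow> 'a set" where
  "max_minors_ideal A \<alpha> =
    genideal A (max_minor \<alpha> ` {I. I \<subseteq> {..<dim_col \<alpha>} \<and> card I = dim_row \<alpha>})"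


section \<open>Bigraded complexes of free modules\<close>

text \<open>
  The free module on a basis \<open>E\<close> consists of the finitely supported functions on \<open>E\<close>; the basis
  element \<open>e\<close> sits in bidegree \<open>\<delta> e\<close>.  In a complex, \<open>bd p e\<close> is the image of the basis
  element \<open>e\<close> of the \<open>p\<close>-th module in the \<open>(p - 1)\<close>-st, for \<open>p \<ge> 1\<close>.
\<close>

definition scale :: "'a::comm_ring_1 \<Rightarrow> ('b \<Rightarrow>\<^sub>0 'a) \<Rightarrow> ('b \<Rightarrow>\<^sub>0 'a)" where
  "scale r x = Poly_Mapping.map (\<lambda>c. r * c) x"

definition free_mod :: "('a::comm_ring_1, 'a) bg_module \<Rightarrow> 'b set \<Rightarrow> ('b \<Rightarrow> bideg)
    \<Rightarrow> ('a, 'b \<Rightarrow>\<^sub>0 'a) bg_module" where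
  "free_mod A E \<delta> =
    \<lparr> carrier = {x. Poly_Mapping.keys x \<subseteq> E \<and> (\<forall>e. Poly_Mapping.lookup x e \<in> carrier A)},
      monoid.mult = undefined, one = undefined,
      zero = 0, add = (+), module.smult = scale,
      piece = (\<lambda>d. {x. Poly_Mapping.keys x \<subseteq> E \<and> (\<forall>e. Poly_Mapping.lookup x e \<in> carrier A)
                     \<and> (\<forall>e\<in>E. Poly_Mapping.lookup x e \<in> piece A (d - \<delta> e))}) \<rparr>"

record (overloaded) ('a::zero, 'b) free_complex =
  gens :: "nat \<Rightarrow> 'b set"
  gdeg :: "nat \<Rightarrow> 'b \<Rightarrow> bideg"
  bd :: "nat \<Rightarrow> 'b \<Rightarrow> ('b \<Rightarrow>\<^sub>0 'a)"

definition term_mod :: "('a::comm_ring_1, 'a) bg_module \<Rightarrow> ('a, 'b) free_complex \<Rightarrow> nat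
    \<Rightarrow> ('a, 'b \<Rightarrow>\<^sub>0 'a) bg_module" where
  "term_mod A F p = free_mod A (gens F p) (gdeg F p)"

definition differential :: "('a::comm_ring_1, 'b) free_complex \<Rightarrow> nat \<Rightarrow> ('b \<Rightarrow>\<^sub>0 'a) \<Rightarrow> ('b \<Rightarrow>\<^sub>0 'a)" where
  "differential F p x = (if p = 0 then 0 else (\<Sum>e\<in>Poly_Mapping.keys x. scale (Poly_Mapping.lookup x e) (bd F p e)))"

definition bg_free_complex :: "('a::comm_ring_1, 'a) bg_module \<Rightarrow> ('a, 'b) free_complex \<Rightarrow> bool" where
  "bg_free_complex A F \<longleftrightarrow>
    (\<forall>p. \<forall>e\<in>gens F (Suc p). bd F (Suc p) e \<in> piece (term_mod A F p) (gdeg F (Suc p) e))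
    \<and> (\<forall>p. \<forall>x\<in>carrier (term_mod A F (Suc p)).
          differential F p (differential F (Suc p) x) = 0)"

definition homology :: "('a::comm_ring_1, 'a) bg_module \<Rightarrow> ('a, 'b) free_complex \<Rightarrow> nat
    \<Rightarrow> ('a, ('b \<Rightarrow>\<^sub>0 'a) set) bg_module" where
  "homology A F p = (let M = term_mod A F p; Z = {x \<in> carrier M. differential F p x = 0} in
    quot_mod (M \<lparr> carrier := Z, piece := (\<lambda>d. piece M d \<inter> Z) \<rparr>)
      (differential F (Suc p) ` carrier (term_mod A F (Suc p))))"


section \<open>Saturation and virtual resolutions\<close>

text \<open>
  \<open>M\<^sup>s\<^sup>a\<^sup>t\<close> is the direct sum over all twists of the global sections of the sheaf associated with \<open>M\<close>
  on \<open>P\<^sup>1 \<times> P\<^sup>1 \<times> Spec C\<close>.  It is computed on the standard charts, on which one of \<open>s, t\<close> and one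
  of \<open>u, v\<close> are invertible: a section is a family of elements of the localizations of \<open>M\<close> at
  \<open>s u, s v, t u, t v\<close> that agree on the overlaps.  Finiteness of the cover makes the direct sum over
  the twists commute with the gluing condition; the piece of bidegree \<open>d\<close> is the contribution of
  the twist by \<open>d\<close>.
\<close>

definition charts :: "(rvar \<times> rvar) set" where
  "charts = {Vs, Vt} \<times> {Vu, Vv}"

definition chart_elem :: "rvar \<times> rvar \<Rightarrow> 'k::comm_ring_1 tpoly" where
  "chart_elem e = emb (X (fst e) * X (snd e))"

definition overlap :: "('k::comm_ring_1 tpoly, 'c) ring_scheme \<Rightarrow> rvar \<times> rvar \<Rightarrow> rvar \<times> rvar
    \<Rightarrow> 'k tpoly set" where
  "overlap A e e' = {x \<otimes>\<^bsub>A\<^esub> y | x y. x \<in> powers A (chart_elem e) \<and> y \<in> powers A (chart_elem e')}"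

definition sat_mod :: "('k::comm_ring_1 tpoly, 'c) ring_scheme \<Rightarrow> ('k tpoly, 'm) bg_module
    \<Rightarrow> ('k tpoly, rvar \<times> rvar \<Rightarrow> ('m \<times> 'k tpoly) set) bg_module" where
  "sat_mod A M = (let L = (\<lambda>e. loc_elem A (chart_elem e) M);
      \<Gamma> = {\<sigma> \<in> (\<Pi>\<^sub>E e\<in>charts. carrier (L e)). \<forall>e\<in>charts. \<forall>e'\<in>charts.
            \<forall>(m, s)\<in>\<sigma> e. \<forall>(m', s')\<in>\<sigma> e'.
              fraction A (overlap A e e') M m s = fraction A (overlap A e e') M m' s'} in
    \<lparr> carrier = \<Gamma>, monoid.mult = undefined, one = undefined,
      zero = (\<lambda>e\<in>charts. \<zero>\<^bsub>L e\<^esub>),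
      add = (\<lambda>\<sigma> \<tau>. \<lambda>e\<in>charts. \<sigma> e \<oplus>\<^bsub>L e\<^esub> \<tau> e),
      module.smult = (\<lambda>r \<sigma>. \<lambda>e\<in>charts. r \<odot>\<^bsub>L e\<^esub> \<sigma> e),
      piece = (\<lambda>d. {\<sigma> \<in> \<Gamma>. \<forall>e\<in>charts. \<sigma> e \<in> piece (L e) d}) \<rparr>)"

definition virtual_resolution :: "('k::comm_ring_1 tpoly, 'k tpoly) bg_module
    \<Rightarrow> ('k tpoly, 'b) free_complex \<Rightarrow> ('k tpoly, 'm) bg_module \<Rightarrow> bool" where
  "virtual_resolution A F M \<longleftrightarrow>
    bg_free_complex A F
    \<and> bg_iso A (sat_mod A (homology A F 0)) (sat_mod A M)
    \<and> (\<forall>p>0. \<exists>N. \<forall>b\<in>ideal_pow A (ext_ideal A B_ideal) N. \<forall>z\<in>carrier (homology A F p).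
          b \<odot>\<^bsub>homology A F p\<^esub> z = \<zero>\<^bsub>homology A F p\<^esub>)"


section \<open>The Eagon--Northcott complex\<close>

text \<open>
  For a \<open>q \<times> r\<close> matrix \<open>\<alpha>\<close> with columns in bidegrees \<open>\<xi> i\<close> and rows in bidegrees \<open>\<eta> j\<close>, the pair
  \<open>(I, \<nu>)\<close> with \<open>I = {i\<^sub>1 < ... < i\<^sub>m}\<close> stands for the basis element
  \<open>X\<^bsub>i\<^sub>1\<^esub> \<and> ... \<and> X\<^bsub>i\<^sub>m\<^esub> \<otimes> Y\<^sup>\<nu>\<close>, and \<open>({}, 0)\<close> in homological degree \<open>0\<close> for the basis \<open>1\<close> of the
  ring.  The bidegrees are those that make all maps of bidegree \<open>(0, 0)\<close>, the ring in degree \<open>0\<close>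
  being untwisted: \<open>(I, \<nu>)\<close> has bidegree \<open>\<Sum>\<^sub>i\<^sub>\<in>\<^sub>I \<xi> i - \<Sum>\<^sub>j (1 + \<nu>\<^sub>j) \<eta> j\<close>.
\<close>

type_synonym en_basis = "nat set \<times> (nat \<Rightarrow>\<^sub>0 nat)"

definition en_gens :: "'a mat \<Rightarrow> nat \<Rightarrow> en_basis set" where
  "en_gens \<alpha> p = (if p = 0 then {({}, 0)}
    else {(I, \<nu>). I \<subseteq> {..<dim_col \<alpha>} \<and> card I = dim_row \<alpha> + p - 1
            \<and> Poly_Mapping.keys \<nu> \<subseteq> {..<dim_row \<alpha>} \<and> (\<Sum>j<dim_row \<alpha>. Poly_Mapping.lookup \<nu> j) = p - 1})"

definition en_deg :: "'a mat \<Rightarrow> (nat \<Rightarrow> bideg) \<Rightarrow> (nat \<Rightarrow> bideg) \<Rightarrow> nat \<Rightarrow> en_basis \<Rightarrow> bideg" where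
  "en_deg \<alpha> \<xi> \<eta> p = (\<lambda>(I, \<nu>). if p = 0 then 0
    else (\<Sum>i\<in>I. \<xi> i) - (\<Sum>j<dim_row \<alpha>. (\<Sum>_\<le>Poly_Mapping.lookup \<nu> j. \<eta> j)))"

definition en_bd :: "'a::comm_ring_1 mat \<Rightarrow> nat \<Rightarrow> en_basis \<Rightarrow> (en_basis \<Rightarrow>\<^sub>0 'a)" where
  "en_bd \<alpha> p = (\<lambda>(I, \<nu>).
    if p = 1 then Poly_Mapping.single ({}, 0) (max_minor \<alpha> I)
    else (\<Sum>j\<in>Poly_Mapping.keys \<nu>. \<Sum>i\<in>I.
      Poly_Mapping.single (I - {i}, \<nu> - Poly_Mapping.single j 1)
        ((-1) ^ card {i'\<in>I. i' < i} * \<alpha> $$ (j, i))))"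

definition EN :: "'a::comm_ring_1 mat \<Rightarrow> (nat \<Rightarrow> bideg) \<Rightarrow> (nat \<Rightarrow> bideg)
    \<Rightarrow> ('a, en_basis) free_complex" where
  "EN \<alpha> \<xi> \<eta> = \<lparr> gens = en_gens \<alpha>, gdeg = en_deg \<alpha> \<xi> \<eta>, bd = en_bd \<alpha> \<rparr>"

end

theory Submission
  imports Defs "HOL-Algebra.QuotRing"
begin

text \<open>
  The Eagon--Northcott complex has length three, so three homology modules have to be killed by powers
  of \<open>f = x y\<close> for each chart, where \<open>x\<close> is one of \<open>s, t\<close> and \<open>y\<close> one of \<open>u, v\<close>.  Three partial
  annihilators are available: the third homology vanishes because some maximal minor is nonzero; each
  maximal minor kills the first homology; and \<open>g\<^sub>r f\<close> kills, up to powers, the first and the second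
  one, because there the rows other than the \<open>r\<close>-th split off and the row operation
  \<open>\<Sum>\<^sub>j g\<^sub>j a\<^sub>j = (0, ..., 0, F\<^sub>0, F\<^sub>1, F\<^sub>2)\<close> leaves the Koszul complex on \<open>F\<^sub>0, F\<^sub>1, F\<^sub>2\<close>, which is linear in
  independent indeterminates with coefficients dividing a power of \<open>g\<^sub>r f\<close>.

  Since \<open>(g\<^sub>1, ..., g\<^sub>n)\<close> has grade two (McCoy's theorem), the second homology is killed by powers of
  \<open>f\<close> alone.  The hypothesis, applied to the primes \<open>(x' - a x, y' - b y)\<close> of height two, shows that
  the coefficients in \<open>R\<close> of the maximal minors have no common zero on the chart, so by the
  Nullstellensatz in two variables a power of \<open>f\<close> lies in the ideal that they generate.  By
  Dedekind--Mertens the first homology, modulo what the grade argument controls, is then killed by a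
  power of \<open>f\<close> as well.  The exponents are uniform because \<open>T\<close> is noetherian.
\<close>


text \<open>Acyclicity criteria by depth are replaced by gluing. Grade two is used only as
  divisibility: if \<open>D\<close> divides every \<open>Y * g p\<close>, then \<open>D\<close>
  divides \<open>Y\<close>; hence a fraction with denominators \<open>g p ^ N\<close> for all
  \<open>p\<close> is a polynomial. In the second homology the preimages found over the various
  \<open>g p * f\<close> glue at once, the third differential being injective. In the first homology
  they agree only up to cycles, and the obstruction is a family of chains modulo Koszul
  coboundaries. The maximal minors kill it, but they are polynomials in the indeterminates, while
  the coboundaries come from a module over \<open>R\<close>; this is why annihilation by a
  polynomial is first turned into annihilation by its coefficients.

  All this takes place in the polynomial ring in all conceivable indeterminates, which is a type,
  and with exponents that depend on the cycle. Setting the foreign indeterminates to zero is a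
  retraction onto \<open>T\<close> that commutes with the differentials; only there does the chain
  condition make the exponents uniform.\<close>

abbreviation "lookup \<equiv> Poly_Mapping.lookup"
abbreviation "keys \<equiv> Poly_Mapping.keys"
abbreviation "single \<equiv> Poly_Mapping.single"

type_synonym ('v, 'a) mpoly = "('v \<Rightarrow>\<^sub>0 nat) \<Rightarrow>\<^sub>0 'a"

section \<open>Exterior algebra in coordinates\<close>

section \<open>Contraction and exterior multiplication\<close>

text \<open>A form is encoded by its coefficient function on all sets of indices, without any bound
  on size or support. The operators below are thus total, and \<open>graded\<close> adds a degree
  only where a degree argument needs one. \<open>sg i I\<close> is the sign of moving the basis
  vector \<open>i\<close> past the smaller members of \<open>I\<close>.\<close>

definition sg :: "nat \<Rightarrow> nat set \<Rightarrow> 'a::comm_ring_1" where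
  "sg i I = (-1) ^ card {k\<in>I. k < i}"

definition ctr1 :: "nat \<Rightarrow> (nat set \<Rightarrow> 'a::comm_ring_1) \<Rightarrow> nat set \<Rightarrow> 'a" where
  "ctr1 i \<omega> I = (if i \<in> I then 0 else sg i I * \<omega> (insert i I))"

definition wdg1 :: "nat \<Rightarrow> (nat set \<Rightarrow> 'a::comm_ring_1) \<Rightarrow> nat set \<Rightarrow> 'a" where
  "wdg1 i \<omega> I = (if i \<in> I then sg i I * \<omega> (I - {i}) else 0)"

definition ctr :: "nat \<Rightarrow> (nat \<Rightarrow> 'a) \<Rightarrow> (nat set \<Rightarrow> 'a::comm_ring_1) \<Rightarrow> nat set \<Rightarrow> 'a" where
  "ctr r a \<omega> I = (\<Sum>i<r. a i * ctr1 i \<omega> I)"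

definition wdg :: "nat \<Rightarrow> (nat \<Rightarrow> 'a) \<Rightarrow> (nat set \<Rightarrow> 'a::comm_ring_1) \<Rightarrow> nat set \<Rightarrow> 'a" where
  "wdg r v \<omega> I = (\<Sum>i<r. v i * wdg1 i \<omega> I)"

lemma sg_insert:
  assumes "k \<notin> I"
  shows "sg i (insert k I) = (if k < i then - sg i I else (sg i I :: 'a::comm_ring_1))"
proof (cases "k < i")
  case True
  have "{k'\<in>insert k I. k' < i} = insert k {k'\<in>I. k' < i}" using True by auto
  moreover have "finite {k'\<in>I. k' < i}" by (rule finite_subset[of _ "{..<i}"]) auto
  ultimately show ?thesis using assms True by (simp add: sg_def)
next
  case False
  then have "{k'\<in>insert k I. k' < i} = {k'\<in>I. k' < i}" by auto
  then show ?thesis using False by (simp add: sg_def)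
qed

lemma sg_self [simp]: "sg i (insert i I) = (sg i I :: 'a::comm_ring_1)" "sg i (I - {i}) = (sg i I :: 'a)"
proof -
  have "{k\<in>insert i I. k < i} = {k\<in>I. k < i}" "{k\<in>I - {i}. k < i} = {k\<in>I. k < i}" by auto
  then show "sg i (insert i I) = (sg i I :: 'a)" "sg i (I - {i}) = (sg i I :: 'a)"
    by (simp_all add: sg_def)
qed

lemma sg_square [simp]: "sg i I * sg i I = (1 :: 'a::comm_ring_1)" "sg i I * (sg i I * x) = (x :: 'a)"
proof -
  show *: "sg i I * sg i I = (1 :: 'a)"
    by (simp add: sg_def power_add [symmetric] flip: mult_2)
  show "sg i I * (sg i I * x) = x"
    using * by (simp flip: mult.assoc)
qed

lemma ctr1_same: "ctr1 i (ctr1 i \<omega>) I = 0"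
  by (simp add: ctr1_def)

lemma ctr1_anticommute: "i \<noteq> k \<Longrightarrow> ctr1 i (ctr1 k \<omega>) I = - ctr1 k (ctr1 i \<omega>) I"
  by (auto simp: ctr1_def sg_insert insert_commute mult_ac)

lemma ctr1_wdg1_same: "ctr1 i (wdg1 i \<omega>) I + wdg1 i (ctr1 i \<omega>) I = \<omega> I"
  by (auto simp: ctr1_def wdg1_def insert_absorb)

lemma ctr1_wdg1_anticommute:
  assumes "i \<noteq> k"
  shows "ctr1 i (wdg1 k \<omega>) I = - wdg1 k (ctr1 i \<omega>) I"
proof (cases "k \<in> I \<and> i \<notin> I")
  case True
  then obtain J where J: "I = insert k J" "k \<notin> J" "i \<notin> J" by (metis Set.set_insert insert_iff)
  have "insert i (insert k J) - {k} = insert i J" using J assms by auto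
  then show ?thesis using J assms by (auto simp: ctr1_def wdg1_def sg_insert insert_commute mult_ac)
next
  case False
  then show ?thesis using assms by (auto simp: ctr1_def wdg1_def)
qed

lemma ctr1_linear: "ctr1 i (\<lambda>I. c * \<omega> I + d * \<omega>' I) I = c * ctr1 i \<omega> I + d * ctr1 i \<omega>' I"
  by (simp add: ctr1_def algebra_simps)

lemma wdg1_linear: "wdg1 i (\<lambda>I. c * \<omega> I + d * \<omega>' I) I = c * wdg1 i \<omega> I + d * wdg1 i \<omega>' I"
  by (simp add: wdg1_def algebra_simps)

lemma ctr1_sum: "ctr1 i (\<lambda>I. \<Sum>j\<in>S. c j * f j I) I = (\<Sum>j\<in>S. c j * ctr1 i (f j) I)"
  by (simp add: ctr1_def sum_distrib_left mult_ac)

lemma wdg1_sum: "wdg1 i (\<lambda>I. \<Sum>j\<in>S. c j * f j I) I = (\<Sum>j\<in>S. c j * wdg1 i (f j) I)"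
  by (simp add: wdg1_def sum_distrib_left mult_ac)

lemma ctr_sum: "ctr r a (\<lambda>I. \<Sum>j\<in>S. c j * f j I) I = (\<Sum>j\<in>S. c j * ctr r a (f j) I)"
  unfolding ctr_def ctr1_sum sum_distrib_left by (subst sum.swap) (simp add: mult_ac)

lemma wdg_sum: "wdg r a (\<lambda>I. \<Sum>j\<in>S. c j * f j I) I = (\<Sum>j\<in>S. c j * wdg r a (f j) I)"
  unfolding wdg_def wdg1_sum sum_distrib_left by (subst sum.swap) (simp add: mult_ac)

lemma ctr_linear: "ctr r a (\<lambda>I. c * \<omega> I + d * \<omega>' I) I = c * ctr r a \<omega> I + d * ctr r a \<omega>' I"
  by (simp add: ctr_def ctr1_linear sum.distrib sum_distrib_left algebra_simps)

lemma wdg_linear: "wdg r a (\<lambda>I. c * \<omega> I + d * \<omega>' I) I = c * wdg r a \<omega> I + d * wdg r a \<omega>' I"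
  by (simp add: wdg_def wdg1_linear sum.distrib sum_distrib_left algebra_simps)

lemma ctr_scale: "ctr r a (\<lambda>I. c * \<omega> I) I = c * ctr r a \<omega> I"
  using ctr_linear[of r a c \<omega> 0 \<omega>] by simp

lemma wdg_scale: "wdg r a (\<lambda>I. c * \<omega> I) I = c * wdg r a \<omega> I"
  using wdg_linear[of r a c \<omega> 0 \<omega>] by simp

lemma ctr_minus: "ctr r a (\<lambda>I. - \<omega> I) I = - ctr r a \<omega> I"
  using ctr_scale[of r a "-1" \<omega>] by simp

lemma ctr_diff: "ctr r a (\<lambda>I. \<omega> I - \<omega>' I) I = ctr r a \<omega> I - ctr r a \<omega>' I"
  using ctr_linear[of r a 1 \<omega> "-1" \<omega>'] by simp

lemma ctr_zero [simp]: "ctr r a (\<lambda>I. 0) I = 0"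
  using ctr_scale[of r a 0 "\<lambda>_. 0"] by simp

lemma wdg_zero [simp]: "wdg r a (\<lambda>I. 0) I = 0"
  using wdg_scale[of r a 0 "\<lambda>_. 0"] by simp

lemma ctr_functional: "ctr r (\<lambda>i. \<Sum>j\<in>S. c j * a j i) \<omega> I = (\<Sum>j\<in>S. c j * ctr r (a j) \<omega> I)"
  unfolding ctr_def sum_distrib_left sum_distrib_right by (subst sum.swap) (simp add: mult_ac)

text \<open>The vanishing diagonal is a hypothesis of its own because in characteristic two
  antisymmetry does not force it.\<close>

lemma alternating_double_sum:
  fixes f :: "nat \<Rightarrow> nat \<Rightarrow> 'a::ab_group_add"
  assumes "\<And>i. f i i = 0" "\<And>i k. i \<noteq> k \<Longrightarrow> f i k = - f k i"
  shows "(\<Sum>i<r. \<Sum>k<r. f i k) = 0"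
proof (induction r)
  case (Suc r)
  have "(\<Sum>i<r. f i r) = (\<Sum>i<r. - f r i)" by (rule sum.cong) (auto intro: assms(2))
  then show ?case using Suc by (simp add: sum.distrib assms(1) sum_negf)
qed simp

lemma ctr_ctr: "ctr r a (ctr r b \<omega>) I = (\<Sum>i<r. \<Sum>k<r. a i * b k * ctr1 i (ctr1 k \<omega>) I)"
proof -
  have "ctr r a (ctr r b \<omega>) I = ctr r a (\<lambda>I. \<Sum>k<r. b k * ctr1 k \<omega> I) I"
    by (simp add: ctr_def [abs_def])
  also have "\<dots> = (\<Sum>k<r. b k * ctr r a (ctr1 k \<omega>) I)" by (rule ctr_sum)
  also have "\<dots> = (\<Sum>i<r. \<Sum>k<r. a i * b k * ctr1 i (ctr1 k \<omega>) I)"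
    unfolding ctr_def sum_distrib_left by (subst sum.swap) (simp add: mult_ac)
  finally show ?thesis .
qed

lemma ctr_same [simp]: "ctr r a (ctr r a \<omega>) I = 0"
  unfolding ctr_ctr
proof (rule alternating_double_sum)
  fix i k :: nat assume "i \<noteq> k"
  then have "ctr1 i (ctr1 k \<omega>) I = - ctr1 k (ctr1 i \<omega>) I" by (rule ctr1_anticommute)
  then show "a i * a k * ctr1 i (ctr1 k \<omega>) I = - (a k * a i * ctr1 k (ctr1 i \<omega>) I)" by simp
qed (simp add: ctr1_same)

lemma ctr_anticommute: "ctr r a (ctr r b \<omega>) I = - ctr r b (ctr r a \<omega>) I"
proof -
  have "(\<Sum>i<r. \<Sum>k<r. a i * b k * ctr1 i (ctr1 k \<omega>) I + b i * a k * ctr1 i (ctr1 k \<omega>) I) = 0"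
  proof (rule alternating_double_sum)
    fix i k :: nat assume "i \<noteq> k"
    then have "ctr1 i (ctr1 k \<omega>) I = - ctr1 k (ctr1 i \<omega>) I" by (rule ctr1_anticommute)
    then show "a i * b k * ctr1 i (ctr1 k \<omega>) I + b i * a k * ctr1 i (ctr1 k \<omega>) I
      = - (a k * b i * ctr1 k (ctr1 i \<omega>) I + b k * a i * ctr1 k (ctr1 i \<omega>) I)"
      by (simp add: algebra_simps)
  qed (simp add: ctr1_same)
  then have "ctr r a (ctr r b \<omega>) I + ctr r b (ctr r a \<omega>) I = 0"
    by (simp add: ctr_ctr sum.distrib)
  then show ?thesis by (simp add: eq_neg_iff_add_eq_0)
qed

text \<open>The Clifford relation, from which all homotopies below come: if a vector pairs to a
  scalar with one row and to zero with the others, wedging with it inverts the contraction with that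
  row up to the scalar.\<close>

lemma ctr_wdg: "ctr r a (wdg r v \<omega>) I = (\<Sum>i<r. a i * v i) * \<omega> I - wdg r v (ctr r a \<omega>) I"
proof -
  have 1: "ctr r a (wdg r v \<omega>) I = (\<Sum>i<r. \<Sum>k<r. a i * v k * ctr1 i (wdg1 k \<omega>) I)"
  proof -
    have "ctr r a (wdg r v \<omega>) I = ctr r a (\<lambda>I. \<Sum>k<r. v k * wdg1 k \<omega> I) I"
      by (simp add: wdg_def [abs_def])
    also have "\<dots> = (\<Sum>k<r. v k * ctr r a (wdg1 k \<omega>) I)" by (rule ctr_sum)
    also have "\<dots> = (\<Sum>i<r. \<Sum>k<r. a i * v k * ctr1 i (wdg1 k \<omega>) I)"
      unfolding ctr_def sum_distrib_left by (subst sum.swap) (simp add: mult_ac)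
    finally show ?thesis .
  qed
  have 2: "wdg r v (ctr r a \<omega>) I = (\<Sum>i<r. \<Sum>k<r. a i * v k * wdg1 k (ctr1 i \<omega>) I)"
  proof -
    have "wdg r v (ctr r a \<omega>) I = wdg r v (\<lambda>I. \<Sum>i<r. a i * ctr1 i \<omega> I) I"
      by (simp add: ctr_def [abs_def])
    also have "\<dots> = (\<Sum>i<r. a i * wdg r v (ctr1 i \<omega>) I)" by (rule wdg_sum)
    also have "\<dots> = (\<Sum>i<r. \<Sum>k<r. a i * v k * wdg1 k (ctr1 i \<omega>) I)"
      unfolding wdg_def sum_distrib_left by (simp add: mult_ac)
    finally show ?thesis .
  qed
  have "ctr r a (wdg r v \<omega>) I + wdg r v (ctr r a \<omega>) I
      = (\<Sum>i<r. \<Sum>k<r. a i * v k * (ctr1 i (wdg1 k \<omega>) I + wdg1 k (ctr1 i \<omega>) I))"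
    unfolding 1 2 by (simp add: sum.distrib distrib_left)
  also have "\<dots> = (\<Sum>i<r. \<Sum>k<r. if k = i then a i * v i * \<omega> I else 0)"
    by (intro sum.cong) (auto simp: ctr1_wdg1_same ctr1_wdg1_anticommute)
  also have "\<dots> = (\<Sum>i<r. a i * v i) * \<omega> I"
    by (simp add: sum_distrib_right)
  finally show ?thesis by (simp add: algebra_simps)
qed

lemma wdg_ctr: "wdg r v (ctr r a \<omega>) I = (\<Sum>i<r. a i * v i) * \<omega> I - ctr r a (wdg r v \<omega>) I"
  by (simp add: ctr_wdg)

lemma wdg_zero_fun [simp]: "wdg r a (\<lambda>I. 0) = (\<lambda>I. 0)" "ctr r a (\<lambda>I. 0) = (\<lambda>I. 0)"
  by (rule ext, simp)+

text \<open>\<open>ctrs r a [j\<^sub>1, ..., j\<^sub>m]\<close> is the composite of the contractions with \<open>a j\<^sub>1\<close>, ..., \<open>a j\<^sub>m\<close>, the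
  last one being applied first, whereas \<open>wdgs\<close> applies the first one first, so that the two undo
  each other.\<close>

primrec ctrs :: "nat \<Rightarrow> (nat \<Rightarrow> nat \<Rightarrow> 'a) \<Rightarrow> nat list \<Rightarrow> (nat set \<Rightarrow> 'a::comm_ring_1) \<Rightarrow> nat set \<Rightarrow> 'a" where
  "ctrs r a [] \<omega> = \<omega>"
| "ctrs r a (j # js) \<omega> = ctr r (a j) (ctrs r a js \<omega>)"

primrec wdgs :: "nat \<Rightarrow> (nat \<Rightarrow> nat \<Rightarrow> 'a) \<Rightarrow> nat list \<Rightarrow> (nat set \<Rightarrow> 'a::comm_ring_1) \<Rightarrow> nat set \<Rightarrow> 'a" where
  "wdgs r v [] \<omega> = \<omega>"
| "wdgs r v (j # js) \<omega> = wdgs r v js (wdg r (v j) \<omega>)"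

lemma ctrs_sum: "ctrs r a js (\<lambda>I. \<Sum>j\<in>S. c j * f j I) = (\<lambda>I. \<Sum>j\<in>S. c j * ctrs r a js (f j) I)"
proof (induction js)
  case (Cons j js)
  show ?case by (rule ext) (simp add: Cons ctr_sum)
qed simp

lemma ctrs_scale: "ctrs r a js (\<lambda>I. c * \<omega> I) = (\<lambda>I. c * ctrs r a js \<omega> I)"
proof (induction js)
  case (Cons j js)
  show ?case by (rule ext) (simp add: Cons ctr_scale)
qed simp

lemma wdgs_linear: "wdgs r v js (\<lambda>I. c * \<omega> I + d * \<omega>' I) = (\<lambda>I. c * wdgs r v js \<omega> I + d * wdgs r v js \<omega>' I)"
proof (induction js arbitrary: \<omega> \<omega>')
  case (Cons j js)
  have "wdg r (v j) (\<lambda>I. c * \<omega> I + d * \<omega>' I) = (\<lambda>I. c * wdg r (v j) \<omega> I + d * wdg r (v j) \<omega>' I)"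
    by (rule ext) (rule wdg_linear)
  then show ?case by (simp add: Cons)
qed simp

lemma wdgs_scale: "wdgs r v js (\<lambda>I. c * \<omega> I) = (\<lambda>I. c * wdgs r v js \<omega> I)"
  using wdgs_linear[of r v js c \<omega> 0 \<omega>] by simp

lemma wdgs_zero [simp]: "wdgs r v js (\<lambda>I. 0) = (\<lambda>I. 0)"
  using wdgs_scale[of r v js 0 "\<lambda>_. 0"] by simp

lemma ctrs_append: "ctrs r a (js @ ks) \<omega> = ctrs r a js (ctrs r a ks \<omega>)"
  by (induction js) auto

lemma ctr_ctrs: "ctr r b (ctrs r a js \<omega>) = (\<lambda>I. (-1) ^ length js * ctrs r a js (ctr r b \<omega>) I)"
proof (induction js)
  case (Cons j js)
  have "ctr r b (ctrs r a (j # js) \<omega>) I = - ctr r (a j) (ctr r b (ctrs r a js \<omega>)) I" for I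
    by (simp add: ctr_anticommute[of r b])
  then show ?case by (simp add: Cons ctr_scale fun_eq_iff)
qed simp

lemma wdgs_ctr:
  assumes "\<And>j. j \<in> set js \<Longrightarrow> (\<Sum>i<r. b i * v j i) = 0"
  shows "wdgs r v js (ctr r b \<omega>) = (\<lambda>I. (-1) ^ length js * ctr r b (wdgs r v js \<omega>) I)"
  using assms
proof (induction js arbitrary: \<omega>)
  case (Cons j js)
  have "wdg r (v j) (ctr r b \<omega>) = (\<lambda>I. (-1) * ctr r b (wdg r (v j) \<omega>) I)"
    using Cons.prems[of j] by (auto simp: wdg_ctr fun_eq_iff)
  then have "wdgs r v (j # js) (ctr r b \<omega>) = (\<lambda>I. (-1) * wdgs r v js (ctr r b (wdg r (v j) \<omega>)) I)"
    by (simp only: wdgs.simps wdgs_scale)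
  also have "\<dots> = (\<lambda>I. (-1) ^ length (j # js) * ctr r b (wdgs r v (j # js) \<omega>) I)"
    using Cons by (auto simp: fun_eq_iff)
  finally show ?case .
qed simp

text \<open>The rightmost contraction is moved to the left past those in between until it meets its
  twin, and contraction squares to zero.\<close>

lemma ctrs_member_zero:
  assumes "j \<in> set js"
  shows "ctrs r a js (ctr r (a j) \<omega>) = (\<lambda>I. 0)"
proof -
  obtain xs ys where js: "js = xs @ j # ys" using assms by (metis split_list)
  have "ctrs r a js (ctr r (a j) \<omega>) = ctrs r a xs (ctr r (a j) (ctrs r a ys (ctr r (a j) \<omega>)))"
    by (simp add: js ctrs_append)
  also have "ctrs r a ys (ctr r (a j) \<omega>) = (\<lambda>I. (-1) ^ length ys * ctr r (a j) (ctrs r a ys \<omega>) I)"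
    by (simp add: ctr_ctrs fun_eq_iff flip: mult.assoc power_add mult_2)
  also have "ctr r (a j) \<dots> = (\<lambda>I. 0)" by (simp add: fun_eq_iff ctr_scale)
  also have "ctrs r a xs (\<lambda>I. 0) = (\<lambda>I. 0)" using ctrs_scale[of r a xs 0 "\<lambda>_. 0"] by simp
  finally show ?thesis .
qed

text \<open>The Clifford relation replaces an adjacent pair of wedge and contraction by
  \<open>m\<close> and a correction \<open>ctr r (a j) \<theta>\<close>. The correction travels
  outwards through the remaining wedges, whose vectors are orthogonal to \<open>a j\<close>, and so
  ends up in the image of a contraction with a row.\<close>

lemma wdgs_ctrs:
  assumes "\<And>j k. j \<in> set js \<Longrightarrow> k \<in> set js \<Longrightarrow> (\<Sum>i<r. a j i * v k i) = (if j = k then m else 0)"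
    and "distinct js"
  shows "\<exists>\<eta>. \<forall>I. wdgs r v js (ctrs r a js \<omega>) I = m ^ length js * \<omega> I + (\<Sum>j\<in>set js. ctr r (a j) (\<eta> j) I)"
  using assms
proof (induction js arbitrary: \<omega>)
  case (Cons j js)
  let ?\<theta> = "wdg r (v j) (ctrs r a js \<omega>)"
  have nj: "j \<notin> set js" using Cons.prems by auto
  have "\<exists>\<eta>. \<forall>I. wdgs r v js (ctrs r a js \<omega>) I = m ^ length js * \<omega> I + (\<Sum>j\<in>set js. ctr r (a j) (\<eta> j) I)"
    by (rule Cons.IH) (use Cons.prems in auto)
  then obtain \<eta> where \<eta>: "\<And>I. wdgs r v js (ctrs r a js \<omega>) I = m ^ length js * \<omega> I + (\<Sum>j\<in>set js. ctr r (a j) (\<eta> j) I)"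
    by blast
  have "wdg r (v j) (ctr r (a j) (ctrs r a js \<omega>)) = (\<lambda>I. m * ctrs r a js \<omega> I + (-1) * ctr r (a j) ?\<theta> I)"
    using Cons.prems(1)[of j j] by (simp add: wdg_ctr fun_eq_iff)
  then have 1: "wdgs r v (j # js) (ctrs r a (j # js) \<omega>) I
      = m * wdgs r v js (ctrs r a js \<omega>) I + (-1) * wdgs r v js (ctr r (a j) ?\<theta>) I" for I
    by (simp only: wdgs.simps ctrs.simps wdgs_linear)
  have 2: "wdgs r v js (ctr r (a j) ?\<theta>) = (\<lambda>I. (-1) ^ length js * ctr r (a j) (wdgs r v js ?\<theta>) I)"
    using Cons.prems(1)[of j] nj by (intro wdgs_ctr) auto
  have *: "wdgs r v (j # js) (ctrs r a (j # js) \<omega>) I = m ^ length (j # js) * \<omega> I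
      + (\<Sum>j\<in>set js. ctr r (a j) (\<lambda>I. m * \<eta> j I) I) + ctr r (a j) (\<lambda>I. (-1) ^ Suc (length js) * wdgs r v js ?\<theta> I) I" for I
    unfolding 1 2 \<eta> ctr_scale by (simp add: sum_distrib_left algebra_simps)
  define \<eta>' where "\<eta>' = (\<lambda>k. if k = j then (\<lambda>I. (-1) ^ Suc (length js) * wdgs r v js ?\<theta> I) else (\<lambda>I. m * \<eta> k I))"
  have "(\<Sum>k\<in>set js. ctr r (a k) (\<eta>' k) I) = (\<Sum>k\<in>set js. ctr r (a k) (\<lambda>I. m * \<eta> k I) I)" for I
    by (rule sum.cong) (use nj in \<open>auto simp: \<eta>'_def\<close>)
  moreover have "\<eta>' j = (\<lambda>I. (-1) ^ Suc (length js) * wdgs r v js ?\<theta> I)" by (simp add: \<eta>'_def)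
  ultimately have "wdgs r v (j # js) (ctrs r a (j # js) \<omega>) I = m ^ length (j # js) * \<omega> I
      + (\<Sum>k\<in>set (j # js). ctr r (a k) (\<eta>' k) I)" for I
    unfolding * list.set sum.insert[OF finite_set nj] by (simp only: ac_simps)
  then show ?case by blast
qed auto

text \<open>The bound \<open>c\<close> may be smaller than the number \<open>r\<close> of columns.
  It then says that the form involves the first \<open>c\<close> basis vectors only, so that it is
  zero as soon as its degree exceeds \<open>c\<close>.\<close>

definition graded :: "nat \<Rightarrow> nat \<Rightarrow> (nat set \<Rightarrow> 'a::zero) \<Rightarrow> bool" where
  "graded c d \<omega> \<longleftrightarrow> (\<forall>I. \<omega> I \<noteq> 0 \<longrightarrow> I \<subseteq> {..<c} \<and> card I = d)"

lemma graded_ctr: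
  assumes "graded c (Suc d) \<omega>"
  shows "graded c d (ctr r a \<omega>)"
  unfolding graded_def
proof (intro allI impI)
  fix I assume "ctr r a \<omega> I \<noteq> 0"
  then obtain i where "a i * ctr1 i \<omega> I \<noteq> 0"
    unfolding ctr_def by (rule sum.not_neutral_contains_not_neutral)
  then have i: "i \<notin> I" "\<omega> (insert i I) \<noteq> 0" by (auto simp: ctr1_def split: if_splits)
  then have *: "insert i I \<subseteq> {..<c}" "card (insert i I) = Suc d"
    using assms unfolding graded_def by blast+
  have "finite I" using finite_subset[OF *(1)] by simp
  then show "I \<subseteq> {..<c} \<and> card I = d" using * i(1) by simp
qed

lemma graded_wdg:
  assumes "graded c d \<omega>" "\<And>i. i < r \<Longrightarrow> c \<le> i \<Longrightarrow> v i = 0"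
  shows "graded c (Suc d) (wdg r v \<omega>)"
  unfolding graded_def
proof (intro allI impI)
  fix I assume "wdg r v \<omega> I \<noteq> 0"
  then obtain i where i: "i \<in> {..<r}" "v i * wdg1 i \<omega> I \<noteq> 0"
    unfolding wdg_def by (rule sum.not_neutral_contains_not_neutral)
  then have nz: "v i \<noteq> 0" "i \<in> I" "\<omega> (I - {i}) \<noteq> 0" by (auto simp: wdg1_def split: if_splits)
  have *: "I - {i} \<subseteq> {..<c}" "card (I - {i}) = d" using assms(1) nz(3) unfolding graded_def by blast+
  have "i < c" using assms(2)[of i] i(1) nz(1) by (cases "i < c") auto
  have "finite (I - {i})" using finite_subset[OF *(1)] by simp
  then have "finite I" by simp
  then have "card I = Suc (card (I - {i}))" using nz(2) by (rule card.remove)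
  then have "card I = Suc d" by (simp only: *(2))
  moreover have "I \<subseteq> {..<c}" using *(1) \<open>i < c\<close> by blast
  ultimately show "I \<subseteq> {..<c} \<and> card I = Suc d" by blast
qed

lemma graded_ctrs: "graded c (length js + d) \<omega> \<Longrightarrow> graded c d (ctrs r a js \<omega>)"
  by (induction js arbitrary: d) (auto intro!: graded_ctr)

lemma graded_wdgs:
  "graded c d \<omega> \<Longrightarrow> (\<And>i j. j \<in> set js \<Longrightarrow> i < r \<Longrightarrow> c \<le> i \<Longrightarrow> v j i = 0)
    \<Longrightarrow> graded c (length js + d) (wdgs r v js \<omega>)"
proof (induction js arbitrary: \<omega> d)
  case (Cons j js)
  have "graded c (Suc d) (wdg r (v j) \<omega>)" using Cons.prems by (intro graded_wdg) auto
  then have "graded c (length js + Suc d) (wdgs r v js (wdg r (v j) \<omega>))"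
    using Cons.prems(2) by (intro Cons.IH) auto
  then show ?case by simp
qed simp

lemma graded_eq_zero:
  assumes "graded c d \<omega>" "c < d"
  shows "\<omega> = (\<lambda>I. 0)"
proof (intro ext, rule ccontr)
  fix I assume "\<omega> I \<noteq> 0"
  then have "I \<subseteq> {..<c}" "card I = d" using assms by (auto simp: graded_def)
  then show False using card_mono[of "{..<c}" I] assms(2) by simp
qed

lemma graded_0:
  assumes "graded c 0 \<omega>" "I \<noteq> {}"
  shows "\<omega> I = 0"
proof (rule ccontr)
  assume "\<omega> I \<noteq> 0"
  then have "I \<subseteq> {..<c}" "card I = 0" using assms by (auto simp: graded_def)
  then show False using assms(2) finite_subset[of I "{..<c}"] by simp
qed

section \<open>Explicit homotopies for the three homology modules\<close>

section \<open>Exactness of the Eagon--Northcott complex up to torsion\<close>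

text \<open>The contraction of an \<open>n\<close>-form with all \<open>n\<close> rows is a 0-form,
  so its vanishing at the empty set makes it zero altogether. Undoing the contractions by vectors
  dual to the rows then leaves \<open>m ^ n * \<omega>\<close> as a sum of boundaries.\<close>

lemma H1_minor:
  fixes a :: "nat \<Rightarrow> nat \<Rightarrow> 'a::comm_ring_1"
  assumes dual: "\<And>j k. j < n \<Longrightarrow> k < n \<Longrightarrow> (\<Sum>i<r. a j i * v k i) = (if j = k then m else 0)"
    and gr: "graded r n \<omega>" and cyc: "ctrs r a [0..<n] \<omega> {} = 0"
  shows "\<exists>\<eta>. \<forall>I. m ^ n * \<omega> I = (\<Sum>j<n. ctr r (a j) (\<eta> j) I)"
proof -
  have "graded r 0 (ctrs r a [0..<n] \<omega>)" using gr by (intro graded_ctrs) simp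
  then have z: "ctrs r a [0..<n] \<omega> = (\<lambda>I. 0)" using cyc graded_0 by (metis (no_types, lifting) ext)
  have "\<exists>\<eta>. \<forall>I. wdgs r v [0..<n] (ctrs r a [0..<n] \<omega>) I
      = m ^ length [0..<n] * \<omega> I + (\<Sum>j\<in>set [0..<n]. ctr r (a j) (\<eta> j) I)"
    by (rule wdgs_ctrs) (auto simp: dual)
  then obtain \<eta> where \<eta>: "\<And>I. 0 = m ^ n * \<omega> I + (\<Sum>j<n. ctr r (a j) (\<eta> j) I)"
    unfolding z by (auto simp: atLeast0LessThan)
  have "m ^ n * \<omega> I = (\<Sum>j<n. ctr r (a j) (\<lambda>I. - \<eta> j I) I)" for I
    using \<eta>[of I] by (simp add: ctr_minus sum_negf eq_neg_iff_add_eq_0)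
  then show ?thesis by (intro exI allI)
qed

text \<open>The forms \<open>S j\<close> have top degree, so wedging with \<open>v l\<close> kills
  them, and the Clifford relation turns the cycle condition into \<open>m * S l = 0\<close>.\<close>

lemma H3_injective:
  fixes a :: "nat \<Rightarrow> nat \<Rightarrow> 'a::idom"
  assumes dual: "\<And>j k. j < n \<Longrightarrow> k < n \<Longrightarrow> (\<Sum>i<r. a j i * v k i) = (if j = k then m else 0)"
    and "m \<noteq> 0" and gr: "\<And>j. j < n \<Longrightarrow> graded r r (S j)"
    and cyc: "\<And>I. (\<Sum>j<n. ctr r (a j) (S j) I) = 0" and "l < n"
  shows "S l I = 0"
proof -
  have "wdg r (v l) (S j) = (\<lambda>I. 0)" if "j < n" for j
    using gr[OF that] by (intro graded_eq_zero[of r "Suc r"] graded_wdg) auto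
  then have *: "wdg r (v l) (ctr r (a j) (S j)) I = (if j = l then m * S l I else 0)" if "j < n" for j
    using that \<open>l < n\<close> by (simp add: wdg_ctr dual)
  have "0 = wdg r (v l) (\<lambda>I. \<Sum>j<n. 1 * ctr r (a j) (S j) I) I" by (simp add: cyc)
  also have "\<dots> = (\<Sum>j<n. wdg r (v l) (ctr r (a j) (S j)) I)" 
    using wdg_sum[of r "v l" "\<lambda>_. 1" "\<lambda>j. ctr r (a j) (S j)" "{..<n}" I] by simp
  also have "\<dots> = m * S l I" using \<open>l < n\<close> by (simp add: *)
  finally show ?thesis using \<open>m \<noteq> 0\<close> by simp
qed

text \<open>Up to powers of \<open>q\<close>, the first Koszul homology of \<open>F\<^sub>0, F\<^sub>1\<close> and of \<open>F\<^sub>0, F\<^sub>1, F\<^sub>2\<close> vanishes.\<close>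

definition koszul_regular :: "'a::comm_ring_1 \<Rightarrow> (nat \<Rightarrow> 'a) \<Rightarrow> bool" where
  "koszul_regular q F \<longleftrightarrow> F 0 \<noteq> 0
    \<and> (\<forall>s t. F 1 * s = F 0 * t \<longrightarrow> (\<exists>N u. q ^ N * s = F 0 * u))
    \<and> (\<forall>t. (\<Sum>i<3. F i * t i) = 0 \<longrightarrow> (\<exists>N x y z. q ^ N * t 0 = - F 1 * x - F 2 * y
          \<and> q ^ N * t 1 = F 0 * x - F 2 * z \<and> q ^ N * t 2 = F 0 * y + F 1 * z))"

definition unit_vec :: "nat \<Rightarrow> nat \<Rightarrow> 'a::comm_ring_1" where
  "unit_vec x i = (if i = x then 1 else 0)"

lemma wdg_unit_vec: "x < r \<Longrightarrow> wdg r (unit_vec x) \<omega> I = wdg1 x \<omega> I"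
  unfolding wdg_def unit_vec_def by (simp add: if_distrib[of "\<lambda>z. z * _"] cong: if_cong)

lemma unit_vec_dot: "x < r \<Longrightarrow> (\<Sum>i<r. b i * unit_vec x i) = b x"
  unfolding unit_vec_def by (simp add: if_distrib[of "\<lambda>z. _ * z"] cong: if_cong)

lemma graded_unit_wdg: "x < r \<Longrightarrow> graded r d \<omega> \<Longrightarrow> graded r (Suc d) (wdg r (unit_vec x) \<omega>)"
  by (rule graded_wdg) auto

text \<open>A form of degree \<open>r - 1\<close>, where \<open>r = c + 3\<close>, is a vector
  \<open>t\<close> in disguise, and a vanishing contraction with \<open>b\<close> means that the two
  by two minors of \<open>b\<close> and \<open>t\<close> vanish. Regularity of the pair
  \<open>b c\<close>, \<open>b (c + 1)\<close> then makes the factor of proportionality an element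
  \<open>u\<close> of the ring, up to a power of \<open>q\<close>.\<close>

lemma top_cycle:
  fixes b :: "nat \<Rightarrow> 'a::idom"
  assumes b0: "\<And>i. i < c \<Longrightarrow> b i = 0" and reg: "koszul_regular q (\<lambda>i. b (c + i))"
    and gr: "graded (c + 3) (c + 2) \<omega>" and cyc: "\<And>I. ctr (c + 3) b \<omega> I = 0"
  shows "\<exists>N u. \<forall>I. q ^ N * \<omega> I = ctr (c + 3) b (\<lambda>I. if I = {..<c + 3} then u else 0) I"
proof -
  let ?r = "c + 3" let ?T = "{..<c + 3}"
  define t where "t x = wdg1 x \<omega> ?T" for x
  \<comment> \<open>Wedging the cycle condition with two unit vectors exceeds the top degree, and
    only the scalars of the Clifford relation survive.\<close>
  have sym: "b y * t x = b x * t y" if "x < ?r" "y < ?r" for x y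
  proof -
    let ?x = "unit_vec x :: nat \<Rightarrow> 'a" and ?y = "unit_vec y :: nat \<Rightarrow> 'a"
    have gy: "graded ?r ?r (wdg ?r ?y \<omega>)"
      using graded_unit_wdg[OF that(2) gr] by (simp add: numeral_3_eq_3)
    have z: "wdg ?r ?x (wdg ?r ?y \<omega>) = (\<lambda>I. 0)"
      using graded_unit_wdg[OF that(1) gy] by (intro graded_eq_zero) auto
    have "wdg ?r ?y (ctr ?r b \<omega>) = (\<lambda>I. b y * \<omega> I + (-1) * ctr ?r b (wdg ?r ?y \<omega>) I)"
      using that by (simp add: wdg_ctr unit_vec_dot fun_eq_iff)
    moreover have "ctr ?r b \<omega> = (\<lambda>I. 0)" using cyc by auto
    ultimately have "(\<lambda>I. b y * \<omega> I + (-1) * ctr ?r b (wdg ?r ?y \<omega>) I) = (\<lambda>I. 0)" by simp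
    then have "0 = wdg ?r ?x (\<lambda>I. b y * \<omega> I + (-1) * ctr ?r b (wdg ?r ?y \<omega>) I) ?T" by simp
    also have "\<dots> = b y * wdg ?r ?x \<omega> ?T - b x * wdg ?r ?y \<omega> ?T"
      unfolding wdg_linear using that by (simp add: wdg_ctr unit_vec_dot z)
    finally show ?thesis using that by (simp add: wdg_unit_vec t_def)
  qed
  have F0: "b c \<noteq> 0" using reg by (auto simp: koszul_regular_def)
  have t0: "t x = 0" if "x < c" for x
    using sym[of x c] F0 b0[OF that] that by simp
  obtain N u where u: "q ^ N * t c = b c * u"
    using reg sym[of c "c + 1"] unfolding koszul_regular_def by fastforce
  have tx: "q ^ N * t x = b x * u" if "x < ?r" for x
  proof -
    have "b c * (q ^ N * t x) = q ^ N * (b c * t x)" by (simp add: mult_ac)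
    also have "\<dots> = q ^ N * (b x * t c)" using sym[of x c] that by simp
    also have "\<dots> = b x * (q ^ N * t c)" by (simp add: mult_ac)
    also have "\<dots> = b c * (b x * u)" unfolding u by (simp add: mult_ac)
    finally show ?thesis using F0 by simp
  qed
  define X where "X = (\<lambda>I. if I = ?T then u else 0)"
  have gX: "graded ?r ?r X" by (auto simp: graded_def X_def)
  have gbX: "graded ?r (c + 2) (ctr ?r b X)"
    using gX by (intro graded_ctr) (simp add: numeral_3_eq_3)
  have "q ^ N * \<omega> I = ctr ?r b X I" for I
  proof (cases "I \<subseteq> ?T \<and> card I = c + 2")
    case False
    then have "\<omega> I = 0" "ctr ?r b X I = 0" using gr gbX unfolding graded_def by blast+
    then show ?thesis by simp
  next
    case True
    have "card (?T - I) = 1" using True card_Diff_subset[of I ?T] finite_subset[of I ?T] by auto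
    then obtain x where "?T - I = {x}" by (meson card_1_singletonE)
    then have x: "x < ?r" "I = ?T - {x}" using True by auto
    have z: "wdg ?r (unit_vec x) X = (\<lambda>I. 0)"
      using graded_unit_wdg[OF x(1) gX] by (intro graded_eq_zero) auto
    have "wdg1 x (ctr ?r b X) ?T = b x * u"
      using wdg_ctr[of ?r "unit_vec x" b X ?T] x(1)
      by (simp only: z wdg_unit_vec unit_vec_dot ctr_zero) (simp add: X_def)
    also have "\<dots> = q ^ N * wdg1 x \<omega> ?T" using tx[OF x(1)] by (simp add: t_def)
    finally have "sg x ?T * ctr ?r b X I = sg x ?T * (q ^ N * \<omega> I)"
      using x by (simp add: wdg1_def mult_ac)
    from arg_cong[OF this, of "\<lambda>z. sg x ?T * z"] show ?thesis by (simp only: sg_square)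
  qed
  then show ?thesis unfolding X_def by blast
qed

text \<open>The rows other than \<open>p\<close> split off: wedging with their dual vectors yields
  \<open>S\<close>. What remains in row \<open>p\<close> is a cycle for \<open>a p\<close> alone,
  and \<open>top_cycle\<close> bounds it. \<open>S\<close> has to be symmetric because
  \<open>S k j\<close> will be the coefficient of the product of the \<open>k\<close>-th and the
  \<open>j\<close>-th variable of the symmetric power.\<close>

lemma H2_torsion_reduced:
  fixes a :: "nat \<Rightarrow> nat \<Rightarrow> 'a::idom"
  assumes p: "p < n" and r: "r = c + 3"
    and dual: "\<And>j k. j < n \<Longrightarrow> k < n \<Longrightarrow> k \<noteq> p \<Longrightarrow> (\<Sum>i<r. a j i * v k i) = (if j = k then \<delta> else 0)"
    and b0: "\<And>i. i < c \<Longrightarrow> a p i = 0" and reg: "koszul_regular q (\<lambda>i. a p (c + i))"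
    and dvd: "\<delta> dvd q" "q \<noteq> 0"
    and gr: "\<And>j. j < n \<Longrightarrow> graded r (c + 2) (\<omega> j)"
    and cyc: "\<And>I. (\<Sum>j<n. ctr r (a j) (\<omega> j) I) = 0"
  shows "\<exists>N S. (\<forall>j k. S j k = S k j) \<and> (\<forall>k<n. \<forall>I. q ^ N * \<omega> k I = (\<Sum>j<n. ctr r (a j) (S k j) I))"
proof -
  have d0: "\<delta> \<noteq> 0" using dvd by auto
  \<comment> \<open>Symmetry dictates the entries \<open>S p j\<close>. No vector is dual to row
    \<open>p\<close>, so \<open>S p p\<close> is zero for now; the missing entry is supplied by
    \<open>top_cycle\<close> at the end.\<close>
  define S where "S k j = (if k \<noteq> p then wdg r (v k) (\<omega> j) else if j \<noteq> p then wdg r (v j) (\<omega> p) else (\<lambda>I. 0))" for k j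
  have eq: "\<delta> * \<omega> k I = (\<Sum>j<n. ctr r (a j) (S k j) I)" if "k < n" "k \<noteq> p" for k I
  proof -
    have "0 = wdg r (v k) (\<lambda>I. \<Sum>j<n. 1 * ctr r (a j) (\<omega> j) I) I" by (simp add: cyc)
    also have "\<dots> = (\<Sum>j<n. wdg r (v k) (ctr r (a j) (\<omega> j)) I)" by (subst wdg_sum) simp
    also have "\<dots> = (\<Sum>j<n. (if j = k then \<delta> * \<omega> k I else 0) - ctr r (a j) (S k j) I)"
      using that by (intro sum.cong refl) (auto simp: wdg_ctr dual S_def)
    also have "\<dots> = \<delta> * \<omega> k I - (\<Sum>j<n. ctr r (a j) (S k j) I)"
      using that by (simp add: sum_subtractf)
    finally show ?thesis by simp
  qed
  \<comment> \<open>Wedge the equation for \<open>\<omega> k\<close> with \<open>v l\<close>: the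
    forms \<open>S k j\<close> have top degree, so only the scalar of the Clifford relation is left,
    namely \<open>\<delta> * S k l\<close>.\<close>
  have sym: "wdg r (v l) (\<omega> k) I = wdg r (v k) (\<omega> l) I" if kl: "k < n" "k \<noteq> p" "l < n" "l \<noteq> p" for k l I
  proof -
    have z: "wdg r (v l) (S k j) = (\<lambda>I. 0)" if "j < n" for j
    proof -
      have "graded r r (S k j)" using graded_wdg[OF gr[OF that], of r "v k"] kl r by (simp add: S_def numeral_3_eq_3)
      then show ?thesis by (intro graded_eq_zero[of r "Suc r"] graded_wdg) auto
    qed
    have "\<delta> * wdg r (v l) (\<omega> k) I = wdg r (v l) (\<lambda>I. \<delta> * \<omega> k I) I" by (simp add: wdg_scale)
    also have "\<dots> = wdg r (v l) (\<lambda>I. \<Sum>j<n. 1 * ctr r (a j) (S k j) I) I" using kl by (simp add: eq)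
    also have "\<dots> = (\<Sum>j<n. wdg r (v l) (ctr r (a j) (S k j)) I)" by (subst wdg_sum) simp
    also have "\<dots> = (\<Sum>j<n. if j = l then \<delta> * S k l I else 0)"
      using kl by (intro sum.cong refl) (auto simp: wdg_ctr dual z)
    also have "\<dots> = \<delta> * wdg r (v k) (\<omega> l) I" using kl by (simp add: S_def)
    finally show ?thesis using d0 by simp
  qed
  have S_sym: "S k j = S j k" if "k < n" "j < n" for k j
    using sym[of j k] that by (auto simp: S_def fun_eq_iff)
  define \<omega>' where "\<omega>' I = \<delta> * \<omega> p I - (\<Sum>j<n. ctr r (a j) (S p j) I)" for I
  have ctr_row: "ctr r (a k) (\<lambda>I. \<delta> * \<omega> k I) I = (\<Sum>j<n. ctr r (a k) (ctr r (a j) (S k j)) I)"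
    if "k < n" "k \<noteq> p" for k I
  proof -
    have "(\<lambda>I. \<delta> * \<omega> k I) = (\<lambda>I. \<Sum>j<n. 1 * ctr r (a j) (S k j) I)" using that by (simp add: eq)
    then show ?thesis using ctr_sum[of r "a k" "\<lambda>_. 1" "\<lambda>j. ctr r (a j) (S k j)" "{..<n}" I] by simp
  qed
  \<comment> \<open>\<open>S\<close> is symmetric while contractions anticommute. Together with
    \<open>ctr_row\<close> this isolates the contribution of row \<open>p\<close> and shows that
    \<open>\<omega>'\<close> is a cycle for it.\<close>
  have alt: "(\<Sum>k<n. \<Sum>j<n. ctr r (a k) (ctr r (a j) (S k j)) I) = 0" for I
  proof -
    have "(\<Sum>k<n. \<Sum>j<n. ctr r (a k) (ctr r (a j) (S k j)) I)
        = (\<Sum>k<n. \<Sum>j<n. if k < n \<and> j < n then ctr r (a k) (ctr r (a j) (S k j)) I else 0)"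
      by (intro sum.cong) auto
    also have "\<dots> = 0"
    proof (rule alternating_double_sum)
      fix i k :: nat
      show "(if i < n \<and> k < n then ctr r (a i) (ctr r (a k) (S i k)) I else 0)
        = - (if k < n \<and> i < n then ctr r (a k) (ctr r (a i) (S k i)) I else 0)"
        using S_sym[of i k] ctr_anticommute[of r "a i" "a k" "S i k" I] by auto
    qed simp
    finally show ?thesis .
  qed
  have cyc': "ctr r (a p) \<omega>' I = 0" for I
  proof -
    have "0 = (\<Sum>k<n. ctr r (a k) (\<lambda>I. \<delta> * \<omega> k I) I)"
      by (simp add: ctr_scale cyc flip: sum_distrib_left)
    also have "\<dots> = ctr r (a p) (\<lambda>I. \<delta> * \<omega> p I) I + (\<Sum>k\<in>{..<n} - {p}. ctr r (a k) (\<lambda>I. \<delta> * \<omega> k I) I)"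
      using p by (simp add: sum.remove)
    also have "(\<Sum>k\<in>{..<n} - {p}. ctr r (a k) (\<lambda>I. \<delta> * \<omega> k I) I)
        = (\<Sum>k\<in>{..<n} - {p}. \<Sum>j<n. ctr r (a k) (ctr r (a j) (S k j)) I)"
      by (intro sum.cong refl ctr_row) auto
    also have "\<dots> = - (\<Sum>j<n. ctr r (a p) (ctr r (a j) (S p j)) I)"
      using alt[of I] p sum.remove[of "{..<n}" p "\<lambda>k. \<Sum>j<n. ctr r (a k) (ctr r (a j) (S k j)) I"]
      by (simp add: eq_neg_iff_add_eq_0 add.commute)
    also have "(\<Sum>j<n. ctr r (a p) (ctr r (a j) (S p j)) I) = ctr r (a p) (\<lambda>I. \<Sum>j<n. ctr r (a j) (S p j) I) I"
      using ctr_sum[of r "a p" "\<lambda>_. 1" "\<lambda>j. ctr r (a j) (S p j)" "{..<n}" I] by simp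
    finally show ?thesis
      unfolding \<omega>'_def [abs_def] ctr_diff by simp
  qed
  have gS: "graded r r (S p j)" if "j < n" for j
  proof (cases "j = p")
    case False
    then show ?thesis using graded_wdg[OF gr[OF p], of r "v j"] r by (simp add: S_def numeral_3_eq_3)
  qed (simp add: S_def graded_def)
  have "graded r (c + 2) \<omega>'"
    unfolding graded_def
  proof (intro allI impI)
    fix I assume "\<omega>' I \<noteq> 0"
    then have "\<omega> p I \<noteq> 0 \<or> (\<exists>j<n. ctr r (a j) (S p j) I \<noteq> 0)"
      unfolding \<omega>'_def by (auto intro: ccontr)
    moreover have "graded r (c + 2) (ctr r (a j) (S p j))" if "j < n" for j
      using gS[OF that] r by (intro graded_ctr) (simp add: numeral_3_eq_3)
    ultimately show "I \<subseteq> {..<r} \<and> card I = c + 2" using gr[OF p] unfolding graded_def by blast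
  qed
  then obtain N u where u: "\<And>I. q ^ N * \<omega>' I = ctr r (a p) (\<lambda>I. if I = {..<r} then u else 0) I"
    using top_cycle[of c "a p" q \<omega>'] b0 reg cyc' unfolding r by blast
  obtain e where e: "q = \<delta> * e" using dvd by auto
  \<comment> \<open>The factor \<open>e\<close>, with \<open>q = \<delta> * e\<close>, compensates
    for the factor \<open>\<delta>\<close> in the equations. Outside the range of rows the entries
    are zero, so that symmetry holds without bounds on the indices.\<close>
  define S' where "S' k j = (if k = p \<and> j = p then (\<lambda>I. e * (if I = {..<r} then u else 0))
    else if k < n \<and> j < n then (\<lambda>I. e * q ^ N * S k j I) else (\<lambda>I. 0))" for k j
  have "S' k j = S' j k" for k j using S_sym[of k j] by (auto simp: S'_def)
  moreover have "q ^ Suc N * \<omega> k I = (\<Sum>j<n. ctr r (a j) (S' k j) I)" if "k < n" for k I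
  proof (cases "k = p")
    case False
    have "q ^ Suc N * \<omega> k I = e * q ^ N * (\<Sum>j<n. ctr r (a j) (S k j) I)"
      using eq[OF that False, of I] by (simp add: e mult_ac flip: eq)
    also have "\<dots> = (\<Sum>j<n. ctr r (a j) (S' k j) I)"
      unfolding sum_distrib_left using that False by (intro sum.cong refl) (simp add: S'_def ctr_scale)
    finally show ?thesis .
  next
    case True
    have "q ^ Suc N * \<omega> p I = e * q ^ N * (\<delta> * \<omega> p I)" by (simp add: e mult_ac)
    also have "\<delta> * \<omega> p I = \<omega>' I + (\<Sum>j<n. ctr r (a j) (S p j) I)" by (simp add: \<omega>'_def)
    also have "e * q ^ N * \<dots> = e * (q ^ N * \<omega>' I) + (\<Sum>j<n. e * q ^ N * ctr r (a j) (S p j) I)"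
      by (simp add: algebra_simps sum_distrib_left)
    also have "\<dots> = ctr r (a p) (S' p p) I + (\<Sum>j<n. e * q ^ N * ctr r (a j) (S p j) I)"
      by (simp add: u S'_def ctr_scale)
    also have "(\<Sum>j<n. e * q ^ N * ctr r (a j) (S p j) I) = (\<Sum>j\<in>{..<n}-{p}. e * q ^ N * ctr r (a j) (S p j) I)"
      by (rule sum.mono_neutral_right) (auto simp: S_def)
    also have "\<dots> = (\<Sum>j\<in>{..<n}-{p}. ctr r (a j) (S' p j) I)"
      using p by (intro sum.cong refl) (simp add: S'_def ctr_scale)
    finally show ?thesis using p True by (simp add: sum.remove)
  qed
  ultimately show ?thesis by blast
qed

text \<open>Row \<open>p\<close> is replaced by the combination \<open>b\<close> of all rows with
  coefficients \<open>g\<close>, at the price of a factor \<open>g p\<close>. Since \<open>b\<close>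
  vanishes in the first \<open>c\<close> columns and the vectors \<open>v\<close> live there,
  \<open>b\<close> is orthogonal to all of them, as the reduced version demands.\<close>

lemma H2_torsion:
  fixes a :: "nat \<Rightarrow> nat \<Rightarrow> 'a::idom"
  assumes p: "p < n" and r: "r = c + 3"
    and dual: "\<And>j k. j < n \<Longrightarrow> k < n \<Longrightarrow> j \<noteq> p \<Longrightarrow> k \<noteq> p \<Longrightarrow> (\<Sum>i<r. a j i * v k i) = (if j = k then \<delta> else 0)"
    and v0: "\<And>k i. k < n \<Longrightarrow> c \<le> i \<Longrightarrow> i < r \<Longrightarrow> v k i = 0"
    and b0: "\<And>i. i < c \<Longrightarrow> (\<Sum>j<n. g j * a j i) = 0"
    and reg: "koszul_regular q (\<lambda>i. \<Sum>j<n. g j * a j (c + i))"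
    and dvd: "\<delta> dvd q" "g p dvd q" "q \<noteq> 0"
    and gr: "\<And>j. j < n \<Longrightarrow> graded r (c + 2) (\<omega> j)"
    and cyc: "\<And>I. (\<Sum>j<n. ctr r (a j) (\<omega> j) I) = 0"
  shows "\<exists>N S. (\<forall>j k. S j k = S k j) \<and> (\<forall>k<n. \<forall>I. q ^ N * \<omega> k I = (\<Sum>j<n. ctr r (a j) (S k j) I))"
proof -
  define b where "b = (\<lambda>i. \<Sum>j<n. g j * a j i)"
  define a' where "a' j = (if j = p then b else a j)" for j
  define \<alpha> :: "nat \<Rightarrow> 'a" where "\<alpha> j = (if j = p then 0 else 1)" for j
  \<comment> \<open>The transpose of the row operation, inverted up to \<open>g p\<close>: it is
    chosen so that \<open>g p * \<omega> k\<close> equals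
    \<open>\<alpha> k * \<omega>' k + g k * \<omega>' p\<close>.\<close>
  define \<omega>' where "\<omega>' j = (if j = p then \<omega> p else (\<lambda>I. g p * \<omega> j I - g j * \<omega> p I))" for j
  have row_op: "(\<Sum>j<n. ctr r (a' j) (\<psi> j) I) = (\<Sum>j<n. ctr r (a j) (\<lambda>I. \<alpha> j * \<psi> j I + g j * \<psi> p I) I)" for \<psi> I
  proof -
    have "(\<Sum>j<n. ctr r (a' j) (\<psi> j) I) = ctr r b (\<psi> p) I + (\<Sum>j\<in>{..<n}-{p}. ctr r (a j) (\<psi> j) I)"
      using p by (simp add: sum.remove a'_def)
    also have "(\<Sum>j\<in>{..<n}-{p}. ctr r (a j) (\<psi> j) I) = (\<Sum>j<n. \<alpha> j * ctr r (a j) (\<psi> j) I)"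
      using p by (simp add: sum.remove \<alpha>_def)
    also have "ctr r b (\<psi> p) I = (\<Sum>j<n. g j * ctr r (a j) (\<psi> p) I)"
      unfolding b_def by (rule ctr_functional)
    finally show ?thesis by (simp add: ctr_linear sum.distrib)
  qed
  have \<omega>: "g p * \<omega> k I = \<alpha> k * \<omega>' k I + g k * \<omega>' p I" for k I
    by (simp add: \<omega>'_def \<alpha>_def)
  have dual': "(\<Sum>i<r. a' j i * v k i) = (if j = k then \<delta> else 0)" if "j < n" "k < n" "k \<noteq> p" for j k
  proof (cases "j = p")
    case True
    have "(\<Sum>i<r. a' j i * v k i) = 0"
    proof (rule sum.neutral, rule ballI)
      fix i assume "i \<in> {..<r}"
      then show "a' j i * v k i = 0" using True b0[of i] v0[OF that(2), of i]
        by (cases "i < c") (auto simp: a'_def b_def)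
    qed
    then show ?thesis using True that by simp
  qed (use that dual in \<open>auto simp: a'_def\<close>)
  have "\<exists>N S. (\<forall>j k. S j k = S k j) \<and> (\<forall>k<n. \<forall>I. q ^ N * \<omega>' k I = (\<Sum>j<n. ctr r (a' j) (S k j) I))"
  proof (rule H2_torsion_reduced[OF p r dual'])
    show "graded r (c + 2) (\<omega>' j)" if "j < n" for j
      unfolding graded_def
    proof (intro allI impI)
      fix I assume "\<omega>' j I \<noteq> 0"
      then have "\<omega> j I \<noteq> 0 \<or> \<omega> p I \<noteq> 0" by (auto simp: \<omega>'_def split: if_splits)
      then show "I \<subseteq> {..<r} \<and> card I = c + 2" using gr[OF that] gr[OF p] unfolding graded_def by blast
    qed
    show "(\<Sum>j<n. ctr r (a' j) (\<omega>' j) I) = 0" for I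
    proof -
      have "(\<Sum>j<n. ctr r (a' j) (\<omega>' j) I) = (\<Sum>j<n. ctr r (a j) (\<lambda>I. g p * \<omega> j I) I)"
        unfolding row_op \<omega> ..
      also have "\<dots> = g p * (\<Sum>j<n. ctr r (a j) (\<omega> j) I)" by (simp add: ctr_scale sum_distrib_left)
      finally show ?thesis by (simp add: cyc)
    qed
  qed (use dvd reg b0 in \<open>auto simp: a'_def b_def\<close>)
  then obtain N S where S: "\<And>j k. S j k = S k j"
      "\<And>k I. k < n \<Longrightarrow> q ^ N * \<omega>' k I = (\<Sum>j<n. ctr r (a' j) (S k j) I)"
    by blast
  obtain e where e: "q = g p * e" using dvd by auto
  \<comment> \<open>The row operation acts on both indices of \<open>S\<close>, which preserves
    symmetry; \<open>e\<close> turns the factor \<open>g p\<close> into \<open>q\<close>.\<close>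
  define T where "T k j = (\<lambda>I. e * (\<alpha> k * (\<alpha> j * S k j I + g j * S k p I) + g k * (\<alpha> j * S p j I + g j * S p p I)))" for k j
  have "T j k = T k j" for j k
    unfolding T_def S(1)[of j k] S(1)[of p k] S(1)[of p j] by (rule ext) (simp add: algebra_simps)
  moreover have "q ^ Suc N * \<omega> k I = (\<Sum>j<n. ctr r (a j) (T k j) I)" if "k < n" for k I
  proof -
    have "q ^ Suc N * \<omega> k I = e * q ^ N * (g p * \<omega> k I)" by (simp add: e mult_ac)
    also have "\<dots> = e * (\<alpha> k * (q ^ N * \<omega>' k I) + g k * (q ^ N * \<omega>' p I))"
      unfolding \<omega> by (simp add: algebra_simps)
    also have "\<dots> = e * (\<alpha> k * (\<Sum>j<n. ctr r (a j) (\<lambda>I. \<alpha> j * S k j I + g j * S k p I) I)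
        + g k * (\<Sum>j<n. ctr r (a j) (\<lambda>I. \<alpha> j * S p j I + g j * S p p I) I))"
      using that p by (simp only: S(2) row_op)
    also have "\<dots> = (\<Sum>j<n. ctr r (a j) (T k j) I)"
      unfolding T_def ctr_scale ctr_linear[of r _ "\<alpha> k" "\<lambda>I. \<alpha> _ * S k _ I + g _ * S k p I" "g k" "\<lambda>I. \<alpha> _ * S p _ I + g _ * S p p I"]
      by (simp add: sum.distrib sum_distrib_left distrib_left)
    finally show ?thesis .
  qed
  ultimately show ?thesis by blast
qed

text \<open>Contracting with all rows except \<open>p\<close> leaves a 1-form \<open>\<tau>\<close>
  that is killed by \<open>b\<close>. As the last three entries of \<open>b\<close> are Koszul
  regular, a power of \<open>q\<close> makes \<open>\<tau>\<close> a contraction with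
  \<open>b\<close> plus a 1-form in the first \<open>c\<close> coordinates. Wedging back with
  \<open>c\<close> vectors from these coordinates kills the latter by degree, while the former
  expands into contractions with the rows because \<open>b\<close> is a combination of them.\<close>

lemma H1_torsion:
  fixes a :: "nat \<Rightarrow> nat \<Rightarrow> 'a::idom"
  assumes p: "p < n" and r: "r = c + 3" and n: "n = Suc c"
    and dual: "\<And>j k. j < n \<Longrightarrow> k < n \<Longrightarrow> j \<noteq> p \<Longrightarrow> k \<noteq> p \<Longrightarrow> (\<Sum>i<r. a j i * v k i) = (if j = k then \<delta> else 0)"
    and v0: "\<And>k i. k < n \<Longrightarrow> c \<le> i \<Longrightarrow> i < r \<Longrightarrow> v k i = 0"
    and b0: "\<And>i. i < c \<Longrightarrow> (\<Sum>j<n. g j * a j i) = 0"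
    and reg: "koszul_regular q (\<lambda>i. \<Sum>j<n. g j * a j (c + i))"
    and dvd: "\<delta> dvd q"
    and gr: "graded r n \<omega>" and cyc: "ctrs r a [0..<n] \<omega> {} = 0"
  shows "\<exists>N \<eta>. \<forall>I. q ^ N * \<omega> I = (\<Sum>j<n. ctr r (a j) (\<eta> j) I)"
proof -
  define b where "b = (\<lambda>i. \<Sum>j<n. g j * a j i)"
  define js where "js = [0..<p] @ [Suc p..<n]"
  have js: "set js = {..<n} - {p}" "distinct js" "length js = c" using p n by (auto simp: js_def)
  have split: "[0..<n] = [0..<p] @ p # [Suc p..<n]"
    using upt_add_eq_append[of 0 p "n - p"] p by (simp add: upt_conv_Cons)
  have "graded r 0 (ctrs r a [0..<n] \<omega>)" using gr by (intro graded_ctrs) simp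
  then have "ctrs r a [0..<n] \<omega> I = 0" for I using cyc graded_0[of r _ I] by (cases "I = {}") auto
  then have "ctrs r a [0..<p] (ctr r (a p) (ctrs r a [Suc p..<n] \<omega>)) = (\<lambda>I. 0)"
    by (simp add: split ctrs_append fun_eq_iff)
  \<comment> \<open>The contraction with row \<open>p\<close> is moved past the rows after it, at
    the cost of a sign, so that it acts first.\<close>
  then have "(\<lambda>I. (-1) ^ length [Suc p..<n] * ctrs r a js (ctr r (a p) \<omega>) I) = (\<lambda>I. 0)"
    by (simp add: ctr_ctrs ctrs_scale js_def ctrs_append)
  then have cp: "ctrs r a js (ctr r (a p) \<omega>) = (\<lambda>I. 0)"
    by (simp add: fun_eq_iff)
  have cj: "ctrs r a js (ctr r (a j) \<omega>) = (\<lambda>I. 0)" if "j < n" for j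
    using that cp ctrs_member_zero[of j js r a \<omega>] js(1) by (cases "j = p") auto
  have "ctr r b \<omega> = (\<lambda>I. \<Sum>j<n. g j * ctr r (a j) \<omega> I)"
    unfolding b_def by (rule ext) (rule ctr_functional)
  then have cb: "ctrs r a js (ctr r b \<omega>) = (\<lambda>I. 0)"
    by (simp add: ctrs_sum cj)
  define \<tau> where "\<tau> = ctrs r a js \<omega>"
  have gt: "graded r 1 \<tau>" unfolding \<tau>_def using gr js n by (intro graded_ctrs) simp
  have bt: "ctr r b \<tau> = (\<lambda>I. 0)" by (simp add: \<tau>_def ctr_ctrs cb)
  have bz: "b i = 0" if "i < c" for i using b0[OF that] by (simp add: b_def)
  have sum_r: "(\<Sum>i<r. f i) = (\<Sum>i<c. f i) + (\<Sum>i<3. f (c + i))" for f :: "nat \<Rightarrow> 'a"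
    unfolding r by (simp add: numeral_3_eq_3 add.assoc)
  have ctr_b: "ctr r b \<omega> I = (\<Sum>i<3. b (c + i) * ctr1 (c + i) \<omega> I)" for \<omega> I
    unfolding ctr_def sum_r by (simp add: bz)
  have sg_e: "sg i {} = (1::'a)" for i by (simp add: sg_def)
  have sg_1: "sg i {k} = (if k < i then -1 else 1::'a)" for i k
    using sg_insert[of k "{}" i, where 'a = 'a] by (simp add: sg_e)
  have "(\<Sum>i<3. b (c + i) * \<tau> {c + i}) = 0"
    using fun_cong[OF bt, of "{}"] by (simp add: ctr_b ctr1_def sg_e)
  moreover have "koszul_regular q (\<lambda>i. b (c + i))" using reg by (simp add: b_def)
  note this[unfolded koszul_regular_def, THEN conjunct2, THEN conjunct2, rule_format, of "\<lambda>i. \<tau> {c + i}"]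
  ultimately obtain N x y z where xyz: "q ^ N * \<tau> {c} = - b (c + 1) * x - b (c + 2) * y"
      "q ^ N * \<tau> {c + 1} = b c * x - b (c + 2) * z" "q ^ N * \<tau> {c + 2} = b c * y + b (c + 1) * z"
    by auto
  \<comment> \<open>The 2-form on the last three basis vectors whose coefficients Koszul regularity
    supplies; subtracting its contraction removes the last three coordinates of
    \<open>q ^ N * \<tau>\<close>.\<close>
  define \<theta> where "\<theta> I = (if I = {c, c + 1} then x else if I = {c, c + 2} then y else if I = {c + 1, c + 2} then z else 0)" for I
  define \<tau>' where "\<tau>' I = q ^ N * \<tau> I - ctr r b \<theta> I" for I
  have "\<theta> {c, c + 1} = x" "\<theta> {c + 1, c} = x" by (auto simp: \<theta>_def)
  moreover have "\<theta> {c, c + 2} = y" "\<theta> {c + 2, c} = y" by (auto simp: \<theta>_def doubleton_eq_iff)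
  moreover have "\<theta> {c + 1, c + 2} = z" "\<theta> {c + 2, c + 1} = z" by (auto simp: \<theta>_def doubleton_eq_iff)
  ultimately have "\<tau>' {c} = 0" "\<tau>' {c + 1} = 0" "\<tau>' {c + 2} = 0"
    unfolding \<tau>'_def xyz ctr_b
    by (simp_all add: numeral_3_eq_3 ctr1_def sg_1)
  moreover have "graded r 1 \<tau>'"
    unfolding graded_def
  proof (intro allI impI)
    have "graded r 2 \<theta>" by (auto simp: graded_def \<theta>_def r)
    then have "graded r 1 (ctr r b \<theta>)" by (intro graded_ctr) (simp add: numeral_2_eq_2)
    moreover fix I assume "\<tau>' I \<noteq> 0"
    then have "\<tau> I \<noteq> 0 \<or> ctr r b \<theta> I \<noteq> 0" by (auto simp: \<tau>'_def)
    ultimately show "I \<subseteq> {..<r} \<and> card I = 1" using gt unfolding graded_def by blast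
  qed
  ultimately have "graded c 1 \<tau>'"
    unfolding graded_def
  proof (intro allI impI)
    fix I assume *: "\<tau>' {c} = 0" "\<tau>' {c + 1} = 0" "\<tau>' {c + 2} = 0"
      "\<forall>I. \<tau>' I \<noteq> 0 \<longrightarrow> I \<subseteq> {..<r} \<and> card I = 1" "\<tau>' I \<noteq> 0"
    then obtain i where i: "I = {i}" "i < r" by (metis card_1_singletonE insert_subset lessThan_iff)
    then have "i \<noteq> c" "i \<noteq> c + 1" "i \<noteq> c + 2" using * by auto
    then show "I \<subseteq> {..<c} \<and> card I = 1" using i r by auto
  qed
  then have "graded c (length js + 1) (wdgs r v js \<tau>')"
    using v0 js by (intro graded_wdgs) auto
  then have Ez: "wdgs r v js \<tau>' = (\<lambda>I. 0)" using js by (intro graded_eq_zero) auto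
  have "(\<lambda>I. q ^ N * \<tau> I) = (\<lambda>I. 1 * \<tau>' I + 1 * ctr r b \<theta> I)" by (simp add: \<tau>'_def)
  from arg_cong[OF this, of "wdgs r v js"]
  have "(\<lambda>I. q ^ N * wdgs r v js \<tau> I) = wdgs r v js (ctr r b \<theta>)"
    unfolding wdgs_scale wdgs_linear Ez by simp
  also have "\<dots> = (\<lambda>I. (-1) ^ length js * ctr r b (wdgs r v js \<theta>) I)"
  proof (rule wdgs_ctr)
    fix j assume "j \<in> set js"
    then have "j < n" using js by auto
    have "(\<Sum>i<3. b (c + i) * v j (c + i)) = (\<Sum>i<3. b (c + i) * 0)"
      by (intro sum.cong refl) (use v0[OF \<open>j < n\<close>] r in auto)
    then show "(\<Sum>i<r. b i * v j i) = 0" unfolding sum_r by (simp add: bz)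
  qed
  finally have E1: "q ^ N * wdgs r v js \<tau> I = ctr r b (\<lambda>I. (-1) ^ length js * wdgs r v js \<theta> I) I" for I
    by (auto simp: fun_eq_iff ctr_scale)
  define \<kappa> where "\<kappa> = (\<lambda>I. (-1) ^ length js * wdgs r v js \<theta> I)"
  have "\<exists>\<eta>. \<forall>I. wdgs r v js (ctrs r a js \<omega>) I = \<delta> ^ length js * \<omega> I + (\<Sum>j\<in>set js. ctr r (a j) (\<eta> j) I)"
    using js dual by (intro wdgs_ctrs) auto
  then obtain \<eta> where \<eta>: "\<And>I. wdgs r v js \<tau> I = \<delta> ^ c * \<omega> I + (\<Sum>j\<in>{..<n} - {p}. ctr r (a j) (\<eta> j) I)"
    unfolding js \<tau>_def by blast
  obtain e where e: "q = \<delta> * e" using dvd by auto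
  \<comment> \<open>\<open>\<eta>\<close> is meaningful for rows other than \<open>p\<close> only,
    so its entry at \<open>p\<close> is masked; \<open>e ^ c\<close> turns
    \<open>\<delta> ^ c\<close> into \<open>q ^ c\<close>.\<close>
  define \<zeta> where "\<zeta> j = (\<lambda>I. e ^ c * g j * \<kappa> I - (if j = p then 0 else e ^ c * q ^ N) * \<eta> j I)" for j
  have "q ^ (N + c) * \<omega> I = (\<Sum>j<n. ctr r (a j) (\<zeta> j) I)" for I
  proof -
    have "q ^ (N + c) * \<omega> I = e ^ c * q ^ N * (\<delta> ^ c * \<omega> I)"
      by (simp add: e power_add power_mult_distrib mult_ac)
    also have "\<delta> ^ c * \<omega> I = wdgs r v js \<tau> I - (\<Sum>j\<in>{..<n} - {p}. ctr r (a j) (\<eta> j) I)"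
      by (simp add: \<eta>)
    also have "e ^ c * q ^ N * \<dots> = e ^ c * (q ^ N * wdgs r v js \<tau> I)
        - (\<Sum>j\<in>{..<n} - {p}. e ^ c * q ^ N * ctr r (a j) (\<eta> j) I)"
      by (simp add: algebra_simps sum_distrib_left)
    also have "q ^ N * wdgs r v js \<tau> I = (\<Sum>j<n. g j * ctr r (a j) \<kappa> I)"
      unfolding E1 b_def \<kappa>_def ctr_functional ..
    also have "(\<Sum>j\<in>{..<n} - {p}. e ^ c * q ^ N * ctr r (a j) (\<eta> j) I)
        = (\<Sum>j<n. (if j = p then 0 else e ^ c * q ^ N) * ctr r (a j) (\<eta> j) I)"
      using p by (simp add: sum.remove)
    finally show ?thesis
      unfolding \<zeta>_def ctr_diff ctr_scale by (simp add: sum_subtractf sum_distrib_left mult_ac)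
  qed
  then show ?thesis by blast
qed

section \<open>Minors as iterated contractions, and dual vectors from adjugates\<close>

section \<open>Minors\<close>

text \<open>An element of \<open>I\<close> and its rank in \<open>I\<close> determine each other.
  This translates the signs of exterior algebra into the column numbers of a submatrix.\<close>

lemma sum_pick:
  fixes f :: "nat \<Rightarrow> nat \<Rightarrow> 'b::comm_monoid_add"
  assumes "finite I" "card I = n"
  shows "(\<Sum>i\<in>I. f i (card {a\<in>I. a < i})) = (\<Sum>p<n. f (pick I p) p)"
proof (rule sum.reindex_bij_witness[where i = "pick I" and j = "\<lambda>i. card {a\<in>I. a < i}"])
  fix i assume i: "i \<in> I"
  show "pick I (card {a\<in>I. a < i}) = i" using i by (rule pick_card_in_set)
  have "{a\<in>I. a < i} \<subset> I" using i by auto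
  from psubset_card_mono[OF assms(1) this] show "card {a\<in>I. a < i} \<in> {..<n}" using assms by simp
  show "f (pick I (card {a \<in> I. a < i})) (card {a \<in> I. a < i}) = f i (card {a\<in>I. a < i})"
    using pick_card_in_set[OF i] by simp
next
  fix p assume "p \<in> {..<n}"
  then show "card {a\<in>I. a < pick I p} = p" "pick I p \<in> I"
    using assms by (auto intro: card_pick_le pick_in_set_le)
qed

lemma pick_delete:
  assumes "finite I" "card I = Suc n" "p < Suc n" "k < n"
  shows "pick (I - {pick I p}) k = (if k < p then pick I k else pick I (Suc k))"
proof -
  define x where "x = pick I p"
  define y where "y = pick I (if k < p then k else Suc k)"
  let ?k = "if k < p then k else Suc k"
  have x: "x \<in> I" "card {a\<in>I. a < x} = p" using assms by (auto simp: x_def intro: card_pick_le pick_in_set_le)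
  have k: "?k < Suc n" using assms by auto
  then have y: "y \<in> I" "card {a\<in>I. a < y} = ?k" using assms unfolding y_def by (auto simp del: pick.simps intro!: card_pick_le pick_in_set_le)
  have xy: "x < y \<longleftrightarrow> p < ?k"
  proof
    assume "x < y"
    then have "{a\<in>I. a < x} \<subset> {a\<in>I. a < y}" using x(1) by auto
    from psubset_card_mono[OF _ this] show "p < ?k" using assms(1) x y by simp
  next
    assume "p < ?k"
    then show "x < y"
    proof (rule contrapos_pp)
      assume "\<not> x < y"
      then have "{a\<in>I. a < y} \<subseteq> {a\<in>I. a < x}" by auto
      from card_mono[OF _ this] show "\<not> p < ?k" using assms(1) x y by simp
    qed
  qed
  have ne: "y \<noteq> x" using x y by (metis less_irrefl lessI)
  have "card {a\<in>I - {x}. a < y} = k"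
  proof (cases "k < p")
    case True
    then have "\<not> x < y" using xy by auto
    then have "{a\<in>I - {x}. a < y} = {a\<in>I. a < y}" by auto
    then show ?thesis using y True by simp
  next
    case False
    then have "x < y" using xy by auto
    then have "{a\<in>I - {x}. a < y} = {a\<in>I. a < y} - {x}" by auto
    then show ?thesis using y False x \<open>x < y\<close> assms(1) by (simp add: card_Diff_singleton)
  qed
  then have "pick (I - {x}) k = y" using pick_card_in_set[of y "I - {x}"] y ne by auto
  then show ?thesis by (simp add: x_def y_def)
qed

definition minor :: "(nat \<Rightarrow> nat \<Rightarrow> 'a::comm_ring_1) \<Rightarrow> nat \<Rightarrow> nat set \<Rightarrow> 'a" where
  "minor a n I = det (mat n n (\<lambda>(i, j). a i (pick I j)))"

lemma max_minor_eq:
  assumes "I \<subseteq> {..<dim_col \<alpha>}" "card I = dim_row \<alpha>"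
  shows "max_minor \<alpha> I = minor (\<lambda>j i. \<alpha> $$ (j, i)) (dim_row \<alpha>) I"
proof -
  have "{j. j < dim_col \<alpha> \<and> j \<in> I} = I" using assms by auto
  then have "submatrix \<alpha> UNIV I = mat (dim_row \<alpha>) (dim_row \<alpha>) (\<lambda>(i, j). \<alpha> $$ (i, pick I j))"
    unfolding submatrix_def using assms by (auto simp: pick_UNIV)
  then show ?thesis by (simp add: max_minor_def minor_def)
qed

text \<open>The cofactor of the entry in row \<open>n\<close> and column \<open>p\<close> carries
  the sign of \<open>n + p\<close>, exterior algebra only that of \<open>p\<close>; hence the factor
  \<open>(-1) ^ n\<close>.\<close>

lemma minor_expand_last_row:
  assumes "finite I" "card I = Suc n"
  shows "(\<Sum>i\<in>I. sg i I * a n i * minor a n (I - {i})) = (-1) ^ n * minor a (Suc n) I"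
proof -
  let ?A = "mat (Suc n) (Suc n) (\<lambda>(i, j). a i (pick I j))"
  have *: "mat_delete ?A n p = mat n n (\<lambda>(i, j). a i (pick (I - {pick I p}) j))" if "p < Suc n" for p
    using assms that by (intro eq_matI) (auto simp: mat_delete_def pick_delete)
  have "(\<Sum>i\<in>I. sg i I * a n i * minor a n (I - {i}))
      = (\<Sum>i\<in>I. (-1) ^ card {k\<in>I. k < i} * a n i * minor a n (I - {i}))"
    by (simp add: sg_def)
  also have "\<dots> = (\<Sum>p<Suc n. (-1) ^ p * a n (pick I p) * minor a n (I - {pick I p}))"
    by (rule sum_pick[OF assms, of "\<lambda>i p. (-1) ^ p * a n i * minor a n (I - {i})"])
  also have "\<dots> = (\<Sum>p<Suc n. (-1) ^ n * (?A $$ (n, p) * cofactor ?A n p))"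
    by (intro sum.cong refl) (simp add: * cofactor_def minor_def minus_one_power_iff)
  also have "\<dots> = (-1) ^ n * minor a (Suc n) I"
    using laplace_expansion_row[of ?A "Suc n" n] by (simp add: minor_def flip: sum_distrib_left)
  finally show ?thesis .
qed

text \<open>Contracting with the last row and then with the others is Laplace expansion, once the
  sum over a set \<open>J\<close> and an \<open>i\<close> outside it is rewritten as a sum over
  \<open>I = insert i J\<close> and \<open>i\<close> in \<open>I\<close>. The sign is common to all
  \<open>\<omega>\<close>, and its value never matters.\<close>

lemma ctrs_eq_minor:
  fixes a :: "nat \<Rightarrow> nat \<Rightarrow> 'a::comm_ring_1"
  shows "\<exists>\<epsilon>\<in>{1, -1}. \<forall>\<omega>. ctrs r a [0..<n] \<omega> {} = \<epsilon> * (\<Sum>I | I \<subseteq> {..<r} \<and> card I = n. \<omega> I * minor a n I)"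
proof (induction n)
  case 0
  have "{I. I \<subseteq> {..<r} \<and> card I = 0} = {{}}" by (auto dest: finite_subset)
  then show ?case by (intro bexI[of _ 1]) (auto simp: minor_def)
next
  case (Suc n)
  then obtain \<epsilon> where \<epsilon>: "\<epsilon> \<in> {1, -1}" "\<And>\<omega>. ctrs r a [0..<n] \<omega> {} = \<epsilon> * (\<Sum>I | I \<subseteq> {..<r} \<and> card I = n. \<omega> I * minor a n I)"
    by blast
  have "ctrs r a [0..<Suc n] \<omega> {} = (\<epsilon> * (-1) ^ n) * (\<Sum>I | I \<subseteq> {..<r} \<and> card I = Suc n. \<omega> I * minor a (Suc n) I)" for \<omega>
  proof -
    let ?J = "{J. J \<subseteq> {..<r} \<and> card J = n}" let ?I = "{I. I \<subseteq> {..<r} \<and> card I = Suc n}"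
    have fin: "finite I" if "I \<subseteq> {..<r}" for I :: "nat set" using that finite_subset by auto
    have "(\<Sum>J\<in>?J. ctr r (a n) \<omega> J * minor a n J) = (\<Sum>J\<in>?J. \<Sum>i\<in>{..<r} - J. sg i J * a n i * \<omega> (insert i J) * minor a n J)"
    proof (intro sum.cong refl)
      fix J assume "J \<in> ?J"
      have "ctr r (a n) \<omega> J = (\<Sum>i\<in>{..<r} - J. sg i J * a n i * \<omega> (insert i J))"
        unfolding ctr_def by (rule sum.mono_neutral_cong_right) (auto simp: ctr1_def mult_ac)
      then show "ctr r (a n) \<omega> J * minor a n J = (\<Sum>i\<in>{..<r} - J. sg i J * a n i * \<omega> (insert i J) * minor a n J)"
        by (simp add: sum_distrib_right)
    qed
    also have "\<dots> = (\<Sum>(J, i)\<in>(SIGMA J:?J. {..<r} - J). sg i J * a n i * \<omega> (insert i J) * minor a n J)"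
      by (rule sum.Sigma) auto
    also have "\<dots> = (\<Sum>(I, i)\<in>(SIGMA I:?I. I). sg i I * a n i * \<omega> I * minor a n (I - {i}))"
      by (rule sum.reindex_bij_witness[where j = "\<lambda>(J, i). (insert i J, i)" and i = "\<lambda>(I, i). (I - {i}, i)"])
         (auto simp: fin card_insert_if insert_absorb)
    also have "\<dots> = (\<Sum>I\<in>?I. \<Sum>i\<in>I. sg i I * a n i * \<omega> I * minor a n (I - {i}))"
      by (rule sum.Sigma [symmetric]) (auto simp: fin)
    also have "\<dots> = (\<Sum>I\<in>?I. \<omega> I * (\<Sum>i\<in>I. sg i I * a n i * minor a n (I - {i})))"
      by (simp add: sum_distrib_left mult_ac)
    also have "\<dots> = (\<Sum>I\<in>?I. \<omega> I * ((-1) ^ n * minor a (Suc n) I))"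
      by (intro sum.cong refl) (simp add: minor_expand_last_row fin)
    also have "\<dots> = (-1) ^ n * (\<Sum>I\<in>?I. \<omega> I * minor a (Suc n) I)"
      by (simp add: sum_distrib_left mult_ac)
    finally show ?thesis by (simp add: ctrs_append \<epsilon>(2) mult_ac)
  qed
  moreover have "\<epsilon> * (-1) ^ n \<in> {1, -1}" using \<epsilon>(1) by (cases "even n") auto
  ultimately show ?case by blast
qed

text \<open>The columns of the adjugate of the chosen submatrix, spread over the positions in
  \<open>I\<close>.\<close>

lemma minor_dual_vectors:
  fixes a :: "nat \<Rightarrow> nat \<Rightarrow> 'a::comm_ring_1"
  assumes "I \<subseteq> {..<r}" "card I = n"
  shows "\<exists>v. (\<forall>j<n. \<forall>k<n. (\<Sum>i<r. a j i * v k i) = (if j = k then minor a n I else 0)) \<and> (\<forall>k i. i \<notin> I \<longrightarrow> v k i = 0)"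
proof -
  let ?A = "mat n n (\<lambda>(i, j). a i (pick I j))"
  define v where "v k i = (if i \<in> I then adj_mat ?A $$ (card {a\<in>I. a < i}, k) else 0)" for k i
  have fin: "finite I" using assms finite_subset by auto
  have A: "?A \<in> carrier_mat n n" by simp
  have "(\<Sum>i<r. a j i * v k i) = (if j = k then minor a n I else 0)" if "j < n" "k < n" for j k
  proof -
    have "(\<Sum>i<r. a j i * v k i) = (\<Sum>i\<in>I. a j i * adj_mat ?A $$ (card {a\<in>I. a < i}, k))"
      using assms by (intro sum.mono_neutral_cong_right) (auto simp: v_def)
    also have "\<dots> = (\<Sum>p<n. a j (pick I p) * adj_mat ?A $$ (p, k))"
      by (rule sum_pick[OF fin assms(2), of "\<lambda>i p. a j i * adj_mat ?A $$ (p, k)"])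
    also have "\<dots> = (?A * adj_mat ?A) $$ (j, k)"
      using that adj_mat(1)[OF A] by (simp add: scalar_prod_def atLeast0LessThan)
    also have "\<dots> = (if j = k then minor a n I else 0)"
      using that by (simp add: adj_mat(2)[OF A] minor_def)
    finally show ?thesis .
  qed
  then show ?thesis by (intro exI[of _ v]) (auto simp: v_def)
qed

section \<open>Lexicographic monomial orders\<close>

text \<open>Any linear order would do. It induces the lexicographic order on monomials, which is
  compatible with addition; this makes the polynomial rings integral domains and gives a meaning to
  the largest monomial of a polynomial.\<close>

instantiation rvar :: linorder
begin

definition rvar_rank :: "rvar \<Rightarrow> nat" where
  "rvar_rank x = (case x of Vs \<Rightarrow> 0 | Vt \<Rightarrow> 1 | Vu \<Rightarrow> 2 | Vv \<Rightarrow> 3)"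

definition less_eq_rvar :: "rvar \<Rightarrow> rvar \<Rightarrow> bool" where
  "less_eq_rvar x y \<longleftrightarrow> rvar_rank x \<le> rvar_rank y"

definition less_rvar :: "rvar \<Rightarrow> rvar \<Rightarrow> bool" where
  "less_rvar x y \<longleftrightarrow> rvar_rank x < rvar_rank y"

instance
  by standard (auto simp: less_eq_rvar_def less_rvar_def rvar_rank_def split: rvar.splits)

end

instantiation cvar :: linorder
begin

definition less_eq_cvar :: "cvar \<Rightarrow> cvar \<Rightarrow> bool" where
  "less_eq_cvar x y \<longleftrightarrow> (case (x, y) of (CV i j \<alpha>, CV i' j' \<alpha>') \<Rightarrow> i < i' \<or> i = i' \<and> (j < j' \<or> j = j' \<and> \<alpha> \<le> \<alpha>'))"

definition less_cvar :: "cvar \<Rightarrow> cvar \<Rightarrow> bool" where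
  "less_cvar x y \<longleftrightarrow> (case (x, y) of (CV i j \<alpha>, CV i' j' \<alpha>') \<Rightarrow> i < i' \<or> i = i' \<and> (j < j' \<or> j = j' \<and> \<alpha> < \<alpha>'))"

instance
  by standard (auto simp: less_eq_cvar_def less_cvar_def split: cvar.splits)

end

section \<open>McCoy's theorem and the grade of the Hilbert-Burch ideal\<close>

section \<open>Ideals of maximal minors in a Hilbert--Burch resolution\<close>

lemma ctrs_map: "ctrs r a (map f js) \<omega> = ctrs r (\<lambda>j. a (f j)) js \<omega>"
  by (induction js) auto

lemma ctrs_permute:
  assumes "distinct xs" "distinct ys" "set xs = set ys"
  shows "\<exists>s\<in>{1, -1}. \<forall>\<omega>. ctrs r a xs \<omega> = (\<lambda>I. s * ctrs r a ys \<omega> I)"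
  using assms
proof (induction xs arbitrary: ys)
  case Nil
  then show ?case by auto
next
  case (Cons x xs)
  then obtain us vs where ys: "ys = us @ x # vs" by (metis list.set_intros(1) split_list)
  have "set xs = set (us @ vs)" "distinct (us @ vs)" using Cons.prems ys by auto
  with Cons obtain s where s: "s \<in> {1, -1}" "\<And>\<omega>. ctrs r a xs \<omega> = (\<lambda>I. s * ctrs r a (us @ vs) \<omega> I)"
    by (metis distinct.simps(2))
  have "ctrs r a (x # xs) \<omega> = (\<lambda>I. (s * (-1) ^ length us) * ctrs r a ys \<omega> I)" for \<omega>
  proof
    fix I
    have "ctrs r a (x # xs) \<omega> I = s * ctr r (a x) (ctrs r a us (ctrs r a vs \<omega>)) I"
      by (simp add: s(2) ctr_scale ctrs_append)
    then show "ctrs r a (x # xs) \<omega> I = (s * (-1) ^ length us) * ctrs r a ys \<omega> I"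
      by (simp add: ctr_ctrs ys ctrs_append)
  qed
  moreover have "s * (-1) ^ length us \<in> {1, -1}" using s(1) by (cases "even (length us)") auto
  ultimately show ?case by blast
qed

lemma ctrs_not_distinct:
  assumes "\<not> distinct ks"
  shows "ctrs r a ks \<omega> = (\<lambda>I. 0)"
proof -
  obtain xs y ys zs where ks: "ks = xs @ [y] @ ys @ [y] @ zs" using not_distinct_decomp[OF assms] by blast
  then have "ctrs r a ks \<omega> = ctrs r a (xs @ y # ys) (ctr r (a y) (ctrs r a zs \<omega>))"
    by (simp add: ctrs_append)
  also have "\<dots> = (\<lambda>I. 0)" by (rule ctrs_member_zero) simp
  finally show ?thesis .
qed

lemma ctr_cong:
  "(\<And>x. x < r \<Longrightarrow> x \<notin> I \<Longrightarrow> \<omega> (insert x I) = \<omega>' (insert x I)) \<Longrightarrow> ctr r a \<omega> I = ctr r a \<omega>' I"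
  unfolding ctr_def by (intro sum.cong) (auto simp: ctr1_def)

text \<open>If \<open>\<psi>\<close> does not involve the basis vector \<open>i\<close>, then those
  terms of the contracted wedge that still contain \<open>i\<close> come from contracting
  \<open>\<psi>\<close> alone, each contraction passing \<open>i\<close> with a sign.\<close>

lemma ctrs_unit_wdg:
  assumes "\<And>I. i \<in> I \<Longrightarrow> \<psi> I = 0" "i < r"
  shows "(\<forall>I. i \<in> I \<longrightarrow> ctrs r a ks \<psi> I = 0)
    \<and> (\<forall>I. i \<in> I \<longrightarrow> ctrs r a ks (wdg r (unit_vec i) \<psi>) I = (-1) ^ length ks * wdg r (unit_vec i) (ctrs r a ks \<psi>) I)"
proof (induction ks)
  case (Cons k ks)
  have 1: "ctr r (a k) (ctrs r a ks \<psi>) I = 0" if "i \<in> I" for I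
    unfolding ctr_def ctr1_def using Cons that by (intro sum.neutral) auto
  have "ctr r (a k) (ctrs r a ks (wdg r (unit_vec i) \<psi>)) I
      = (-1) ^ length (k # ks) * wdg r (unit_vec i) (ctr r (a k) (ctrs r a ks \<psi>)) I" if "i \<in> I" for I
  proof -
    have "ctr r (a k) (ctrs r a ks (wdg r (unit_vec i) \<psi>)) I
        = ctr r (a k) (\<lambda>I. (-1) ^ length ks * wdg r (unit_vec i) (ctrs r a ks \<psi>) I) I"
      using Cons that by (intro ctr_cong) auto
    also have "\<dots> = (-1) ^ length (k # ks) * wdg r (unit_vec i) (ctr r (a k) (ctrs r a ks \<psi>)) I"
      using Cons that by (simp add: ctr_scale ctr_wdg)
    finally show ?thesis .
  qed
  with 1 show ?case by simp
qed (use assms in auto)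

text \<open>McCoy's theorem: one descends from the maximal minors to the minor
  of size \<open>0\<close>; the minors of size \<open>t\<close> in the columns \<open>K \<union> {i}\<close> give a column relation.\<close>

lemma mccoy_minors:
  fixes a :: "nat \<Rightarrow> nat \<Rightarrow> 'a::comm_ring_1"
  assumes inj: "\<And>v. (\<And>j. j < n \<Longrightarrow> D dvd (\<Sum>i<c. a j i * v i)) \<Longrightarrow> \<forall>i<c. D dvd v i"
    and top: "\<And>ks \<omega>. length ks = c \<Longrightarrow> set ks \<subseteq> {..<n} \<Longrightarrow> graded c c \<omega> \<Longrightarrow> D dvd Y * ctrs c a ks \<omega> {}"
  shows "D dvd Y"
proof -
  have "\<forall>ks (\<omega> :: nat set \<Rightarrow> 'a). length ks = t \<longrightarrow> set ks \<subseteq> {..<n} \<longrightarrow> graded c t \<omega> \<longrightarrow> D dvd Y * ctrs c a ks \<omega> {}"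
    if "t \<le> c" for t
    using that
  proof (induction rule: inc_induct)
    case base
    then show ?case using top by blast
  next
    case (step t)
    show ?case
    proof (intro allI impI)
      fix ks and \<omega> :: "nat set \<Rightarrow> 'a"
      assume ks: "length ks = t" "set ks \<subseteq> {..<n}" and \<omega>: "graded c t \<omega>"
      define e :: "nat set \<Rightarrow> nat set \<Rightarrow> 'a" where "e K I = (if I = K then 1 else 0)" for K I
      let ?K = "{K. K \<subseteq> {..<c} \<and> card K = t}"
      have "\<omega> = (\<lambda>I. \<Sum>K\<in>?K. \<omega> K * e K I)"
      proof
        fix I
        have "(\<Sum>K\<in>?K. \<omega> K * e K I) = (\<Sum>K\<in>?K. if K = I then \<omega> I else 0)"
          by (intro sum.cong) (auto simp: e_def)
        also have "\<dots> = \<omega> I" using \<omega> by (auto simp: graded_def)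
        finally show "\<omega> I = (\<Sum>K\<in>?K. \<omega> K * e K I)" ..
      qed
      then have "ctrs c a ks \<omega> {} = ctrs c a ks (\<lambda>I. \<Sum>K\<in>?K. \<omega> K * e K I) {}" by (rule arg_cong)
      then have eq: "Y * ctrs c a ks \<omega> {} = (\<Sum>K\<in>?K. \<omega> K * (Y * ctrs c a ks (e K) {}))"
        by (simp add: ctrs_sum sum_distrib_left mult_ac)
      have *: "D dvd Y * ctrs c a ks (e K) {}" if K: "K \<in> ?K" for K
      proof -
        \<comment> \<open>A set \<open>K\<close> of fewer than \<open>c\<close> columns misses some
          column \<open>i\<close>. Contractions of length \<open>Suc t\<close> on \<open>K\<close>
          and \<open>i\<close> are the products of the rows with the vector of contractions of
          length \<open>t\<close>, so \<open>inj\<close> applies to that vector; its entry at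
          \<open>i\<close> is, up to sign, the contraction on \<open>K\<close>.\<close>
        have "K \<noteq> {..<c}" using K step by auto
        then obtain i where i: "i < c" "i \<notin> K" using K by auto
        have z: "e K I = 0" if "i \<in> I" for I using that i by (auto simp: e_def)
        have sg_e: "sg i {} = (1 :: 'a)" by (simp add: sg_def)
        define \<theta> where "\<theta> = wdg c (unit_vec i) (e K)"
        have "graded c t (e K)" using K by (auto simp: graded_def e_def)
        then have g\<theta>: "graded c (Suc t) \<theta>" unfolding \<theta>_def by (rule graded_unit_wdg[OF i(1)])
        have "D dvd (\<Sum>x<c. a k x * (Y * ctrs c a ks \<theta> {x}))" if "k < n" for k
        proof -
          have "(\<Sum>x<c. a k x * (Y * ctrs c a ks \<theta> {x})) = Y * ctrs c a (k # ks) \<theta> {}"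
            by (simp add: ctr_def ctr1_def sg_def sum_distrib_left mult_ac)
          then show ?thesis using step.IH ks that g\<theta> by (metis length_Cons insert_subset lessThan_iff list.simps(15))
        qed
        then have "D dvd Y * ctrs c a ks \<theta> {i}"
          using inj[of "\<lambda>x. Y * ctrs c a ks \<theta> {x}"] i(1) by blast
        also have "ctrs c a ks \<theta> {i} = (-1) ^ length ks * wdg c (unit_vec i) (ctrs c a ks (e K)) {i}"
          using ctrs_unit_wdg[of i "e K" c a ks] i z by (simp add: \<theta>_def)
        also have "wdg c (unit_vec i) (ctrs c a ks (e K)) {i} = ctrs c a ks (e K) {}"
          using i by (simp add: wdg_unit_vec wdg1_def sg_e)
        finally have "D dvd (-1) ^ length ks * (Y * ctrs c a ks (e K) {})" by (simp add: mult_ac)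
        then show ?thesis by (cases "even (length ks)") auto
      qed
      show "D dvd Y * ctrs c a ks \<omega> {}" unfolding eq by (rule dvd_sum, rule dvd_mult) (rule *)
    qed
  qed
  note this[of 0, rule_format, of "[]" "\<lambda>I. if I = {} then 1 else 0"]
  moreover have "graded c 0 (\<lambda>I. if I = {} then 1 else 0 :: 'a)" by (auto simp: graded_def)
  ultimately show ?thesis by simp
qed

text \<open>\<open>pick\<close> enumerates the infinite complement of \<open>p\<close>, so the
  numbering does not depend on the number of rows, and it agrees with the rows of
  \<open>submatrix \<phi> (- {p}) UNIV\<close>.\<close>

definition other_row :: "nat \<Rightarrow> nat \<Rightarrow> nat" where
  "other_row p i = pick (- {p}) i"

lemma other_rows:
  assumes "p < Suc c"
  shows "other_row p ` {..<c} = {..<Suc c} - {p}" "inj_on (other_row p) {..<c}"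
proof -
  have inf: "infinite (- {p})" by (simp add: finite_compl)
  show inj: "inj_on (other_row p) {..<c}"
    unfolding inj_on_def other_row_def using pick_mono_inf[OF inf] by (metis nat_neq_iff)
  have "{a. a < Suc c \<and> a \<in> - {p}} = {..<Suc c} - {p}" by auto
  then have "other_row p i < Suc c" if "i < c" for i
    unfolding other_row_def using that assms by (intro pick_le) simp
  moreover have "other_row p i \<noteq> p" for i
    using pick_in_set_inf[OF inf] by (auto simp: other_row_def)
  ultimately have "other_row p ` {..<c} \<subseteq> {..<Suc c} - {p}" by auto
  then show "other_row p ` {..<c} = {..<Suc c} - {p}"
    by (rule card_subset_eq[rotated]) (use assms in \<open>simp_all add: card_image inj\<close>)
qed

lemma det_other_rows:
  assumes "\<phi> \<in> carrier_mat (Suc c) c" "p < Suc c"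
  shows "det (submatrix \<phi> (- {p}) UNIV) = minor (\<lambda>i j. \<phi> $$ (other_row p i, j)) c {..<c}"
proof -
  have "{i. i < Suc c \<and> i \<in> - {p}} = {..<Suc c} - {p}" by auto
  then have "card {i. i < dim_row \<phi> \<and> i \<in> - {p}} = c" using assms by simp
  moreover have "card {j. j < dim_col \<phi> \<and> j \<in> UNIV} = c" using assms by simp
  moreover have "pick {..<c} j = j" if "j < c" for j
  proof -
    have "{a\<in>{..<c}. a < j} = {..<j}" using that by auto
    then show ?thesis using pick_card_in_set[of j "{..<c}"] that by simp
  qed
  ultimately have "submatrix \<phi> (- {p}) UNIV = mat c c (\<lambda>(i, j). \<phi> $$ (other_row p i, pick {..<c} j))"
    by (intro eq_matI) (auto simp: submatrix_def other_row_def pick_UNIV)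
  then show ?thesis by (simp add: minor_def)
qed

lemma dual_vectors_other_rows:
  assumes "\<phi> \<in> carrier_mat (Suc c) c" "p < Suc c"
  shows "\<exists>v. (\<forall>j<Suc c. \<forall>k<Suc c. j \<noteq> p \<longrightarrow> k \<noteq> p
      \<longrightarrow> (\<Sum>i<c. \<phi> $$ (j, i) * v k i) = (if j = k then det (submatrix \<phi> (- {p}) UNIV) else 0))"
proof -
  obtain w where w: "\<And>j k. j < c \<Longrightarrow> k < c \<Longrightarrow> (\<Sum>i<c. \<phi> $$ (other_row p j, i) * w k i)
      = (if j = k then det (submatrix \<phi> (- {p}) UNIV) else 0)"
    using minor_dual_vectors[of "{..<c}" c c "\<lambda>i j. \<phi> $$ (other_row p i, j)"]
    unfolding det_other_rows[OF assms] by auto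
  define ix where "ix = inv_into {..<c} (other_row p)"
  have ix: "ix j < c" "other_row p (ix j) = j" if "j < Suc c" "j \<noteq> p" for j
  proof -
    have "j \<in> other_row p ` {..<c}" using that other_rows(1)[OF assms(2)] by simp
    from inv_into_into[OF this] f_inv_into_f[OF this] show "ix j < c" "other_row p (ix j) = j"
      by (simp_all add: ix_def)
  qed
  have "ix j = ix k \<longleftrightarrow> j = k" if "j < Suc c" "j \<noteq> p" "k < Suc c" "k \<noteq> p" for j k
    using ix that by metis
  then show ?thesis using w[OF ix(1) ix(1)] ix(2) by (intro exI[of _ "\<lambda>k. w (ix k)"]) simp
qed

text \<open>Exactness makes \<open>\<phi>\<close> injective modulo every nonzero \<open>D\<close>:
  if \<open>\<phi> v = D w\<close>, cancelling \<open>D\<close> shows that \<open>w\<close> is a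
  syzygy of \<open>g\<close>, so \<open>w = \<phi> u\<close> and \<open>v = D u\<close>. The maximal
  minors of \<open>\<phi>\<close> are the \<open>g p\<close> up to units, and McCoy's theorem
  concludes.\<close>

lemma hilbert_burch_dvd:
  fixes \<phi> :: "'k::idom rpoly mat"
  assumes hb: "hilbert_burch n \<phi> g kl cd"
    and dvd: "\<And>p. p < n \<Longrightarrow> D dvd Y * g p"
  shows "D dvd Y"
proof -
  define c where "c = n - 1"
  have n: "n = Suc c" and \<phi>: "\<phi> \<in> carrier_mat (Suc c) c"
    using hb by (auto simp: hilbert_burch_def c_def)
  have inj: "\<And>v. v \<in> carrier_vec c \<Longrightarrow> \<phi> *\<^sub>v v = 0\<^sub>v n \<Longrightarrow> v = 0\<^sub>v c"
    and ex: "\<And>w. w \<in> carrier_vec n \<Longrightarrow> (\<Sum>j<n. g j * w $ j) = 0 \<longleftrightarrow> (\<exists>v\<in>carrier_vec c. w = \<phi> *\<^sub>v v)"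
    using hb by (auto simp: hilbert_burch_def c_def)
  obtain e where e: "e dvd 1" "\<And>j. j < n \<Longrightarrow> \<exists>\<epsilon>\<in>{1, -1}. g j = \<epsilon> * e * det (submatrix \<phi> (- {j}) UNIV)"
    using hb by (auto simp: hilbert_burch_def)
  have entry: "(\<phi> *\<^sub>v v) $ j = (\<Sum>i<c. \<phi> $$ (j, i) * v $ i)" if "v \<in> carrier_vec c" "j < n" for v j
    using that \<phi> n by (simp add: scalar_prod_def atLeast0LessThan)
  show ?thesis
  proof (rule mccoy_minors[where a = "\<lambda>j i. \<phi> $$ (j, i)" and n = n and c = c])
    fix v :: "nat \<Rightarrow> 'k rpoly" assume v: "\<And>j. j < n \<Longrightarrow> D dvd (\<Sum>i<c. \<phi> $$ (j, i) * v i)"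
    let ?v = "vec c v"
    have \<phi>v: "(\<phi> *\<^sub>v ?v) $ j = (\<Sum>i<c. \<phi> $$ (j, i) * v i)" if "j < n" for j
      using entry[of ?v j] that by simp
    have dim: "\<phi> *\<^sub>v ?v \<in> carrier_vec n" using \<phi> n by simp
    show "\<forall>i<c. D dvd v i"
    \<comment> \<open>Cancellation fails for \<open>D = 0\<close>; there divisibility means
      vanishing, and the injectivity of \<open>\<phi>\<close> itself is what is needed.\<close>
    proof (cases "D = 0")
      case True
      then have "\<phi> *\<^sub>v ?v = 0\<^sub>v n" using v \<phi>v dim True n \<phi> by (intro eq_vecI) auto
      from inj[OF _ this] have "?v = 0\<^sub>v c" by simp
      then have "v i = 0" if "i < c" for i using that by (metis index_vec index_zero_vec(1))
      then show ?thesis by simp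
    next
      case False
      obtain w where w: "\<And>j. j < n \<Longrightarrow> (\<Sum>i<c. \<phi> $$ (j, i) * v i) = D * w j"
        using v unfolding dvd_def by metis
      have "(\<Sum>j<n. g j * (\<phi> *\<^sub>v ?v) $ j) = 0" using ex[OF dim] by auto
      then have "D * (\<Sum>j<n. g j * vec n w $ j) = 0"
        by (simp add: \<phi>v w sum_distrib_left mult.left_commute cong: sum.cong_simp)
      then have "(\<Sum>j<n. g j * vec n w $ j) = 0" using False by simp
      then obtain u where u: "u \<in> carrier_vec c" "vec n w = \<phi> *\<^sub>v u" using ex[of "vec n w"] by auto
      have "w j = (\<Sum>i<c. \<phi> $$ (j, i) * u $ i)" if "j < n" for j
        using entry[OF u(1) that] that by (simp flip: u(2))
      then have "(\<phi> *\<^sub>v (?v - D \<cdot>\<^sub>v u)) $ j = 0" if "j < n" for j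
        using entry[of "?v - D \<cdot>\<^sub>v u" j] u(1) that w[OF that]
        by (simp add: right_diff_distrib sum_subtractf sum_distrib_left mult.left_commute)
      then have "\<phi> *\<^sub>v (?v - D \<cdot>\<^sub>v u) = 0\<^sub>v n" using \<phi> n by (intro eq_vecI) auto
      then have "?v - D \<cdot>\<^sub>v u = 0\<^sub>v c" using u by (intro inj) auto
      then have "(?v - D \<cdot>\<^sub>v u) $ i = 0" if "i < c" for i using that by simp
      then have "v i = D * u $ i" if "i < c" for i using that u(1) by simp
      then show ?thesis by simp
    qed
  next
    fix ks and \<omega> :: "nat set \<Rightarrow> 'k rpoly"
    assume ks: "length ks = c" "set ks \<subseteq> {..<n}" and \<omega>: "graded c c \<omega>"
    show "D dvd Y * ctrs c (\<lambda>j i. \<phi> $$ (j, i)) ks \<omega> {}"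
    proof (cases "distinct ks")
      case True
      have "card ({..<n} - set ks) = 1" using ks True n by (simp add: card_Diff_subset distinct_card)
      then obtain p where p: "{..<n} - set ks = {p}" by (meson card_1_singletonE)
      then have "p < n" and set: "set ks = {..<n} - {p}" using ks by auto
      have "set ks = set (map (other_row p) [0..<c])" "distinct (map (other_row p) [0..<c])"
        using other_rows[of p c] set \<open>p < n\<close> n by (auto simp: distinct_map atLeast0LessThan)
      from ctrs_permute[OF True this(2,1), of c "\<lambda>j i. \<phi> $$ (j, i)"]
      obtain s where s0: "s \<in> {1, -1}" "\<And>\<omega>. ctrs c (\<lambda>j i. \<phi> $$ (j, i)) ks \<omega>
          = (\<lambda>I. s * ctrs c (\<lambda>j i. \<phi> $$ (j, i)) (map (other_row p) [0..<c]) \<omega> I)"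
        by blast
      have s: "ctrs c (\<lambda>j i. \<phi> $$ (j, i)) ks \<omega> {} = s * ctrs c (\<lambda>j i. \<phi> $$ (other_row p j, i)) [0..<c] \<omega> {}"
        unfolding s0(2) ctrs_map ..
      obtain \<epsilon> where \<epsilon>: "ctrs c (\<lambda>j i. \<phi> $$ (other_row p j, i)) [0..<c] \<omega> {}
          = \<epsilon> * (\<Sum>I | I \<subseteq> {..<c} \<and> card I = c. \<omega> I * minor (\<lambda>j i. \<phi> $$ (other_row p j, i)) c I)"
        using ctrs_eq_minor[of c "\<lambda>j i. \<phi> $$ (other_row p j, i)" c] by blast
      have "{I. I \<subseteq> {..<c} \<and> card I = c} = {{..<c}}" using card_subset_eq[of "{..<c}"] by auto
      then have "ctrs c (\<lambda>j i. \<phi> $$ (j, i)) ks \<omega> {} = s * \<epsilon> * \<omega> {..<c} * det (submatrix \<phi> (- {p}) UNIV)"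
        using s \<epsilon> det_other_rows[OF \<phi>, of p] \<open>p < n\<close> n by simp
      moreover have "D dvd Y * det (submatrix \<phi> (- {p}) UNIV)"
      proof -
        obtain \<epsilon>' where e': "\<epsilon>' \<in> {1, -1}" "g p = \<epsilon>' * e * det (submatrix \<phi> (- {p}) UNIV)" using e(2) \<open>p < n\<close> by blast
        obtain f where f: "1 = e * f" using e(1) by (auto simp: dvd_def)
        have "Y * det (submatrix \<phi> (- {p}) UNIV) = Y * (e * f) * det (submatrix \<phi> (- {p}) UNIV)" by (simp flip: f)
        also have "\<dots> = Y * g p * (\<epsilon>' * f)" using e' by auto
        finally have eq: "Y * det (submatrix \<phi> (- {p}) UNIV) = Y * g p * (\<epsilon>' * f)" .
        show ?thesis unfolding eq using dvd[OF \<open>p < n\<close>] by (rule dvd_mult2)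
      qed
      ultimately show ?thesis
        using dvd_mult[of D "Y * det (submatrix \<phi> (- {p}) UNIV)" "s * \<epsilon> * \<omega> {..<c}"] by (simp add: mult_ac)
    next
      case False
      then show ?thesis by (simp add: ctrs_not_distinct)
    qed
  qed
qed

section \<open>Substitution, division, and regularity of linear forms\<close>

section \<open>Evaluation of polynomials\<close>

definition monv :: "('v \<Rightarrow> 'b::comm_ring_1) \<Rightarrow> ('v \<Rightarrow>\<^sub>0 nat) \<Rightarrow> 'b" where
  "monv f m = (\<Prod>x\<in>keys m. f x ^ lookup m x)"

definition evalm :: "('a::comm_ring_1 \<Rightarrow> 'b::comm_ring_1) \<Rightarrow> ('v \<Rightarrow> 'b) \<Rightarrow> (('v, 'a) mpoly) \<Rightarrow> 'b" where
  "evalm \<psi> f p = (\<Sum>m\<in>keys p. \<psi> (lookup p m) * monv f m)"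

abbreviation cst :: "'a::zero \<Rightarrow> (('v, 'a) mpoly)" where
  "cst \<equiv> single 0"

abbreviation var :: "'v \<Rightarrow> (('v, 'a::zero_neq_one) mpoly)" where
  "var x \<equiv> single (single x 1) 1"

lemma monv_superset:
  assumes "finite S" "keys m \<subseteq> S"
  shows "monv f m = (\<Prod>x\<in>S. f x ^ lookup m x)"
  unfolding monv_def by (rule prod.mono_neutral_left) (use assms in \<open>auto simp: in_keys_iff\<close>)

lemma monv_0 [simp]: "monv f 0 = 1"
  by (simp add: monv_def)

lemma monv_add: "monv f (m + m') = monv f m * monv f m'"
proof -
  let ?S = "keys m \<union> keys m'"
  have "keys (m + m') \<subseteq> ?S" by (rule Poly_Mapping.keys_add)
  then show ?thesis
    by (simp add: monv_superset[of ?S] lookup_add power_add prod.distrib)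
qed

lemma monv_single [simp]: "monv f (single x k) = f x ^ k"
  by (simp add: monv_superset[of "{x}"])

lemma evalm_superset:
  assumes "\<psi> 0 = 0" "finite S" "keys p \<subseteq> S"
  shows "evalm \<psi> f p = (\<Sum>m\<in>S. \<psi> (lookup p m) * monv f m)"
  unfolding evalm_def by (rule sum.mono_neutral_left) (use assms in \<open>auto simp: in_keys_iff\<close>)

lemma poly_mapping_sum_singles: "p = (\<Sum>m\<in>keys p. single m (lookup p m))"
proof (rule poly_mapping_eqI)
  fix k
  have "lookup (\<Sum>m\<in>keys p. single m (lookup p m)) k
      = (\<Sum>m\<in>keys p. if m = k then lookup p k else 0)"
    by (simp add: lookup_sum lookup_single when_def if_distrib cong: if_cong sum.cong_simp)
  then show "lookup p k = lookup (\<Sum>m\<in>keys p. single m (lookup p m)) k"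
    by (simp add: in_keys_iff)
qed

lemma poly_mapping_induct_add [case_names zero add]:
  assumes "P 0" "\<And>p m c. P p \<Longrightarrow> P (p + single m c)"
  shows "P (p :: 'a \<Rightarrow>\<^sub>0 'b::comm_monoid_add)"
proof -
  have "P (\<Sum>m\<in>S. single m (c m))" if "finite S" for S :: "'a set" and c :: "'a \<Rightarrow> 'b"
    using that
  proof induction
    case (insert x F)
    then show ?case using assms(2)[of "\<Sum>m\<in>F. single m (c m)" x "c x"] by (simp add: add.commute)
  qed (simp add: assms(1))
  from this[of "keys p" "lookup p"] show ?thesis
    by (simp flip: poly_mapping_sum_singles)
qed

context
  fixes \<psi> :: "'a::comm_ring_1 \<Rightarrow> 'b::comm_ring_1" and f :: "'v \<Rightarrow> 'b"
  assumes hom: "comm_ring_hom \<psi>"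
begin

interpretation comm_ring_hom \<psi> by (rule hom)

lemma evalm_single: "evalm \<psi> f (single m c) = \<psi> c * monv f m"
  by (simp add: evalm_superset[where S = "{m}"])

lemma evalm_0: "evalm \<psi> f 0 = 0"
  by (simp add: evalm_def)

lemma evalm_add: "evalm \<psi> f (p + q) = evalm \<psi> f p + evalm \<psi> f q"
proof -
  let ?S = "keys p \<union> keys q"
  have "keys (p + q) \<subseteq> ?S" by (rule Poly_Mapping.keys_add)
  then show ?thesis
    by (simp add: evalm_superset[where S = ?S] lookup_add hom_add sum.distrib distrib_right)
qed

lemma evalm_mult: "evalm \<psi> f (p * q) = evalm \<psi> f p * evalm \<psi> f q"
proof (induction p rule: poly_mapping_induct_add)
  case (add p m c)
  have "evalm \<psi> f (single m c * q) = \<psi> c * monv f m * evalm \<psi> f q"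
  proof (induction q rule: poly_mapping_induct_add)
    case (add q m' c')
    then show ?case
      by (simp add: distrib_left evalm_add mult_single evalm_single monv_add hom_mult algebra_simps)
  qed (simp add: evalm_0)
  then show ?case using add by (simp add: distrib_right evalm_add evalm_single)
qed (simp add: evalm_0)

lemma evalm_hom: "comm_ring_hom (evalm \<psi> f)"
  by standard (simp_all add: evalm_0 evalm_add evalm_mult evalm_single flip: single_one)

lemma evalm_cst [simp]: "evalm \<psi> f (cst c) = \<psi> c"
  by (simp add: evalm_single)

lemma evalm_var [simp]: "evalm \<psi> f (var x) = f x"
  by (simp add: evalm_single)

end

lemma monv_var:
  fixes m :: "'v \<Rightarrow>\<^sub>0 nat"
  shows "monv var m = single m (1::'a::comm_ring_1)"
proof (induction m rule: poly_mapping_induct_add)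
  case (add m x k)
  have "var x ^ k = (single (single x k) 1 :: ('v, 'a) mpoly)"
    by (induction k) (auto simp: mult_single simp flip: single_add)
  then show ?case using add by (simp add: monv_add mult_single)
qed simp

lemma hom_eqI:
  fixes h h' :: "(('v, 'a::comm_ring_1) mpoly) \<Rightarrow> 'b::comm_ring_1"
  assumes "comm_ring_hom h" "comm_ring_hom h'" "\<And>c. h (cst c) = h' (cst c)" "\<And>x. h (var x) = h' (var x)"
  shows "h p = h' p"
proof -
  interpret h: comm_ring_hom h by fact
  interpret h': comm_ring_hom h' by fact
  show ?thesis
  proof (induction p rule: poly_mapping_induct_add)
    case (add p m c)
    have "h (single m 1) = h' (single m 1)"
    proof (induction m rule: poly_mapping_induct_add)
      case (add m x k)
      have "single (single x k) 1 = (var x ^ k :: ('v, 'a) mpoly)"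
        using monv_var[of "single x k", where 'a = 'a] by simp
      then have "h (single (single x k) 1) = h' (single (single x k) 1)"
        using assms(4)[of x] by (simp only: h.hom_power h'.hom_power)
      moreover have "single (m + single x k) (1::'a)
          = single m 1 * single (single x k) 1" by (simp add: mult_single)
      ultimately show ?case using add by (simp add: h.hom_mult h'.hom_mult)
    qed (simp add: assms)
    moreover have "single m c = cst c * single m 1" by (simp add: mult_single)
    ultimately show ?case using add assms(3) by (simp add: h.hom_add h'.hom_add h.hom_mult h'.hom_mult)
  qed simp
qed

section \<open>Pseudo-division\<close>

text \<open>Subrings are sets because \<open>T\<close>, the polynomials free of a variable and those
  in given variables all live inside one polynomial type.\<close>

definition subring_set :: "'a::comm_ring_1 set \<Rightarrow> bool" where
  "subring_set K \<longleftrightarrow> 0 \<in> K \<and> 1 \<in> K \<and> (\<forall>x\<in>K. \<forall>y\<in>K. x + y \<in> K \<and> x - y \<in> K \<and> x * y \<in> K)"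

lemma subring_setD:
  assumes "subring_set K"
  shows "0 \<in> K" "1 \<in> K" "x \<in> K \<Longrightarrow> y \<in> K \<Longrightarrow> x + y \<in> K" "x \<in> K \<Longrightarrow> y \<in> K \<Longrightarrow> x - y \<in> K" "x \<in> K \<Longrightarrow> y \<in> K \<Longrightarrow> x * y \<in> K"
  using assms by (auto simp: subring_set_def)

lemma subring_set_uminus: "subring_set K \<Longrightarrow> x \<in> K \<Longrightarrow> - x \<in> K"
  using subring_setD(1)[of K] subring_setD(4)[of K 0 x] by simp

lemma subring_set_sum: "subring_set K \<Longrightarrow> (\<And>i. i \<in> A \<Longrightarrow> f i \<in> K) \<Longrightarrow> sum f A \<in> K"
  by (induction A rule: infinite_finite_induct) (auto intro: subring_setD)

lemma subring_set_prod: "subring_set K \<Longrightarrow> (\<And>i. i \<in> A \<Longrightarrow> f i \<in> K) \<Longrightarrow> prod f A \<in> K"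
  by (induction A rule: infinite_finite_induct) (auto intro: subring_setD)

lemma subring_set_power: "subring_set K \<Longrightarrow> x \<in> K \<Longrightarrow> x ^ n \<in> K"
  by (induction n) (auto intro: subring_setD)

definition polys_over :: "'a::comm_ring_1 set \<Rightarrow> 'a poly set" where
  "polys_over K = {p. \<forall>i. coeff p i \<in> K}"

lemma subring_polys_over: "subring_set K \<Longrightarrow> subring_set (polys_over K)"
  unfolding subring_set_def[of "polys_over K"]
  by (auto simp: polys_over_def coeff_mult intro!: subring_set_sum subring_setD(3-5))
     (auto simp: one_poly.rep_eq coeff_pCons split: nat.splits intro: subring_setD)

text \<open>Each step multiplies by the leading coefficient of \<open>Q\<close> before it cancels
  the leading term of \<open>P\<close>, so that no coefficient leaves \<open>K\<close>.\<close>

lemma pseudo_division_over: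
  fixes P Q :: "'a::idom poly"
  assumes K: "subring_set K" and Q: "Q \<in> polys_over K" "Q \<noteq> 0" and "P \<in> polys_over K"
  shows "\<exists>N A R. A \<in> polys_over K \<and> R \<in> polys_over K \<and> smult (lead_coeff Q ^ N) P = A * Q + R
    \<and> (R = 0 \<or> degree R < degree Q)"
  using assms(4)
proof (induction "degree P" arbitrary: P rule: less_induct)
  case less
  note KK = subring_polys_over[OF K]
  show ?case
  proof (cases "P = 0 \<or> degree P < degree Q")
    case True
    then show ?thesis using less.prems subring_setD(1)[OF KK]
      by (intro exI[of _ 0] exI[of _ "0::'a poly"] exI[of _ P]) auto
  next
    case False
    define M where "M = monom (lead_coeff P) (degree P - degree Q)"
    define P' where "P' = smult (lead_coeff Q) P - M * Q"
    have M: "M \<in> polys_over K" using less.prems K by (auto simp: M_def polys_over_def intro: subring_setD)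
    have sm: "smult (lead_coeff Q) P \<in> polys_over K"
      using Q less.prems K by (auto simp: polys_over_def intro: subring_setD)
    have P': "P' \<in> polys_over K" unfolding P'_def by (intro subring_setD[OF KK] M Q sm)
    have "degree (M * Q) \<le> degree P"
      using degree_mult_le[of M Q] degree_monom_le[of "lead_coeff P" "degree P - degree Q"] False unfolding M_def by linarith
    then have "degree P' \<le> degree P" unfolding P'_def by (intro degree_diff_le) auto
    moreover have "coeff P' (degree P) = 0"
      using False by (simp add: P'_def M_def coeff_monom_mult)
    ultimately have "P' = 0 \<or> degree P' < degree P"
      by (metis leading_coeff_0_iff order.strict_iff_order)
    then have "\<exists>N A R. A \<in> polys_over K \<and> R \<in> polys_over K \<and> smult (lead_coeff Q ^ N) P' = A * Q + R
      \<and> (R = 0 \<or> degree R < degree Q)"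
    proof
      assume "P' = 0"
      then show ?thesis using subring_setD(1)[OF KK]
        by (intro exI[of _ 0] exI[of _ "0::'a poly"] exI[of _ "0::'a poly"]) auto
    qed (use less.hyps P' in blast)
    then obtain N A R where NAR: "A \<in> polys_over K" "R \<in> polys_over K" "smult (lead_coeff Q ^ N) P' = A * Q + R"
      "R = 0 \<or> degree R < degree Q" by blast
    have "smult (lead_coeff Q ^ Suc N) P = smult (lead_coeff Q ^ N) P' + smult (lead_coeff Q ^ N) (M * Q)"
      by (simp add: P'_def smult_diff_right mult.commute)
    also have "\<dots> = (A + smult (lead_coeff Q ^ N) M) * Q + R"
      unfolding NAR by (simp add: algebra_simps)
    finally have "smult (lead_coeff Q ^ Suc N) P = (A + smult (lead_coeff Q ^ N) M) * Q + R" .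
    moreover have "smult (lead_coeff Q ^ N) M \<in> polys_over K"
      using M Q K by (auto simp: polys_over_def intro!: subring_setD(5) subring_set_power)
    ultimately show ?thesis using NAR subring_setD(3)[OF KK] by blast
  qed
qed

section \<open>Polynomials in one distinguished variable\<close>

definition free_of :: "'v \<Rightarrow> (('v, 'a::comm_ring_1) mpoly) set" where
  "free_of v = {p. \<forall>m\<in>keys p. lookup m v = 0}"

text \<open>A set of monomials closed under addition spans a subring; \<open>free_of\<close> and
  \<open>T\<close> are both of this kind.\<close>

lemma subring_keys:
  assumes "0 \<in> M" "\<And>m m'. m \<in> M \<Longrightarrow> m' \<in> M \<Longrightarrow> m + m' \<in> M"
  shows "subring_set {p :: ('v, 'a::comm_ring_1) mpoly. keys p \<subseteq> M}"
proof -
  have "keys (p + q) \<subseteq> M \<and> keys (p - q) \<subseteq> M \<and> keys (p * q) \<subseteq> M"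
    if "keys p \<subseteq> M" "keys q \<subseteq> M" for p q :: "('v, 'a) mpoly"
    using that Poly_Mapping.keys_add[of p q] keys_diff[of p q] keys_mult[of p q] assms(2) by blast
  then show ?thesis using assms(1) by (simp add: subring_set_def)
qed

lemma subring_free_of: "subring_set (free_of v)"
proof -
  have "free_of v = {p. keys p \<subseteq> {m. lookup m v = 0}}" by (auto simp: free_of_def)
  show ?thesis unfolding \<open>free_of v = _\<close> by (rule subring_keys) (auto simp: lookup_add)
qed

lemma free_of_cst [simp]: "cst c \<in> free_of v"
  by (auto simp: free_of_def)

lemma free_of_single: "lookup m v = 0 \<Longrightarrow> single m c \<in> free_of v"
  by (auto simp: free_of_def)

text \<open>The coefficients stay in the same polynomial type, so no second ring of polynomials in
  the remaining variables is needed. That they do not involve \<open>v\<close> is recorded by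
  \<open>polys_over (free_of v)\<close>, and evaluation at \<open>var v\<close> undoes the
  map.\<close>

definition to_poly :: "'v \<Rightarrow> (('v, 'a::comm_ring_1) mpoly) \<Rightarrow> (('v, 'a) mpoly) poly" where
  "to_poly v = evalm (\<lambda>c. [:cst c:]) (\<lambda>x. if x = v then [:0, 1:] else [:var x:])"

lemma cst_poly_hom: "comm_ring_hom (\<lambda>c. [:cst c:] :: (('v, 'a::comm_ring_1) mpoly) poly)"
  by standard (auto simp: single_add mult_single one_pCons mult.commute)

lemma to_poly_hom: "comm_ring_hom (to_poly v)"
  unfolding to_poly_def by (rule evalm_hom[OF cst_poly_hom])

lemma poly_to_poly [simp]:
  fixes p :: "('v, 'a::comm_ring_1) mpoly"
  shows "poly (to_poly v p) (var v) = p"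
proof (rule hom_eqI[where h' = "\<lambda>p. p"])
  interpret comm_ring_hom "to_poly v" by (rule to_poly_hom)
  show "comm_ring_hom (\<lambda>p. poly (to_poly v p) (var v))"
    by standard (auto simp: hom_add hom_mult)
  show "comm_ring_hom (\<lambda>p :: ('v, 'a) mpoly. p)" by standard auto
qed (auto simp: to_poly_def evalm_single[OF cst_poly_hom])

lemma to_poly_over:
  fixes p :: "('v, 'a::comm_ring_1) mpoly"
  shows "to_poly v p \<in> polys_over (free_of v)"
proof (induction p rule: poly_mapping_induct_add)
  case zero
  then show ?case by (simp add: to_poly_def evalm_0[OF cst_poly_hom] polys_over_def subring_setD(1)[OF subring_free_of])
next
  case (add p m c)
  note K = subring_polys_over[OF subring_free_of[of v]]
  have c: "[:cst c:] \<in> polys_over (free_of v)" for c :: 'a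
    by (auto simp: polys_over_def coeff_pCons split: nat.splits intro: subring_setD(1)[OF subring_free_of])
  have "(if x = v then [:0, 1:] else [:var x:]) \<in> polys_over (free_of v)" for x
    by (auto simp: polys_over_def coeff_pCons split: nat.splits intro: subring_setD(1,2)[OF subring_free_of] free_of_single)
       (auto simp: free_of_def lookup_single when_def)
  then have "monv (\<lambda>x. if x = v then [:0, 1:] else [:var x:]) m \<in> polys_over (free_of v)"
    unfolding monv_def by (intro subring_set_prod[OF K] subring_set_power[OF K])
  then have "to_poly v (single m c) \<in> polys_over (free_of v)"
    unfolding to_poly_def evalm_single[OF cst_poly_hom] by (intro subring_setD(5)[OF K] c)
  then show ?case using add subring_setD(3)[OF K]
    by (simp add: to_poly_def evalm_add[OF cst_poly_hom])
qed

lemma to_poly_free: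
  fixes p :: "('v, 'a::comm_ring_1) mpoly"
  assumes p: "p \<in> free_of v"
  shows "to_poly v p = [:p:]"
proof -
  have sm: "to_poly v (single m c) = [:single m c:]" if "lookup m v = 0" for m and c :: 'a
  proof -
    have pw: "[:x:] ^ k = [:x ^ k:]" for x :: "('v, 'a) mpoly" and k
      by (induction k) (auto simp: one_pCons)
    have pr: "(\<Prod>x\<in>S. [:f x:]) = [:\<Prod>x\<in>S. f x:]" for S :: "'v set" and f :: "_ \<Rightarrow> ('v, 'a) mpoly"
      by (induction S rule: infinite_finite_induct) (auto simp: one_pCons)
    have "monv (\<lambda>x. if x = v then [:0, 1:] else [:var x :: ('v, 'a) mpoly:]) m = (\<Prod>x\<in>keys m. [:var x ^ lookup m x:])"
      unfolding monv_def using that by (intro prod.cong refl) (auto simp: in_keys_iff pw)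
    also have "\<dots> = [:monv var m:]" by (simp add: monv_def pr)
    also have "monv var m = single m (1::'a)" by (rule monv_var)
    finally show ?thesis
      by (simp add: to_poly_def evalm_single[OF cst_poly_hom] mult_single)
  qed
  interpret comm_ring_hom "to_poly v" by (rule to_poly_hom)
  have hp: "(\<Sum>m\<in>S. [:f m:]) = [:\<Sum>m\<in>S. f m:]" for S :: "('v \<Rightarrow>\<^sub>0 nat) set" and f :: "_ \<Rightarrow> ('v, 'a) mpoly"
    by (induction S rule: infinite_finite_induct) auto
  have "to_poly v p = (\<Sum>m\<in>keys p. to_poly v (single m (lookup p m)))"
    by (subst poly_mapping_sum_singles[of p]) (rule hom_sum)
  also have "\<dots> = (\<Sum>m\<in>keys p. [:single m (lookup p m):])"
    using p by (intro sum.cong refl sm) (auto simp: free_of_def)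
  finally show ?thesis by (simp add: hp flip: poly_mapping_sum_singles)
qed

text \<open>\<open>F\<close> has degree one in \<open>v\<close>, so pseudo-division by it leaves a
  remainder of degree zero in \<open>v\<close>. The factor is a power of the leading coefficient
  \<open>h\<close>, which may be enlarged to the same power of any multiple
  \<open>q\<close>.\<close>

lemma linear_division:
  fixes F F' p :: "('v::linorder, 'a::idom) mpoly"
  assumes F: "F = cst h * var v + F'" "F' \<in> free_of v" "h \<noteq> 0" and q: "h dvd q"
  shows "\<exists>N A r. r \<in> free_of v \<and> cst q ^ N * p = F * A + r"
proof -
  interpret comm_ring_hom "to_poly v" by (rule to_poly_hom)
  have h: "cst h \<noteq> (0 :: ('v, 'a) mpoly)" using F(3) by (metis lookup_single_eq lookup_zero)
  have tF: "to_poly v F = [:F', cst h:]"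
    using F by (simp add: hom_add hom_mult to_poly_free) (simp add: to_poly_def evalm_single[OF cst_poly_hom])
  obtain N A R where *: "R \<in> polys_over (free_of v)" "smult (lead_coeff (to_poly v F) ^ N) (to_poly v p) = A * to_poly v F + R"
      "R = 0 \<or> degree R < degree (to_poly v F)"
    using pseudo_division_over[OF subring_free_of to_poly_over _ to_poly_over, of v F p] h tF by auto
  then have "degree R = 0" using tF h by auto
  then obtain r where r: "R = [:r:]" by (meson degree_eq_zeroE)
  have "r \<in> free_of v" using *(1) by (auto simp: r polys_over_def coeff_pCons split: nat.splits dest: spec[of _ 0])
  have "poly (smult (cst h ^ N) (to_poly v p)) (var v) = poly (A * to_poly v F + R) (var v)"
    using *(2) tF h by simp
  then have eq: "cst h ^ N * p = F * poly A (var v) + r"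
    using r poly_to_poly[of v p] poly_to_poly[of v F] by (simp only: poly_smult poly_add poly_mult) (simp add: mult.commute)
  obtain e where e: "q = h * e" using q by auto
  have "cst q ^ N * p = cst e ^ N * (cst h ^ N * p)"
    by (simp add: e mult_single power_mult_distrib mult_ac flip: power_mult_distrib)
  also have "\<dots> = F * (cst e ^ N * poly A (var v)) + cst e ^ N * r" unfolding eq by (simp add: algebra_simps)
  finally have qN: "cst q ^ N * p = F * (cst e ^ N * poly A (var v)) + cst e ^ N * r" .
  have "cst e ^ N \<in> (free_of v :: (('v, 'a) mpoly) set)" by (intro subring_set_power[OF subring_free_of]) simp
  then show ?thesis using qN subring_setD(5)[OF subring_free_of _ \<open>r \<in> free_of v\<close>] by blast
qed

text \<open>Multiplication by \<open>F\<close> raises the degree in \<open>v\<close> by one.\<close>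

lemma linear_multiple_free:
  fixes F F' p :: "('v::linorder, 'a::idom) mpoly"
  assumes F: "F = cst h * var v + F'" "F' \<in> free_of v" "h \<noteq> 0" and p: "F * p \<in> free_of v"
  shows "p = 0"
proof (rule ccontr)
  assume "p \<noteq> 0"
  interpret comm_ring_hom "to_poly v" by (rule to_poly_hom)
  have h: "cst h \<noteq> (0 :: ('v, 'a) mpoly)" using F(3) by (metis lookup_single_eq lookup_zero)
  have tF: "to_poly v F = [:F', cst h:]"
    using F by (simp add: hom_add hom_mult to_poly_free) (simp add: to_poly_def evalm_single[OF cst_poly_hom])
  have tp: "to_poly v p \<noteq> 0" using poly_to_poly[of v p] \<open>p \<noteq> 0\<close> by (metis poly_0)
  have "degree (to_poly v F * to_poly v p) = degree (to_poly v F) + degree (to_poly v p)"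
    using tp tF h by (intro degree_mult_eq) auto
  moreover have "to_poly v F * to_poly v p = [:F * p:]"
    using to_poly_free[OF p] by (simp only: hom_mult)
  ultimately show False using tF h by simp
qed

text \<open>Each \<open>F i\<close> is linear in an indeterminate of its own that the other two do
  not contain. Division by \<open>F i\<close> leaves remainders free of that indeterminate, and a
  multiple of \<open>F i\<close> free of it is zero; thus every relation among the
  \<open>F i\<close> reduces to one among remainders.\<close>

lemma koszul_regular_linear:
  fixes F :: "nat \<Rightarrow> ('v::linorder, 'a::idom) mpoly"
  assumes F: "\<And>i. i < 3 \<Longrightarrow> F i = cst (h i) * var (C i) + F' i"
    and F': "\<And>i. i < 3 \<Longrightarrow> F' i \<in> free_of (C i)"
    and free: "\<And>i j. i < 3 \<Longrightarrow> j < 3 \<Longrightarrow> i \<noteq> j \<Longrightarrow> F i \<in> free_of (C j)"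
    and h: "\<And>i. i < 3 \<Longrightarrow> h i \<noteq> 0" "\<And>i. i < 3 \<Longrightarrow> h i dvd q"
  shows "koszul_regular (cst q) F"
proof -
  note division = linear_division[OF F F' h(1) h(2)]
  note multiple = linear_multiple_free[OF F F' h(1)]
  note K = subring_setD[OF subring_free_of]
  have nz: "F i \<noteq> 0" if "i < 3" for i
    using multiple[of i 1] that by (metis K(1) mult_zero_left zero_neq_one)
  have K1: "\<exists>N u. cst q ^ N * s = F i * u" if ij: "i < 3" "j < 3" "i \<noteq> j" and eq: "F j * s = F i * t" for i j s t
  proof -
    obtain N u r where r: "r \<in> free_of (C i)" "cst q ^ N * s = F i * u + r" using division ij by metis
    have "F i * (cst q ^ N * t - F j * u) = cst q ^ N * (F i * t) - F i * F j * u" by (simp add: algebra_simps)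
    also have "\<dots> = cst q ^ N * (F j * s) - F i * F j * u" by (simp only: eq)
    also have "\<dots> = F j * (cst q ^ N * s) - F i * F j * u" by (simp add: algebra_simps)
    also have "\<dots> = F j * r" unfolding r(2) by (simp add: algebra_simps)
    finally have *: "F i * (cst q ^ N * t - F j * u) = F j * r" .
    have "F j * r \<in> free_of (C i)" using free[of j i] ij r(1) by (intro K(5)) auto
    then have "cst q ^ N * t - F j * u = 0" using multiple[of i] ij by (metis *)
    then have "F j * r = 0" using * by simp
    then show ?thesis using r nz ij by auto
  qed
  have K2: "\<exists>N x y z. cst q ^ N * t 0 = - F 1 * x - F 2 * y \<and> cst q ^ N * t 1 = F 0 * x - F 2 * z
      \<and> cst q ^ N * t 2 = F 0 * y + F 1 * z" if sum: "(\<Sum>i<3. F i * t i) = 0" for t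
  proof -
    have sum: "F 0 * t 0 + F 1 * t 1 + F 2 * t 2 = 0" using sum by (simp add: numeral_3_eq_3 numeral_2_eq_2)
    obtain N1 A1 r1 where r1: "r1 \<in> free_of (C 0)" "cst q ^ N1 * t 1 = F 0 * A1 + r1" using division[of 0 "t 1"] by auto
    obtain N2 A2 r2 where r2: "r2 \<in> free_of (C 0)" "cst q ^ N2 * t 2 = F 0 * A2 + r2" using division[of 0 "t 2"] by auto
    \<comment> \<open>The two divisions come with different powers; each is multiplied by the power
      of the other, which makes \<open>q1 * q2\<close> the common factor.\<close>
    define q1 q2 :: "('v, 'a) mpoly" where "q1 = cst q ^ N1" and "q2 = cst q ^ N2"
    define s1 s2 where "s1 = q2 * r1" and "s2 = q1 * r2"
    have qf: "cst q ^ N \<in> (free_of v :: (('v, 'a) mpoly) set)" for N v by (intro subring_set_power[OF subring_free_of]) simp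
    have s: "s1 \<in> free_of (C 0)" "s2 \<in> free_of (C 0)"
      using r1 r2 qf by (auto simp: s1_def s2_def q1_def q2_def intro!: K(5))
    have t1: "q1 * q2 * t 1 = F 0 * (q2 * A1) + s1" and t2: "q1 * q2 * t 2 = F 0 * (q1 * A2) + s2"
      using arg_cong[OF r1(2), of "\<lambda>z. q2 * z"] arg_cong[OF r2(2), of "\<lambda>z. q1 * z"]
      by (simp_all add: s1_def s2_def q1_def q2_def algebra_simps)
    have "F 0 * (- (q1 * q2 * t 0 + F 1 * (q2 * A1) + F 2 * (q1 * A2)))
        = F 1 * (q1 * q2 * t 1 - F 0 * (q2 * A1)) + F 2 * (q1 * q2 * t 2 - F 0 * (q1 * A2)) - q1 * q2 * (F 0 * t 0 + F 1 * t 1 + F 2 * t 2)"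
      by (simp add: algebra_simps)
    also have "\<dots> = F 1 * s1 + F 2 * s2" unfolding t1 t2 sum by simp
    finally have *: "F 0 * (- (q1 * q2 * t 0 + F 1 * (q2 * A1) + F 2 * (q1 * A2))) = F 1 * s1 + F 2 * s2" .
    \<comment> \<open>The right side of the identity is free of \<open>C 0\<close> and the left side
      is a multiple of \<open>F 0\<close>, so both vanish. What remains is a relation between
      \<open>F 1\<close> and \<open>F 2\<close>, which \<open>K1\<close> resolves.\<close>
    have "F 1 * s1 + F 2 * s2 \<in> free_of (C 0)" using free[of 1 0] free[of 2 0] s by (intro K(3,5)) auto
    then have z: "- (q1 * q2 * t 0 + F 1 * (q2 * A1) + F 2 * (q1 * A2)) = 0"
      using multiple[of 0 "- (q1 * q2 * t 0 + F 1 * (q2 * A1) + F 2 * (q1 * A2))"] * by simp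
    then have F12: "F 1 * s1 + F 2 * s2 = 0" using * by simp
    then have "F 2 * s2 = F 1 * (- s1)" by (simp add: eq_neg_iff_add_eq_0 add.commute)
    from K1[OF _ _ _ this] obtain M z where Mz: "cst q ^ M * s2 = F 1 * z" by auto
    define q3 :: "('v, 'a) mpoly" where "q3 = cst q ^ M"
    have "F 1 * (q3 * s1 + F 2 * z) = q3 * (F 1 * s1 + F 2 * s2)"
      using Mz by (simp add: q3_def algebra_simps)
    then have s1: "q3 * s1 = - F 2 * z" using F12 nz[of 1] by (simp add: eq_neg_iff_add_eq_0)
    define N where "N = N1 + N2 + M"
    have qN: "cst q ^ N = q3 * (q1 * q2)" by (simp add: N_def q1_def q2_def q3_def power_add)
    have u1: "cst q ^ N * t 1 = F 0 * (q3 * q2 * A1) - F 2 * z"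
      using arg_cong[OF t1, of "\<lambda>z. q3 * z"] s1 by (simp add: qN algebra_simps)
    have u2: "cst q ^ N * t 2 = F 0 * (q3 * q1 * A2) + F 1 * z"
      using arg_cong[OF t2, of "\<lambda>z. q3 * z"] Mz by (simp add: qN q3_def algebra_simps)
    have "q1 * q2 * t 0 = - (F 1 * (q2 * A1) + F 2 * (q1 * A2))"
      using z by (simp add: eq_neg_iff_add_eq_0 add.assoc)
    then have u0: "cst q ^ N * t 0 = - F 1 * (q3 * q2 * A1) - F 2 * (q3 * q1 * A2)"
      by (simp add: qN mult.assoc) (simp add: algebra_simps)
    show ?thesis using u0 u1 u2 by blast
  qed
  show ?thesis
    unfolding koszul_regular_def using nz[of 0] K1[of 0 1] K2 by auto
qed

section \<open>A qualitative Dedekind-Mertens theorem\<close>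

section \<open>Annihilators of polynomials with coefficients in a module\<close>

definition submodule_fun :: "('j \<Rightarrow> 'a::comm_ring_1) set \<Rightarrow> bool" where
  "submodule_fun N \<longleftrightarrow> (\<lambda>_. 0) \<in> N \<and> (\<forall>x\<in>N. \<forall>y\<in>N. (\<lambda>j. x j + y j) \<in> N) \<and> (\<forall>c. \<forall>x\<in>N. (\<lambda>j. c * x j) \<in> N)"

text \<open>\<open>N[C]\<close>, the families of polynomials all of whose coefficient families lie in \<open>N\<close>.\<close>

definition poly_families :: "('j \<Rightarrow> 'a::comm_ring_1) set \<Rightarrow> ('j \<Rightarrow> ('v, 'a) mpoly) set" where
  "poly_families N = {Y. \<forall>\<mu>. (\<lambda>j. lookup (Y j) \<mu>) \<in> N}"

lemma lookup_cst_mult [simp]: "lookup (cst c * y) \<mu> = c * lookup y \<mu>"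
  for c :: "'a::comm_ring_1" and y :: "('v, 'a) mpoly"
  by (simp add: mult_map_scale_conv_mult [symmetric] map.rep_eq when_def)

lemma cst_cst_mult: "cst a * (cst b * y) = cst (a * b) * y"
  for a b :: "'a::comm_ring_1" and y :: "('v, 'a) mpoly"
  by (simp add: mult_single flip: mult.assoc)

text \<open>\<open>L\<close> may exceed the support of \<open>y\<close>, so that all members of a
  family can share one index set.\<close>

lemma lookup_mult_finite:
  fixes m y :: "('v, 'a::comm_ring_1) mpoly"
  assumes "finite L" "keys y \<subseteq> L"
  shows "lookup (m * y) \<mu>
    = (\<Sum>\<kappa>\<in>keys m. \<Sum>\<nu>\<in>L. if \<kappa> + \<nu> = \<mu> then lookup m \<kappa> * lookup y \<nu> else 0)"
proof -
  have y: "y = (\<Sum>\<nu>\<in>L. single \<nu> (lookup y \<nu>))"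
    by (subst poly_mapping_sum_singles, rule sum.mono_neutral_left) (use assms in \<open>auto simp: in_keys_iff\<close>)
  have "m * y = (\<Sum>\<kappa>\<in>keys m. single \<kappa> (lookup m \<kappa>)) * (\<Sum>\<nu>\<in>L. single \<nu> (lookup y \<nu>))"
    by (simp flip: y poly_mapping_sum_singles)
  also have "\<dots> = (\<Sum>\<kappa>\<in>keys m. \<Sum>\<nu>\<in>L. single (\<kappa> + \<nu>) (lookup m \<kappa> * lookup y \<nu>))"
    by (simp add: sum_product mult_single)
  finally show ?thesis by (simp add: lookup_sum lookup_single when_def)
qed

context
  fixes N :: "('j \<Rightarrow> 'a::comm_ring_1) set"
  assumes N: "submodule_fun N"
begin

lemma submodule_funD:
  "(\<lambda>_. 0) \<in> N" "x \<in> N \<Longrightarrow> y \<in> N \<Longrightarrow> (\<lambda>j. x j + y j) \<in> N" "x \<in> N \<Longrightarrow> (\<lambda>j. c * x j) \<in> N"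
  using N by (auto simp: submodule_fun_def)

lemma submodule_fun_sum: "(\<And>i. i \<in> S \<Longrightarrow> x i \<in> N) \<Longrightarrow> (\<lambda>j. \<Sum>i\<in>S. x i j) \<in> N"
  by (induction S rule: infinite_finite_induct) (auto intro: submodule_funD)

lemma submodule_fun_diff: "x \<in> N \<Longrightarrow> y \<in> N \<Longrightarrow> (\<lambda>j. x j - y j) \<in> N"
  using submodule_funD(2)[OF _ submodule_funD(3)[of y "-1"], of x] by simp

lemma poly_families_add: "Y \<in> poly_families N \<Longrightarrow> Z \<in> poly_families N \<Longrightarrow> (\<lambda>j. Y j + Z j) \<in> poly_families N"
  by (simp add: poly_families_def lookup_add submodule_funD(2))

lemma poly_families_scale: "Y \<in> poly_families N \<Longrightarrow> (\<lambda>j. cst c * Y j) \<in> poly_families N"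
  by (simp add: poly_families_def submodule_funD(3))

lemma poly_families_mult:
  fixes Y :: "'j \<Rightarrow> ('v, 'a) mpoly"
  assumes Y: "Y \<in> poly_families N" "finite (\<Union>j. keys (Y j))"
  shows "(\<lambda>j. m * Y j) \<in> poly_families N"
proof -
  let ?L = "\<Union>j. keys (Y j)"
  have "lookup (m * Y j) \<mu> = (\<Sum>\<kappa>\<in>keys m. \<Sum>\<nu>\<in>?L. if \<kappa> + \<nu> = \<mu>
      then lookup m \<kappa> * lookup (Y j) \<nu> else 0)" for \<mu> j
    using Y(2) by (intro lookup_mult_finite) auto
  moreover have "(\<lambda>j. if \<kappa> + \<nu> = \<mu> then lookup m \<kappa> * lookup (Y j) \<nu> else 0) \<in> N" for \<kappa> \<nu> \<mu>
    using Y(1) submodule_funD(1) submodule_funD(3) by (cases "\<kappa> + \<nu> = \<mu>") (auto simp: poly_families_def)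
  ultimately show ?thesis
    unfolding poly_families_def by (simp add: submodule_fun_sum)
qed

lemma keys_cst_mult: "keys (cst c * y) \<subseteq> keys y"
  for y :: "('v, 'a) mpoly"
  by (auto simp: in_keys_iff)

text \<open>Let \<open>l\<close> be the largest monomial at which \<open>Y\<close> fails to lie in
  \<open>N\<close>. In the coefficient of \<open>m * Y\<close> at \<open>\<kappa> + l\<close> all
  terms but \<open>lookup m \<kappa> * lookup (Y j) l\<close> lie in \<open>N\<close>: the higher
  coefficients of \<open>m\<close> kill \<open>Y\<close> by hypothesis, and the lower monomials of
  \<open>m\<close> meet only monomials of \<open>Y\<close> beyond \<open>l\<close>. Hence
  multiplying \<open>Y\<close> by \<open>lookup m \<kappa>\<close> leaves fewer failures.\<close>

lemma top_coefficient_nilpotent: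
  fixes Y :: "'j \<Rightarrow> ('v::linorder, 'a) mpoly"
  assumes "finite L" "\<And>j. keys (Y j) \<subseteq> L"
    and "(\<lambda>j. m * Y j) \<in> poly_families N"
    and "\<And>\<kappa>'. \<kappa>' > \<kappa> \<Longrightarrow> (\<lambda>j. cst (lookup m \<kappa>') * Y j) \<in> poly_families N"
  shows "\<exists>e. (\<lambda>j. cst (lookup m \<kappa> ^ e) * Y j) \<in> poly_families N"
  using assms(2-4)
proof (induction "card {\<nu>\<in>L. (\<lambda>j. lookup (Y j) \<nu>) \<notin> N}" arbitrary: Y rule: less_induct)
  case less
  let ?bad = "\<lambda>Y. {\<nu>\<in>L. (\<lambda>j. lookup (Y j) \<nu>) \<notin> N}"
  let ?c = "lookup m \<kappa>"
  show ?case
  proof (cases "?bad Y = {}")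
    case True
    have "(\<lambda>j. lookup (Y j) \<mu>) \<in> N" for \<mu>
    proof (cases "\<mu> \<in> L")
      case False
      then have "lookup (Y j) \<mu> = 0" for j using less.prems(1)[of j] by (meson in_keys_iff subsetD)
      then show ?thesis using submodule_funD(1) by simp
    qed (use True in auto)
    then show ?thesis by (intro exI[of _ 0]) (simp add: poly_families_def)
  next
    case False
    define l where "l = Max (?bad Y)"
    have l: "l \<in> ?bad Y" "\<And>\<nu>. \<nu> \<in> ?bad Y \<Longrightarrow> \<nu> \<le> l"
      using False assms(1) by (auto simp: l_def simp del: mem_Collect_eq intro!: Max_in Max_ge)
    have good: "(\<lambda>j. lookup (Y j) \<nu>) \<in> N" if "\<nu> \<in> L" "\<nu> > l" for \<nu>
      by (rule ccontr) (use l(2)[of \<nu>] that in auto)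
    have cl: "(\<lambda>j. ?c * lookup (Y j) l) \<in> N"
    proof (cases "\<kappa> \<in> keys m")
      case False
      then show ?thesis using submodule_funD(1) by (simp add: in_keys_iff)
    next
      case True
      define t where "t \<kappa>' \<nu> j = (if \<kappa>' + \<nu> = \<kappa> + l then lookup m \<kappa>' * lookup (Y j) \<nu> else 0)" for \<kappa>' \<nu> j
      let ?S = "keys m \<times> L"
      have 1: "lookup (m * Y j) (\<kappa> + l) = (\<Sum>(\<kappa>', \<nu>)\<in>?S. t \<kappa>' \<nu> j)" for j
        using lookup_mult_finite[OF assms(1) less.prems(1), of m j "\<kappa> + l"] by (simp add: t_def sum.cartesian_product)
      have 2: "(\<Sum>(\<kappa>', \<nu>)\<in>?S. t \<kappa>' \<nu> j) = t \<kappa> l j + (\<Sum>(\<kappa>', \<nu>)\<in>?S - {(\<kappa>, l)}. t \<kappa>' \<nu> j)" for j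
        using True l(1) assms(1) by (subst sum.remove[of ?S "(\<kappa>, l)"]) auto
      have eq: "t \<kappa> l j = lookup (m * Y j) (\<kappa> + l) - (\<Sum>(\<kappa>', \<nu>)\<in>?S - {(\<kappa>, l)}. t \<kappa>' \<nu> j)" for j
        unfolding 1 2 by simp
      have "(\<lambda>j. t \<kappa>' \<nu> j) \<in> N" if "(\<kappa>', \<nu>) \<in> ?S - {(\<kappa>, l)}" for \<kappa>' \<nu>
      proof (cases "\<kappa>' + \<nu> = \<kappa> + l")
        case False
        then show ?thesis using submodule_funD(1) by (simp add: t_def)
      next
        case eq': True
        consider "\<kappa>' > \<kappa>" | "\<kappa>' < \<kappa>" | "\<kappa>' = \<kappa>" by (meson linorder_less_linear)
        then show ?thesis
        proof cases
          case 1
          then show ?thesis using less.prems(3)[of \<kappa>'] eq' by (simp add: t_def poly_families_def)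
        next
          case 2
          have "\<nu> > l"
          proof (rule ccontr)
            assume "\<not> l < \<nu>"
            then have "\<kappa>' + \<nu> < \<kappa> + l" using 2 by (intro add_less_le_mono) auto
            then show False using eq' by simp
          qed
          then show ?thesis using good that eq' submodule_funD(3) by (simp add: t_def)
        next
          case 3
          then show ?thesis using that eq' by simp
        qed
      qed
      then have "(\<lambda>j. \<Sum>x\<in>?S - {(\<kappa>, l)}. (case x of (\<kappa>', \<nu>) \<Rightarrow> t \<kappa>' \<nu>) j) \<in> N"
        by (intro submodule_fun_sum) auto
      then have "(\<lambda>j. \<Sum>(\<kappa>', \<nu>)\<in>?S - {(\<kappa>, l)}. t \<kappa>' \<nu> j) \<in> N"
        by (simp add: case_prod_beta)
      moreover have "(\<lambda>j. lookup (m * Y j) (\<kappa> + l)) \<in> N" using less.prems(2) by (simp add: poly_families_def)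
      ultimately have "(\<lambda>j. t \<kappa> l j) \<in> N" unfolding eq by (rule submodule_fun_diff[rotated])
      then show ?thesis by (simp add: t_def)
    qed
    define Y' where "Y' j = cst ?c * Y j" for j
    have "?bad Y' \<subseteq> ?bad Y" using submodule_funD(3)[of _ ?c] by (auto simp: Y'_def)
    moreover have "l \<notin> ?bad Y'" using cl by (simp add: Y'_def)
    ultimately have "?bad Y' \<subset> ?bad Y" using l(1) by blast
    then have "card (?bad Y') < card (?bad Y)" using assms(1) by (intro psubset_card_mono) auto
    moreover have "keys (Y' j) \<subseteq> L" for j
      using keys_cst_mult less.prems(1) unfolding Y'_def by blast
    moreover have "(\<lambda>j. m * Y' j) \<in> poly_families N"
      using poly_families_scale[OF less.prems(2), of ?c] by (simp add: Y'_def mult.left_commute)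
    moreover have "(\<lambda>j. cst (lookup m \<kappa>') * Y' j) \<in> poly_families N" if "\<kappa>' > \<kappa>" for \<kappa>'
      using poly_families_scale[OF less.prems(3)[OF that], of ?c] by (simp add: Y'_def mult.left_commute)
    ultimately obtain e where "(\<lambda>j. cst (?c ^ e) * Y' j) \<in> poly_families N" using less.hyps by blast
    then show ?thesis
      by (intro exI[of _ "Suc e"]) (simp add: Y'_def cst_cst_mult mult.commute[of "?c ^ e"])
  qed
qed

text \<open>The outer induction provides powers of the coefficients above \<open>\<kappa>\<close>
  that kill \<open>Y\<close>, whereas \<open>top_coefficient_nilpotent\<close> asks for these
  coefficients themselves. The inner induction lowers the exponents: an exponent \<open>f k\<close>
  of at least two is split into \<open>f k - 1\<close> for \<open>Y1\<close> and one for
  \<open>Y2\<close>.\<close>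

lemma coefficient_nilpotent:
  fixes Y :: "'j \<Rightarrow> ('v::linorder, 'a) mpoly"
  assumes L: "finite L" and "\<And>j. keys (Y j) \<subseteq> L" "(\<lambda>j. m * Y j) \<in> poly_families N"
  shows "\<exists>e. (\<lambda>j. cst (lookup m \<kappa> ^ e) * Y j) \<in> poly_families N"
  using assms(2,3)
proof (induction "card {\<kappa>'\<in>keys m. \<kappa>' > \<kappa>}" arbitrary: \<kappa> Y rule: less_induct)
  case outer: less
  let ?hi = "{\<kappa>'\<in>keys m. \<kappa>' > \<kappa>}" and ?c = "lookup m"
  let ?ann = "\<lambda>c Y. (\<lambda>j. cst c * Y j) \<in> poly_families N"
  have scale_hyps: "(\<And>j. keys (cst c * Y j) \<subseteq> L)" "(\<lambda>j. m * (cst c * Y j)) \<in> poly_families N"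
    if "\<And>j. keys (Y j) \<subseteq> L" "(\<lambda>j. m * Y j) \<in> poly_families N" for c and Y :: "'j \<Rightarrow> ('v, 'a) mpoly"
    using keys_cst_mult that(1) poly_families_scale[OF that(2), of c] by (blast, simp add: mult.left_commute)
  have inner: "\<exists>e. ?ann (?c \<kappa> ^ e) Y"
    if "\<And>j. keys (Y j) \<subseteq> L" "(\<lambda>j. m * Y j) \<in> poly_families N" "\<And>\<kappa>'. \<kappa>' \<in> ?hi \<Longrightarrow> ?ann (?c \<kappa>' ^ f \<kappa>') Y"
    for Y and f :: "('v \<Rightarrow>\<^sub>0 nat) \<Rightarrow> nat"
    using that
  proof (induction "\<Sum>\<kappa>'\<in>?hi. f \<kappa>'" arbitrary: f Y rule: less_induct)
    case less
    show ?case
    proof (cases "\<forall>\<kappa>'\<in>?hi. ?ann (?c \<kappa>') Y")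
      case True
      have "?ann (?c \<kappa>') Y" if "\<kappa>' > \<kappa>" for \<kappa>'
        using True that submodule_funD(1) by (cases "\<kappa>' \<in> keys m") (auto simp: in_keys_iff poly_families_def)
      then show ?thesis using less.prems by (intro top_coefficient_nilpotent[OF L]) auto
    next
      case False
      then obtain k where k: "k \<in> ?hi" "\<not> ?ann (?c k) Y" by blast
      have "f k \<noteq> 0"
      proof
        assume "f k = 0"
        then have "?ann 1 Y" using less.prems(3)[OF k(1)] by simp
        from poly_families_scale[OF this, of "?c k"] k(2) show False by simp
      qed
      moreover have "f k \<noteq> 1" using less.prems(3)[OF k(1)] k(2) by (metis power_one_right)
      ultimately have fk: "f k \<ge> 2" by linarith
      have sum_less: "(\<Sum>\<kappa>'\<in>?hi. (f(k := x)) \<kappa>') < (\<Sum>\<kappa>'\<in>?hi. f \<kappa>')" if "x < f k" for x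
        using k(1) that by (intro sum_strict_mono_ex1) auto
      define Y1 where "Y1 = (\<lambda>j. cst (?c k) * Y j)"
      have "\<exists>e. ?ann (?c \<kappa> ^ e) Y1"
      proof (rule less.hyps[of "f(k := f k - 1)"])
        fix \<kappa>' assume \<kappa>': "\<kappa>' \<in> ?hi"
        show "?ann (?c \<kappa>' ^ (f(k := f k - 1)) \<kappa>') Y1"
        proof (cases "\<kappa>' = k")
          case True
          have "?c k ^ f k = ?c k ^ (f k - 1) * ?c k" using fk by (simp flip: power_Suc2)
          then show ?thesis using less.prems(3)[OF k(1)] True by (simp add: Y1_def cst_cst_mult)
        next
          case False
          then show ?thesis using poly_families_scale[OF less.prems(3)[OF \<kappa>'], of "?c k"]
            by (simp add: Y1_def mult.left_commute)
        qed
      qed (use sum_less fk scale_hyps[OF less.prems(1,2)] in \<open>auto simp: Y1_def\<close>)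
      then obtain e where e: "?ann (?c \<kappa> ^ e) Y1" by blast
      \<comment> \<open>That this power kills \<open>Y1\<close> means that \<open>?c k\<close>
        itself kills \<open>Y2\<close>, so the exponent at \<open>k\<close> drops to one.\<close>
      define Y2 where "Y2 = (\<lambda>j. cst (?c \<kappa> ^ e) * Y j)"
      have "\<exists>e. ?ann (?c \<kappa> ^ e) Y2"
      proof (rule less.hyps[of "f(k := 1)"])
        fix \<kappa>' assume \<kappa>': "\<kappa>' \<in> ?hi"
        show "?ann (?c \<kappa>' ^ (f(k := 1)) \<kappa>') Y2"
        proof (cases "\<kappa>' = k")
          case True
          then show ?thesis using e by (simp add: Y1_def Y2_def mult.left_commute)
        next
          case False
          then show ?thesis using poly_families_scale[OF less.prems(3)[OF \<kappa>'], of "?c \<kappa> ^ e"]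
            by (simp add: Y2_def mult.left_commute)
        qed
      qed (use sum_less fk scale_hyps[OF less.prems(1,2)] in \<open>auto simp: Y2_def\<close>)
      then obtain e' where "?ann (?c \<kappa> ^ e') Y2" by blast
      then show ?thesis by (intro exI[of _ "e' + e"]) (simp add: Y2_def power_add cst_cst_mult)
    qed
  qed
  have "\<exists>e. ?ann (?c \<kappa>' ^ e) Y" if "\<kappa>' \<in> ?hi" for \<kappa>'
  proof (rule outer.hyps)
    have "{\<kappa>''\<in>keys m. \<kappa>'' > \<kappa>'} \<subset> ?hi" using that by auto
    then show "card {\<kappa>''\<in>keys m. \<kappa>'' > \<kappa>'} < card ?hi" by (intro psubset_card_mono) auto
  qed (use outer.prems in auto)
  then have "\<exists>f. \<forall>\<kappa>'\<in>?hi. ?ann (?c \<kappa>' ^ f \<kappa>') Y" by (intro bchoice ballI)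
  then obtain f where "\<forall>\<kappa>'\<in>?hi. ?ann (?c \<kappa>' ^ f \<kappa>') Y" ..
  then show ?case using inner[OF outer.prems, of f] by blast
qed

lemma coefficient_nilpotent_power:
  fixes Y :: "'j \<Rightarrow> ('v::linorder, 'a) mpoly"
  assumes L: "finite L" and "\<And>j. keys (Y j) \<subseteq> L" "(\<lambda>j. m ^ K * Y j) \<in> poly_families N"
  shows "\<exists>e. (\<lambda>j. cst (lookup m \<kappa> ^ e) * Y j) \<in> poly_families N"
  using assms(2,3)
proof (induction K arbitrary: Y)
  case 0
  then show ?case by (intro exI[of _ 0]) simp
next
  case (Suc K)
  define L' where "L' = (\<lambda>(a, b). a + b) ` (keys (m ^ K) \<times> L)"
  have "\<exists>e. (\<lambda>j. cst (lookup m \<kappa> ^ e) * (m ^ K * Y j)) \<in> poly_families N"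
  proof (rule coefficient_nilpotent)
    show "finite L'" using L by (simp add: L'_def)
    show "keys (m ^ K * Y j) \<subseteq> L'" for j
      using keys_mult[of "m ^ K" "Y j"] Suc.prems(1)[of j] by (force simp: L'_def)
    show "(\<lambda>j. m * (m ^ K * Y j)) \<in> poly_families N" using Suc.prems(2) by (simp add: mult.assoc)
  qed
  then obtain e where e: "(\<lambda>j. cst (lookup m \<kappa> ^ e) * (m ^ K * Y j)) \<in> poly_families N" by blast
  have "\<exists>e'. (\<lambda>j. cst (lookup m \<kappa> ^ e') * (cst (lookup m \<kappa> ^ e) * Y j)) \<in> poly_families N"
  proof (rule Suc.IH)
    show "keys (cst (lookup m \<kappa> ^ e) * Y j) \<subseteq> L" for j
      using keys_cst_mult Suc.prems(1) by blast
    show "(\<lambda>j. m ^ K * (cst (lookup m \<kappa> ^ e) * Y j)) \<in> poly_families N"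
      using e by (simp add: mult.left_commute)
  qed
  then obtain e' where "(\<lambda>j. cst (lookup m \<kappa> ^ e') * (cst (lookup m \<kappa> ^ e) * Y j)) \<in> poly_families N" ..
  then show ?case by (intro exI[of _ "e' + e"]) (simp add: power_add cst_cst_mult)
qed

text \<open>One factor \<open>a + b\<close> is split off at a time and absorbed into
  \<open>Y\<close> as \<open>a\<close> or as \<open>b\<close>, which avoids binomial
  coefficients.\<close>

lemma annihilator_add_power:
  assumes "(\<lambda>j. cst (a ^ i) * Y j) \<in> poly_families N" "(\<lambda>j. cst (b ^ k) * Y j) \<in> poly_families N"
  shows "(\<lambda>j. cst ((a + b) ^ (i + k)) * Y j) \<in> poly_families N"
  using assms
proof (induction "i + k" arbitrary: i k Y)
  case 0
  then show ?case by simp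
next
  case (Suc x)
  show ?case
  proof (cases "i = 0 \<or> k = 0")
    case True
    then have "Y \<in> poly_families N" using Suc.prems by auto
    then show ?thesis by (rule poly_families_scale)
  next
    case False
    then obtain i' k' where ik: "i = Suc i'" "k = Suc k'" by (metis not0_implies_Suc)
    have 1: "(\<lambda>j. cst ((a + b) ^ (i' + k)) * (cst a * Y j)) \<in> poly_families N"
    proof (rule Suc.hyps)
      show "(\<lambda>j. cst (a ^ i') * (cst a * Y j)) \<in> poly_families N"
        using Suc.prems(1) by (simp add: ik cst_cst_mult mult.commute[of a])
      show "(\<lambda>j. cst (b ^ k) * (cst a * Y j)) \<in> poly_families N"
        using poly_families_scale[OF Suc.prems(2), of a] by (simp add: mult.left_commute)
    qed (use Suc.hyps(2) ik in simp)
    have 2: "(\<lambda>j. cst ((a + b) ^ (i + k')) * (cst b * Y j)) \<in> poly_families N"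
    proof (rule Suc.hyps)
      show "(\<lambda>j. cst (b ^ k') * (cst b * Y j)) \<in> poly_families N"
        using Suc.prems(2) by (simp add: ik cst_cst_mult mult.commute[of b])
      show "(\<lambda>j. cst (a ^ i) * (cst b * Y j)) \<in> poly_families N"
        using poly_families_scale[OF Suc.prems(1), of b] by (simp add: mult.left_commute)
    qed (use Suc.hyps(2) ik in simp)
    have "(a + b) ^ (i + k) = (a + b) ^ (i' + k) * a + (a + b) ^ (i + k') * b"
      by (simp add: ik algebra_simps)
    then have "cst ((a + b) ^ (i + k)) * Y j = cst ((a + b) ^ (i' + k)) * (cst a * Y j) + cst ((a + b) ^ (i + k')) * (cst b * Y j)" for j
      by (simp only: cst_cst_mult single_add distrib_right)
    then show ?thesis using poly_families_add[OF 1 2] by simp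
  qed
qed

end

text \<open>The ideal generated by \<open>S\<close>, built up by one multiple at a time so that
  statements about its elements can be proved by induction.\<close>

inductive_set lin_combs :: "'a::comm_ring_1 set \<Rightarrow> 'a set" for S where
  zero: "0 \<in> lin_combs S"
| add: "x \<in> lin_combs S \<Longrightarrow> s \<in> S \<Longrightarrow> x + c * s \<in> lin_combs S"

lemma lin_combs_plus:
  assumes "y \<in> lin_combs S" "x \<in> lin_combs S"
  shows "x + y \<in> lin_combs S"
  using assms
proof (induction y rule: lin_combs.induct)
  case (add y s c)
  then show ?case using lin_combs.add[of "x + y" S s c] by (simp add: add.assoc)
qed simp

lemma lin_combs_mult: "x \<in> lin_combs S \<Longrightarrow> c * x \<in> lin_combs S"
proof (induction x rule: lin_combs.induct)
  case (add x s d)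
  then show ?case using lin_combs.add[of "c * x" S s "c * d"] by (simp add: algebra_simps)
qed (simp add: lin_combs.zero)

lemma lin_combs_base: "s \<in> S \<Longrightarrow> s \<in> lin_combs S"
  using lin_combs.add[OF lin_combs.zero, of s S 1] by simp

text \<open>Only powers matter here, so the exact exponents of the Dedekind-Mertens lemma are not
  tracked. The passage from the polynomials in \<open>M\<close> to the ideal of their coefficients
  is what lets a Nullstellensatz over the coefficient ring act on modules over the polynomial
  ring.\<close>

lemma content_nilpotent:
  fixes Y :: "'j \<Rightarrow> ('v::linorder, 'a::comm_ring_1) mpoly"
  assumes N: "submodule_fun N" and L: "finite L" "\<And>j. keys (Y j) \<subseteq> L"
    and M: "\<And>m. m \<in> M \<Longrightarrow> \<exists>K. (\<lambda>j. m ^ K * Y j) \<in> poly_families N"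
    and a: "a \<in> lin_combs {lookup m \<kappa> | m \<kappa>. m \<in> M}"
  shows "\<exists>e. (\<lambda>j. cst (a ^ e) * Y j) \<in> poly_families N"
  using a
proof (induction a rule: lin_combs.induct)
  case zero
  then show ?case using N by (intro exI[of _ 1]) (simp add: poly_families_def submodule_fun_def)
next
  case (add x s c)
  then obtain e where e: "(\<lambda>j. cst (x ^ e) * Y j) \<in> poly_families N" by blast
  from add obtain m \<kappa> where m: "m \<in> M" "s = lookup m \<kappa>" by blast
  obtain e' where "(\<lambda>j. cst (s ^ e') * Y j) \<in> poly_families N"
    using M[OF m(1)] coefficient_nilpotent_power[OF N L(1), of Y m _ \<kappa>] L(2) m(2) by blast
  from poly_families_scale[OF N this, of "c ^ e'"] have "(\<lambda>j. cst ((c * s) ^ e') * Y j) \<in> poly_families N"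
    by (simp add: power_mult_distrib cst_cst_mult)
  from annihilator_add_power[OF N e this] show ?case by blast
qed

section \<open>Gluing preimages along an ideal of grade two\<close>

section \<open>The acyclicity argument\<close>

lemma lookup_scale [simp]: "lookup (scale r x) e = r * lookup x e"
  by (simp add: scale_def map.rep_eq when_def)

lemma keys_scale: "keys (scale r x) \<subseteq> keys x"
  by (auto simp: in_keys_iff)

lemma scale_scale: "scale r (scale s x) = scale (r * s) x"
  by (rule poly_mapping_eqI) (simp add: mult.assoc)

lemma scale_one [simp]: "scale 1 x = x"
  by (rule poly_mapping_eqI) simp

lemma scale_right_diff: "scale r (x - y) = scale r x - scale r y"
  by (rule poly_mapping_eqI) (simp add: lookup_minus right_diff_distrib)

lemma scale_right_add: "scale r (x + y) = scale r x + scale r y"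
  by (rule poly_mapping_eqI) (simp add: lookup_add distrib_left)

lemma scale_cancel: "scale r x = scale r y \<Longrightarrow> r \<noteq> 0 \<Longrightarrow> x = y" for r :: "'a::idom"
  by (rule poly_mapping_eqI) (metis lookup_scale mult_left_cancel)

lemma cst_eq_0_iff [simp]: "cst c = (0 :: ('v, 'a::comm_ring_1) mpoly) \<longleftrightarrow> c = 0"
  by (metis lookup_single_eq lookup_zero single_zero)

lemma cst_mult: "cst (c * d) = (cst c * cst d :: ('v, 'a::comm_ring_1) mpoly)"
  by (simp add: mult_single)

lemma cst_power: "cst (c ^ k) = (cst c ^ k :: ('v, 'a::comm_ring_1) mpoly)"
  by (induction k) (auto simp: cst_mult simp flip: single_one)

text \<open>The quotient is chosen as a function of the coefficient alone and is applied by
  \<open>Poly_Mapping.map\<close>, which keeps zero coefficients zero; this gives the bound on the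
  support.\<close>

lemma poly_mapping_divide:
  assumes "\<And>k. c dvd lookup x k"
  shows "\<exists>y. (\<forall>k. lookup x k = c * lookup y k) \<and> keys y \<subseteq> keys (x :: 'e \<Rightarrow>\<^sub>0 'a::comm_ring_1)"
proof -
  define h where "h a = (SOME b. a = c * b)" for a
  have h: "lookup x k = c * h (lookup x k)" for k
    unfolding h_def using assms[of k] unfolding dvd_def by (rule someI_ex)
  let ?y = "Poly_Mapping.map h x"
  have "lookup x k = c * lookup ?y k" for k
    using h[of k] by (auto simp: map.rep_eq when_def)
  moreover have "keys ?y \<subseteq> keys x" by (auto simp: in_keys_iff map.rep_eq when_def)
  ultimately show ?thesis by blast
qed

lemma cst_dvdI: "(\<And>\<mu>. D dvd lookup y \<mu>) \<Longrightarrow> cst D dvd y" for y :: "('v, 'a::comm_ring_1) mpoly"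
  using poly_mapping_divide[of D y] by (metis dvdI lookup_cst_mult poly_mapping_eqI)

lemma cst_dvdD: "cst D dvd y \<Longrightarrow> D dvd lookup y \<mu>" for y :: "('v, 'a::comm_ring_1) mpoly"
  by (auto elim!: dvdE)

text \<open>The family \<open>g\<close> generates an ideal of grade at least \<open>2\<close>.\<close>

definition grade_two :: "nat \<Rightarrow> (nat \<Rightarrow> 'a::comm_ring_1) \<Rightarrow> bool" where
  "grade_two n g \<longleftrightarrow> (\<exists>p<n. g p \<noteq> 0) \<and> (\<forall>D Y. (\<forall>p<n. D dvd Y * g p) \<longrightarrow> D dvd Y)"

text \<open>Induction on the sum of the exponents. If none of them is zero, lowering the one at
  \<open>q\<close> gives \<open>D dvd Y * g q\<close>, and this for every \<open>q\<close>.\<close>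

lemma grade_two_powers:
  assumes "grade_two n g" "\<And>p. p < n \<Longrightarrow> D dvd Y * g p ^ e p"
  shows "D dvd Y"
  using assms(2)
proof (induction "\<Sum>p<n. e p" arbitrary: e Y rule: less_induct)
  case less
  show ?case
  proof (cases "\<exists>p<n. e p = 0")
    case True
    then show ?thesis using less.prems by fastforce
  next
    case False
    have "D dvd Y * g q" if "q < n" for q
    proof (rule less.hyps)
      have eq: "e q = Suc (e q - 1)" using False that by auto
      have power_eq: "g q ^ e q = g q * g q ^ (e q - 1)" by (subst eq) simp
      show "(\<Sum>p<n. (e(q := e q - 1)) p) < (\<Sum>p<n. e p)"
        using that eq by (intro sum_strict_mono_ex1) auto
      fix p assume p: "p < n"
      show "D dvd Y * g q * g p ^ (e(q := e q - 1)) p"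
      proof (cases "p = q")
        case True
        then show ?thesis using less.prems[OF p] power_eq by (simp add: True mult.assoc)
      next
        case False
        then show ?thesis using dvd_mult2[OF less.prems[OF p], of "g q"] by (simp add: mult_ac)
      qed
    qed
    then show ?thesis using assms(1) unfolding grade_two_def by blast
  qed
qed

text \<open>The \<open>y r\<close> are the numerators of one fraction with denominators
  \<open>g r ^ N\<close>. Compatibility with \<open>y r\<close> says that \<open>g p ^ N\<close>
  divides \<open>g r ^ N\<close> times each coefficient of \<open>y p\<close>; as this holds for all
  \<open>r\<close>, grade two removes the powers of the \<open>g r\<close>.\<close>

lemma grade_two_poly:
  fixes y :: "nat \<Rightarrow> 'e \<Rightarrow>\<^sub>0 (('v::linorder, 'a::idom) mpoly)"
  assumes g: "grade_two n g" and eq: "\<And>r s. r < n \<Longrightarrow> s < n \<Longrightarrow> scale (cst (g s ^ N)) (y r) = scale (cst (g r ^ N)) (y s)"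
    and p: "p < n" "g p \<noteq> 0"
  shows "\<exists>w. keys w \<subseteq> keys (y p) \<and> y p = scale (cst (g p ^ N)) w"
proof -
  have "cst (g p ^ N) dvd lookup (y p) k" for k
  proof (rule cst_dvdI)
    fix \<mu>
    show "g p ^ N dvd lookup (lookup (y p) k) \<mu>"
    proof (rule grade_two_powers[OF g])
      fix r assume r: "r < n"
      have "cst (g p ^ N) * lookup (y r) k = cst (g r ^ N) * lookup (y p) k"
        using arg_cong[OF eq[OF r p(1)], of "\<lambda>x. lookup x k"] by simp
      then have "cst (g p ^ N) dvd cst (g r ^ N) * lookup (y p) k" by (metis dvd_triv_left)
      from cst_dvdD[OF this, of \<mu>] show "g p ^ N dvd lookup (lookup (y p) k) \<mu> * g r ^ N"
        unfolding lookup_cst_mult by (simp only: mult.commute)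
    qed
  qed
  then obtain w where "\<forall>k. lookup (y p) k = cst (g p ^ N) * lookup w k"
      "keys w \<subseteq> keys (y p)" using poly_mapping_divide by blast
  then show ?thesis by (intro exI[of _ w]) (auto intro: poly_mapping_eqI)
qed

definition linear_map :: "(('e \<Rightarrow>\<^sub>0 't::comm_ring_1) \<Rightarrow> ('e \<Rightarrow>\<^sub>0 't)) \<Rightarrow> bool" where
  "linear_map d \<longleftrightarrow> (\<forall>x y. d (x - y) = d x - d y) \<and> (\<forall>r x. d (scale r x) = scale r (d x))"

text \<open>The coefficients of \<open>y\<close> range over the whole polynomial type. That they can
  be taken in \<open>T\<close> is settled later by a retraction.\<close>

definition image_up_to :: "(('e \<Rightarrow>\<^sub>0 't::comm_ring_1) \<Rightarrow> ('e \<Rightarrow>\<^sub>0 't)) \<Rightarrow> 'e set \<Rightarrow> 't \<Rightarrow> ('e \<Rightarrow>\<^sub>0 't) \<Rightarrow> bool" where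
  "image_up_to d E q z \<longleftrightarrow> (\<exists>N y. keys y \<subseteq> E \<and> scale (q ^ N) z = d y)"

text \<open>The lower bound \<open>low\<close> allows the common exponent to be compared with one
  that has been fixed before.\<close>

lemma image_up_to_uniform:
  assumes d: "linear_map d" and "finite S" "\<And>r. r \<in> S \<Longrightarrow> image_up_to d E (q r) (z r)"
  shows "\<exists>N\<ge>low. \<exists>y. \<forall>r\<in>S. keys (y r) \<subseteq> E \<and> scale (q r ^ N) (z r) = d (y r)"
proof -
  have "\<forall>r\<in>S. \<exists>N y. keys y \<subseteq> E \<and> scale (q r ^ N) (z r) = d y"
    using assms(3) by (auto simp: image_up_to_def)
  from bchoice[OF this] obtain N where "\<forall>r\<in>S. \<exists>y. keys y \<subseteq> E \<and> scale (q r ^ N r) (z r) = d y" ..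
  from bchoice[OF this] obtain y
    where y: "\<And>r. r \<in> S \<Longrightarrow> keys (y r) \<subseteq> E \<and> scale (q r ^ N r) (z r) = d (y r)"
    by blast
  define M where "M = low + (\<Sum>r\<in>S. N r)"
  have "keys (scale (q r ^ (M - N r)) (y r)) \<subseteq> E
      \<and> scale (q r ^ M) (z r) = d (scale (q r ^ (M - N r)) (y r))" if "r \<in> S" for r
  proof
    show "keys (scale (q r ^ (M - N r)) (y r)) \<subseteq> E" using y[OF that] by (intro order.trans[OF keys_scale]) simp
    have "N r \<le> M" using member_le_sum[of r S N] that assms(2) by (simp add: M_def)
    then have "q r ^ M = q r ^ (M - N r) * q r ^ N r" by (simp flip: power_add)
    then show "scale (q r ^ M) (z r) = d (scale (q r ^ (M - N r)) (y r))"
      using y[OF that] d by (simp add: linear_map_def flip: scale_scale)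
  qed
  moreover have "M \<ge> low" by (simp add: M_def)
  ultimately show ?thesis by (intro exI[of _ M] conjI exI[of _ "\<lambda>r. scale (q r ^ (M - N r)) (y r)"]) auto
qed

lemma keys_diff_scale: "keys x \<subseteq> E \<Longrightarrow> keys y \<subseteq> E \<Longrightarrow> keys (scale a x - scale b y) \<subseteq> E"
  using keys_diff keys_scale by (metis (no_types, lifting) Un_subset_iff order.trans)

text \<open>After cross-multiplication the preimages \<open>y r\<close> of multiples of
  \<open>z\<close> have equal images, so they agree by injectivity of \<open>d3\<close> and glue by
  grade two.\<close>

lemma chase_second:
  fixes d3 :: "('e \<Rightarrow>\<^sub>0 (('v::linorder, 'a::idom) mpoly)) \<Rightarrow> _"
  assumes d3: "linear_map d3" and inj: "\<And>x. keys x \<subseteq> E3 \<Longrightarrow> d3 x = 0 \<Longrightarrow> x = 0"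
    and g: "grade_two n g" and f: "f \<noteq> 0"
    and z: "\<And>r. r < n \<Longrightarrow> image_up_to d3 E3 (cst (g r * f)) z"
  shows "image_up_to d3 E3 (cst f) z"
proof -
  have L: "d3 (x - y) = d3 x - d3 y" "d3 (scale r x) = scale r (d3 x)" for r x y using d3 by (auto simp: linear_map_def)
  obtain N y where "\<forall>r\<in>{..<n}. keys (y r) \<subseteq> E3 \<and> scale (cst (g r * f) ^ N) z = d3 (y r)"
    using image_up_to_uniform[OF d3, of "{..<n}" E3 "\<lambda>r. cst (g r * f)" "\<lambda>_. z" 0] z by blast
  then have y: "\<And>r. r < n \<Longrightarrow> keys (y r) \<subseteq> E3"
      "\<And>r. r < n \<Longrightarrow> scale (cst (g r * f) ^ N) z = d3 (y r)" by auto
  obtain p where p: "p < n" "g p \<noteq> 0" using g by (auto simp: grade_two_def)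
  have pw: "cst (g r * f) ^ N = cst (f ^ N) * cst (g r ^ N)" for r
    by (simp add: cst_mult cst_power power_mult_distrib)
  have "scale (cst (g s ^ N)) (y r) = scale (cst (g r ^ N)) (y s)" if "r < n" "s < n" for r s
  proof -
    have "d3 (scale (cst (g s * f) ^ N) (y r) - scale (cst (g r * f) ^ N) (y s)) = 0"
      by (simp add: L scale_scale mult.commute flip: y(2)[OF that(1)] y(2)[OF that(2)])
    from inj[OF _ this] have "scale (cst (g s * f) ^ N) (y r) = scale (cst (g r * f) ^ N) (y s)"
      using keys_diff_scale[OF y(1)[OF that(1)] y(1)[OF that(2)]] by auto
    then show ?thesis using f by (auto simp: pw simp flip: scale_scale dest: scale_cancel)
  qed
  from grade_two_poly[OF g this p]
  obtain w where w: "keys w \<subseteq> keys (y p)" "y p = scale (cst (g p ^ N)) w" by blast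
  have "scale (cst (f ^ N) * cst (g p ^ N)) z = scale (cst (g p ^ N)) (d3 w)"
    using y(2)[OF p(1)] unfolding pw by (simp only: w(2) L)
  then have "scale (cst (g p ^ N)) (scale (cst f ^ N) z) = scale (cst (g p ^ N)) (d3 w)"
    by (simp add: scale_scale cst_power mult.commute)
  then have "scale (cst f ^ N) z = d3 w" using p by (rule_tac scale_cancel) auto
  then show ?thesis using w(1) y(1)[OF p(1)] unfolding image_up_to_def by blast
qed


lemma lin_combs_image_mult: "x \<in> lin_combs S \<Longrightarrow> f * x \<in> lin_combs ((*) f ` S)"
proof (induction x rule: lin_combs.induct)
  case (add x s c)
  then show ?case using lin_combs.add[of "f * x" "(*) f ` S" "f * s" c] by (simp add: algebra_simps)
qed (simp add: lin_combs.zero)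

text \<open>The Koszul coboundaries \<open>x\<^sub>s v\<^sub>r - x\<^sub>r v\<^sub>s\<close>; McCoy's theorem is applied to the quotient by them.\<close>

definition coboundaries :: "nat \<Rightarrow> (nat \<Rightarrow> 'a) \<Rightarrow> (nat \<times> nat \<times> 'e \<Rightarrow> 'a::comm_ring_1) set" where
  "coboundaries n x = {b. \<exists>v. \<forall>r s e. b (r, s, e) = (if r < n \<and> s < n then x s * v r e - x r * v s e else 0)}"

lemma submodule_coboundaries:
  fixes x :: "nat \<Rightarrow> 'a::comm_ring_1"
  shows "submodule_fun (coboundaries n x :: (nat \<times> nat \<times> 'e \<Rightarrow> 'a) set)"
  unfolding submodule_fun_def
proof (intro conjI ballI allI)
  show "(\<lambda>_. 0) \<in> coboundaries n x" unfolding coboundaries_def by (auto intro!: exI[of _ "\<lambda>_ _. 0"])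
next
  fix b b' :: "nat \<times> nat \<times> 'e \<Rightarrow> 'a" assume "b \<in> coboundaries n x" "b' \<in> coboundaries n x"
  then obtain v v' where "\<And>r s e. b (r, s, e) = (if r < n \<and> s < n then x s * v r e - x r * v s e else 0)"
    "\<And>r s e. b' (r, s, e) = (if r < n \<and> s < n then x s * v' r e - x r * v' s e else 0)"
    unfolding coboundaries_def by blast
  then show "(\<lambda>j. b j + b' j) \<in> coboundaries n x"
    unfolding coboundaries_def by (auto intro!: exI[of _ "\<lambda>r e. v r e + v' r e"] simp: algebra_simps)
next
  fix c and b :: "nat \<times> nat \<times> 'e \<Rightarrow> 'a" assume "b \<in> coboundaries n x"
  then obtain v where "\<And>r s e. b (r, s, e) = (if r < n \<and> s < n then x s * v r e - x r * v s e else 0)"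
    unfolding coboundaries_def by blast
  then show "(\<lambda>j. c * b j) \<in> coboundaries n x"
    unfolding coboundaries_def by (auto intro!: exI[of _ "\<lambda>r e. c * v r e"] simp: algebra_simps)
qed

text \<open>The representation as a coboundary is chosen for each monomial separately. Finiteness of
  \<open>E\<close> and of the set of monomials that occur allows the choices to be assembled into
  polynomials.\<close>

lemma coboundary_poly:
  fixes w :: "nat \<Rightarrow> nat \<Rightarrow> 'e \<Rightarrow>\<^sub>0 (('v, 'a::comm_ring_1) mpoly)"
  assumes w: "(\<lambda>(r, s, e). if r < n \<and> s < n then lookup (w r s) e else 0) \<in> poly_families (coboundaries n x)"
    and E: "finite E" "\<And>r s. r < n \<Longrightarrow> s < n \<Longrightarrow> keys (w r s) \<subseteq> E"
  shows "\<exists>v. (\<forall>r. keys (v r) \<subseteq> E)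
    \<and> (\<forall>r<n. \<forall>s<n. w r s = scale (cst (x s)) (v r) - scale (cst (x r)) (v s))"
proof -
  define L where "L = (\<Union>r<n. \<Union>s<n. \<Union>e\<in>E. keys (lookup (w r s) e))"
  have fin: "finite L" using E by (simp add: L_def)
  have "\<exists>v. \<forall>r s e. r < n \<longrightarrow> s < n \<longrightarrow> lookup (lookup (w r s) e) \<mu> = x s * v r e - x r * v s e" for \<mu>
  proof -
    have "(\<lambda>j. lookup ((\<lambda>(r, s, e). if r < n \<and> s < n then lookup (w r s) e else 0) j) \<mu>) \<in> coboundaries n x"
      using w by (simp add: poly_families_def)
    then obtain v where *: "\<And>r s e. lookup (if r < n \<and> s < n then lookup (w r s) e else 0) \<mu>
        = (if r < n \<and> s < n then x s * v r e - x r * v s e else 0)"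
      unfolding coboundaries_def by auto
    show ?thesis
    proof (intro exI allI impI)
      fix r s e assume "r < n" "s < n"
      then show "lookup (lookup (w r s) e) \<mu> = x s * v r e - x r * v s e"
        using *[of r s e] by simp
    qed
  qed
  then obtain v where v: "\<And>\<mu> r s e. r < n \<Longrightarrow> s < n
      \<Longrightarrow> lookup (lookup (w r s) e) \<mu> = x s * v \<mu> r e - x r * v \<mu> s e"
    by metis
  define V where "V r = (\<Sum>e\<in>E. single e (\<Sum>\<mu>\<in>L. single \<mu> (v \<mu> r e)))" for r
  have V: "lookup (lookup (V r) e) \<mu> = (if e \<in> E \<and> \<mu> \<in> L then v \<mu> r e else 0)" for r e \<mu>
    using E(1) fin by (simp add: V_def lookup_sum lookup_single when_def)
  have "keys (V r) \<subseteq> E" for r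
  proof
    fix e assume "e \<in> keys (V r)"
    then obtain \<mu> where "lookup (lookup (V r) e) \<mu> \<noteq> 0"
      by (metis in_keys_iff lookup_zero poly_mapping_eqI)
    then show "e \<in> E" by (simp add: V split: if_splits)
  qed
  moreover have "w r s = scale (cst (x s)) (V r) - scale (cst (x r)) (V s)" if "r < n" "s < n" for r s
  proof (rule poly_mapping_eqI, rule poly_mapping_eqI)
    fix e \<mu>
    have "lookup (lookup (w r s) e) \<mu> = 0" if "\<not> (e \<in> E \<and> \<mu> \<in> L)"
    proof (cases "e \<in> E")
      case True
      then have "\<mu> \<notin> keys (lookup (w r s) e)" using that \<open>r < n\<close> \<open>s < n\<close> by (auto simp: L_def)
      then show ?thesis by (simp add: in_keys_iff)
    next
      case False
      then have "e \<notin> keys (w r s)" using E(2)[OF \<open>r < n\<close> \<open>s < n\<close>] by blast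
      then show ?thesis by (simp add: in_keys_iff)
    qed
    then show "lookup (lookup (w r s) e) \<mu>
        = lookup (lookup (scale (cst (x s)) (V r) - scale (cst (x r)) (V s)) e) \<mu>"
      using v[OF that, of e \<mu>] by (cases "e \<in> E \<and> \<mu> \<in> L") (auto simp: V lookup_minus)
  qed
  ultimately show ?thesis by blast
qed

text \<open>The preimages \<open>y r\<close> of \<open>x r * z\<close> need not be compatible: the
  cycles \<open>c r s = x s * y r - x r * y s\<close> are, up to a power of \<open>f\<close>, images
  of chains \<open>w r s\<close>. If \<open>w\<close> were a coboundary, subtracting the images of
  the \<open>v r\<close> would make the \<open>y r\<close> compatible, and grade two would glue
  them. A preimage of \<open>m ^ k * z\<close> shows that some power of \<open>m * f\<close> makes
  \<open>w\<close> a coboundary. This holds for every \<open>m\<close> in \<open>M\<close>, hence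
  for the ideal of all their coefficients, which contains a power of \<open>f\<close>.\<close>

lemma chase_first:
  fixes d3 d2 :: "('e \<Rightarrow>\<^sub>0 (('v::linorder, 'a::idom) mpoly)) \<Rightarrow> _"
  assumes d3: "linear_map d3" and d2: "linear_map d2"
    and inj: "\<And>x. keys x \<subseteq> E3 \<Longrightarrow> d3 x = 0 \<Longrightarrow> x = 0" and E3: "finite E3"
    and exact: "\<And>y. keys y \<subseteq> E2 \<Longrightarrow> d2 y = 0 \<Longrightarrow> image_up_to d3 E3 (cst f) y"
    and complex: "\<And>x. keys x \<subseteq> E3 \<Longrightarrow> d2 (d3 x) = 0" "\<And>x. keys x \<subseteq> E3 \<Longrightarrow> keys (d3 x) \<subseteq> E2"
    and g: "grade_two n g" and f: "f \<noteq> 0"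
    and z: "\<And>r. r < n \<Longrightarrow> image_up_to d2 E2 (cst (g r * f)) z" "\<And>m. m \<in> M \<Longrightarrow> image_up_to d2 E2 m z"
    and content: "f ^ a \<in> lin_combs {lookup m \<kappa> | m \<kappa>. m \<in> M}"
  shows "image_up_to d2 E2 (cst f) z"
proof -
  have L3: "d3 (x - y) = d3 x - d3 y" "d3 (scale r x) = scale r (d3 x)" for r x y using d3 by (auto simp: linear_map_def)
  have L2: "d2 (x - y) = d2 x - d2 y" "d2 (scale r x) = scale r (d2 x)" for r x y using d2 by (auto simp: linear_map_def)
  obtain N y where "\<forall>r\<in>{..<n}. keys (y r) \<subseteq> E2 \<and> scale (cst (g r * f) ^ N) z = d2 (y r)"
    using image_up_to_uniform[OF d2, of "{..<n}" E2 "\<lambda>r. cst (g r * f)" "\<lambda>_. z" 0] z by blast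
  define x where "x r = (g r * f) ^ N" for r
  have y: "\<And>r. r < n \<Longrightarrow> keys (y r) \<subseteq> E2"
      "\<And>r. r < n \<Longrightarrow> d2 (y r) = scale (cst (x r)) z"
    using \<open>\<forall>r\<in>{..<n}. _ r\<close> by (auto simp: x_def cst_power)
  obtain p where p: "p < n" "g p \<noteq> 0" using g by (auto simp: grade_two_def)
  define c where "c r s = scale (cst (x s)) (y r) - scale (cst (x r)) (y s)" for r s
  have im: "image_up_to d3 E3 (cst f) (c (fst rs) (snd rs))" if "rs \<in> {..<n} \<times> {..<n}" for rs
  proof (rule exact)
    have "fst rs < n" "snd rs < n" using that by auto
    then show "keys (c (fst rs) (snd rs)) \<subseteq> E2"
      unfolding c_def by (intro keys_diff_scale y)
    show "d2 (c (fst rs) (snd rs)) = 0"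
      using \<open>fst rs < n\<close> \<open>snd rs < n\<close> by (simp add: c_def L2 y scale_scale mult.commute)
  qed
  obtain K w' where "\<forall>rs\<in>{..<n} \<times> {..<n}. keys (w' rs) \<subseteq> E3 \<and> scale (cst f ^ K) (c (fst rs) (snd rs)) = d3 (w' rs)"
    using image_up_to_uniform[OF d3, of "{..<n} \<times> {..<n}" E3 "\<lambda>_. cst f" "\<lambda>rs. c (fst rs) (snd rs)" 0] im by blast
  then have "\<exists>w. \<forall>r<n. \<forall>s<n. keys (w r s) \<subseteq> E3 \<and> d3 (w r s) = scale (cst f ^ K) (c r s)"
    by (intro exI[of _ "\<lambda>r s. w' (r, s)"]) auto
  then obtain w where w: "\<And>r s. r < n \<Longrightarrow> s < n \<Longrightarrow> keys (w r s) \<subseteq> E3"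
      "\<And>r s. r < n \<Longrightarrow> s < n \<Longrightarrow> d3 (w r s) = scale (cst f ^ K) (c r s)" by blast
  \<comment> \<open>All the \<open>w r s\<close> as a single family, extended by zero to the indices
    at which elements of \<open>coboundaries\<close> are required to vanish.\<close>
  define Y where "Y = (\<lambda>(r, s, e). if r < n \<and> s < n then lookup (w r s) e else 0)"
  define L where "L = (\<Union>r<n. \<Union>s<n. \<Union>e\<in>E3. keys (lookup (w r s) e))"
  have finL: "finite L" using E3 by (simp add: L_def)
  have YL: "keys (Y j) \<subseteq> L" for j
  proof (cases j)
    case (fields r s e)
    show ?thesis
    proof (cases "r < n \<and> s < n \<and> e \<in> E3")
      case True
      then show ?thesis by (auto simp: fields Y_def L_def)
    next
      case False
      then have "r < n \<Longrightarrow> s < n \<Longrightarrow> e \<notin> keys (w r s)" using w(1)[of r s] by blast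
      then have "Y j = 0" by (auto simp: fields Y_def in_keys_iff)
      then show ?thesis by simp
    qed
  qed
  have mY: "\<exists>k. (\<lambda>j. (m * cst f) ^ k * Y j) \<in> poly_families (coboundaries n x)" if m: "m \<in> M" for m
  proof -
    obtain k y' where y': "keys y' \<subseteq> E2" "d2 y' = scale (m ^ k) z"
      using z(2)[OF m] unfolding image_up_to_def by metis
    \<comment> \<open>The difference of two preimages of the same multiple of \<open>z\<close>,
      hence a cycle.\<close>
    define c' where "c' r = scale (cst (x r)) y' - scale (m ^ k) (y r)" for r
    have im: "image_up_to d3 E3 (cst f) (c' r)" if "r \<in> {..<n}" for r
    proof (rule exact)
      show "keys (c' r) \<subseteq> E2"
        unfolding c'_def using that by (intro keys_diff_scale y y') simp
      show "d2 (c' r) = 0"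
        using that by (simp add: c'_def L2 y y' scale_scale mult.commute)
    qed
    obtain K' u where "K' \<ge> K" "\<forall>r\<in>{..<n}. keys (u r) \<subseteq> E3 \<and> scale (cst f ^ K') (c' r) = d3 (u r)"
      using image_up_to_uniform[OF d3, of "{..<n}" E3 "\<lambda>_. cst f" c' K] im by blast
    then have K': "K' \<ge> K" and u: "\<And>r. r < n \<Longrightarrow> keys (u r) \<subseteq> E3"
      "\<And>r. r < n \<Longrightarrow> d3 (u r) = scale (cst f ^ K') (c' r)" by auto
    define j where "j = K' - K"
    \<comment> \<open>By injectivity of \<open>d3\<close> it suffices to compare images, and
      \<open>m ^ k * c r s\<close> equals \<open>x r * c' s - x s * c' r\<close>.\<close>
    have rel: "scale (m ^ k * cst f ^ j) (w r s) = scale (cst (x r)) (u s) - scale (cst (x s)) (u r)" if "r < n" "s < n" for r s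
    proof -
      have fK: "cst f ^ K' = cst f ^ j * cst f ^ K" using K' by (simp add: j_def flip: power_add)
      have "d3 (scale (m ^ k * cst f ^ j) (w r s)) = scale (cst f ^ K') (scale (m ^ k) (c r s))"
        by (simp add: L3 w(2)[OF that] fK scale_scale mult_ac)
      also have "\<dots> = d3 (scale (cst (x r)) (u s) - scale (cst (x s)) (u r))"
        unfolding L3 u(2)[OF that(1)] u(2)[OF that(2)] c_def c'_def
        by (simp add: scale_right_diff scale_scale mult_ac)
      finally have zero: "d3 (scale (m ^ k * cst f ^ j) (w r s) - (scale (cst (x r)) (u s) - scale (cst (x s)) (u r))) = 0"
        by (simp only: L3 diff_self)
      have "keys (scale (m ^ k * cst f ^ j) (w r s) - scale 1 (scale (cst (x r)) (u s) - scale (cst (x s)) (u r))) \<subseteq> E3"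
        by (rule keys_diff_scale[OF w(1)[OF that] keys_diff_scale[OF u(1)[OF that(2)] u(1)[OF that(1)]]])
      then have "scale (m ^ k * cst f ^ j) (w r s) - (scale (cst (x r)) (u s) - scale (cst (x s)) (u r)) = 0"
        unfolding scale_one by (rule inj) (rule zero)
      then show ?thesis by simp
    qed
    have entry: "lookup (m ^ k * cst f ^ j * Y (r, s, e)) \<mu> = (if r < n \<and> s < n
        then x s * (- lookup (lookup (u r) e) \<mu>)
          - x r * (- lookup (lookup (u s) e) \<mu>) else 0)" for r s e \<mu>
    proof (cases "r < n \<and> s < n")
      case True
      then have "m ^ k * cst f ^ j * Y (r, s, e) = lookup (scale (m ^ k * cst f ^ j) (w r s)) e"
        by (simp add: Y_def)
      then show ?thesis using True by (simp add: rel lookup_minus)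
    next
      case False
      then have "Y (r, s, e) = 0" by (auto simp: Y_def)
      then show ?thesis using False by auto
    qed
    have "(\<lambda>i. lookup ((m ^ k * cst f ^ j) * Y i) \<mu>) \<in> coboundaries n x" for \<mu>
      unfolding coboundaries_def
      by (intro CollectI exI[of _ "\<lambda>r e. - lookup (lookup (u r) e) \<mu>"] allI) (rule entry)
    then have "(\<lambda>i. (m ^ k * cst f ^ j) * Y i) \<in> poly_families (coboundaries n x)"
      by (simp add: poly_families_def)
    \<comment> \<open>A further factor \<open>m ^ j * cst f ^ k\<close> equalises the two exponents,
      so that a power of the single element \<open>m * cst f\<close> appears.\<close>
    from poly_families_mult[OF submodule_coboundaries this, of "m ^ j * cst f ^ k"]
    have "(\<lambda>i. m ^ j * cst f ^ k * ((m ^ k * cst f ^ j) * Y i)) \<in> poly_families (coboundaries n x)"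
    proof -
      have "finite (\<Union>i. keys ((m ^ k * cst f ^ j) * Y i))"
      proof (rule finite_subset)
        show "(\<Union>i. keys ((m ^ k * cst f ^ j) * Y i)) \<subseteq> (\<lambda>(a, b). a + b) ` (keys (m ^ k * cst f ^ j) \<times> L)"
          using keys_mult[of "m ^ k * cst f ^ j"] YL by (fastforce simp: image_iff)
      qed (use finL in simp)
      then show ?thesis using poly_families_mult[OF submodule_coboundaries \<open>_ \<in> poly_families (coboundaries n x)\<close>] by blast
    qed
    then have "(\<lambda>i. (m * cst f) ^ (j + k) * Y i) \<in> poly_families (coboundaries n x)"
      by (simp add: power_add power_mult_distrib mult_ac)
    then show ?thesis by blast
  qed
  \<comment> \<open>The coefficients of \<open>m * cst f\<close> are \<open>f\<close> times those of
    \<open>m\<close>, so the ideal generated by them contains \<open>f * f ^ a\<close>.\<close>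
  define M' where "M' = (\<lambda>m. m * cst f) ` M"
  have "f * f ^ a \<in> lin_combs ((*) f ` {lookup m \<kappa> | m \<kappa>. m \<in> M})"
    using content by (rule lin_combs_image_mult)
  also have "(*) f ` {lookup m \<kappa> | m \<kappa>. m \<in> M} = {lookup m \<kappa> | m \<kappa>. m \<in> M'}"
  proof -
    have "lookup (m * cst f) \<kappa> = f * lookup m \<kappa>" for m :: "('v, 'a) mpoly" and \<kappa>
      by (simp add: mult.commute[of m])
    then show ?thesis by (auto simp: M'_def image_iff) metis+
  qed
  finally have "\<exists>e. (\<lambda>j. cst ((f * f ^ a) ^ e) * Y j) \<in> poly_families (coboundaries n x)"
    by (intro content_nilpotent[OF submodule_coboundaries finL YL]) (auto simp: M'_def mY)
  then obtain e where e: "(\<lambda>j. cst ((f * f ^ a) ^ e) * Y j) \<in> poly_families (coboundaries n x)" ..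
  define F where "F = (f * f ^ a) ^ e"
  have "(\<lambda>(r, s, k). if r < n \<and> s < n then lookup (scale (cst F) (w r s)) k else 0) = (\<lambda>j. cst F * Y j)"
    by (auto simp: fun_eq_iff Y_def)
  then have "(\<lambda>(r, s, k). if r < n \<and> s < n then lookup (scale (cst F) (w r s)) k else 0) \<in> poly_families (coboundaries n x)"
    using e by (simp add: F_def)
  moreover have "keys (scale (cst F) (w r s)) \<subseteq> E3" if "r < n" "s < n" for r s
    using w(1)[OF that] by (rule order.trans[OF keys_scale])
  ultimately have "\<exists>v. (\<forall>r. keys (v r) \<subseteq> E3)
      \<and> (\<forall>r<n. \<forall>s<n. scale (cst F) (w r s) = scale (cst (x s)) (v r) - scale (cst (x r)) (v s))"
    by (rule coboundary_poly[OF _ E3])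
  then obtain v where v: "\<And>r. keys (v r) \<subseteq> E3"
      "\<And>r s. r < n \<Longrightarrow> s < n \<Longrightarrow> scale (cst F) (w r s) = scale (cst (x s)) (v r) - scale (cst (x r)) (v s)"
    by blast
  define q :: "('v, 'a) mpoly" where "q = cst F * cst f ^ K"
  \<comment> \<open>The corrected preimages: \<open>t r\<close> still maps to
    \<open>q * x r * z\<close>, since the added part is a boundary, and the \<open>t r\<close> are
    compatible.\<close>
  define t where "t r = scale q (y r) - scale 1 (d3 (v r))" for r
  have t_keys: "keys (t r) \<subseteq> E2" if "r < n" for r
    unfolding t_def using y(1)[OF that] complex(2)[OF v(1)] by (rule keys_diff_scale)
  have xt: "scale (cst (x s)) (t r) = scale (cst (x r)) (t s)" if "r < n" "s < n" for r s
  proof -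
    have "d3 (scale (cst F) (w r s)) = scale (cst (x s)) (scale q (y r)) - scale (cst (x r)) (scale q (y s))"
      unfolding L3 w(2)[OF that] c_def q_def by (simp add: scale_right_diff scale_scale mult_ac)
    moreover have "d3 (scale (cst F) (w r s)) = scale (cst (x s)) (d3 (v r)) - scale (cst (x r)) (d3 (v s))"
      unfolding v(2)[OF that] L3 ..
    ultimately show ?thesis unfolding t_def scale_right_diff by (simp add: algebra_simps)
  qed
  have gx: "cst (x r) = cst (f ^ N) * cst (g r ^ N)" for r
    by (simp add: x_def cst_mult power_mult_distrib mult.commute)
  have "scale (cst (g s ^ N)) (t r) = scale (cst (g r ^ N)) (t s)" if "r < n" "s < n" for r s
    using xt[OF that] f unfolding gx scale_scale[symmetric] by (auto dest: scale_cancel)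
  from grade_two_poly[OF g this p]
  obtain h where h: "keys h \<subseteq> keys (t p)" "t p = scale (cst (g p ^ N)) h" by blast
  have "scale (cst (g p ^ N)) (d2 h) = d2 (t p)" by (simp add: h(2) L2)
  also have "\<dots> = scale q (scale (cst (x p)) z)"
    using y(2)[OF p(1)] complex(1)[OF v(1)] by (simp add: t_def L2)
  also have "\<dots> = scale (cst (g p ^ N)) (scale (q * cst (f ^ N)) z)"
    unfolding gx by (simp add: scale_scale mult_ac)
  finally have "d2 h = scale (q * cst (f ^ N)) z" using p by (rule_tac scale_cancel) auto
  moreover have "q * cst (f ^ N) = cst f ^ ((a + 1) * e + K + N)"
    by (simp add: q_def F_def cst_power cst_mult power_add power_mult power_mult_distrib)
  ultimately show ?thesis
    unfolding image_up_to_def using h(1) t_keys[OF p(1)] by (metis order.trans)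
qed

section \<open>The Eagon-Northcott differentials as contractions\<close>

section \<open>The differentials of the Eagon--Northcott complex\<close>

abbreviation pm1 :: "nat \<Rightarrow> nat \<Rightarrow>\<^sub>0 nat" where
  "pm1 j \<equiv> single j 1"

lemma differential_superset:
  assumes "finite S" "keys x \<subseteq> S" "p \<noteq> 0"
  shows "differential F p x = (\<Sum>e\<in>S. scale (lookup x e) (bd F p e))"
proof -
  have "differential F p x = (\<Sum>e\<in>keys x. scale (lookup x e) (bd F p e))"
    using assms(3) by (simp add: differential_def)
  also have "\<dots> = (\<Sum>e\<in>S. scale (lookup x e) (bd F p e))"
    by (rule sum.mono_neutral_left) (use assms in \<open>auto simp: in_keys_iff intro!: poly_mapping_eqI\<close>)
  finally show ?thesis .
qed

lemma linear_differential:
  fixes F :: "('a::comm_ring_1, 'b) free_complex"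
  shows "linear_map (differential F p)"
proof (cases "p = 0")
  case True
  then show ?thesis by (auto simp: linear_map_def differential_def intro!: poly_mapping_eqI)
next
  case False
  show ?thesis unfolding linear_map_def
  proof (intro conjI allI)
    fix x y :: "'b \<Rightarrow>\<^sub>0 'a"
    let ?S = "keys x \<union> keys y"
    have "differential F p z = (\<Sum>e\<in>?S. scale (lookup z e) (bd F p e))" if "keys z \<subseteq> ?S" for z
      using that False by (intro differential_superset) auto
    from this[of "x - y"] this[of x] this[of y] keys_diff[of x y]
    show "differential F p (x - y) = differential F p x - differential F p y"
      by (intro poly_mapping_eqI) (simp add: lookup_sum lookup_minus left_diff_distrib sum_subtractf)
  next
    fix r and x :: "'b \<Rightarrow>\<^sub>0 'a"
    show "differential F p (scale r x) = scale r (differential F p x)"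
    proof -
      have "differential F p z = (\<Sum>e\<in>keys x. scale (lookup z e) (bd F p e))"
        if "keys z \<subseteq> keys x" for z
        using that False by (intro differential_superset) auto
      from this[of "scale r x"] this[of x] keys_scale[of r x] show ?thesis
        by (intro poly_mapping_eqI) (simp add: lookup_sum sum_distrib_left mult.assoc)
    qed
  qed
qed

definition pm_of :: "'e set \<Rightarrow> ('e \<Rightarrow> 'a) \<Rightarrow> 'e \<Rightarrow>\<^sub>0 'a::comm_monoid_add" where
  "pm_of E W = (\<Sum>e\<in>E. single e (W e))"

lemma lookup_pm_of: "finite E \<Longrightarrow> lookup (pm_of E W) e = (if e \<in> E then W e else 0)"
  by (simp add: pm_of_def lookup_sum lookup_single when_def)

lemma keys_pm_of: "finite E \<Longrightarrow> keys (pm_of E W) \<subseteq> E"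
  by (auto simp: in_keys_iff lookup_pm_of split: if_splits)

lemma degree_one_monomial:
  assumes "keys \<nu> \<subseteq> {..<n}" "(\<Sum>j<n. lookup \<nu> j) = 1"
  shows "\<exists>k<n. \<nu> = pm1 k"
proof -
  have "(\<Sum>j<n. lookup \<nu> j) \<noteq> 0" using assms(2) by simp
  from sum.not_neutral_contains_not_neutral[OF this]
  obtain k where k: "k < n" "lookup \<nu> k \<noteq> 0" by auto
  have split: "(\<Sum>j<n. lookup \<nu> j) = lookup \<nu> k + (\<Sum>j\<in>{..<n}-{k}. lookup \<nu> j)"
    using k(1) by (simp add: sum.remove)
  then have "lookup \<nu> k = 1" "(\<Sum>j\<in>{..<n}-{k}. lookup \<nu> j) = 0" using assms(2) k by linarith+
  then have "lookup \<nu> j = (if j = k then 1 else 0)" if "j < n" for j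
    using that by simp
  moreover have "lookup \<nu> j = 0" if "\<not> j < n" for j
    using assms(1) that by (meson in_keys_iff lessThan_iff subsetD)
  ultimately have "lookup \<nu> j = (if j = k then 1 else 0)" for j
    using k(1) by (cases "j < n") auto
  then show ?thesis using k(1) by (intro exI[of _ k]) (auto intro!: poly_mapping_eqI simp: lookup_single when_def)
qed

lemma lookup_pm1: "lookup (pm1 k) j = (if k = j then 1 else 0)"
  by (simp add: lookup_single when_def)

lemma sum_lookup_pm1: "k < n \<Longrightarrow> (\<Sum>j<n. lookup (\<nu> + pm1 k) j) = Suc (\<Sum>j<n. lookup \<nu> j)"
  by (simp add: lookup_add lookup_pm1 sum.distrib del: One_nat_def)

lemma minus_plus_pm1: "j \<in> keys \<nu> \<Longrightarrow> \<nu> - pm1 j + pm1 j = \<nu>"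
  by (rule poly_mapping_eqI) (auto simp: lookup_add lookup_minus lookup_pm1 in_keys_iff simp del: One_nat_def)

lemma degree_two_monomial:
  assumes "keys \<nu> \<subseteq> {..<n}" "(\<Sum>j<n. lookup \<nu> j) = 2"
  shows "\<exists>k<n. \<exists>l<n. \<nu> = pm1 k + pm1 l"
proof -
  have "(\<Sum>j<n. lookup \<nu> j) \<noteq> 0" using assms(2) by simp
  from sum.not_neutral_contains_not_neutral[OF this]
  obtain k where k: "k < n" "lookup \<nu> k \<noteq> 0" by auto
  have eq: "\<nu> - pm1 k + pm1 k = \<nu>" using k by (intro minus_plus_pm1) (simp add: in_keys_iff)
  have "Suc (\<Sum>j<n. lookup (\<nu> - pm1 k) j) = 2"
    using sum_lookup_pm1[OF k(1), of "\<nu> - pm1 k"] assms(2) unfolding eq by simp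
  moreover have "keys (\<nu> - pm1 k) \<subseteq> {..<n}"
    using assms(1) by (auto simp: in_keys_iff lookup_minus subset_iff)
  ultimately obtain l where "l < n" "\<nu> - pm1 k = pm1 l" using degree_one_monomial[of "\<nu> - pm1 k" n] by auto
  then show ?thesis using k(1) eq by (metis add.commute)
qed

lemma pm1_sum_eq:
  assumes eq: "pm1 k + pm1 l = pm1 k' + pm1 l'"
  shows "(k = k' \<and> l = l') \<or> (k = l' \<and> l = k')"
proof -
  have "k = k' \<or> k = l'"
    using arg_cong[OF eq, of "\<lambda>x. lookup x k"] by (auto simp: lookup_add lookup_pm1 simp del: One_nat_def split: if_splits)
  then show ?thesis
  proof
    assume "k = k'"
    then have "pm1 l = pm1 l'" using eq by simp
    then have "l = l'" by (metis lookup_pm1 zero_neq_one)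
    then show ?thesis using \<open>k = k'\<close> by simp
  next
    assume "k = l'"
    then have "pm1 l = pm1 k'" using eq by (simp add: add.commute)
    then have "l = k'" by (metis lookup_pm1 zero_neq_one)
    then show ?thesis using \<open>k = l'\<close> by simp
  qed
qed

context
  fixes \<alpha> :: "'a::comm_ring_1 mat" and \<xi> \<eta> :: "nat \<Rightarrow> bideg" and q r :: nat
  assumes dims: "dim_row \<alpha> = q" "dim_col \<alpha> = r"
begin

private abbreviation row :: "nat \<Rightarrow> nat \<Rightarrow> 'a" where
  "row j i \<equiv> \<alpha> $$ (j, i)"

private abbreviation slice :: "(en_basis \<Rightarrow>\<^sub>0 'a) \<Rightarrow> (nat \<Rightarrow>\<^sub>0 nat) \<Rightarrow> nat set \<Rightarrow> 'a" where
  "slice x \<nu> \<equiv> (\<lambda>I. lookup x (I, \<nu>))"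

private abbreviation dEN :: "nat \<Rightarrow> (en_basis \<Rightarrow>\<^sub>0 'a) \<Rightarrow> (en_basis \<Rightarrow>\<^sub>0 'a)" where
  "dEN \<equiv> differential (EN \<alpha> \<xi> \<eta>)"

lemma en_gens_Suc: "(I, \<nu>) \<in> en_gens \<alpha> (Suc p) \<longleftrightarrow> I \<subseteq> {..<r} \<and> card I = q + p
    \<and> keys \<nu> \<subseteq> {..<q} \<and> (\<Sum>j<q. lookup \<nu> j) = p"
  by (simp add: en_gens_def dims)

lemma en_gens_1: "(I, \<nu>) \<in> en_gens \<alpha> (Suc 0) \<longleftrightarrow> I \<subseteq> {..<r} \<and> card I = q \<and> \<nu> = 0"
proof -
  have "keys \<nu> \<subseteq> {..<q} \<and> (\<Sum>j<q. lookup \<nu> j) = 0 \<longleftrightarrow> \<nu> = 0"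
  proof
    assume *: "keys \<nu> \<subseteq> {..<q} \<and> (\<Sum>j<q. lookup \<nu> j) = 0"
    have "lookup \<nu> j = 0" for j
      using * by (cases "j < q") (auto simp: in_keys_iff subset_iff)
    then show "\<nu> = 0" by (intro poly_mapping_eqI) simp
  qed auto
  then show ?thesis by (auto simp: en_gens_Suc)
qed

lemma slice_graded:
  assumes "keys x \<subseteq> en_gens \<alpha> (Suc p)"
  shows "graded r (q + p) (slice x \<nu>)"
  unfolding graded_def
proof (intro allI impI)
  fix I assume "lookup x (I, \<nu>) \<noteq> 0"
  then have "(I, \<nu>) \<in> en_gens \<alpha> (Suc p)" using assms by (meson in_keys_iff subsetD)
  then show "I \<subseteq> {..<r} \<and> card I = q + p" by (simp add: en_gens_Suc)
qed

lemma lookup_bd: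
  assumes "(I', \<nu>') \<in> en_gens \<alpha> (Suc (Suc p))"
  shows "lookup (bd (EN \<alpha> \<xi> \<eta>) (Suc (Suc p)) (I', \<nu>')) (I, \<nu>)
    = (\<Sum>j<q. \<Sum>i<r. if i \<notin> I \<and> (insert i I, \<nu> + pm1 j) = (I', \<nu>') then sg i I * row j i else 0)"
proof -
  have I': "I' \<subseteq> {..<r}" "finite I'" and \<nu>': "keys \<nu>' \<subseteq> {..<q}"
    using assms finite_subset[of I' "{..<r}"] by (auto simp: en_gens_Suc)
  let ?t = "\<lambda>j i. if i \<notin> I \<and> (insert i I, \<nu> + pm1 j) = (I', \<nu>') then sg i I * row j i else 0"
  have "lookup (bd (EN \<alpha> \<xi> \<eta>) (Suc (Suc p)) (I', \<nu>')) (I, \<nu>)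
      = (\<Sum>j\<in>keys \<nu>'. \<Sum>i\<in>I'. ((-1) ^ card {i'\<in>I'. i' < i} * row j i when (I' - {i}, \<nu>' - pm1 j) = (I, \<nu>)))"
    by (simp add: EN_def en_bd_def lookup_sum lookup_single)
  also have "\<dots> = (\<Sum>j\<in>keys \<nu>'. \<Sum>i\<in>I'. ?t j i)"
  proof (intro sum.cong refl)
    fix j i assume j: "j \<in> keys \<nu>'" and i: "i \<in> I'"
    have "(I' - {i}, \<nu>' - pm1 j) = (I, \<nu>) \<longleftrightarrow> i \<notin> I \<and> (insert i I, \<nu> + pm1 j) = (I', \<nu>')"
      using minus_plus_pm1[OF j] i by (auto simp del: One_nat_def)
    moreover have "(-1) ^ card {i'\<in>I'. i' < i} = (sg i I :: 'a)" if "insert i I = I'"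
      using sg_self(1)[of i I] unfolding that sg_def by simp
    ultimately show "((-1) ^ card {i'\<in>I'. i' < i} * row j i when (I' - {i}, \<nu>' - pm1 j) = (I, \<nu>)) = ?t j i"
      by (auto simp: when_def)
  qed
  also have "\<dots> = (\<Sum>j\<in>keys \<nu>'. \<Sum>i<r. ?t j i)"
    by (intro sum.cong refl sum.mono_neutral_left) (use I' in auto)
  also have "\<dots> = (\<Sum>j<q. \<Sum>i<r. ?t j i)"
  proof (rule sum.mono_neutral_left)
    show "\<forall>j\<in>{..<q} - keys \<nu>'. (\<Sum>i<r. ?t j i) = 0"
    proof
      fix j assume "j \<in> {..<q} - keys \<nu>'"
      then have "\<nu> + pm1 j \<noteq> \<nu>'" by (auto simp: in_keys_iff lookup_add)
      then show "(\<Sum>i<r. ?t j i) = 0" by simp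
    qed
  qed (use \<nu>' in auto)
  finally show ?thesis .
qed

text \<open>The differential lowers an exponent without any multiplicity. Its component at
  \<open>\<nu>\<close> therefore collects, for each \<open>j\<close>, the contraction with row
  \<open>j\<close> of the slice at \<open>\<nu> + pm1 j\<close>; this carries the homotopies from
  exterior algebra over to the complex.\<close>

lemma lookup_dEN:
  assumes x: "keys x \<subseteq> en_gens \<alpha> (Suc (Suc p))"
  shows "lookup (dEN (Suc (Suc p)) x) (I, \<nu>) = (\<Sum>j<q. ctr r (row j) (slice x (\<nu> + pm1 j)) I)"
proof -
  let ?t = "\<lambda>e j i. if i \<notin> I \<and> (insert i I, \<nu> + pm1 j) = e then sg i I * row j i else 0"
  let ?K = "keys x"
  have "lookup (dEN (Suc (Suc p)) x) (I, \<nu>)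
      = (\<Sum>e\<in>?K. lookup x e * lookup (bd (EN \<alpha> \<xi> \<eta>) (Suc (Suc p)) e) (I, \<nu>))"
    by (simp add: differential_def lookup_sum)
  also have "\<dots> = (\<Sum>e\<in>?K. \<Sum>j<q. \<Sum>i<r. lookup x e * ?t e j i)"
  proof (rule sum.cong[OF refl])
    fix e assume "e \<in> ?K"
    moreover obtain I' \<nu>' where e: "e = (I', \<nu>')" by fastforce
    ultimately have "lookup (bd (EN \<alpha> \<xi> \<eta>) (Suc (Suc p)) e) (I, \<nu>) = (\<Sum>j<q. \<Sum>i<r. ?t e j i)"
      unfolding e using x by (intro lookup_bd) auto
    then show "lookup x e * lookup (bd (EN \<alpha> \<xi> \<eta>) (Suc (Suc p)) e) (I, \<nu>)
        = (\<Sum>j<q. \<Sum>i<r. lookup x e * ?t e j i)" by (simp only: sum_distrib_left)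
  qed
  also have "\<dots> = (\<Sum>j<q. \<Sum>i<r. \<Sum>e\<in>?K. lookup x e * ?t e j i)"
    by (subst sum.swap, rule sum.cong[OF refl], rule sum.swap)
  also have "\<dots> = (\<Sum>j<q. \<Sum>i<r. row j i * ctr1 i (slice x (\<nu> + pm1 j)) I)"
  proof (intro sum.cong refl)
    fix j i
    have "(\<Sum>e\<in>?K. lookup x e * ?t e j i)
        = (\<Sum>e\<in>?K. if e = (insert i I, \<nu> + pm1 j) then (if i \<notin> I then lookup x (insert i I, \<nu> + pm1 j) * sg i I * row j i else 0) else 0)"
      by (intro sum.cong refl) auto
    also have "\<dots> = row j i * ctr1 i (slice x (\<nu> + pm1 j)) I"
      by (auto simp: ctr1_def in_keys_iff mult_ac)
    finally show "(\<Sum>e\<in>?K. lookup x e * ?t e j i) = row j i * ctr1 i (slice x (\<nu> + pm1 j)) I" .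
  qed
  finally show ?thesis by (simp add: ctr_def)
qed

lemma keys_dEN:
  assumes x: "keys x \<subseteq> en_gens \<alpha> (Suc (Suc p))"
  shows "keys (dEN (Suc (Suc p)) x) \<subseteq> en_gens \<alpha> (Suc p)"
proof
  fix e assume e: "e \<in> keys (dEN (Suc (Suc p)) x)"
  obtain I \<nu> where e': "e = (I, \<nu>)" by fastforce
  have "(\<Sum>j<q. ctr r (row j) (slice x (\<nu> + pm1 j)) I) \<noteq> 0"
    using e unfolding e' in_keys_iff lookup_dEN[OF x] .
  from sum.not_neutral_contains_not_neutral[OF this]
  obtain j where j: "j < q" "ctr r (row j) (slice x (\<nu> + pm1 j)) I \<noteq> 0" by auto
  from sum.not_neutral_contains_not_neutral[OF j(2)[unfolded ctr_def]]
  obtain i where "row j i * ctr1 i (slice x (\<nu> + pm1 j)) I \<noteq> 0" by blast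
  then have i: "i \<notin> I" "lookup x (insert i I, \<nu> + pm1 j) \<noteq> 0"
    by (auto simp: ctr1_def split: if_splits)
  then have g: "(insert i I, \<nu> + pm1 j) \<in> en_gens \<alpha> (Suc (Suc p))" using x by (meson in_keys_iff subsetD)
  then have I: "I \<subseteq> {..<r}" by (auto simp: en_gens_Suc)
  have "card I = q + p" using g i(1) finite_subset[OF I] by (simp add: en_gens_Suc)
  moreover have "keys \<nu> \<subseteq> keys (\<nu> + pm1 j)" by (auto simp: in_keys_iff lookup_add)
  moreover have "(\<Sum>j<q. lookup \<nu> j) = p" using g sum_lookup_pm1[OF j(1), of \<nu>] by (simp add: en_gens_Suc)
  ultimately show "e \<in> en_gens \<alpha> (Suc p)" using g I unfolding e' en_gens_Suc by blast
qed

lemma finite_minor_sets: "finite {I. I \<subseteq> {..<r} \<and> card I = q}"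
  by (rule finite_subset[of _ "Pow {..<r}"]) auto

lemma dEN_1:
  assumes x: "keys x \<subseteq> en_gens \<alpha> (Suc 0)"
  shows "dEN (Suc 0) x = single ({}, 0) (\<Sum>I | I \<subseteq> {..<r} \<and> card I = q. slice x 0 I * minor row q I)"
proof -
  let ?J = "{I. I \<subseteq> {..<r} \<and> card I = q}"
  have "dEN (Suc 0) x = (\<Sum>e\<in>(\<lambda>I. (I, 0)) ` ?J. scale (lookup x e) (bd (EN \<alpha> \<xi> \<eta>) (Suc 0) e))"
  proof (rule differential_superset)
    show "keys x \<subseteq> (\<lambda>I. (I, 0)) ` ?J"
    proof
      fix e assume "e \<in> keys x"
      moreover obtain I \<nu> where e: "e = (I, \<nu>)" by fastforce
      ultimately have "I \<in> ?J" "\<nu> = 0" using x en_gens_1[of I \<nu>] by auto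
      then show "e \<in> (\<lambda>I. (I, 0)) ` ?J" using e by blast
    qed
  qed (use finite_minor_sets in auto)
  also have "\<dots> = (\<Sum>I\<in>?J. scale (slice x 0 I) (single ({}, 0) (minor row q I)))"
    by (subst sum.reindex) (auto simp: inj_on_def EN_def en_bd_def max_minor_eq dims)
  also have "\<dots> = single ({}, 0) (\<Sum>I\<in>?J. slice x 0 I * minor row q I)"
    by (rule poly_mapping_eqI) (simp add: lookup_sum lookup_single when_def)
  finally show ?thesis .
qed

lemma dEN_1_ctrs:
  "\<exists>\<epsilon>\<in>{1, -1}. \<forall>x. keys x \<subseteq> en_gens \<alpha> (Suc 0)
    \<longrightarrow> ctrs r row [0..<q] (slice x 0) {} = \<epsilon> * lookup (dEN (Suc 0) x) ({}, 0)"
proof -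
  obtain \<epsilon> where \<epsilon>: "\<epsilon> \<in> {1, -1}" "\<And>\<omega>. ctrs r row [0..<q] \<omega> {} = \<epsilon> * (\<Sum>I | I \<subseteq> {..<r} \<and> card I = q. \<omega> I * minor row q I)"
    using ctrs_eq_minor[of r row q] by blast
  show ?thesis by (rule bexI[OF _ \<epsilon>(1)]) (simp add: \<epsilon>(2) dEN_1)
qed

text \<open>In degree one, contraction with row \<open>j\<close> followed by contraction with all
  rows uses row \<open>j\<close> twice. In higher degrees the slice at
  \<open>\<nu> + pm1 j + pm1 k\<close> is symmetric in \<open>j\<close> and \<open>k\<close>, while
  the contractions anticommute.\<close>

lemma dEN_complex:
  assumes x: "keys x \<subseteq> en_gens \<alpha> (Suc p)"
  shows "dEN p (dEN (Suc p) x) = 0"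
proof (cases p)
  case 0
  then show ?thesis by (simp add: differential_def)
next
  case (Suc p')
  note x = x[unfolded Suc]
  show ?thesis
  proof (cases p')
    case 0
    note x = x[unfolded 0]
    obtain \<epsilon> where \<epsilon>: "\<epsilon> \<in> {1, -1}" "\<And>x. keys x \<subseteq> en_gens \<alpha> (Suc 0)
        \<Longrightarrow> ctrs r row [0..<q] (slice x 0) {} = \<epsilon> * lookup (dEN (Suc 0) x) ({}, 0)"
      using dEN_1_ctrs by blast
    have "slice (dEN (Suc (Suc 0)) x) 0 = (\<lambda>I. \<Sum>j<q. 1 * ctr r (row j) (slice x (pm1 j)) I)"
      by (simp add: lookup_dEN[OF x])
    then have "ctrs r row [0..<q] (slice (dEN (Suc (Suc 0)) x) 0) {}
        = (\<Sum>j<q. ctrs r row [0..<q] (ctr r (row j) (slice x (pm1 j))) {})"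
      by (simp add: ctrs_sum[of r row "[0..<q]" "\<lambda>_. 1", simplified])
    also have "\<dots> = 0"
    proof (rule sum.neutral, rule ballI)
      fix j assume "j \<in> {..<q}"
      then have "ctrs r row [0..<q] (ctr r (row j) (slice x (pm1 j))) = (\<lambda>I. 0)" by (intro ctrs_member_zero) simp
      then show "ctrs r row [0..<q] (ctr r (row j) (slice x (pm1 j))) {} = 0" by simp
    qed
    finally have "lookup (dEN (Suc 0) (dEN (Suc (Suc 0)) x)) ({}, 0) = 0"
      using \<epsilon>(2)[OF keys_dEN[OF x]] \<epsilon>(1) by auto
    then show ?thesis unfolding Suc 0 using dEN_1[OF keys_dEN[OF x]] by simp
  next
    case (Suc p'')
    note x = x[unfolded Suc]
    have "lookup (dEN (Suc (Suc p'')) (dEN (Suc (Suc (Suc p''))) x)) (I, \<nu>) = 0" for I \<nu>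
    proof -
      have "lookup (dEN (Suc (Suc p'')) (dEN (Suc (Suc (Suc p''))) x)) (I, \<nu>)
          = (\<Sum>j<q. ctr r (row j) (\<lambda>I. \<Sum>k<q. 1 * ctr r (row k) (slice x (\<nu> + pm1 j + pm1 k)) I) I)"
        unfolding lookup_dEN[OF keys_dEN[OF x]] lookup_dEN[OF x] by simp
      also have "\<dots> = (\<Sum>j<q. \<Sum>k<q. ctr r (row j) (ctr r (row k) (slice x (\<nu> + pm1 j + pm1 k))) I)"
        unfolding ctr_sum by simp
      also have "\<dots> = 0"
      proof (rule alternating_double_sum)
        fix j k :: nat assume "j \<noteq> k"
        have "\<nu> + pm1 j + pm1 k = \<nu> + pm1 k + pm1 j" by (simp add: ac_simps)
        then show "ctr r (row j) (ctr r (row k) (slice x (\<nu> + pm1 j + pm1 k))) I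
            = - ctr r (row k) (ctr r (row j) (slice x (\<nu> + pm1 k + pm1 j))) I"
          using ctr_anticommute[of r "row j" "row k"] by simp
      qed simp
      finally show ?thesis .
    qed
    then show ?thesis unfolding \<open>p = Suc p'\<close> Suc by (intro poly_mapping_eqI) auto
  qed
qed

lemma finite_en_gens: "finite (en_gens \<alpha> (Suc 0))" "finite (en_gens \<alpha> (Suc (Suc 0)))" "finite (en_gens \<alpha> (Suc (Suc (Suc 0))))"
proof -
  have "en_gens \<alpha> (Suc 0) \<subseteq> Pow {..<r} \<times> {0}" by (auto simp: en_gens_1)
  then show "finite (en_gens \<alpha> (Suc 0))" by (rule finite_subset) simp
  have "en_gens \<alpha> (Suc (Suc 0)) \<subseteq> Pow {..<r} \<times> pm1 ` {..<q}"
  proof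
    fix e assume *: "e \<in> en_gens \<alpha> (Suc (Suc 0))"
    obtain I \<nu> where e: "e = (I, \<nu>)" by fastforce
    have "I \<subseteq> {..<r}" "\<exists>k<q. \<nu> = pm1 k" using * degree_one_monomial[of \<nu> q] by (auto simp: e en_gens_Suc)
    then show "e \<in> Pow {..<r} \<times> pm1 ` {..<q}" using e by blast
  qed
  then show "finite (en_gens \<alpha> (Suc (Suc 0)))" by (rule finite_subset) simp
  have "en_gens \<alpha> (Suc (Suc (Suc 0))) \<subseteq> Pow {..<r} \<times> (\<lambda>(k, l). pm1 k + pm1 l) ` ({..<q} \<times> {..<q})"
  proof
    fix e assume *: "e \<in> en_gens \<alpha> (Suc (Suc (Suc 0)))"
    obtain I \<nu> where e: "e = (I, \<nu>)" by fastforce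
    have "I \<subseteq> {..<r}" and "\<exists>k<q. \<exists>l<q. \<nu> = pm1 k + pm1 l"
      using * degree_two_monomial[of \<nu> q] by (auto simp: e en_gens_Suc numeral_2_eq_2)
    then obtain k l where "k < q" "l < q" "\<nu> = pm1 k + pm1 l" by blast
    then show "e \<in> Pow {..<r} \<times> (\<lambda>(k, l). pm1 k + pm1 l) ` ({..<q} \<times> {..<q})"
      using e \<open>I \<subseteq> {..<r}\<close> by (auto intro!: image_eqI[of _ _ "(k, l)"])
  qed
  then show "finite (en_gens \<alpha> (Suc (Suc (Suc 0))))" by (rule finite_subset) simp
qed

end

context
  fixes \<alpha> :: "'a::idom mat" and \<xi> \<eta> :: "nat \<Rightarrow> bideg" and n c :: nat
  assumes dims: "dim_row \<alpha> = n" "dim_col \<alpha> = c + 3" and n: "n = Suc c"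
begin

private abbreviation "rw \<equiv> (\<lambda>j i. \<alpha> $$ (j, i))"
private abbreviation "D \<equiv> differential (EN \<alpha> \<xi> \<eta>)"
private abbreviation "E1 \<equiv> en_gens \<alpha> (Suc 0)"
private abbreviation "E2 \<equiv> en_gens \<alpha> (Suc (Suc 0))"
private abbreviation "E3 \<equiv> en_gens \<alpha> (Suc (Suc (Suc 0)))"

private lemmas lookup_D = lookup_dEN[OF dims, of _ _ \<xi> \<eta>]
private lemmas gens_Suc = en_gens_Suc[OF dims]
private lemmas fin_gens = finite_en_gens[OF dims]

lemma slices_graded:
  fixes x :: "en_basis \<Rightarrow>\<^sub>0 'a"
  shows "keys x \<subseteq> E1 \<Longrightarrow> graded (c + 3) n (\<lambda>I. lookup x (I, \<nu>))"
  "keys x \<subseteq> E2 \<Longrightarrow> graded (c + 3) (c + 2) (\<lambda>I. lookup x (I, \<nu>))"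
  "keys x \<subseteq> E3 \<Longrightarrow> graded (c + 3) (c + 3) (\<lambda>I. lookup x (I, \<nu>))"
  using slice_graded[OF dims, of x 0] slice_graded[OF dims, of x "Suc 0"] slice_graded[OF dims, of x "Suc (Suc 0)"] n
  by (simp_all add: numeral_3_eq_3)

lemma EN_H3:
  assumes x: "keys x \<subseteq> E3" "D (Suc (Suc (Suc 0))) x = 0"
    and I: "I \<subseteq> {..<c + 3}" "card I = n" "minor rw n I \<noteq> 0"
  shows "x = 0"
proof (rule poly_mapping_eqI)
  fix e :: en_basis
  obtain J \<nu> where e: "e = (J, \<nu>)" by fastforce
  obtain v where v: "\<And>j k. j < n \<Longrightarrow> k < n \<Longrightarrow> (\<Sum>i<c + 3. rw j i * v k i) = (if j = k then minor rw n I else 0)"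
    using minor_dual_vectors[OF I(1,2), of rw] by blast
  have "lookup x (J, pm1 k + pm1 l) = 0" if "k < n" "l < n" for k l
  proof (rule H3_injective[OF v I(3), where S = "\<lambda>j I. lookup x (I, pm1 k + pm1 j)"])
    show "(\<Sum>j<n. ctr (c + 3) (rw j) (\<lambda>I. lookup x (I, pm1 k + pm1 j)) J) = 0" for J
      using lookup_D[OF x(1), of J "pm1 k"] x(2) by simp
  qed (use that slices_graded(3)[OF x(1)] in auto)
  moreover have "\<exists>k<n. \<exists>l<n. \<nu> = pm1 k + pm1 l" if "e \<in> E3"
    using that degree_two_monomial[of \<nu> n] by (auto simp: e gens_Suc)
  ultimately show "lookup x e = lookup 0 e"
    using x(1) unfolding e by (metis in_keys_iff lookup_zero subsetD)
qed

text \<open>Turns a family of forms into a chain. Cutting the forms down to the basis of the complex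
  is harmless: at a basis element of homological degree one, the contractions read them only at
  basis elements of degree two.\<close>

lemma image_E2I:
  assumes z: "keys z \<subseteq> E1"
    and \<eta>': "\<And>I. q ^ N * lookup z (I, 0) = (\<Sum>j<n. ctr (c + 3) (rw j) (\<eta>' j) I)"
  shows "image_up_to (D (Suc (Suc 0))) E2 q z"
proof -
  define y where "y = pm_of E2 (\<lambda>(I, \<nu>). \<eta>' (THE k. \<nu> = pm1 k) I)"
  have the: "(THE k. pm1 j = pm1 k) = j" for j by (rule the_equality) (auto dest: arg_cong[of _ _ keys])
  have y: "lookup y (I, pm1 j) = (if (I, pm1 j) \<in> E2 then \<eta>' j I else 0)" for I j
    unfolding y_def by (simp add: lookup_pm_of[OF fin_gens(2)] the del: One_nat_def)
  have ky: "keys y \<subseteq> E2" unfolding y_def by (rule keys_pm_of[OF fin_gens(2)])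
  have "lookup (scale (q ^ N) z) (I, \<nu>) = lookup (D (Suc (Suc 0)) y) (I, \<nu>)" for I \<nu>
  proof (cases "(I, \<nu>) \<in> E1")
    case False
    then have "(I, \<nu>) \<notin> keys z" "(I, \<nu>) \<notin> keys (D (Suc (Suc 0)) y)"
      using z keys_dEN[OF dims ky] by auto
    then show ?thesis by (simp add: in_keys_iff)
  next
    case True
    then have I: "I \<subseteq> {..<c + 3}" "card I = n" "\<nu> = 0" using en_gens_1[OF dims] by auto
    have "finite I" using finite_subset[OF I(1)] by simp
    have "ctr (c + 3) (rw j) (\<lambda>I. lookup y (I, \<nu> + pm1 j)) I = ctr (c + 3) (rw j) (\<eta>' j) I" if "j < n" for j
    proof (rule ctr_cong)
      fix x assume "x < c + 3" "x \<notin> I"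
      then have "(insert x I, pm1 j) \<in> E2"
        using I \<open>finite I\<close> that sum_lookup_pm1[OF that, of 0] by (simp add: gens_Suc)
      then show "lookup y (insert x I, \<nu> + pm1 j) = \<eta>' j (insert x I)"
        unfolding I(3) add_0 y by simp
    qed
    then show ?thesis unfolding lookup_D[OF ky] by (simp add: I(3) \<eta>')
  qed
  then have "scale (q ^ N) z = D (Suc (Suc 0)) y" by (intro poly_mapping_eqI) auto
  then show ?thesis using ky unfolding image_up_to_def by blast
qed

lemma EN_H1_minor:
  assumes z: "keys z \<subseteq> E1" "D (Suc 0) z = 0" and I: "I \<subseteq> {..<c + 3}" "card I = n"
  shows "image_up_to (D (Suc (Suc 0))) E2 (minor rw n I) z"
proof -
  obtain v where v: "\<And>j k. j < n \<Longrightarrow> k < n \<Longrightarrow> (\<Sum>i<c + 3. rw j i * v k i) = (if j = k then minor rw n I else 0)"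
    using minor_dual_vectors[OF I(1,2), of rw] by blast
  have "ctrs (c + 3) rw [0..<n] (\<lambda>I. lookup z (I, 0)) {} = 0"
    using dEN_1_ctrs[OF dims, of \<xi> \<eta>] z by auto
  from H1_minor[OF v slices_graded(1)[OF z(1)] this]
  obtain \<eta>' where "\<And>I'. minor rw n I ^ n * lookup z (I', 0) = (\<Sum>j<n. ctr (c + 3) (rw j) (\<eta>' j) I')"
    by blast
  then show ?thesis by (rule image_E2I[OF z(1)])
qed

lemma EN_H1_torsion:
  assumes z: "keys z \<subseteq> E1" "D (Suc 0) z = 0" and p: "p < n"
    and dual: "\<And>j k. j < n \<Longrightarrow> k < n \<Longrightarrow> j \<noteq> p \<Longrightarrow> k \<noteq> p \<Longrightarrow> (\<Sum>i<c + 3. rw j i * v k i) = (if j = k then \<delta> else 0)"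
    and v0: "\<And>k i. k < n \<Longrightarrow> c \<le> i \<Longrightarrow> i < c + 3 \<Longrightarrow> v k i = 0"
    and b0: "\<And>i. i < c \<Longrightarrow> (\<Sum>j<n. g j * rw j i) = 0"
    and reg: "koszul_regular q (\<lambda>i. \<Sum>j<n. g j * rw j (c + i))"
    and dvd: "\<delta> dvd q"
  shows "image_up_to (D (Suc (Suc 0))) E2 q z"
proof -
  have "ctrs (c + 3) rw [0..<n] (\<lambda>I. lookup z (I, 0)) {} = 0"
    using dEN_1_ctrs[OF dims, of \<xi> \<eta>] z by auto
  from H1_torsion[OF p refl n dual v0 b0 reg dvd slices_graded(1)[OF z(1)] this]
  obtain N \<eta>' where "\<And>I. q ^ N * lookup z (I, 0) = (\<Sum>j<n. ctr (c + 3) (rw j) (\<eta>' j) I)"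
    by blast
  then show ?thesis by (rule image_E2I[OF z(1)])
qed

lemma EN_H2_torsion:
  assumes z: "keys z \<subseteq> E2" "D (Suc (Suc 0)) z = 0" and p: "p < n"
    and dual: "\<And>j k. j < n \<Longrightarrow> k < n \<Longrightarrow> j \<noteq> p \<Longrightarrow> k \<noteq> p \<Longrightarrow> (\<Sum>i<c + 3. rw j i * v k i) = (if j = k then \<delta> else 0)"
    and v0: "\<And>k i. k < n \<Longrightarrow> c \<le> i \<Longrightarrow> i < c + 3 \<Longrightarrow> v k i = 0"
    and b0: "\<And>i. i < c \<Longrightarrow> (\<Sum>j<n. g j * rw j i) = 0"
    and reg: "koszul_regular q (\<lambda>i. \<Sum>j<n. g j * rw j (c + i))"
    and dvd: "\<delta> dvd q" "g p dvd q" "q \<noteq> 0"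
  shows "image_up_to (D (Suc (Suc (Suc 0)))) E3 q z"
proof -
  have "(\<Sum>j<n. ctr (c + 3) (rw j) (\<lambda>I. lookup z (I, pm1 j)) I) = 0" for I
    using lookup_D[OF z(1), of I 0] z(2) by simp
  from H2_torsion[OF p refl dual v0 b0 reg dvd slices_graded(2)[OF z(1)] this]
  obtain N S where S: "\<And>j k. S j k = S k j"
      "\<And>k I. k < n \<Longrightarrow> q ^ N * lookup z (I, pm1 k) = (\<Sum>j<n. ctr (c + 3) (rw j) (S k j) I)"
    by blast
  \<comment> \<open>A quadratic monomial determines its two indices up to order, and
    \<open>S\<close> is symmetric, so any decomposition will do.\<close>
  define kl where "kl \<nu> = (SOME kl. \<nu> = pm1 (fst kl) + pm1 (snd kl))" for \<nu>
  have kl: "S (fst (kl (pm1 k + pm1 l))) (snd (kl (pm1 k + pm1 l))) = S k l" for k l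
  proof -
    have "pm1 k + pm1 l = pm1 (fst (kl (pm1 k + pm1 l))) + pm1 (snd (kl (pm1 k + pm1 l)))"
      unfolding kl_def by (rule someI[of _ "(k, l)"]) simp
    from pm1_sum_eq[OF this] show ?thesis using S(1) by auto
  qed
  define y where "y = pm_of E3 (\<lambda>(I, \<nu>). S (fst (kl \<nu>)) (snd (kl \<nu>)) I)"
  have y: "lookup y (I, pm1 k + pm1 j) = (if (I, pm1 k + pm1 j) \<in> E3 then S k j I else 0)" for I k j
    unfolding y_def by (simp add: lookup_pm_of[OF fin_gens(3)] kl del: One_nat_def)
  have ky: "keys y \<subseteq> E3" unfolding y_def by (rule keys_pm_of[OF fin_gens(3)])
  have "lookup (scale (q ^ N) z) (I, \<nu>) = lookup (D (Suc (Suc (Suc 0))) y) (I, \<nu>)" for I \<nu>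
  proof (cases "(I, \<nu>) \<in> E2")
    case False
    then have "(I, \<nu>) \<notin> keys z" "(I, \<nu>) \<notin> keys (D (Suc (Suc (Suc 0))) y)"
      using z keys_dEN[OF dims ky] by auto
    then show ?thesis by (simp add: in_keys_iff)
  next
    case True
    then have I: "I \<subseteq> {..<c + 3}" "card I = n + 1" and "\<exists>k<n. \<nu> = pm1 k"
      using degree_one_monomial[of \<nu> n] by (auto simp: gens_Suc)
    then obtain k where k: "k < n" "\<nu> = pm1 k" by blast
    have "finite I" using finite_subset[OF I(1)] by simp
    have "ctr (c + 3) (rw j) (\<lambda>I. lookup y (I, \<nu> + pm1 j)) I = ctr (c + 3) (rw j) (S k j) I" if "j < n" for j
    proof (rule ctr_cong)
      fix x assume x: "x < c + 3" "x \<notin> I"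
      have "keys (pm1 k + pm1 j) \<subseteq> {..<n}"
        using Poly_Mapping.keys_add[of "pm1 k" "pm1 j"] k(1) that by auto
      then have "(insert x I, pm1 k + pm1 j) \<in> E3"
        using x I \<open>finite I\<close> sum_lookup_pm1[OF that, of "pm1 k"] sum_lookup_pm1[OF k(1), of 0]
        by (simp add: gens_Suc)
      then show "lookup y (insert x I, \<nu> + pm1 j) = S k j (insert x I)"
        unfolding k(2) y by simp
    qed
    then show ?thesis unfolding lookup_D[OF ky] by (simp add: k(2) S(2)[OF k(1)] del: One_nat_def)
  qed
  then have "scale (q ^ N) z = D (Suc (Suc (Suc 0))) y" by (intro poly_mapping_eqI) auto
  then show ?thesis using ky unfolding image_up_to_def by blast
qed

end

section \<open>Common zeros, first in the affine plane and then on a chart\<close>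

section \<open>The Nullstellensatz in two variables\<close>

definition ideal_set :: "'a::comm_ring_1 set \<Rightarrow> bool" where
  "ideal_set J \<longleftrightarrow> 0 \<in> J \<and> (\<forall>x\<in>J. \<forall>y\<in>J. x + y \<in> J) \<and> (\<forall>c. \<forall>x\<in>J. c * x \<in> J)"

lemma ideal_setD:
  assumes "ideal_set J"
  shows "0 \<in> J" "x \<in> J \<Longrightarrow> y \<in> J \<Longrightarrow> x + y \<in> J" "x \<in> J \<Longrightarrow> c * x \<in> J" "x \<in> J \<Longrightarrow> y \<in> J \<Longrightarrow> x - y \<in> J"
proof -
  show "0 \<in> J" "x \<in> J \<Longrightarrow> y \<in> J \<Longrightarrow> x + y \<in> J" "x \<in> J \<Longrightarrow> c * x \<in> J"
    using assms by (auto simp: ideal_set_def)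
  show "x - y \<in> J" if "x \<in> J" "y \<in> J"
  proof -
    have "x + (-1) * y \<in> J" using assms that unfolding ideal_set_def by blast
    then show ?thesis by simp
  qed
qed

text \<open>Otherwise one plus the product of all linear factors would be a polynomial of positive
  degree without a root.\<close>

lemma infinite_alg_closed: "infinite (UNIV :: 'k::alg_closed_field set)"
proof
  assume fin: "finite (UNIV :: 'k set)"
  define p :: "'k poly" where "p = (\<Prod>a\<in>UNIV. [:- a, 1:]) + 1"
  have ev: "poly p b = 1" for b
    using fin by (auto simp: p_def poly_prod prod_zero_iff intro!: exI[of _ b])
  have "degree (\<Prod>a\<in>(UNIV::'k set). [:- a, 1:]) = card (UNIV :: 'k set)"
    by (subst degree_prod_eq_sum_degree) auto
  then have "degree p > 0" using fin
    by (simp add: p_def degree_add_eq_left card_gt_0_iff)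
  then obtain b where "poly p b = 0" using alg_closed_imp_poly_has_root by blast
  with ev show False by simp
qed

text \<open>A nonzero element of least degree divides all the others and is not constant, so any
  root of it will do.\<close>

lemma ideal_common_root:
  fixes K :: "'k::alg_closed_field poly set"
  assumes K: "ideal_set K" and "1 \<notin> K"
  shows "\<exists>b. \<forall>q\<in>K. poly q b = 0"
proof (cases "K \<subseteq> {0}")
  case True
  then have "\<forall>q\<in>K. poly q 0 = 0" by (metis poly_0 singletonD subsetD)
  then show ?thesis ..
next
  case False
  then obtain q0 where "q0 \<in> K \<and> q0 \<noteq> 0" by auto
  from exists_least_iff[of "\<lambda>d. \<exists>q\<in>K. q \<noteq> 0 \<and> degree q = d", THEN iffD1] this
  obtain q where q: "q \<in> K" "q \<noteq> 0" "\<And>p. p \<in> K \<Longrightarrow> p \<noteq> 0 \<Longrightarrow> degree q \<le> degree p"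
    by (metis not_le)
  have "degree q > 0"
  proof (rule ccontr)
    assume "\<not> degree q > 0"
    then obtain c where c: "q = [:c:]" by (metis degree_eq_zeroE gr0I)
    then have "[:1 / c:] * q = 1" using q(2) by (simp add: one_pCons)
    then show False using ideal_setD(3)[OF K q(1), of "[:1 / c:]"] \<open>1 \<notin> K\<close> by simp
  qed
  then obtain b where b: "poly q b = 0" using alg_closed_imp_poly_has_root by blast
  have "poly p b = 0" if "p \<in> K" for p
  proof -
    have "p mod q = p - (p div q) * q" by (simp add: minus_div_mult_eq_mod)
    then have "p mod q \<in> K" using K that q(1) by (simp add: ideal_setD)
    then have "p mod q = 0" using q degree_mod_less[OF q(2), of p] by force
    then have "p = (p div q) * q" by (metis add.right_neutral div_mult_mod_eq)
    then show ?thesis using b by (metis mult_zero_right poly_mult)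
  qed
  then show ?thesis by blast
qed

text \<open>The value is substituted for the inner of the two variables; the outer one stays
  free.\<close>

definition evx :: "'a::comm_ring_1 \<Rightarrow> 'a poly poly \<Rightarrow> 'a poly" where
  "evx a = map_poly (\<lambda>c. poly c a)"

lemma coeff_evx: "coeff (evx a p) i = poly (coeff p i) a"
  by (simp add: evx_def coeff_map_poly)

lemma evx_add: "evx a (p + q) = evx a p + evx a q"
  by (rule poly_eqI) (simp add: coeff_evx)

lemma evx_mult: "evx a (p * q) = evx a p * evx a q"
  by (rule poly_eqI) (simp add: coeff_evx coeff_mult poly_sum)

lemma evx_const: "evx a [:f:] = [:poly f a:]"
  by (rule poly_eqI) (simp add: coeff_evx coeff_pCons split: nat.splits)

lemma evx_lift: "evx a (map_poly (\<lambda>c. [:c:]) p) = p"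
  by (rule poly_eqI) (simp add: coeff_evx coeff_map_poly)

text \<open>By elimination. If \<open>J\<close> contains a nonzero polynomial \<open>f\<close> in
  the inner variable alone, a root of \<open>f\<close> may serve as first coordinate unless
  \<open>J\<close> becomes trivial there; in that case the linear factor of the root is invertible
  modulo \<open>J\<close> and can be cancelled from \<open>f\<close>. If there is no such
  \<open>f\<close>, an element of least degree in the outer variable divides all of \<open>J\<close>
  up to powers of its leading coefficient, and any first coordinate off the roots of that
  coefficient works.\<close>

lemma nullstellensatz_two_variables:
  fixes J :: "'k::alg_closed_field poly poly set"
  assumes J: "ideal_set J" and "1 \<notin> J"
  shows "\<exists>a b. \<forall>p\<in>J. poly (evx a p) b = 0"
proof (cases "\<exists>f. f \<noteq> 0 \<and> [:f:] \<in> J")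
  case True
  have "\<exists>a b. \<forall>p\<in>J. poly (evx a p) b = 0" if "f \<noteq> 0" "[:f:] \<in> J" for f
    using that
  proof (induction "degree f" arbitrary: f rule: less_induct)
    case less
    have "degree f > 0"
    proof (rule ccontr)
      assume "\<not> degree f > 0"
      then obtain c where c: "f = [:c:]" by (metis degree_eq_zeroE gr0I)
      then have "[:[:1 / c:]:] * [:f:] = 1" using less.prems(1) by (simp add: one_pCons)
      then show False using ideal_setD(3)[OF J less.prems(2), of "[:[:1 / c:]:]"] \<open>1 \<notin> J\<close> by simp
    qed
    then obtain a where "poly f a = 0" using alg_closed_imp_poly_has_root by blast
    then obtain f' where f': "f = [:- a, 1:] * f'" unfolding poly_eq_0_iff_dvd by (auto elim: dvdE)
    show ?case
    proof (cases "1 \<in> evx a ` J")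
      case False
      have "ideal_set (evx a ` J)"
        unfolding ideal_set_def
      proof (intro conjI ballI allI)
        show "0 \<in> evx a ` J" using ideal_setD(1)[OF J] by (force simp: evx_def)
        show "x + y \<in> evx a ` J" if "x \<in> evx a ` J" "y \<in> evx a ` J" for x y
          using that ideal_setD(2)[OF J] by (auto simp flip: evx_add)
        show "c * x \<in> evx a ` J" if x: "x \<in> evx a ` J" for c x
        proof -
          obtain p where p: "p \<in> J" "x = evx a p" using x by auto
          have "c * x = evx a (map_poly (\<lambda>c. [:c:]) c * p)" by (simp add: evx_mult evx_lift p)
          then show ?thesis using ideal_setD(3)[OF J p(1)] by blast
        qed
      qed
      from ideal_common_root[OF this False] show ?thesis by blast
    next
      case True
      then obtain p where p: "p \<in> J" "evx a p = 1" by auto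
      have "[:[:- a, 1:]:] dvd p - 1"
        unfolding const_poly_dvd_iff
      proof
        fix i
        have "poly (coeff (p - 1) i) a = coeff (evx a p - 1) i"
          by (cases i) (simp_all add: coeff_evx one_pCons)
        also have "\<dots> = 0" unfolding p(2) by simp
        finally show "[:- a, 1:] dvd coeff (p - 1) i" by (simp only: poly_eq_0_iff_dvd)
      qed
      then obtain h where "p - 1 = [:[:- a, 1:]:] * h" by (auto elim: dvdE)
      then have 1: "p - [:[:- a, 1:]:] * h = 1" by (simp add: algebra_simps)
      have f: "[:f:] = [:[:- a, 1:]:] * [:f':]" by (simp add: f')
      have "[:f':] * p - h * [:f:] = [:f':] * (p - [:[:- a, 1:]:] * h)"
        unfolding f by (simp only: algebra_simps)
      then have "[:f':] * p - h * [:f:] = [:f':]" unfolding 1 by simp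
      moreover have "[:f':] * p - h * [:f:] \<in> J"
        by (rule ideal_setD(4)[OF J ideal_setD(3)[OF J p(1)] ideal_setD(3)[OF J less.prems(2)]])
      ultimately have "[:f':] \<in> J" by (simp only:)
      moreover have "f' \<noteq> 0" using less.prems(1) f' by auto
      moreover from this have "degree f = Suc (degree f')" unfolding f' by (subst degree_mult_eq) auto
      then have "degree f' < degree f" by simp
      ultimately show ?thesis by (intro less.hyps)
    qed
  qed
  then show ?thesis using True by blast
next
  case False
  show ?thesis
  proof (cases "J \<subseteq> {0}")
    case True
    have "evx 0 0 = (0 :: 'k poly)" by (simp add: evx_def)
    then have "\<forall>p\<in>J. poly (evx 0 p) 0 = 0" using True by (metis poly_0 singletonD subsetD)
    then show ?thesis by blast
  next
    case nz: False
    then obtain q0 where "q0 \<in> J \<and> q0 \<noteq> 0" by auto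
    from exists_least_iff[of "\<lambda>d. \<exists>q\<in>J. q \<noteq> 0 \<and> degree q = d", THEN iffD1] this
    obtain q where q: "q \<in> J" "q \<noteq> 0" "\<And>p. p \<in> J \<Longrightarrow> p \<noteq> 0 \<Longrightarrow> degree q \<le> degree p"
      by (metis not_le)
    have dq: "degree q > 0" using False q by (metis degree_eq_zeroE gr0I pCons_eq_0_iff)
    let ?l = "lead_coeff q"
    have "finite {a. poly ?l a = 0}" using q(2) by (intro poly_roots_finite) simp
    then obtain a where a: "poly ?l a \<noteq> 0" using ex_new_if_finite[OF infinite_alg_closed] by blast
    \<comment> \<open>The leading coefficient survives at \<open>a\<close>, so the specialised
      polynomial still has positive degree and therefore a root.\<close>
    have "coeff (evx a q) (degree q) \<noteq> 0" using a by (simp add: coeff_evx)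
    then have "degree q \<le> degree (evx a q)" by (rule le_degree)
    then obtain b where b: "poly (evx a q) b = 0" using alg_closed_imp_poly_has_root dq by (metis le_trans not_le)
    have "poly (evx a p) b = 0" if p: "p \<in> J" for p
    proof -
      have UN: "subring_set (UNIV :: 'k poly set)" "x \<in> polys_over (UNIV :: 'k poly set)" for x
        by (auto simp: subring_set_def polys_over_def)
      obtain N A R where R: "smult (?l ^ N) p = A * q + R" "R = 0 \<or> degree R < degree q"
        using pseudo_division_over[OF UN(1) UN(2) q(2) UN(2)] by metis
      have "R = [:?l ^ N:] * p - A * q" using R(1) by simp
      then have "R \<in> J" using ideal_setD[OF J] p q(1) by metis
      then have "R = 0" using R(2) q(3) by (metis not_le)
      then have "[:?l ^ N:] * p = A * q" using R(1) by simp
      then have "poly (evx a ([:?l ^ N:] * p)) b = poly (evx a (A * q)) b" by (rule arg_cong)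
      then have "poly ?l a ^ N * poly (evx a p) b = 0"
        unfolding evx_mult evx_const by (simp add: b poly_power)
      then show ?thesis using a by simp
    qed
    then show ?thesis by blast
  qed
qed

section \<open>Charts of the biprojective space\<close>

text \<open>On the chart \<open>x\<close> and \<open>y\<close> are inverted; \<open>x'\<close> and
  \<open>y'\<close> are their partners.\<close>

definition chart_vars :: "rvar \<Rightarrow> rvar \<Rightarrow> rvar \<Rightarrow> rvar \<Rightarrow> bool" where
  "chart_vars x x' y y' \<longleftrightarrow> {x, x'} = {Vs, Vt} \<and> {y, y'} = {Vu, Vv}"

lemma UNIV_rvar: "(UNIV :: rvar set) = {Vs, Vt, Vu, Vv}"
  using rvar.exhaust by blast

lemma chart_varsD:
  assumes "chart_vars x x' y y'"
  shows "distinct [x, x', y, y']" "z = x \<or> z = x' \<or> z = y \<or> z = y'"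
    "mon_deg m = (int (lookup m x + lookup m x'), int (lookup m y + lookup m y'))"
  using assms unfolding chart_vars_def mon_deg_def
  by (auto simp: doubleton_eq_iff) (cases z; simp)+

lemma chart_vars_neq:
  assumes "chart_vars x x' y y'"
  shows "x \<noteq> x'" "x \<noteq> y" "x \<noteq> y'" "x' \<noteq> x" "x' \<noteq> y" "x' \<noteq> y'"
    "y \<noteq> x" "y \<noteq> x'" "y \<noteq> y'" "y' \<noteq> x" "y' \<noteq> x'" "y' \<noteq> y"
  using chart_varsD(1)[OF assms] by auto

lemma evx_0 [simp]: "evx a 0 = 0" and evx_1 [simp]: "evx a 1 = 1"
  by (rule poly_eqI, simp add: coeff_evx)+

definition lift_const :: "'k::comm_ring_1 \<Rightarrow> 'k poly poly" where
  "lift_const c = [:[:c:]:]"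

lemma lift_const_hom: "comm_ring_hom lift_const"
  by standard (auto simp: lift_const_def one_pCons)

lemma X_eq_var: "X x = var x"
  by (simp add: X_def)

text \<open>The variables \<open>x\<close> and \<open>y\<close> of the chart become 1;
  \<open>x'\<close> becomes the inner and \<open>y'\<close> the outer variable.\<close>

definition dehom :: "rvar \<Rightarrow> rvar \<Rightarrow> 'k::comm_ring_1 rpoly \<Rightarrow> 'k poly poly" where
  "dehom x' y' = evalm lift_const (\<lambda>z. if z = x' then [:[:0, 1:]:] else if z = y' then [:0, 1:] else 1)"

text \<open>The kernel is the ideal of the point, generated by \<open>x' - a x\<close> and
  \<open>y' - b y\<close>. Presenting it by a map into a domain makes its primality
  immediate.\<close>

definition to_point :: "rvar \<Rightarrow> rvar \<Rightarrow> rvar \<Rightarrow> rvar \<Rightarrow> 'k::comm_ring_1 \<Rightarrow> 'k \<Rightarrow> 'k rpoly \<Rightarrow> 'k rpoly" where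
  "to_point x x' y y' a b = evalm cst (\<lambda>z. if z = x' then cst a * X x else if z = y' then cst b * X y else X z)"

lemma cst_hom: "comm_ring_hom (cst :: 'a::comm_ring_1 \<Rightarrow> ('v, 'a) mpoly)"
  by standard (auto simp: single_add mult_single)

lemma to_point_hom: "comm_ring_hom (to_point x x' y y' a b)"
  unfolding to_point_def by (rule evalm_hom[OF cst_hom])

lemma dehom_hom: "comm_ring_hom (dehom x' y')"
  unfolding dehom_def by (rule evalm_hom[OF lift_const_hom])

lemma monv_chart:
  assumes "chart_vars x x' y y'"
  shows "monv f m = f x ^ lookup m x * f x' ^ lookup m x'
    * f y ^ lookup m y * f y' ^ lookup m y'"
proof -
  have "monv f m = (\<Prod>z\<in>{x, x', y, y'}. f z ^ lookup m z)"
    by (rule monv_superset) (use chart_varsD(2)[OF assms] in auto)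
  then show ?thesis using chart_varsD(1)[OF assms] by (simp add: mult.assoc)
qed

lemma coeff_dehom:
  assumes ch: "chart_vars x x' y y'"
  shows "coeff (coeff (dehom x' y' h) j) i
    = (\<Sum>m\<in>keys h. if lookup m x' = i \<and> lookup m y' = j then lookup h m else 0)"
proof -
  have mon: "[:[:0, 1:]:] ^ k * [:0, 1:] ^ l = (monom (monom 1 k) l :: 'a poly poly)" for k l
  proof -
    have "[:[:0, 1:]:] ^ k = ([:monom 1 k:] :: 'a poly poly)" by (induction k) (auto simp: monom_0 monom_Suc one_pCons)
    moreover have "[:0, 1:] ^ l = (monom 1 l :: 'a poly poly)" by (simp add: monom_altdef)
    ultimately show ?thesis by (simp add: smult_monom)
  qed
  have "dehom x' y' h = (\<Sum>m\<in>keys h. lift_const (lookup h m)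
      * monom (monom 1 (lookup m x')) (lookup m y'))"
    unfolding dehom_def evalm_def monv_chart[OF ch]
    by (intro sum.cong refl) (simp add: chart_vars_neq[OF ch] flip: mon)
  then show ?thesis
    by (simp add: coeff_sum lift_const_def smult_monom) (intro sum.cong refl, auto)
qed

lemma R_piece_keys: "h \<in> R_piece d \<Longrightarrow> m \<in> keys h \<Longrightarrow> mon_deg m = d"
  by (simp add: R_piece_def)

text \<open>The bidegree restores the exponents of \<open>x\<close> and \<open>y\<close>.\<close>

lemma dehom_inj_piece:
  assumes ch: "chart_vars x x' y y'" and h: "h \<in> R_piece d" "h' \<in> R_piece d" and eq: "dehom x' y' h = dehom x' y' h'"
  shows "h = h'"
proof -
  have ext: "m = m'" if "mon_deg m = mon_deg m'" "lookup m x' = lookup m' x'"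
      "lookup m y' = lookup m' y'" for m m'
  proof (rule poly_mapping_eqI)
    fix z show "lookup m z = lookup m' z"
      using that chart_varsD(2)[OF ch, of z] unfolding chart_varsD(3)[OF ch] by auto
  qed
  have lk: "lookup h m = coeff (coeff (dehom x' y' h) (lookup m y')) (lookup m x')"
    if "mon_deg m = d" "h \<in> R_piece d" for m h
  proof -
    have "coeff (coeff (dehom x' y' h) (lookup m y')) (lookup m x')
        = (\<Sum>m'\<in>keys h. if m' = m then lookup h m else 0)"
      unfolding coeff_dehom[OF ch] using that ext by (intro sum.cong refl) (auto simp: R_piece_keys)
    then show ?thesis by (simp add: in_keys_iff)
  qed
  show ?thesis
  proof (rule poly_mapping_eqI)
    fix m show "lookup h m = lookup h' m"
    proof (cases "mon_deg m = d")
      case True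
      then show ?thesis using lk h eq by metis
    next
      case False
      then have "m \<notin> keys h" "m \<notin> keys h'" using R_piece_keys[OF h(1)] R_piece_keys[OF h(2)] False by blast+
      then show ?thesis by (simp add: in_keys_iff)
    qed
  qed
qed

lemma R_piece_mult: "p \<in> R_piece d \<Longrightarrow> q \<in> R_piece e \<Longrightarrow> p * q \<in> R_piece (d + e)"
proof -
  have md: "mon_deg (m + m') = mon_deg m + mon_deg m'" for m m'
    by (simp add: mon_deg_def lookup_add)
  assume "p \<in> R_piece d" "q \<in> R_piece e"
  then show ?thesis using keys_mult[of p q] by (fastforce simp: R_piece_def md)
qed

lemma R_piece_add: "p \<in> R_piece d \<Longrightarrow> q \<in> R_piece d \<Longrightarrow> p + q \<in> R_piece d"
  using Poly_Mapping.keys_add[of p q] by (auto simp: R_piece_def)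

lemma R_piece_0 [simp]: "0 \<in> R_piece d"
  by (simp add: R_piece_def)

lemma R_piece_cst: "cst c \<in> R_piece 0"
  by (auto simp: R_piece_def mon_deg_def zero_prod_def)

lemma R_piece_X:
  assumes ch: "chart_vars x x' y y'"
  shows "X x \<in> R_piece (1, 0)" "X x' \<in> R_piece (1, 0)" "X y \<in> R_piece (0, 1)" "X y' \<in> R_piece (0, 1)"
  using chart_varsD(1)[OF ch] by (auto simp: X_def R_piece_def chart_varsD(3)[OF ch] lookup_single)

lemma R_piece_power: "p \<in> R_piece (i, j) \<Longrightarrow> p ^ k \<in> R_piece (int k * i, int k * j)"
proof (induction k)
  case 0
  then show ?case using R_piece_cst[of 1] by (simp add: zero_prod_def)
next
  case (Suc k)
  then have "p * p ^ k \<in> R_piece ((i, j) + (int k * i, int k * j))" by (intro R_piece_mult) auto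
  then show ?case by (simp add: algebra_simps)
qed

text \<open>After the substitution every monomial of \<open>h\<close> becomes a multiple of the same
  monomial in \<open>x\<close> and \<open>y\<close>, fixed by the bidegree; the multiples add up to
  the value of \<open>h\<close> at the affine point.\<close>

lemma to_point_piece:
  assumes ch: "chart_vars x x' y y'" and h: "h \<in> R_piece (int A, int B)"
  shows "to_point x x' y y' a b h = cst (poly (evx a (dehom x' y' h)) b) * X x ^ A * X y ^ B"
proof -
  have "comm_ring_hom (\<lambda>h. poly (evx a (dehom x' y' h)) b)"
  proof -
    interpret comm_ring_hom "dehom x' y'" by (rule dehom_hom)
    show ?thesis by standard (auto simp: hom_add hom_mult evx_add evx_mult)
  qed
  then interpret e: comm_ring_hom "\<lambda>h. poly (evx a (dehom x' y' h)) b" .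
  interpret c: comm_ring_hom "cst :: 'a \<Rightarrow> 'a rpoly" by (rule cst_hom)
  interpret t: comm_ring_hom "to_point x x' y y' a b" by (rule to_point_hom)
  have single: "to_point x x' y y' a b (single m k)
      = cst (poly (evx a (dehom x' y' (single m k))) b) * X x ^ A * X y ^ B" if "mon_deg m = (int A, int B)" for m k
  proof -
    have AB: "A = lookup m x + lookup m x'" "B = lookup m y + lookup m y'"
      using that chart_varsD(3)[OF ch, of m] by auto
    have "poly (evx a (dehom x' y' (single m k))) b = k * a ^ lookup m x' * b ^ lookup m y'"
    proof -
      have pw: "evx a (p ^ k) = evx a p ^ k" for p k by (induction k) (auto simp: evx_mult)
      have v: "evx a [:0, 1:] = [:0, 1:]" by (rule poly_eqI) (auto simp: coeff_evx coeff_pCons split: nat.splits)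
      have "dehom x' y' (single m k)
          = [:[:k:]:] * ([:[:0, 1:]:] ^ lookup m x' * [:0, 1:] ^ lookup m y')"
        by (simp add: dehom_def evalm_single[OF lift_const_hom] monv_chart[OF ch] chart_vars_neq[OF ch] lift_const_def)
      then show ?thesis by (simp only: evx_mult pw v evx_const) (simp add: poly_power)
    qed
    moreover have "to_point x x' y y' a b (single m k)
        = cst k * X x ^ lookup m x * (cst a * X x) ^ lookup m x' * X y ^ lookup m y * (cst b * X y) ^ lookup m y'"
      by (simp add: to_point_def evalm_single[OF cst_hom] monv_chart[OF ch] chart_vars_neq[OF ch] mult.assoc)
    ultimately show ?thesis
      unfolding AB by (simp add: c.hom_mult c.hom_power power_mult_distrib power_add mult_ac)
  qed
  have "to_point x x' y y' a b h = (\<Sum>m\<in>keys h. to_point x x' y y' a b (single m (lookup h m)))"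
    by (subst poly_mapping_sum_singles[of h]) (rule t.hom_sum)
  also have "\<dots> = (\<Sum>m\<in>keys h. cst (poly (evx a (dehom x' y' (single m (lookup h m)))) b) * X x ^ A * X y ^ B)"
    using h by (intro sum.cong refl single) (simp add: R_piece_keys)
  also have "\<dots> = cst (poly (evx a (dehom x' y' h)) b) * X x ^ A * X y ^ B"
    by (subst (2) poly_mapping_sum_singles[of h]) (simp only: e.hom_sum c.hom_sum sum_distrib_right)
  finally show ?thesis .
qed

text \<open>Zero lies in every piece; in all other cases the bidegree is that of a monomial.\<close>

lemma R_piece_nonneg:
  assumes "h \<in> R_piece d"
  shows "\<exists>A B. h \<in> R_piece (int A, int B)"
proof (cases "h = 0")
  case False
  then obtain m where "m \<in> keys h" by (metis keys_eq_empty ex_in_conv)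
  then have "d = mon_deg m" using R_piece_keys[OF assms] by simp
  then show ?thesis using assms by (auto simp: mon_deg_def simp flip: of_nat_add)
qed simp

text \<open>Dehomogenize, use the affine theorem, and homogenize back. \<open>J\<close> consists of
  the dehomogenizations of bihomogeneous members of the ideal of \<open>S\<close>; it is closed
  under addition because factors \<open>x\<close> and \<open>y\<close>, which become 1, equalise
  bidegrees. A member with dehomogenization 1 has to be a monomial in \<open>x\<close> and
  \<open>y\<close>.\<close>

lemma chart_nullstellensatz:
  fixes S :: "'k::alg_closed_field rpoly set"
  assumes ch: "chart_vars x x' y y'" and S: "\<And>h. h \<in> S \<Longrightarrow> \<exists>d. h \<in> R_piece d"
    and nz: "\<And>a b. \<exists>h\<in>S. to_point x x' y y' a b h \<noteq> 0"
  shows "\<exists>N. (X x * X y) ^ N \<in> lin_combs S"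
proof -
  interpret d: comm_ring_hom "dehom x' y' :: 'k rpoly \<Rightarrow> _" by (rule dehom_hom)
  have dx: "dehom x' y' (X x) = (1 :: 'k poly poly)" "dehom x' y' (X y) = (1 :: 'k poly poly)"
      "dehom x' y' (X x') = ([:[:0, 1:]:] :: 'k poly poly)" "dehom x' y' (X y') = ([:0, 1:] :: 'k poly poly)"
      "dehom x' y' (cst k) = [:[:k:]:]" for k :: 'k
    by (simp_all add: dehom_def X_def evalm_single[OF lift_const_hom] lift_const_def chart_vars_neq[OF ch] one_pCons)
  have pX: "X x \<in> (R_piece (1, 0) :: 'k rpoly set)" "X x' \<in> (R_piece (1, 0) :: 'k rpoly set)"
      "X y \<in> (R_piece (0, 1) :: 'k rpoly set)" "X y' \<in> (R_piece (0, 1) :: 'k rpoly set)"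
    by (rule R_piece_X[OF ch])+
  define J where "J = {p. \<exists>A B h. h \<in> lin_combs S \<and> h \<in> R_piece (int A, int B) \<and> dehom x' y' h = p}"
  have J_mult: "dehom x' y' u * p \<in> J" if p: "p \<in> J" and u: "u \<in> R_piece (int A', int B')" for u p A' B'
  proof -
    obtain A B h where h: "h \<in> lin_combs S" "h \<in> R_piece (int A, int B)" "dehom x' y' h = p"
      using p by (auto simp: J_def)
    have "u * h \<in> R_piece (int (A' + A), int (B' + B))" using R_piece_mult[OF u h(2)] by simp
    moreover have "u * h \<in> lin_combs S" using h(1) by (rule lin_combs_mult)
    moreover have "dehom x' y' (u * h) = dehom x' y' u * p" by (simp add: d.hom_mult h(3))
    ultimately show ?thesis unfolding J_def by blast
  qed
  have J_add: "p + q \<in> J" if p: "p \<in> J" and q: "q \<in> J" for p q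
  proof -
    obtain A B h where h: "h \<in> lin_combs S" "h \<in> R_piece (int A, int B)" "dehom x' y' h = p"
      using p by (auto simp: J_def)
    obtain A' B' h' where h': "h' \<in> lin_combs S" "h' \<in> R_piece (int A', int B')" "dehom x' y' h' = q"
      using q by (auto simp: J_def)
    have pw: "X x ^ i * X y ^ j \<in> (R_piece (int i, int j) :: 'k rpoly set)" for i j
      using R_piece_mult[OF R_piece_power[OF pX(1), of i] R_piece_power[OF pX(3), of j]] by simp
    let ?h = "(X x ^ A' * X y ^ B') * h + (X x ^ A * X y ^ B) * h'"
    have "?h \<in> R_piece (int (A + A'), int (B + B'))"
    proof (rule R_piece_add)
      show "(X x ^ A' * X y ^ B') * h \<in> R_piece (int (A + A'), int (B + B'))"
        using R_piece_mult[OF pw[of A' B'] h(2)] by (simp add: add.commute)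
      show "(X x ^ A * X y ^ B) * h' \<in> R_piece (int (A + A'), int (B + B'))"
        using R_piece_mult[OF pw[of A B] h'(2)] by simp
    qed
    moreover have "?h \<in> lin_combs S" by (intro lin_combs_plus lin_combs_mult h h')
    moreover have "dehom x' y' ?h = p + q" by (simp add: d.hom_add d.hom_mult d.hom_power dx h(3) h'(3))
    ultimately show ?thesis unfolding J_def by blast
  qed
  have J_0: "0 \<in> J" unfolding J_def by (auto intro!: exI[of _ 0] lin_combs.zero)
  \<comment> \<open>Closure under constants and under the two affine coordinates suffices, by
    induction over both layers of the polynomial \<open>c\<close>.\<close>
  have J_ideal: "c * p \<in> J" if p: "p \<in> J" for c p
  proof (induction c)
    case 0
    then show ?case using J_0 by simp
  next
    case (pCons q c)
    have "[:q:] * p \<in> J"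
    proof (induction q)
      case 0
      then show ?case using J_0 by simp
    next
      case (pCons k q)
      have "[:[:k:]:] * p \<in> J" using J_mult[OF p, of "cst k" 0 0] R_piece_cst[of k] by (simp only: dx) (simp add: zero_prod_def)
      moreover have "[:[:0, 1:]:] * ([:q:] * p) \<in> J"
        using J_mult[OF pCons.IH, of "X x'" 1 0] pX(2) by (simp only: dx) simp
      moreover have "[:pCons k q:] * p = [:[:k:]:] * p + [:[:0, 1:]:] * ([:q:] * p)"
        by (simp add: smult_add_left[symmetric])
      ultimately show ?case using J_add by metis
    qed
    moreover have "[:0, 1:] * (c * p) \<in> J" using J_mult[OF pCons.IH, of "X y'" 0 1] pX(4) by (simp only: dx) simp
    moreover have "pCons q c * p = [:q:] * p + [:0, 1:] * (c * p)" by simp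
    ultimately show ?case using J_add by metis
  qed
  have "1 \<in> J"
  proof (rule ccontr)
    assume "1 \<notin> J"
    moreover have "ideal_set J" using J_0 J_add J_ideal by (auto simp: ideal_set_def)
    ultimately obtain a b where ab: "\<And>p. p \<in> J \<Longrightarrow> poly (evx a p) b = 0"
      using nullstellensatz_two_variables by blast
    obtain h where h: "h \<in> S" "to_point x x' y y' a b h \<noteq> 0" using nz by blast
    obtain A B where AB: "h \<in> R_piece (int A, int B)" using S[OF h(1)] R_piece_nonneg by blast
    then have "dehom x' y' h \<in> J" using lin_combs_base[OF h(1)] by (auto simp: J_def)
    then show False using h(2) ab by (simp add: to_point_piece[OF ch AB])
  qed
  then obtain A B h where h: "h \<in> lin_combs S" "h \<in> R_piece (int A, int B)" "dehom x' y' h = 1" by (auto simp: J_def)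
  have "h = X x ^ A * X y ^ B"
  proof (rule dehom_inj_piece[OF ch h(2)])
    show "X x ^ A * X y ^ B \<in> (R_piece (int A, int B) :: 'k rpoly set)"
      using R_piece_mult[OF R_piece_power[OF pX(1), of A] R_piece_power[OF pX(3), of B]] by simp
  qed (simp add: h(3) d.hom_mult d.hom_power dx)
  then have "(X x * X y) ^ (A + B) = X x ^ B * X y ^ A * h" by (simp add: power_mult_distrib power_add mult_ac)
  then show ?thesis using lin_combs_mult[OF h(1)] by metis
qed

section \<open>The primes of points: height and localization\<close>

section \<open>Rings and ideals given as sets\<close>

lemma cring_of_subring:
  fixes A :: "('a::comm_ring_1, 'z) ring_scheme"
  assumes K: "subring_set (carrier A)"
    and ops: "monoid.mult A = (*)" "one A = 1" "zero A = 0" "add A = (+)"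
  shows "cring A"
proof (rule cringI)
  show "abelian_group A"
  proof (rule abelian_groupI)
    fix x assume "x \<in> carrier A"
    then show "\<exists>y\<in>carrier A. y \<oplus>\<^bsub>A\<^esub> x = \<zero>\<^bsub>A\<^esub>"
      using subring_set_uminus[OF K] by (intro bexI[of _ "- x"]) (auto simp: ops)
  qed (use subring_setD[OF K] in \<open>auto simp: ops add_ac\<close>)
  show "comm_monoid A"
    by (rule comm_monoidI) (use subring_setD[OF K] in \<open>auto simp: ops mult_ac\<close>)
qed (auto simp: ops distrib_right)

lemma ideal_of_set:
  fixes A :: "('a::comm_ring_1, 'z) ring_scheme"
  assumes K: "subring_set (carrier A)"
    and ops: "monoid.mult A = (*)" "one A = 1" "zero A = 0" "add A = (+)"
    and I: "I \<subseteq> carrier A" "0 \<in> I" "\<And>x y. x \<in> I \<Longrightarrow> y \<in> I \<Longrightarrow> x + y \<in> I"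
      "\<And>c x. c \<in> carrier A \<Longrightarrow> x \<in> I \<Longrightarrow> c * x \<in> I"
  shows "ideal I A"
proof -
  interpret cring A by (rule cring_of_subring[OF K ops])
  have inv: "\<ominus>\<^bsub>A\<^esub> x = - x" if "x \<in> carrier A" for x
    using that subring_set_uminus[OF K] by (intro minus_equality) (auto simp: ops)
  show ?thesis
  proof (rule idealI)
    show "ring A" by (rule ring_axioms)
    show "subgroup I (add_monoid A)"
    proof
      show "inv\<^bsub>add_monoid A\<^esub> x \<in> I" if "x \<in> I" for x
      proof -
        have "inv\<^bsub>add_monoid A\<^esub> x = - x" using that I(1) inv by (auto simp: a_inv_def)
        moreover have "- 1 * x \<in> I" using that subring_set_uminus[OF K subring_setD(2)[OF K]] by (rule I(4)[rotated])
        ultimately show ?thesis by simp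
      qed
    qed (use I in \<open>auto simp: ops\<close>)
  next
    fix a x assume "a \<in> I" "x \<in> carrier A"
    then have "x * a \<in> I" by (intro I(4))
    then show "x \<otimes>\<^bsub>A\<^esub> a \<in> I" "a \<otimes>\<^bsub>A\<^esub> x \<in> I" by (simp_all add: ops mult.commute)
  qed
qed

lemma set_of_ideal:
  fixes A :: "('a::comm_ring_1, 'z) ring_scheme"
  assumes ops: "monoid.mult A = (*)" "one A = 1" "zero A = 0" "add A = (+)" and I: "ideal I A"
  shows "I \<subseteq> carrier A" "0 \<in> I" "\<And>x y. x \<in> I \<Longrightarrow> y \<in> I \<Longrightarrow> x + y \<in> I"
      "\<And>c x. c \<in> carrier A \<Longrightarrow> x \<in> I \<Longrightarrow> c * x \<in> I"
proof -
  interpret ideal I A by fact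
  show "I \<subseteq> carrier A" by (rule a_subset)
  show "0 \<in> I" using additive_subgroup.zero_closed[OF is_additive_subgroup] by (simp add: ops)
  show "\<And>x y. x \<in> I \<Longrightarrow> y \<in> I \<Longrightarrow> x + y \<in> I" using additive_subgroup.a_closed[OF is_additive_subgroup] by (simp add: ops)
  show "\<And>c x. c \<in> carrier A \<Longrightarrow> x \<in> I \<Longrightarrow> c * x \<in> I" using I_l_closed by (simp add: ops)
qed

lemma R_ops: "carrier R_ring = UNIV" "monoid.mult R_ring = (*)" "one R_ring = 1" "zero R_ring = 0" "add R_ring = (+)"
  by (auto simp: R_ring_def)

lemma subring_UNIV: "subring_set (carrier R_ring)"
  by (simp add: R_ops subring_set_def)

lemma primeideal_kernel:
  fixes h :: "'k::comm_ring_1 rpoly \<Rightarrow> 'b::idom"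
  assumes "comm_ring_hom h"
  shows "primeideal {f. h f = 0} R_ring"
proof -
  interpret comm_ring_hom h by fact
  show ?thesis
  proof (rule primeidealI)
    show "ideal {f. h f = 0} R_ring"
      by (rule ideal_of_set[OF subring_UNIV R_ops(2-5)]) (auto simp: hom_add hom_mult R_ops)
    show "cring (R_ring :: ('k rpoly, 'k rpoly) bg_module)" by (rule cring_of_subring[OF subring_UNIV R_ops(2-5)])
    show "carrier R_ring \<noteq> {f. h f = 0}"
    proof
      assume "carrier R_ring = {f. h f = 0}"
      then have "h 1 = 0" using R_ops(1) by blast
      then show False by simp
    qed
  qed (auto simp: R_ops hom_mult)
qed

lemma prime_set:
  assumes "primeideal Q (R_ring :: ('k::comm_ring_1 rpoly, 'k rpoly) bg_module)"
  shows "ideal_set Q" "1 \<notin> Q" "p * q \<in> Q \<Longrightarrow> p \<in> Q \<or> q \<in> Q"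
proof -
  interpret primeideal Q R_ring by fact
  note i = set_of_ideal[OF R_ops(2-5) ideal_axioms]
  show "ideal_set Q" using i by (auto simp: ideal_set_def R_ops)
  show "1 \<notin> Q"
  proof
    assume "1 \<in> Q"
    then have "c \<in> Q" for c using i(4)[of c 1] by (simp add: R_ops)
    then show False using I_notcarr by (auto simp: R_ops)
  qed
  show "p * q \<in> Q \<Longrightarrow> p \<in> Q \<or> q \<in> Q" using I_prime[of p q] by (simp add: R_ops)
qed

section \<open>Points have height two\<close>

lemma to_poly_poly:
  fixes P :: "(('v, 'a::comm_ring_1) mpoly) poly"
  assumes "P \<in> polys_over (free_of v)"
  shows "to_poly v (poly P (var v)) = P"
proof -
  interpret comm_ring_hom "to_poly v" by (rule to_poly_hom)
  have tv: "to_poly v (var v) = [:0, 1:]" by (simp add: to_poly_def evalm_single[OF cst_poly_hom] one_pCons)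
  show ?thesis using assms
  proof (induction P)
    case (pCons c P)
    have "c \<in> free_of v" using pCons.prems by (auto simp: polys_over_def coeff_pCons split: nat.splits dest: spec[of _ 0])
    moreover have "P \<in> polys_over (free_of v)"
      unfolding polys_over_def
    proof (clarify)
      fix i have "coeff (pCons c P) (Suc i) \<in> free_of v" using pCons.prems unfolding polys_over_def by blast
      then show "coeff P i \<in> free_of v" by simp
    qed
    ultimately show ?case using pCons.IH by (simp only: poly_pCons hom_add hom_mult to_poly_free tv) simp
  qed simp
qed

lemma to_poly_degree_0: "degree (to_poly v p) = 0 \<Longrightarrow> p \<in> free_of v"
  for p :: "('v, 'a::comm_ring_1) mpoly"
proof -
  assume "degree (to_poly v p) = 0"
  then obtain c where c: "to_poly v p = [:c:]" by (meson degree_eq_zeroE)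
  have "c \<in> free_of v" using to_poly_over[of v p] by (auto simp: c polys_over_def coeff_pCons split: nat.splits dest: spec[of _ 0])
  moreover have "p = c" using poly_to_poly[of v p] by (simp add: c)
  ultimately show ?thesis by simp
qed

lemma to_poly_eq_0_iff [simp]: "to_poly v p = 0 \<longleftrightarrow> p = 0"
  for p :: "('v, 'a::comm_ring_1) mpoly"
proof -
  interpret comm_ring_hom "to_poly v" by (rule to_poly_hom)
  show ?thesis using poly_to_poly[of v p] by auto
qed

text \<open>Polynomials in \<open>v\<close> over the fraction field of those free of
  \<open>v\<close> have no chain of two nonzero primes. Concretely, if \<open>Q2\<close> contained
  no nonzero polynomial free of \<open>v\<close>, an element \<open>m\<close> of least degree in
  \<open>v\<close> would divide all of \<open>Q2\<close> up to powers of its leading coefficient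
  \<open>l\<close>, and these lie outside \<open>Q1\<close>. Applied to an element of least degree
  of \<open>Q1\<close>, this contradicts minimality unless \<open>m\<close> lies in
  \<open>Q1\<close>, and then \<open>Q2\<close> is contained in \<open>Q1\<close>.\<close>

lemma prime_pair_elimination:
  fixes Q1 Q2 :: "'k::idom rpoly set"
  assumes Q1: "primeideal Q1 R_ring" and Q2: "primeideal Q2 R_ring" and sub: "Q1 \<subset> Q2" and nz: "Q1 \<noteq> {0}"
  shows "\<exists>r\<in>Q2. r \<noteq> 0 \<and> r \<in> free_of v"
proof (rule ccontr)
  assume "\<not> ?thesis"
  then have free: "r = 0" if "r \<in> Q2" "r \<in> free_of v" for r using that by blast
  note I1 = ideal_setD[OF prime_set(1)[OF Q1]] and I2 = ideal_setD[OF prime_set(1)[OF Q2]]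
  let ?d = "\<lambda>p :: 'k rpoly. degree (to_poly v p)"
  interpret comm_ring_hom "to_poly v :: 'k rpoly \<Rightarrow> _" by (rule to_poly_hom)
  have least: "\<exists>q\<in>Q. q \<noteq> 0 \<and> (\<forall>p\<in>Q. p \<noteq> 0 \<longrightarrow> ?d q \<le> ?d p)" if "q0 \<in> Q" "q0 \<noteq> 0" for Q q0
  proof -
    have "\<exists>n. \<exists>q\<in>Q. q \<noteq> 0 \<and> ?d q = n" using that by blast
    from this[unfolded exists_least_iff[of "\<lambda>n. \<exists>q\<in>Q. q \<noteq> 0 \<and> ?d q = n"]]
    show ?thesis by (metis not_le)
  qed
  obtain q0 where "q0 \<in> Q1" "q0 \<noteq> 0" using nz I1(1) by blast
  then obtain q1 where q1: "q1 \<in> Q1" "q1 \<noteq> 0" "\<And>p. p \<in> Q1 \<Longrightarrow> p \<noteq> 0 \<Longrightarrow> ?d q1 \<le> ?d p" using least by metis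
  obtain m where m: "m \<in> Q2" "m \<noteq> 0" "\<And>p. p \<in> Q2 \<Longrightarrow> p \<noteq> 0 \<Longrightarrow> ?d m \<le> ?d p" using least q1 sub by (metis psubsetD)
  have dm: "?d m > 0" using to_poly_degree_0 free m by (metis gr0I)
  define l where "l = lead_coeff (to_poly v m)"
  have l: "l \<noteq> 0" "l \<in> free_of v" using m(2) to_poly_over[of v m] by (auto simp: l_def polys_over_def)
  have div: "\<exists>N A. A \<in> polys_over (free_of v) \<and> l ^ N * p = poly A (var v) * m" if "p \<in> Q2" for p
  proof -
    obtain N A R where A: "A \<in> polys_over (free_of v)" "R \<in> polys_over (free_of v)"
        "smult (l ^ N) (to_poly v p) = A * to_poly v m + R" "R = 0 \<or> degree R < ?d m"
      using pseudo_division_over[OF subring_free_of to_poly_over _ to_poly_over, of v m p] m(2) unfolding l_def by auto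
    have "poly (smult (l ^ N) (to_poly v p)) (var v) = poly (A * to_poly v m + R) (var v)" using A(3) by simp
    then have eq: "l ^ N * p = poly A (var v) * m + poly R (var v)"
      using poly_to_poly[of v p] poly_to_poly[of v m] by (simp only: poly_smult poly_add poly_mult)
    then have "poly R (var v) = l ^ N * p - poly A (var v) * m" by simp
    then have "poly R (var v) \<in> Q2" using that m(1) I2 by metis
    moreover have "?d (poly R (var v)) = degree R" by (simp only: to_poly_poly[OF A(2)])
    ultimately have "poly R (var v) = 0" using m(3) A(4) to_poly_poly[OF A(2)] by (metis not_le poly_0)
    then show ?thesis using eq A(1) by auto
  qed
  have l1: "l ^ N \<notin> Q1" for N
  proof (induction N)
    case 0
    then show ?case using prime_set(2)[OF Q1] by simp
  next
    case (Suc N)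
    then show ?case using prime_set(3)[OF Q1, of l "l ^ N"] free[OF _ l(2)] l(1) sub by auto
  qed
  obtain N A where A: "A \<in> polys_over (free_of v)" "l ^ N * q1 = poly A (var v) * m" using div q1(1) sub by blast
  have "l ^ N * q1 \<in> Q1" by (rule I1(3)[OF q1(1)])
  then have "poly A (var v) \<in> Q1 \<or> m \<in> Q1" unfolding A(2) by (rule prime_set(3)[OF Q1])
  then show False
  proof
    assume AQ: "poly A (var v) \<in> Q1"
    have "l ^ N * q1 \<noteq> 0" using l(1) q1(2) by simp
    then have A0: "poly A (var v) \<noteq> 0" unfolding A(2) by auto
    have "to_poly v (l ^ N) = [:l ^ N:]" by (intro to_poly_free subring_set_power[OF subring_free_of] l(2))
    then have "?d (l ^ N * q1) = ?d q1" using l(1) by (simp only: hom_mult) (simp add: degree_mult_eq)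
    moreover have "?d (poly A (var v) * m) = ?d (poly A (var v)) + ?d m"
      using A0 m(2) by (simp only: hom_mult) (rule degree_mult_eq, simp_all)
    ultimately have "?d (poly A (var v)) < ?d q1" using A(2) dm by simp
    then show False using q1(3)[OF AQ A0] by simp
  next
    assume mQ: "m \<in> Q1"
    have "p \<in> Q1" if "p \<in> Q2" for p
    proof -
      obtain N A where "l ^ N * p = poly A (var v) * m" using div[OF \<open>p \<in> Q2\<close>] by blast
      then have "l ^ N * p \<in> Q1" using I1(3)[OF mQ] by simp
      then show ?thesis using prime_set(3)[OF Q1] l1 by blast
    qed
    then show False using sub by blast
  qed
qed

text \<open>As \<open>r\<close> vanishes at \<open>v = e\<close>, it is \<open>var v - e\<close>
  times a cofactor of smaller degree, and primality puts one of the two into \<open>Q\<close>. The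
  cofactor is again free of \<open>u\<close>, so the descent continues.\<close>

lemma linear_factor_in_prime:
  fixes Q :: "'k::idom rpoly set" and e :: "'k rpoly"
  assumes Q: "primeideal Q R_ring" and r: "r \<in> Q" "r \<noteq> 0" "r \<in> free_of u"
    and e: "e \<in> free_of u" "e \<in> free_of v" "u \<noteq> v"
    and ker: "\<And>f. f \<in> Q \<Longrightarrow> f \<in> free_of u \<Longrightarrow> poly (to_poly v f) e = 0"
  shows "var v - e \<in> Q"
  using r
proof (induction "degree (to_poly v r)" arbitrary: r rule: less_induct)
  case less
  interpret tv: comm_ring_hom "to_poly v :: 'k rpoly \<Rightarrow> _" by (rule to_poly_hom)
  interpret tu: comm_ring_hom "to_poly u :: 'k rpoly \<Rightarrow> _" by (rule to_poly_hom)
  have tvv: "to_poly v (var v :: 'k rpoly) = [:0, 1:]" by (simp add: to_poly_def evalm_single[OF cst_poly_hom] one_pCons)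
  have "[:- e, 1:] dvd to_poly v r" using ker[OF less.prems(1,3)] by (simp add: poly_eq_0_iff_dvd)
  then obtain P where P: "to_poly v r = [:- e, 1:] * P" by (auto elim: dvdE)
  define r1 where "r1 = poly P (var v)"
  have r_eq: "r = (var v - e) * r1"
    using poly_to_poly[of v r] by (simp add: P r1_def algebra_simps)
  then have "r1 \<noteq> 0" using less.prems(2) by auto
  have te: "to_poly v (var v - e) = [:- e, 1:]" using e(2) by (simp only: tv.hom_minus tvv to_poly_free) simp
  have deg: "degree (to_poly v r) = Suc (degree (to_poly v r1))"
    using \<open>r1 \<noteq> 0\<close> unfolding r_eq tv.hom_mult te by (subst degree_mult_eq) auto
  have free: "r1 \<in> free_of u"
  proof -
    have "(var v :: 'k rpoly) \<in> free_of u" using e(3) by (intro free_of_single) (simp add: lookup_single)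
    then have f: "var v - e \<in> free_of u" using e(1) by (rule subring_setD(4)[OF subring_free_of])
    have ne: "var v - e \<noteq> 0" using less.prems(2) r_eq by auto
    have "to_poly u r = [:r:]" using less.prems(3) by (rule to_poly_free)
    then have "[:var v - e:] * to_poly u r1 = [:r:]" unfolding r_eq tu.hom_mult to_poly_free[OF f] .
    then have "degree ([:var v - e:] * to_poly u r1) = 0" by simp
    then have "degree (to_poly u r1) = 0" using ne \<open>r1 \<noteq> 0\<close> by (simp add: degree_mult_eq)
    then show ?thesis by (rule to_poly_degree_0)
  qed
  have "var v - e \<in> Q \<or> r1 \<in> Q" using less.prems(1) unfolding r_eq by (rule prime_set(3)[OF Q])
  then show ?case using less.hyps[of r1] deg \<open>r1 \<noteq> 0\<close> free by auto
qed

text \<open>The polynomials \<open>f\<close> with this property form a subring that contains the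
  constants, so the variables decide.\<close>

lemma congruent_to_hom:
  fixes h :: "'k::comm_ring_1 rpoly \<Rightarrow> 'k rpoly"
  assumes h: "comm_ring_hom h" "\<And>c. h (cst c) = cst c" and J: "ideal_set J" and v: "\<And>z. var z - h (var z) \<in> J"
  shows "f - h f \<in> J"
proof -
  interpret comm_ring_hom h by fact
  note J = ideal_setD[OF J]
  have mult: "f * g - h (f * g) \<in> J" if "f - h f \<in> J" "g - h g \<in> J" for f g
  proof -
    have "f * g - h (f * g) = g * (f - h f) + h f * (g - h g)" by (simp add: hom_mult algebra_simps)
    then show ?thesis using J that by metis
  qed
  have add_closed: "f + g - h (f + g) \<in> J" if "f - h f \<in> J" "g - h g \<in> J" for f g
    using J(2)[OF that] by (simp add: hom_add algebra_simps)
  have mon: "single m 1 - h (single m 1) \<in> J" for m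
  proof (induction m rule: poly_mapping_induct_add)
    case (add m x k)
    have "var x ^ k - h (var x ^ k) \<in> J" for k
    proof (induction k)
      case (Suc k)
      then show ?case using mult[OF v[of x]] by simp
    qed (simp add: J(1))
    moreover have "single (single x k) 1 = (var x ^ k :: 'k rpoly)"
      using monv_var[of "single x k", where 'a = 'k] by simp
    moreover have "single (m + single x k) (1::'k)
        = single m 1 * single (single x k) 1" by (simp add: mult_single)
    ultimately show ?case using mult[OF add] by simp
  qed (simp add: J(1))
  show ?thesis
  proof (induction f rule: poly_mapping_induct_add)
    case (add p m c)
    have s: "single m c = cst c * single m 1" by (simp add: mult_single)
    have "cst c - h (cst c) \<in> J" by (simp add: h(2) J(1))
    then have "single m c - h (single m c) \<in> J" unfolding s by (rule mult[OF _ mon])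
    then show ?case by (rule add_closed[OF add.IH])
  qed (simp add: J(1))
qed

lemma to_point_var:
  assumes ch: "chart_vars x x' y y'"
  shows "to_point x x' y y' a b (cst c) = cst c" "to_point x x' y y' a b (X x) = X x" "to_point x x' y y' a b (X y) = X y"
    "to_point x x' y y' a b (X x') = cst a * X x" "to_point x x' y y' a b (X y') = cst b * X y"
  using chart_vars_neq[OF ch] by (simp_all add: to_point_def X_def evalm_single[OF cst_hom])

lemma poly_to_poly_subst:
  fixes f :: "('v, 'a::comm_ring_1) mpoly"
  shows "poly (to_poly v f) e = evalm cst (\<lambda>z. if z = v then e else var z) f"
proof (rule hom_eqI[where h = "\<lambda>f. poly (to_poly v f) e"])
  interpret comm_ring_hom "to_poly v :: (('v, 'a) mpoly) \<Rightarrow> _" by (rule to_poly_hom)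
  show "comm_ring_hom (\<lambda>f. poly (to_poly v f) e)" by standard (auto simp: hom_add hom_mult)
  show "comm_ring_hom (evalm cst (\<lambda>z. if z = v then e else var z))" by (rule evalm_hom[OF cst_hom])
qed (simp_all add: to_poly_def evalm_single[OF cst_poly_hom] evalm_single[OF cst_hom])

lemma evalm_free_cong:
  assumes "f \<in> free_of u" "\<And>z. z \<noteq> u \<Longrightarrow> s z = t z"
  shows "evalm \<psi> s f = evalm \<psi> t f"
proof -
  have "monv s m = monv t m" if "m \<in> keys f" for m
    unfolding monv_def
  proof (rule prod.cong[OF refl])
    fix z assume "z \<in> keys m"
    then have "z \<noteq> u" using assms(1) that by (auto simp: free_of_def in_keys_iff)
    then show "s z ^ lookup m z = t z ^ lookup m z" using assms(2) by simp
  qed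
  then show ?thesis unfolding evalm_def by (intro sum.cong refl) simp
qed

text \<open>Let two nonzero primes form a chain strictly below \<open>P\<close>. Eliminating
  \<open>x'\<close> puts \<open>y' - b y\<close> into the upper one, eliminating \<open>y'\<close>
  puts \<open>x' - a x\<close> into it, and then it contains \<open>P\<close>. The bound is attained
  by zero and the kernel of \<open>h\<close>, the substitution for \<open>x'\<close> alone.\<close>

lemma ht_point:
  fixes a b :: "'k::idom"
  assumes ch: "chart_vars x x' y y'"
  defines "P \<equiv> {f. to_point x x' y y' a b f = 0}"
  shows "ht R_ring P = 2"
proof -
  note ne = chart_vars_neq[OF ch]
  interpret p: comm_ring_hom "to_point x x' y y' a b" by (rule to_point_hom)
  have ex: "cst a * X x \<in> free_of x'" "cst a * X x \<in> free_of y'" "cst b * X y \<in> free_of x'" "cst b * X y \<in> free_of y'"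
    using ne by (auto simp: X_def free_of_def mult_single lookup_single)
  have Pp: "primeideal P R_ring" unfolding P_def by (rule primeideal_kernel[OF to_point_hom])
  have upper: False if Q: "primeideal Q1 R_ring" "primeideal Q2 R_ring" "Q1 \<subset> Q2" "Q2 \<subset> P" "Q1 \<noteq> {0}" for Q1 Q2
  proof -
    have "X y' - cst b * X y \<in> Q2"
    proof -
      obtain r where r: "r \<in> Q2" "r \<noteq> 0" "r \<in> free_of x'" using prime_pair_elimination[OF Q(1-3,5)] by blast
      have "var y' - cst b * X y \<in> Q2"
      proof (rule linear_factor_in_prime[OF Q(2) r ex(3,4)])
        fix f assume f: "f \<in> Q2" "f \<in> free_of x'"
        have "poly (to_poly y' f) (cst b * X y) = to_point x x' y y' a b f"
          unfolding poly_to_poly_subst to_point_def by (rule evalm_free_cong[OF f(2)]) (simp add: X_def)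
        then show "poly (to_poly y' f) (cst b * X y) = 0" using f(1) Q(4) by (auto simp: P_def)
      qed (use ne in simp)
      then show ?thesis by (simp add: X_def)
    qed
    moreover have "X x' - cst a * X x \<in> Q2"
    proof -
      obtain r where r: "r \<in> Q2" "r \<noteq> 0" "r \<in> free_of y'" using prime_pair_elimination[OF Q(1-3,5)] by blast
      have "var x' - cst a * X x \<in> Q2"
      proof (rule linear_factor_in_prime[OF Q(2) r ex(2,1)])
        fix f assume f: "f \<in> Q2" "f \<in> free_of y'"
        have "poly (to_poly x' f) (cst a * X x) = to_point x x' y y' a b f"
          unfolding poly_to_poly_subst to_point_def by (rule evalm_free_cong[OF f(2)]) (simp add: X_def)
        then show "poly (to_poly x' f) (cst a * X x) = 0" using f(1) Q(4) by (auto simp: P_def)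
      qed (use ne in simp)
      then show ?thesis by (simp add: X_def)
    qed
    ultimately have "var z - to_point x x' y y' a b (var z) \<in> Q2" for z
      using chart_varsD(2)[OF ch, of z] to_point_var[OF ch, of a b] ideal_setD(1)[OF prime_set(1)[OF Q(2)]]
      unfolding X_eq_var by auto
    then have *: "f - to_point x x' y y' a b f \<in> Q2" for f
      by (rule congruent_to_hom[OF to_point_hom to_point_var(1)[OF ch] prime_set(1)[OF Q(2)]])
    have "f \<in> Q2" if "f \<in> P" for f using *[of f] that by (simp add: P_def)
    then have "P \<subseteq> Q2" by blast
    then show False using Q(4) by blast
  qed
  let ?S = "{enat m | m. \<exists>c :: nat \<Rightarrow> 'k rpoly set.
      (\<forall>i\<le>m. primeideal (c i) R_ring) \<and> (\<forall>i<m. c i \<subset> c (Suc i)) \<and> c m = P}"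
  have le: "m \<le> 2" if "\<forall>i\<le>m. primeideal (c i) R_ring" "\<forall>i<m. c i \<subset> c (Suc i)" "c m = P" for m and c :: "nat \<Rightarrow> 'k rpoly set"
  proof (rule ccontr)
    assume "\<not> m \<le> 2"
    then have "m = Suc (Suc (Suc (m - 3)))" by simp
    then obtain l where l: "m = Suc (Suc (Suc l))" by blast
    \<comment> \<open>The prime three steps below \<open>P\<close> serves only to make the next one
      nonzero.\<close>
    have "c l \<subset> c (Suc l)" "0 \<in> c l" using that l ideal_setD(1)[OF prime_set(1)[of "c l"]] by auto
    then have "c (Suc l) \<noteq> {0}" by auto
    moreover have "primeideal (c (Suc l)) R_ring" "primeideal (c (Suc (Suc l))) R_ring"
        "c (Suc l) \<subset> c (Suc (Suc l))" "c (Suc (Suc l)) \<subset> P"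
      using that l by (auto simp del: psubset_eq)
    ultimately show False using upper by blast
  qed
  define h where "h = evalm cst (\<lambda>z. if z = x' then cst a * X x else X z :: 'k rpoly)"
  have hh: "comm_ring_hom h" unfolding h_def by (rule evalm_hom[OF cst_hom])
  interpret h: comm_ring_hom h by (rule hh)
  have h_var: "h (cst k) = cst k" "h (X z) = (if z = x' then cst a * X x else X z)" for k z
    by (simp_all add: h_def X_def evalm_single[OF cst_hom])
  have ph: "to_point x x' y y' a b (h f) = to_point x x' y y' a b f" for f
  proof (rule hom_eqI[where h = "\<lambda>f. to_point x x' y y' a b (h f)" and h' = "to_point x x' y y' a b"])
    show "comm_ring_hom (\<lambda>f. to_point x x' y y' a b (h f))"
      by standard (auto simp: h.hom_add h.hom_mult p.hom_add p.hom_mult)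
    show "to_point x x' y y' a b (h (var z)) = to_point x x' y y' a b (var z)" for z
      unfolding X_eq_var[symmetric] h_var by (auto simp: p.hom_mult to_point_var[OF ch])
  qed (simp_all only: h_var to_point_hom)
  define c where "c i = (if i = 0 then {0} else if i = 1 then {f. h f = 0} else P)" for i :: nat
  have Xne: "X u - cst k * X w \<noteq> (0 :: 'k rpoly)" if "u \<noteq> w" for u w k
  proof
    assume "X u - cst k * X w = (0 :: 'k rpoly)"
    then have "lookup (X u - cst k * X w) (single u 1) = (0 :: 'k)" by simp
    moreover have "single w 1 \<noteq> single u (1::nat)" using that by (metis lookup_single_eq lookup_single_not_eq zero_neq_one)
    ultimately show False by (simp add: X_def mult_single lookup_minus lookup_single)
  qed
  have "comm_ring_hom (\<lambda>f :: 'k rpoly. f)" by standard auto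
  from primeideal_kernel[OF this] have "primeideal {0 :: 'k rpoly} R_ring" by simp
  then have "\<forall>i\<le>2. primeideal (c i) R_ring"
    using primeideal_kernel[OF hh] Pp by (auto simp: c_def)
  moreover have "\<forall>i<2. c i \<subset> c (Suc i)"
  proof -
    have "X x' - cst a * X x \<in> {f. h f = 0}" using ne by (simp add: h.hom_minus h.hom_mult h_var)
    moreover have "X x' - cst a * X x \<noteq> 0" using Xne[of x' x a] ne by metis
    moreover have "{0} \<subseteq> {f. h f = 0}" by simp
    ultimately have 1: "{0} \<subset> {f. h f = 0}" by blast
    have "h f = 0 \<Longrightarrow> f \<in> P" for f using ph[of f] by (simp add: P_def)
    moreover have "X y' - cst b * X y \<in> P" by (simp add: P_def p.hom_minus p.hom_mult to_point_var[OF ch])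
    moreover have "h (X y' - cst b * X y) \<noteq> 0" using Xne[of y' y b] ne by (simp add: h.hom_minus h.hom_mult h_var)
    ultimately have 2: "{f. h f = 0} \<subset> P" by blast
    show ?thesis using 1 2 by (auto simp: c_def less_Suc_eq numeral_2_eq_2)
  qed
  moreover have "c 2 = P" by (simp add: c_def)
  ultimately have "enat 2 \<in> ?S" by blast
  moreover have "s \<le> enat 2" if "s \<in> ?S" for s using that le by auto
  ultimately have "Sup ?S = enat 2" by (intro antisym Sup_least Sup_upper)
  then show ?thesis unfolding ht_def by (simp add: numeral_eq_enat)
qed

section \<open>Localization at a prime ideal\<close>

text \<open>Inside the fraction field the localization becomes transparent: each fraction class is
  the set \<open>cls q\<close> of representatives of one element \<open>q\<close> of the subring
  \<open>Q\<close>. The ring structure is transported along \<open>cls\<close>, and the fractions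
  with numerator in \<open>J\<close> form an ideal that contains the generators of the localized
  ideal.\<close>

lemma loc_ideal_mem:
  fixes A :: "('a::idom, 'a, 'd) module_scheme"
  assumes K: "subring_set (carrier A)"
    and ops: "monoid.mult A = (*)" "one A = 1" "zero A = 0" "add A = (+)" "module.smult A = (*)"
    and P: "0 \<in> P" "1 \<notin> P" "\<And>x y. x \<in> carrier A - P \<Longrightarrow> y \<in> carrier A - P \<Longrightarrow> x * y \<notin> P"
    and J: "ideal J A"
    and x: "x \<in> carrier A" "fraction A (carrier A - P) A x 1 \<in> loc_ideal A P J"
  shows "\<exists>s\<in>carrier A - P. s * x \<in> J"
proof -
  note K' = subring_setD[OF K] and J' = set_of_ideal[OF ops(1-4) J]
  define S where "S = carrier A - P"
  have S: "1 \<in> S" "\<And>x y. x \<in> S \<Longrightarrow> y \<in> S \<Longrightarrow> x * y \<in> S" "\<And>x. x \<in> S \<Longrightarrow> x \<noteq> 0" "\<And>x. x \<in> S \<Longrightarrow> x \<in> carrier A"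
    using P K' by (auto simp: S_def)
  define cls where "cls q = {(x, s). x \<in> carrier A \<and> s \<in> S \<and> Fract x s = q}" for q
  define Q where "Q = {Fract x s | x s. x \<in> carrier A \<and> s \<in> S}"
  have fr: "fraction A S A x s = cls (Fract x s)" if "x \<in> carrier A" "s \<in> S" for x s
  proof -
    have "(\<exists>w\<in>S. w * (s' * x) = w * (s * x')) \<longleftrightarrow> Fract x' s' = Fract x s" if "s' \<in> S" for x' s'
    proof -
      have "(\<exists>w\<in>S. w * (s' * x) = w * (s * x')) \<longleftrightarrow> s' * x = s * x'" using S(1,3) by auto
      also have "\<dots> \<longleftrightarrow> Fract x' s' = Fract x s" using S(3)[OF that] S(3)[OF \<open>s \<in> S\<close>] by (auto simp: eq_fract mult.commute)
      finally show ?thesis .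
    qed
    then show ?thesis by (auto simp: fraction_def cls_def ops)
  qed
  have ne: "\<exists>x s. (x, s) \<in> cls q" if "q \<in> Q" for q using that by (auto simp: Q_def cls_def)
  have cls_D: "x \<in> carrier A" "s \<in> S" "Fract x s = q" if "(x, s) \<in> cls q" for x s q using that by (auto simp: cls_def)
  define L where "L = loc_prime A P"
  have L_car: "carrier L = cls ` Q"
  proof -
    have "carrier L = {fraction A S A x s | x s. x \<in> carrier A \<and> s \<in> S}"
      by (simp add: L_def loc_prime_def Let_def S_def[symmetric])
    also have "\<dots> = {cls (Fract x s) | x s. x \<in> carrier A \<and> s \<in> S}" using fr by metis
    finally show ?thesis by (auto simp: Q_def)
  qed
  have L_mult: "cls p \<otimes>\<^bsub>L\<^esub> cls q = cls (p * q)" if "p \<in> Q" "q \<in> Q" for p q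
  proof -
    have "fraction A S A (x * y) (s * s') = cls (p * q)" if "(x, s) \<in> cls p" "(y, s') \<in> cls q" for x y s s'
      using cls_D[OF that(1)] cls_D[OF that(2)] K' S by (subst fr) (auto simp: mult_fract)
    moreover have "cls p \<otimes>\<^bsub>L\<^esub> cls q = (\<Union>(x, s)\<in>cls p. \<Union>(y, s')\<in>cls q. fraction A S A (x * y) (s * s'))"
      by (simp add: L_def loc_prime_def Let_def S_def[symmetric] ops)
    ultimately show ?thesis using ne[OF that(1)] ne[OF that(2)] by fastforce
  qed
  have L_add: "cls p \<oplus>\<^bsub>L\<^esub> cls q = cls (p + q)" if "p \<in> Q" "q \<in> Q" for p q
  proof -
    have "fraction A S A (s' * x + s * y) (s * s') = cls (p + q)" if "(x, s) \<in> cls p" "(y, s') \<in> cls q" for x y s s'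
      using cls_D[OF that(1)] cls_D[OF that(2)] K' S by (subst fr) (auto simp: add_fract[symmetric] add_fract mult.commute add.commute)
    moreover have "cls p \<oplus>\<^bsub>L\<^esub> cls q = (\<Union>(x, s)\<in>cls p. \<Union>(y, s')\<in>cls q. fraction A S A (s' * x + s * y) (s * s'))"
      by (simp add: L_def loc_prime_def Let_def S_def[symmetric] ops fraction_add_def)
    ultimately show ?thesis using ne[OF that(1)] ne[OF that(2)] by fastforce
  qed
  have L_one: "one L = cls 1" and L_zero: "zero L = cls 0"
    using K' S(1) by (auto simp: L_def loc_prime_def Let_def S_def[symmetric] ops fr One_fract_def Zero_fract_def)
  have inj: "p = q" if "p \<in> Q" "cls p = cls q" for p q
    using ne[OF that(1)] that(2) by (auto simp: cls_def)
  have subQ: "subring_set Q"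
  proof -
    have "Fract x s + Fract y s' \<in> Q" "Fract x s - Fract y s' \<in> Q" "Fract x s * Fract y s' \<in> Q"
      if "x \<in> carrier A" "s \<in> S" "y \<in> carrier A" "s' \<in> S" for x y s s'
      unfolding Q_def using that K' S by (auto intro!: exI simp: add_fract diff_fract mult_fract)
    moreover have "0 \<in> Q" "1 \<in> Q" unfolding Q_def Zero_fract_def One_fract_def using K' S(1) by blast+
    ultimately show ?thesis unfolding subring_set_def by (auto simp: Q_def)
  qed
  note Q' = subring_setD[OF subQ]
  let ?Q = "\<lparr>carrier = Q, monoid.mult = (*), one = 1, zero = 0, add = (+)\<rparr> :: 'a fract ring"
  have cQ: "cring ?Q" by (rule cring_of_subring) (simp_all add: subQ)
  have iso: "cls \<in> ring_iso ?Q L"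
    by (rule ring_iso_memI) (auto simp: L_car L_mult L_add L_one bij_betw_def inj_on_def intro: inj)
  \<comment> \<open>Transport along an isomorphism yields a ring after the zero has been replaced by
    the image of zero; here the replacement changes nothing.\<close>
  have "ring (L\<lparr>zero := cls 0\<rparr>)"
    using ring.ring_iso_imp_img_ring[OF cring.axioms(1)[OF cQ] iso] by simp
  moreover have "L\<lparr>zero := cls 0\<rparr> = L" using L_zero by (cases L) simp
  ultimately have ringL: "ring L" by simp
  interpret L: ring L by (rule ringL)
  define QJ where "QJ = {Fract a s | a s. a \<in> J \<and> s \<in> S}"
  have QJ_Q: "QJ \<subseteq> Q" using J'(1) by (auto simp: QJ_def Q_def)
  have QJ_add: "p + q \<in> QJ" if pq: "p \<in> QJ" "q \<in> QJ" for p q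
  proof -
    obtain a s b s' where e: "p = Fract a s" "a \<in> J" "s \<in> S" "q = Fract b s'" "b \<in> J" "s' \<in> S" using pq by (auto simp: QJ_def)
    have "a * s' + b * s \<in> J" using J' S e by (metis mult.commute)
    then show ?thesis unfolding QJ_def e using e S by (auto simp: add_fract)
  qed
  have QJ_mult: "p * q \<in> QJ" if pq: "p \<in> Q" "q \<in> QJ" for p q
  proof -
    obtain a s b s' where e: "p = Fract a s" "a \<in> carrier A" "s \<in> S" "q = Fract b s'" "b \<in> J" "s' \<in> S" using pq by (auto simp: QJ_def Q_def)
    have "a * b \<in> J" using J' e by metis
    then show ?thesis unfolding QJ_def e using e S by (auto simp: mult_fract)
  qed
  have QJ_0: "0 \<in> QJ" unfolding QJ_def Zero_fract_def using J'(2) S(1) by blast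
  have id: "ideal (cls ` QJ) L"
  proof (rule idealI[OF ringL])
    show "subgroup (cls ` QJ) (add_monoid L)"
    proof
      show "cls ` QJ \<subseteq> carrier (add_monoid L)" using QJ_Q by (auto simp: L_car)
      show "\<And>x y. x \<in> cls ` QJ \<Longrightarrow> y \<in> cls ` QJ \<Longrightarrow> x \<otimes>\<^bsub>add_monoid L\<^esub> y \<in> cls ` QJ"
        using QJ_Q QJ_add by (auto simp: L_add subset_iff)
      show "\<one>\<^bsub>add_monoid L\<^esub> \<in> cls ` QJ" using QJ_0 by (simp add: L_zero)
      fix z assume "z \<in> cls ` QJ"
      then obtain q where q: "z = cls q" "q \<in> QJ" by blast
      then have qq: "q \<in> Q" "- q \<in> Q" using QJ_Q subring_set_uminus[OF subQ] by auto
      have "\<ominus>\<^bsub>L\<^esub> z = cls (- q)" by (rule L.minus_equality) (use qq q in \<open>auto simp: L_add L_zero L_car\<close>)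
      moreover have "- q \<in> QJ" using QJ_mult[of "- 1" q] subring_set_uminus[OF subQ Q'(2)] q by simp
      ultimately show "inv\<^bsub>add_monoid L\<^esub> z \<in> cls ` QJ" by (simp add: a_inv_def)
    qed
  next
    fix a z assume "a \<in> cls ` QJ" "z \<in> carrier L"
    then obtain q p where qp: "a = cls q" "q \<in> QJ" "z = cls p" "p \<in> Q" by (auto simp: L_car)
    moreover have "p * q \<in> QJ" using qp QJ_mult by blast
    ultimately show "z \<otimes>\<^bsub>L\<^esub> a \<in> cls ` QJ" "a \<otimes>\<^bsub>L\<^esub> z \<in> cls ` QJ"
      using QJ_Q by (auto simp: L_mult subset_iff mult.commute[of q p])
  qed
  have "(\<lambda>x. fraction A S A x \<one>\<^bsub>A\<^esub>) ` J \<subseteq> cls ` QJ"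
  proof (rule image_subsetI)
    fix a assume "a \<in> J"
    then have "fraction A S A a \<one>\<^bsub>A\<^esub> = cls (Fract a 1)" "Fract a 1 \<in> QJ"
      using J'(1) S(1) fr[of a 1] by (auto simp: ops QJ_def)
    then show "fraction A S A a \<one>\<^bsub>A\<^esub> \<in> cls ` QJ" by blast
  qed
  then have "loc_ideal A P J \<subseteq> cls ` QJ"
    unfolding loc_ideal_def S_def[symmetric] L_def[symmetric] by (rule L.genideal_minimal[OF id])
  then have "cls (Fract x 1) \<in> cls ` QJ" using x S(1) by (auto simp: fr S_def[symmetric])
  then obtain q where "q \<in> QJ" "cls (Fract x 1) = cls q" by blast
  moreover have "Fract x 1 \<in> Q" using x S(1) by (auto simp: Q_def)
  ultimately have "Fract x 1 \<in> QJ" using inj by metis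
  then obtain a s where as: "Fract x 1 = Fract a s" "a \<in> J" "s \<in> S" by (auto simp: QJ_def)
  then have "s * x = a" using S(3) by (simp add: eq_fract mult.commute)
  then show ?thesis using as S_def by blast
qed

section \<open>From equality of localized ideals to the content of the minors\<close>

section \<open>Homomorphisms acting on coefficients\<close>

definition map_coeffs :: "('a::comm_ring_1 \<Rightarrow> 'b::comm_ring_1) \<Rightarrow> (('v, 'a) mpoly) \<Rightarrow> (('v, 'b) mpoly)" where
  "map_coeffs \<pi> = evalm (\<lambda>c. cst (\<pi> c)) var"

lemma map_coeffs:
  assumes "comm_ring_hom \<pi>"
  shows "comm_ring_hom (map_coeffs \<pi>)" "lookup (map_coeffs \<pi> f) \<mu> = \<pi> (lookup f \<mu>)"
proof -
  interpret p: comm_ring_hom \<pi> by fact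
  have h: "comm_ring_hom (\<lambda>c. cst (\<pi> c))" by standard (auto simp: p.hom_add p.hom_mult single_add mult_single)
  show "comm_ring_hom (map_coeffs \<pi>)" unfolding map_coeffs_def by (rule evalm_hom[OF h])
  show "lookup (map_coeffs \<pi> f) \<mu> = \<pi> (lookup f \<mu>)"
  proof (induction f rule: poly_mapping_induct_add)
    case (add p m c)
    then show ?case by (simp add: map_coeffs_def evalm_add[OF h] evalm_single[OF h] monv_var mult_single lookup_add p.hom_add lookup_single when_def del: One_nat_def)
  qed (simp add: map_coeffs_def evalm_0[OF h])
qed

lemma map_coeffs_eq_0: "comm_ring_hom \<pi> \<Longrightarrow> map_coeffs \<pi> f = 0 \<longleftrightarrow> (\<forall>\<mu>. \<pi> (lookup f \<mu>) = 0)"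
  by (auto simp: poly_mapping_eq_iff map_coeffs(2) fun_eq_iff)

section \<open>The ring \<open>T\<close>\<close>

lemma T_carrier_keys: "T_carrier n kl ab = {f. keys f \<subseteq> {m. keys m \<subseteq> T_vars n kl ab}}"
  by (auto simp: T_carrier_def)

lemma subring_T_carrier: "subring_set (T_carrier n kl ab)"
  unfolding T_carrier_keys
  by (rule subring_keys) (auto dest!: subsetD[OF Poly_Mapping.keys_add])

lemma T_ops: "carrier (T_ring n kl ab) = T_carrier n kl ab" "monoid.mult (T_ring n kl ab) = (*)" "one (T_ring n kl ab) = 1"
  "zero (T_ring n kl ab) = 0" "add (T_ring n kl ab) = (+)" "module.smult (T_ring n kl ab) = (*)"
  by (simp_all add: T_ring_def)

lemma cring_T: "cring (T_ring n kl ab)"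
  by (rule cring_of_subring) (simp_all add: T_ops subring_T_carrier)

lemma cst_T: "cst c \<in> T_carrier n kl ab"
  by (simp add: T_carrier_def)

lemma emb_cst: "emb = cst"
  by (simp add: emb_def fun_eq_iff)

lemma finite_gen_mons: "finite (gen_mons kl ab i j)"
proof -
  define N where "N = nat (fst (zdeg (ab i) - zdeg (kl j))) + nat (snd (zdeg (ab i) - zdeg (kl j)))"
  have N: "fst (zdeg (ab i) - zdeg (kl j)) \<le> int N" "snd (zdeg (ab i) - zdeg (kl j)) \<le> int N"
    by (simp_all add: N_def)
  have "lookup \<alpha> z \<le> N" if "\<alpha> \<in> gen_mons kl ab i j" for \<alpha> z
    using that N by (cases z) (auto simp: gen_mons_def mon_deg_def prod_eq_iff)
  then have "lookup ` gen_mons kl ab i j \<subseteq> (\<Pi>\<^sub>E z\<in>UNIV. {..N})" by auto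
  moreover have "finite (UNIV :: rvar set)" by (subst UNIV_rvar) simp
  then have "finite (\<Pi>\<^sub>E z\<in>(UNIV :: rvar set). {..N})" by (intro finite_PiE) simp_all
  ultimately have "finite (lookup ` gen_mons kl ab i j)" by (rule finite_subset)
  then show ?thesis by (rule finite_imageD) (simp add: inj_on_def lookup_inject)
qed

lemma H_single: "H kl ab j i = (\<Sum>\<alpha>\<in>gen_mons kl ab i j. single (single (CV i j \<alpha>) 1) (single \<alpha> 1))"
  by (simp add: H_def emb_def mult_single)

lemma H_T:
  assumes "i < 3" "j < n"
  shows "H kl ab j i \<in> T_carrier n kl ab"
  unfolding H_single
proof (rule subring_set_sum[OF subring_T_carrier])
  fix \<alpha> assume "\<alpha> \<in> gen_mons kl ab i j"
  then have "CV i j \<alpha> \<in> T_vars n kl ab" using assms unfolding T_vars_def by blast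
  then show "single (single (CV i j \<alpha>) 1) (single \<alpha> 1) \<in> T_carrier n kl ab"
    by (simp add: T_carrier_def)
qed

lemma generic_elem_T: "i < 3 \<Longrightarrow> generic_elem n g kl ab i \<in> T_carrier n kl ab"
  unfolding generic_elem_def emb_cst
  by (rule subring_set_sum[OF subring_T_carrier], rule subring_setD(5)[OF subring_T_carrier H_T cst_T]) simp_all

text \<open>Membership in the extended ideal is thereby tested on coefficients. If \<open>P\<close>
  is the kernel of a homomorphism, its extension is the kernel of the map that this homomorphism
  induces on coefficients.\<close>

lemma ext_ideal_T:
  fixes P :: "'k::comm_ring_1 rpoly set"
  assumes P: "ideal_set P"
  shows "ext_ideal (T_ring n kl ab) P = {f \<in> T_carrier n kl ab. \<forall>\<mu>. lookup f \<mu> \<in> P}" (is "_ = ?I")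
proof -
  interpret T: cring "T_ring n kl ab :: ('k tpoly, 'k tpoly) bg_module" by (rule cring_T)
  note K = subring_setD[OF subring_T_carrier[where 'a = 'k and n = n and kl = kl and ab = ab]]
  note P' = ideal_setD[OF P]
  have "ideal ?I (T_ring n kl ab)"
  proof (rule ideal_of_set)
    fix c x :: "'k tpoly" assume cx: "c \<in> carrier (T_ring n kl ab)" "x \<in> ?I"
    have "lookup (c * x) \<mu> \<in> P" for \<mu>
      unfolding lookup_mult_finite[OF finite_keys order_refl]
    proof -
      have s: "sum f A \<in> P" if "\<And>i. i \<in> A \<Longrightarrow> f i \<in> P" for f :: "(cvar \<Rightarrow>\<^sub>0 nat) \<Rightarrow> _" and A
        using that by (induction A rule: infinite_finite_induct) (auto intro: P')
      show "(\<Sum>\<kappa>\<in>keys c. \<Sum>\<nu>\<in>keys x. if \<kappa> + \<nu> = \<mu> then lookup c \<kappa> * lookup x \<nu> else 0) \<in> P"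
        by (intro s) (use cx P' in auto)
    qed
    then show "c * x \<in> ?I" using cx K by (simp add: T_ops)
  qed (use K P' in \<open>auto simp: T_ops subring_T_carrier lookup_add\<close>)
  moreover have "emb ` P \<subseteq> ?I" using P' by (auto simp: emb_cst cst_T lookup_single when_def)
  ultimately have 1: "ext_ideal (T_ring n kl ab) P \<subseteq> ?I" unfolding ext_ideal_def by (rule T.genideal_minimal)
  have sub: "emb ` P \<subseteq> carrier (T_ring n kl ab)" by (auto simp: T_ops emb_cst cst_T)
  have id: "ideal (ext_ideal (T_ring n kl ab) P) (T_ring n kl ab)" unfolding ext_ideal_def by (rule T.genideal_ideal[OF sub])
  note I = set_of_ideal[OF T_ops(2-5) id]
  have gen: "emb p \<in> ext_ideal (T_ring n kl ab) P" if "p \<in> P" for p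
    unfolding ext_ideal_def using T.genideal_self[OF sub] that by blast
  have "f \<in> ext_ideal (T_ring n kl ab) P" if f: "f \<in> ?I" for f
  proof -
    have t: "single m (lookup f m) \<in> ext_ideal (T_ring n kl ab) P" if "m \<in> keys f" for m
    proof -
      have "single m (lookup f m) = single m 1 * emb (lookup f m)"
        by (simp add: emb_def mult_single)
      moreover have "single m 1 \<in> T_carrier n kl ab" using f that by (auto simp: T_carrier_def)
      ultimately show ?thesis using I(4)[of "single m 1" "emb (lookup f m)"] gen f by (simp add: T_ops)
    qed
    have s: "sum h A \<in> ext_ideal (T_ring n kl ab) P" if "\<And>i. i \<in> A \<Longrightarrow> h i \<in> ext_ideal (T_ring n kl ab) P"
      for h :: "(cvar \<Rightarrow>\<^sub>0 nat) \<Rightarrow> _" and A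
      using that by (induction A rule: infinite_finite_induct) (auto intro: I)
    have "(\<Sum>m\<in>keys f. single m (lookup f m)) \<in> ext_ideal (T_ring n kl ab) P"
      by (rule s[OF t])
    then show ?thesis unfolding poly_mapping_sum_singles[of f, symmetric] .
  qed
  with 1 show ?thesis by blast
qed

lemma FF_ideal_mem:
  fixes g :: "nat \<Rightarrow> 'k::comm_ring_1 rpoly"
  assumes "f \<in> FF_ideal n g kl ab"
  shows "\<exists>t. (\<forall>i. t i \<in> T_carrier n kl ab) \<and> f = (\<Sum>i<3. t i * generic_elem n g kl ab i)"
proof -
  interpret T: cring "T_ring n kl ab :: ('k tpoly, 'k tpoly) bg_module" by (rule cring_T)
  note K = subring_setD[OF subring_T_carrier[where 'a = 'k and n = n and kl = kl and ab = ab]]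
  let ?I = "{f. \<exists>t. (\<forall>i. t i \<in> T_carrier n kl ab) \<and> f = (\<Sum>i<3. t i * generic_elem n g kl ab i)}"
  have "ideal ?I (T_ring n kl ab)"
  proof (rule ideal_of_set)
    show "?I \<subseteq> carrier (T_ring n kl ab)"
      by (auto simp: T_ops intro!: subring_set_sum[OF subring_T_carrier] K(5) generic_elem_T)
    have "(\<forall>i. (0::'k tpoly) \<in> T_carrier n kl ab) \<and> 0 = (\<Sum>i<3. 0 * generic_elem n g kl ab i)" using K(1) by simp
    then show "0 \<in> ?I" by (intro CollectI exI[of _ "\<lambda>i. 0"])
  next
    fix x y :: "'k tpoly" assume "x \<in> ?I" "y \<in> ?I"
    then obtain t t' where "\<forall>i. t i \<in> T_carrier n kl ab" "x = (\<Sum>i<3. t i * generic_elem n g kl ab i)"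
      "\<forall>i. t' i \<in> T_carrier n kl ab" "y = (\<Sum>i<3. t' i * generic_elem n g kl ab i)" by blast
    then show "x + y \<in> ?I" by (intro CollectI exI[of _ "\<lambda>i. t i + t' i"]) (auto simp: K distrib_right sum.distrib)
  next
    fix c x :: "'k tpoly" assume "c \<in> carrier (T_ring n kl ab)" "x \<in> ?I"
    then obtain t where "c \<in> T_carrier n kl ab" "\<forall>i. t i \<in> T_carrier n kl ab" "x = (\<Sum>i<3. t i * generic_elem n g kl ab i)"
      by (auto simp: T_ops)
    then show "c * x \<in> ?I" by (intro CollectI exI[of _ "\<lambda>i. c * t i"]) (auto simp: K sum_distrib_left mult.assoc)
  qed (simp_all add: T_ops subring_T_carrier)
  moreover have "generic_elem n g kl ab ` {..<3} \<subseteq> ?I"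
  proof -
    have "(\<forall>i'. (if i' = i then 1 else 0 :: 'k tpoly) \<in> T_carrier n kl ab)
        \<and> generic_elem n g kl ab i = (\<Sum>i'<3. (if i' = i then 1 else 0) * generic_elem n g kl ab i')" if "i < 3" for i
      using K(1,2) that by (simp add: if_distrib[of "\<lambda>x. x * _"] cong: if_cong)
    note t = this
    show ?thesis
    proof (rule image_subsetI, rule CollectI)
      fix i :: nat assume "i \<in> {..<3}"
      then have "i < 3" by simp
      then show "\<exists>t. (\<forall>i. t i \<in> T_carrier n kl ab) \<and> generic_elem n g kl ab i = (\<Sum>i<3. t i * generic_elem n g kl ab i)"
        by (intro exI[where x = "\<lambda>i'. if i' = i then 1 else 0"] t)
    qed
  qed
  ultimately have "FF_ideal n g kl ab \<subseteq> ?I" unfolding FF_ideal_def by (rule T.genideal_minimal)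
  then show ?thesis using assms by blast
qed

lemma FF_ideal_ideal: "ideal (FF_ideal n g kl ab) (T_ring n kl ab)"
  unfolding FF_ideal_def by (rule cring.cring_simprules ring.genideal_ideal[OF cring.axioms(1)[OF cring_T]])+ (auto simp: T_ops generic_elem_T)

section \<open>Syzygies and a nonvanishing maximal minor\<close>

text \<open>Adjoining indeterminates preserves exactness, since a relation over the larger ring is a
  family of relations over \<open>R\<close>, one for each monomial.\<close>

lemma syzygy_poly:
  fixes W :: "nat \<Rightarrow> ('v, 'k::comm_ring_1 rpoly) mpoly"
  assumes hb: "hilbert_burch n \<phi> g kl cd" and W: "(\<Sum>l<n. cst (g l) * W l) = 0"
  shows "\<exists>V. \<forall>l<n. W l = (\<Sum>i<n - 1. cst (\<phi> $$ (l, i)) * V i)"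
proof -
  have dim: "\<phi> \<in> carrier_mat n (n - 1)" using hb by (simp add: hilbert_burch_def)
  have "\<forall>\<mu>. \<exists>v. v \<in> carrier_vec (n - 1) \<and> vec n (\<lambda>l. lookup (W l) \<mu>) = \<phi> *\<^sub>v v"
  proof
    fix \<mu>
    have "(\<Sum>l<n. g l * vec n (\<lambda>l. lookup (W l) \<mu>) $ l) = lookup (\<Sum>l<n. cst (g l) * W l) \<mu>"
      by (simp add: lookup_sum)
    then have "(\<Sum>l<n. g l * vec n (\<lambda>l. lookup (W l) \<mu>) $ l) = 0" by (simp only: W lookup_zero)
    moreover have *: "\<forall>w\<in>carrier_vec n. (\<Sum>j<n. g j * w $ j) = 0 \<longleftrightarrow> (\<exists>v\<in>carrier_vec (n - 1). w = \<phi> *\<^sub>v v)"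
      using hb[unfolded hilbert_burch_def] by (elim conjE)
    ultimately have "\<exists>v\<in>carrier_vec (n - 1). vec n (\<lambda>l. lookup (W l) \<mu>) = \<phi> *\<^sub>v v"
      using bspec[OF *, of "vec n (\<lambda>l. lookup (W l) \<mu>)"] by simp
    then show "\<exists>v. v \<in> carrier_vec (n - 1) \<and> vec n (\<lambda>l. lookup (W l) \<mu>) = \<phi> *\<^sub>v v" by blast
  qed
  from choice[OF this] obtain v where v: "\<And>\<mu>. v \<mu> \<in> carrier_vec (n - 1)" "\<And>\<mu>. vec n (\<lambda>l. lookup (W l) \<mu>) = \<phi> *\<^sub>v v \<mu>" by blast
  let ?L = "\<Union>l<n. keys (W l)"
  have fin: "finite ?L" by simp
  have "W l = (\<Sum>i<n - 1. cst (\<phi> $$ (l, i)) * pm_of ?L (\<lambda>\<mu>. v \<mu> $ i))" if l: "l < n" for l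
  proof (rule poly_mapping_eqI)
    fix \<mu>
    have "lookup (W l) \<mu> = vec n (\<lambda>l. lookup (W l) \<mu>) $ l" using l by simp
    then have "lookup (W l) \<mu> = (\<phi> *\<^sub>v v \<mu>) $ l" unfolding v(2)[of \<mu>] .
    also have "\<dots> = (\<Sum>i<n - 1. \<phi> $$ (l, i) * v \<mu> $ i)"
      using l dim v(1)[of \<mu>] by (auto simp: scalar_prod_def lessThan_atLeast0)
    finally have eq: "lookup (W l) \<mu> = (\<Sum>i<n - 1. \<phi> $$ (l, i) * v \<mu> $ i)" .
    have "lookup (W l) \<mu> = 0" if "\<mu> \<notin> ?L" using that l by (auto simp: in_keys_iff)
    then show "lookup (W l) \<mu> = lookup (\<Sum>i<n - 1. cst (\<phi> $$ (l, i)) * pm_of ?L (\<lambda>\<mu>. v \<mu> $ i)) \<mu>"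
      unfolding lookup_sum lookup_cst_mult lookup_pm_of[OF fin] using eq by (cases "\<mu> \<in> ?L") simp_all
  qed
  then show ?thesis by (intro exI allI impI)
qed

text \<open>The composition in the order opposite to \<open>wdgs_ctrs\<close>. On a form killed by
  the contractions the Clifford relation leaves no corrections, so this is an equation.\<close>

lemma ctrs_wdgs_dual:
  assumes "\<And>j k. j \<in> set js \<Longrightarrow> k \<in> set js \<Longrightarrow> (\<Sum>i<r. a j i * v k i) = (if j = k then m k else 0)" "distinct js"
    and "\<And>j. j \<in> set js \<Longrightarrow> ctr r (a j) \<omega> = (\<lambda>I. 0)"
  shows "ctrs r a js (wdgs r v js \<omega>) = (\<lambda>I. (\<Prod>j\<in>set js. m j) * \<omega> I)"
  using assms
proof (induction js arbitrary: \<omega>)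
  case (Cons j js)
  have k0: "ctr r (a k) (wdg r (v j) \<omega>) = (\<lambda>I. 0)" if k: "k \<in> set js" for k
  proof
    fix I
    have "k \<noteq> j" using k Cons.prems(2) by auto
    then have "(\<Sum>i<r. a k i * v j i) = 0" using Cons.prems(1)[of k j] k by simp
    moreover have "ctr r (a k) \<omega> = (\<lambda>I. 0)" by (rule Cons.prems(3)) (simp add: k)
    ultimately show "ctr r (a k) (wdg r (v j) \<omega>) I = 0" by (simp add: ctr_wdg)
  qed
  have "ctrs r a js (wdgs r v js (wdg r (v j) \<omega>)) = (\<lambda>I. (\<Prod>j\<in>set js. m j) * wdg r (v j) \<omega> I)"
    by (rule Cons.IH) (use Cons.prems(1,2) k0 in auto)
  then have "ctrs r a (j # js) (wdgs r v (j # js) \<omega>) = ctr r (a j) (\<lambda>I. (\<Prod>j\<in>set js. m j) * wdg r (v j) \<omega> I)" by simp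
  also have "\<dots> = (\<lambda>I. (\<Prod>j\<in>set (j # js). m j) * \<omega> I)"
  proof
    fix I
    have "(\<Sum>i<r. a j i * v j i) = m j" using Cons.prems(1)[of j j] by simp
    moreover have "ctr r (a j) \<omega> = (\<lambda>I. 0)" by (rule Cons.prems(3)) simp
    ultimately show "ctr r (a j) (\<lambda>I. (\<Prod>j\<in>set js. m j) * wdg r (v j) \<omega> I) I = (\<Prod>j\<in>set (j # js). m j) * \<omega> I"
      using Cons.prems(2) by (simp add: ctr_scale ctr_wdg mult_ac)
  qed
  finally show ?case .
qed simp

text \<open>Cauchy-Binet in the language of forms: wedging the constant form with the
  \<open>v k\<close> and contracting with the rows gives the product of the \<open>m k\<close>,
  which is a combination of maximal minors. If \<open>h\<close> killed all minors, it would kill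
  this product, whose factors have nonzero images in a domain.\<close>

lemma nonzero_minor:
  fixes h :: "'a::comm_ring_1 \<Rightarrow> 'b::idom"
  fixes a :: "nat \<Rightarrow> nat \<Rightarrow> 'a"
  assumes h: "comm_ring_hom h"
    and dual: "\<And>j k. j < n \<Longrightarrow> k < n \<Longrightarrow> (\<Sum>i<r. a j i * v k i) = (if j = k then m k else 0)"
    and m: "\<And>k. k < n \<Longrightarrow> h (m k) \<noteq> 0"
  shows "\<exists>I. I \<subseteq> {..<r} \<and> card I = n \<and> h (minor a n I) \<noteq> 0"
proof (rule ccontr)
  assume no: "\<not> ?thesis"
  interpret comm_ring_hom h by fact
  define \<omega> :: "nat set \<Rightarrow> 'a" where "\<omega> I = (if I = {} then 1 else 0)" for I
  have "ctr r (a j) \<omega> = (\<lambda>I. 0)" for j by (auto simp: ctr_def ctr1_def \<omega>_def fun_eq_iff intro!: sum.neutral)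
  then have 1: "ctrs r a [0..<n] (wdgs r v [0..<n] \<omega>) {} = (\<Prod>j\<in>set [0..<n]. m j)"
    using ctrs_wdgs_dual[of "[0..<n]" a v r m \<omega>] dual by (auto simp: \<omega>_def)
  obtain \<epsilon> where \<epsilon>: "\<And>\<omega>. ctrs r a [0..<n] \<omega> {} = \<epsilon> * (\<Sum>I | I \<subseteq> {..<r} \<and> card I = n. \<omega> I * minor a n I)"
    using ctrs_eq_minor[where r = r and a = a and n = n] by meson
  have "h (\<Sum>I | I \<subseteq> {..<r} \<and> card I = n. wdgs r v [0..<n] \<omega> I * minor a n I) = 0"
    unfolding hom_sum hom_mult using no by (intro sum.neutral) auto
  then have "h (\<Prod>j\<in>set [0..<n]. m j) = 0" unfolding 1[symmetric] \<epsilon> hom_mult by simp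
  then have "(\<Prod>j\<in>set [0..<n]. h (m j)) = 0" by (simp add: hom_prod)
  then show False using m by (auto simp: prod_zero_iff)
qed

section \<open>Bidegrees of minors\<close>

definition T_hom :: "bideg \<Rightarrow> 'k::comm_ring_1 tpoly set" where
  "T_hom d = {f. \<forall>\<mu>. lookup f \<mu> \<in> R_piece d}"

lemma R_piece_sum: "(\<And>i. i \<in> A \<Longrightarrow> f i \<in> R_piece d) \<Longrightarrow> sum f A \<in> R_piece d"
  by (induction A rule: infinite_finite_induct) (auto intro: R_piece_add)

lemma T_hom_0 [simp]: "0 \<in> T_hom d"
  by (simp add: T_hom_def)

lemma T_hom_cst: "c \<in> R_piece d \<Longrightarrow> cst c \<in> T_hom d"
  by (simp add: T_hom_def lookup_single when_def)

lemma T_hom_1: "1 \<in> T_hom 0"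
  using T_hom_cst[OF R_piece_cst[of 1]] by simp

lemma T_hom_add: "f \<in> T_hom d \<Longrightarrow> g \<in> T_hom d \<Longrightarrow> f + g \<in> T_hom d"
  by (simp add: T_hom_def lookup_add R_piece_add)

lemma T_hom_sum: "(\<And>i. i \<in> A \<Longrightarrow> f i \<in> T_hom d) \<Longrightarrow> sum f A \<in> T_hom d"
  by (induction A rule: infinite_finite_induct) (auto intro: T_hom_add)

lemma T_hom_mult:
  assumes "f \<in> T_hom d" "g \<in> T_hom e"
  shows "f * g \<in> T_hom (d + e)"
proof -
  have "lookup (f * g) \<mu> \<in> R_piece (d + e)" for \<mu>
    unfolding lookup_mult_finite[OF finite_keys order_refl]
    by (intro R_piece_sum) (use assms in \<open>auto simp: T_hom_def intro: R_piece_mult\<close>)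
  then show ?thesis by (simp add: T_hom_def)
qed

lemma T_hom_prod: "(\<And>i. i \<in> A \<Longrightarrow> f i \<in> T_hom (d i)) \<Longrightarrow> prod f A \<in> T_hom (sum d A)"
  by (induction A rule: infinite_finite_induct) (auto intro: T_hom_mult T_hom_1)

lemma T_hom_of_int: "of_int z * f \<in> T_hom d" if "f \<in> T_hom d"
proof -
  have "of_int z = (cst (cst (of_int z)) :: 'a tpoly)"
    by (metis single_of_int)
  then show ?thesis using T_hom_mult[OF T_hom_cst[OF R_piece_cst] that, of "of_int z"] by simp
qed

lemma T_hom_H: "H kl ab j i \<in> T_hom (zdeg (ab i) - zdeg (kl j))"
  unfolding H_single
  by (intro T_hom_sum) (auto simp: T_hom_def lookup_single when_def R_piece_def gen_mons_def)

text \<open>All permutations contribute the same bidegree, since each row and each column is used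
  once.\<close>

lemma minor_T_hom:
  assumes I: "finite I" "card I = n" and a: "\<And>j i. j < n \<Longrightarrow> i \<in> I \<Longrightarrow> a j i \<in> T_hom (\<xi> i - \<eta> j)"
  shows "minor a n I \<in> T_hom (sum \<xi> I - (\<Sum>j<n. \<eta> j))"
proof -
  have pick: "pick I k \<in> I" if "k < n" for k using that I by (intro pick_in_set) auto
  have "(\<Prod>i = 0..<n. a i (pick I (p i))) \<in> T_hom (sum \<xi> I - (\<Sum>j<n. \<eta> j))" if p: "p permutes {0..<n}" for p
  proof -
    have lt: "p i < n" if "i < n" for i using p that by (metis atLeastLessThan_iff permutes_in_image zero_le)
    have "(\<Prod>i = 0..<n. a i (pick I (p i))) \<in> T_hom (\<Sum>i = 0..<n. \<xi> (pick I (p i)) - \<eta> i)"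
      by (intro T_hom_prod a pick lt) auto
    also have "(\<Sum>i = 0..<n. \<xi> (pick I (p i)) - \<eta> i) = (\<Sum>i = 0..<n. \<xi> (pick I (p i))) - (\<Sum>j<n. \<eta> j)"
      by (simp add: sum_subtractf lessThan_atLeast0)
    also have "(\<Sum>i = 0..<n. \<xi> (pick I (p i))) = (\<Sum>i = 0..<n. \<xi> (pick I i))"
      using sum.permute[OF p, of "\<lambda>i. \<xi> (pick I i)"] by (simp add: o_def)
    also have "\<dots> = sum \<xi> I" using sum_pick[OF I, of "\<lambda>i _. \<xi> i"] by (simp add: lessThan_atLeast0)
    finally show ?thesis .
  qed
  note * = this
  have "minor a n I = (\<Sum>p\<in>{p. p permutes {0..<n}}. signof p * (\<Prod>i = 0..<n. a i (pick I (p i))))"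
    unfolding minor_def
    by (subst det_def'[of _ n], simp)
       (auto intro!: sum.cong prod.cong simp: permutes_in_image dest: permutes_in_image[THEN iffD2])
  also have "\<dots> \<in> T_hom (sum \<xi> I - (\<Sum>j<n. \<eta> j))"
    by (intro T_hom_sum T_hom_of_int *) simp
  finally show ?thesis .
qed

lemma minor_subring:
  assumes K: "subring_set K" and I: "finite I" "card I = n" and a: "\<And>j i. j < n \<Longrightarrow> i \<in> I \<Longrightarrow> a j i \<in> K"
  shows "minor a n I \<in> K"
  using I a
proof (induction n arbitrary: I)
  case 0
  then show ?case using subring_setD(2)[OF K] by (simp add: minor_def det_dim_zero)
next
  case (Suc n)
  have "sg i I * a n i * minor a n (I - {i}) \<in> K" if "i \<in> I" for i
  proof -
    have "minor a n (I - {i}) \<in> K" by (rule Suc.IH) (use Suc.prems that in auto)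
    moreover have "sg i I \<in> K"
      unfolding sg_def by (intro subring_set_power[OF K] subring_set_uminus[OF K] subring_setD(2)[OF K])
    ultimately show ?thesis using Suc.prems(3) that by (intro subring_setD(5)[OF K]) auto
  qed
  then have "(\<Sum>i\<in>I. sg i I * a n i * minor a n (I - {i})) \<in> K" by (rule subring_set_sum[OF K])
  then have "(-1) ^ n * ((-1) ^ n * minor a (Suc n) I) \<in> K"
    unfolding minor_expand_last_row[OF Suc.prems(1,2)]
    by (rule subring_setD(5)[OF K, rotated]) (intro subring_set_power[OF K] subring_set_uminus[OF K] subring_setD(2)[OF K])
  moreover have "(-1) ^ n * ((-1) ^ n * minor a (Suc n) I) = minor a (Suc n) I"
    by (simp flip: mult.assoc power_mult_distrib)
  ultimately show ?case by (simp only:)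
qed

lemma phi_Psi_dims:
  assumes "hilbert_burch n \<phi> g kl cd" "n = Suc c"
  shows "dim_row (phi_Psi n \<phi> kl ab) = n" "dim_col (phi_Psi n \<phi> kl ab) = c + 3"
    "j < n \<Longrightarrow> i < c \<Longrightarrow> phi_Psi n \<phi> kl ab $$ (j, i) = cst (\<phi> $$ (j, i))"
    "j < n \<Longrightarrow> i < 3 \<Longrightarrow> phi_Psi n \<phi> kl ab $$ (j, c + i) = H kl ab j i"
  using assms by (auto simp: phi_Psi_def concat_cols_def Psi_def hilbert_burch_def emb_def)

lemma phi_Psi_entries:
  assumes hb: "hilbert_burch n \<phi> g kl cd" and n: "n = Suc c" and ji: "j < n" "i < c + 3"
  shows "phi_Psi n \<phi> kl ab $$ (j, i) \<in> T_carrier n kl ab"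
    "phi_Psi n \<phi> kl ab $$ (j, i) \<in> T_hom (phi_Psi_deg n cd ab i - zdeg (kl j))"
proof -
  have "phi_Psi n \<phi> kl ab $$ (j, i) \<in> T_carrier n kl ab \<inter> T_hom (phi_Psi_deg n cd ab i - zdeg (kl j))"
  proof (cases "i < c")
    case True
    moreover have "\<phi> $$ (j, i) \<in> R_piece (cd i - zdeg (kl j))" using hb ji(1) True n by (auto simp: hilbert_burch_def)
    ultimately show ?thesis unfolding phi_Psi_dims(3)[OF hb n ji(1) True] by (simp add: cst_T T_hom_cst phi_Psi_deg_def n)
  next
    case False
    define k where "k = i - c"
    have "i = c + k" "k < 3" using False ji(2) by (auto simp: k_def)
    moreover have "H kl ab j k \<in> T_carrier n kl ab" using ji(1) \<open>k < 3\<close> by (rule H_T[rotated])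
    ultimately show ?thesis using phi_Psi_dims(4)[OF hb n ji(1) \<open>k < 3\<close>, of ab] T_hom_H[of kl ab j k]
      by (simp add: phi_Psi_deg_def n)
  qed
  then show "phi_Psi n \<phi> kl ab $$ (j, i) \<in> T_carrier n kl ab"
    "phi_Psi n \<phi> kl ab $$ (j, i) \<in> T_hom (phi_Psi_deg n cd ab i - zdeg (kl j))" by auto
qed

lemma max_minor_props:
  assumes hb: "hilbert_burch n \<phi> g kl cd" and n: "n = Suc c" and I: "I \<subseteq> {..<c + 3}" "card I = n"
  shows "max_minor (phi_Psi n \<phi> kl ab) I = minor (\<lambda>j i. phi_Psi n \<phi> kl ab $$ (j, i)) n I"
    "max_minor (phi_Psi n \<phi> kl ab) I \<in> T_carrier n kl ab"
    "max_minor (phi_Psi n \<phi> kl ab) I \<in> T_hom (sum (phi_Psi_deg n cd ab) I - (\<Sum>j<n. zdeg (kl j)))"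
proof -
  have fin: "finite I" using I(1) finite_subset by blast
  show eq: "max_minor (phi_Psi n \<phi> kl ab) I = minor (\<lambda>j i. phi_Psi n \<phi> kl ab $$ (j, i)) n I"
    using max_minor_eq[of I "phi_Psi n \<phi> kl ab"] I by (simp add: phi_Psi_dims[OF hb n])
  show "max_minor (phi_Psi n \<phi> kl ab) I \<in> T_carrier n kl ab"
    unfolding eq by (rule minor_subring[OF subring_T_carrier fin I(2)]) (rule phi_Psi_entries(1)[OF hb n], use I(1) in auto)
  show "max_minor (phi_Psi n \<phi> kl ab) I \<in> T_hom (sum (phi_Psi_deg n cd ab) I - (\<Sum>j<n. zdeg (kl j)))"
    unfolding eq by (rule minor_T_hom[OF fin I(2)]) (rule phi_Psi_entries(2)[OF hb n], use I(1) in auto)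
qed

section \<open>The content of the maximal minors\<close>

text \<open>Equality of the localizations provides \<open>s j\<close> outside the extended prime
  such that \<open>s j * g j\<close> is a combination of the generic elements. Comparing the two
  expressions gives a syzygy of \<open>g\<close>, which \<open>\<phi>\<close> resolves; hence the
  columns of \<open>\<phi>\<close> and \<open>\<Psi>\<close> combine to \<open>s j\<close> times the
  \<open>j\<close>-th unit vector, for every \<open>j\<close>. A matrix with this property has a
  maximal minor outside the extended prime.\<close>

lemma ideal_localization_eq_minor:
  fixes \<phi> :: "'k::idom rpoly mat"
  assumes hb: "hilbert_burch n \<phi> g kl cd" and n: "n = Suc c" and h: "comm_ring_hom (h :: 'k rpoly \<Rightarrow> 'k rpoly)"
    and loc: "loc_ideal (T_ring n kl ab) (ext_ideal (T_ring n kl ab) {f. h f = 0}) (FF_ideal n g kl ab)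
      = loc_ideal (T_ring n kl ab) (ext_ideal (T_ring n kl ab) {f. h f = 0}) (emb ` G_ideal n g)"
  shows "\<exists>I. I \<subseteq> {..<c + 3} \<and> card I = n \<and> (\<exists>\<mu>. h (lookup (max_minor (phi_Psi n \<phi> kl ab) I) \<mu>) \<noteq> 0)"
proof -
  let ?A = "T_ring n kl ab :: ('k tpoly, 'k tpoly) bg_module" and ?\<alpha> = "phi_Psi n \<phi> kl ab" and ?h = "map_coeffs h"
  define P where "P = {f. h f = 0}"
  define E where "E = ext_ideal ?A P"
  interpret R: cring "R_ring :: ('k rpoly, 'k rpoly) bg_module" by (rule cring_of_subring[OF subring_UNIV R_ops(2-5)])
  interpret h: comm_ring_hom h by fact
  interpret m: comm_ring_hom ?h by (rule map_coeffs(1)[OF h])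
  have P: "ideal_set P" unfolding P_def by (rule prime_set(1)[OF primeideal_kernel[OF h]])
  have E_iff: "f \<in> E \<longleftrightarrow> ?h f = 0" if "f \<in> T_carrier n kl ab" for f
    using that unfolding E_def ext_ideal_T[OF P] map_coeffs_eq_0[OF h] by (simp add: P_def)
  note K = subring_setD[OF subring_T_carrier[where 'a = 'k and n = n and kl = kl and ab = ab]]
  have "\<exists>s t. ?h s \<noteq> 0 \<and> s * cst (g j) = (\<Sum>i<3. t i * generic_elem n g kl ab i)" if j: "j < n" for j
  proof -
    have "g j \<in> G_ideal n g" unfolding G_ideal_def using R.genideal_self[of "g ` {..<n}"] j by (auto simp: R_ops)
    then have "fraction ?A (carrier ?A - E) ?A (cst (g j)) 1 \<in> loc_ideal ?A E (emb ` G_ideal n g)"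
      unfolding loc_ideal_def genideal_def by (auto simp: T_ops emb_cst)
    then have "fraction ?A (carrier ?A - E) ?A (cst (g j)) 1 \<in> loc_ideal ?A E (FF_ideal n g kl ab)"
      using loc by (simp add: E_def P_def)
    then have "\<exists>s\<in>carrier ?A - E. s * cst (g j) \<in> FF_ideal n g kl ab"
    proof (rule loc_ideal_mem[rotated -1])
      show "0 \<in> E" "1 \<notin> E" using E_iff[OF K(1)] E_iff[OF K(2)] by simp_all
      fix x y assume "x \<in> carrier ?A - E" "y \<in> carrier ?A - E"
      then show "x * y \<notin> E" using E_iff[of x] E_iff[of y] E_iff[OF K(5), of x y] by (auto simp: T_ops m.hom_mult)
    qed (simp_all add: T_ops subring_T_carrier FF_ideal_ideal cst_T)
    then obtain s where s: "s \<in> T_carrier n kl ab" "s \<notin> E" "s * cst (g j) \<in> FF_ideal n g kl ab" by (auto simp: T_ops)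
    then show ?thesis using FF_ideal_mem[OF s(3)] E_iff[OF s(1)] by blast
  qed
  then have "\<forall>j\<in>{..<n}. \<exists>s t. ?h s \<noteq> 0 \<and> s * cst (g j) = (\<Sum>i<3. t i * generic_elem n g kl ab i)" by simp
  from bchoice[OF this] obtain s where "\<forall>j\<in>{..<n}. \<exists>t. ?h (s j) \<noteq> 0 \<and> s j * cst (g j) = (\<Sum>i<3. t i * generic_elem n g kl ab i)" by blast
  from bchoice[OF this] obtain t where
    st: "\<And>j. j < n \<Longrightarrow> ?h (s j) \<noteq> 0" "\<And>j. j < n \<Longrightarrow> s j * cst (g j) = (\<Sum>i<3. t j i * generic_elem n g kl ab i)" by auto
  have "\<exists>u. \<forall>l<n. (\<Sum>i<c + 3. ?\<alpha> $$ (l, i) * u i) = (if l = j then s j else 0)" if j: "j < n" for j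
  proof -
    \<comment> \<open>The vector with entry \<open>s j\<close> at position \<open>j\<close>, minus
      the part that the columns of \<open>\<Psi>\<close> already account for; it is a
      syzygy.\<close>
    let ?W = "\<lambda>l. (if l = j then s j else 0) - (\<Sum>i<3. t j i * H kl ab l i)"
    have "(\<Sum>l<n. cst (g l) * ?W l) = s j * cst (g j) - (\<Sum>l<n. \<Sum>i<3. t j i * (H kl ab l i * cst (g l)))"
      using j by (simp add: right_diff_distrib sum_subtractf sum_distrib_left mult_ac if_distrib[of "\<lambda>x. _ * x"] cong: if_cong)
    also have "\<dots> = 0"
      unfolding st(2)[OF j] generic_elem_def emb_cst by (subst sum.swap) (simp add: sum_distrib_left)
    finally obtain V where V: "\<And>l. l < n \<Longrightarrow> ?W l = (\<Sum>i<c. cst (\<phi> $$ (l, i)) * V i)"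
      using syzygy_poly[OF hb, of ?W] unfolding n diff_Suc_1 by meson
    have "(\<Sum>i<c + 3. ?\<alpha> $$ (l, i) * (if i < c then V i else t j (i - c))) = (if l = j then s j else 0)" if l: "l < n" for l
    proof -
      have "(\<Sum>i<c + 3. ?\<alpha> $$ (l, i) * (if i < c then V i else t j (i - c)))
          = (\<Sum>i<c. ?\<alpha> $$ (l, i) * V i) + (\<Sum>i<3. ?\<alpha> $$ (l, c + i) * t j i)"
        by (simp add: eval_nat_numeral)
      also have "\<dots> = ?W l + (\<Sum>i<3. t j i * H kl ab l i)"
        using l V[OF l] by (simp add: phi_Psi_dims(3,4)[OF hb n] mult.commute)
      finally show ?thesis by simp
    qed
    then show ?thesis by (intro exI[where x = "\<lambda>i. if i < c then V i else t j (i - c)"] allI impI)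
  qed
  then have "\<forall>j\<in>{..<n}. \<exists>u. \<forall>l<n. (\<Sum>i<c + 3. ?\<alpha> $$ (l, i) * u i) = (if l = j then s j else 0)" by simp
  from bchoice[OF this] obtain u where
    u: "\<And>j l. j < n \<Longrightarrow> l < n \<Longrightarrow> (\<Sum>i<c + 3. ?\<alpha> $$ (l, i) * u j i) = (if l = j then s j else 0)" by auto
  obtain I where I: "I \<subseteq> {..<c + 3}" "card I = n" "?h (minor (\<lambda>j i. ?\<alpha> $$ (j, i)) n I) \<noteq> 0"
    using nonzero_minor[where h = ?h and n = n and r = "c + 3" and a = "\<lambda>j i. ?\<alpha> $$ (j, i)" and v = u and m = s] map_coeffs(1)[OF h] u st(1) by auto
  have "?h (max_minor ?\<alpha> I) \<noteq> 0" unfolding max_minor_props(1)[OF hb n I(1,2)] by (rule I(3))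
  then show ?thesis using I(1,2) unfolding map_coeffs_eq_0[OF h] by blast
qed

text \<open>A point of the chart gives a prime of height two that does not contain \<open>B\<close>,
  since \<open>X x * X y\<close> is not in it. By hypothesis some coefficient of some maximal minor
  lies outside this prime, so the coefficients have no common zero on the chart.\<close>

lemma minors_content:
  fixes \<phi> :: "'k::alg_closed_field rpoly mat"
  assumes hb: "hilbert_burch n \<phi> g kl cd" and n: "n = Suc c" and ch: "chart_vars x x' y y'"
    and loc: "\<And>\<pp>. primeideal \<pp> (R_ring :: ('k rpoly, 'k rpoly) bg_module) \<Longrightarrow> \<not> B_ideal \<subseteq> \<pp>
      \<Longrightarrow> ht (R_ring :: ('k rpoly, 'k rpoly) bg_module) \<pp> = 2
      \<Longrightarrow> loc_ideal (T_ring n kl ab) (ext_ideal (T_ring n kl ab) \<pp>) (FF_ideal n g kl ab)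
        = loc_ideal (T_ring n kl ab) (ext_ideal (T_ring n kl ab) \<pp>) (emb ` G_ideal n g)"
  shows "\<exists>N. (X x * X y) ^ N \<in> lin_combs {lookup m \<kappa> | m \<kappa>.
    m \<in> max_minor (phi_Psi n \<phi> kl ab) ` {I. I \<subseteq> {..<c + 3} \<and> card I = n}}"
proof (rule chart_nullstellensatz[OF ch])
  let ?M = "max_minor (phi_Psi n \<phi> kl ab) ` {I. I \<subseteq> {..<c + 3} \<and> card I = n}"
  fix f assume "f \<in> {lookup m \<kappa> | m \<kappa>. m \<in> ?M}"
  then show "\<exists>d. f \<in> R_piece d" using max_minor_props(3)[OF hb n] unfolding T_hom_def by blast
next
  let ?M = "max_minor (phi_Psi n \<phi> kl ab) ` {I. I \<subseteq> {..<c + 3} \<and> card I = n}"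
  fix a b :: 'k
  let ?h = "to_point x x' y y' a b" 
  let ?P = "{f. ?h f = 0}"
  interpret R: cring "R_ring :: ('k rpoly, 'k rpoly) bg_module" by (rule cring_of_subring[OF subring_UNIV R_ops(2-5)])
  interpret h: comm_ring_hom ?h by (rule to_point_hom)
  have gen: "X z * X z' \<in> genideal R_ring S" "X z' * X z \<in> genideal R_ring S" if "X z \<in> S" for z z' and S :: "'k rpoly set"
  proof -
    have "ideal (genideal R_ring S) R_ring" by (rule R.genideal_ideal) (simp add: R_ops)
    note I = set_of_ideal[OF R_ops(2-5) this]
    have "X z \<in> genideal R_ring S" using R.genideal_self[of S] that by (auto simp: R_ops)
    then show "X z' * X z \<in> genideal R_ring S" by (intro I(4)) (simp_all add: R_ops)
    then show "X z * X z' \<in> genideal R_ring S" by (simp only: mult.commute)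
  qed
  have "x \<in> {Vs, Vt}" "y \<in> {Vu, Vv}" using ch by (auto simp: chart_vars_def)
  then have "X x * X y \<in> (B_ideal :: 'k rpoly set)" unfolding B_ideal_def by (auto intro: gen)
  moreover have "X z \<noteq> (0 :: 'k rpoly)" for z unfolding X_def by (metis lookup_single_eq lookup_zero one_neq_zero)
  then have "?h (X x * X y) \<noteq> 0" by (simp add: h.hom_mult to_point_var[OF ch])
  ultimately have "\<not> B_ideal \<subseteq> ?P" by blast
  then have "loc_ideal (T_ring n kl ab) (ext_ideal (T_ring n kl ab) ?P) (FF_ideal n g kl ab)
        = loc_ideal (T_ring n kl ab) (ext_ideal (T_ring n kl ab) ?P) (emb ` G_ideal n g)"
    by (intro loc primeideal_kernel[OF to_point_hom] ht_point[OF ch])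
  from ideal_localization_eq_minor[OF hb n to_point_hom this]
  show "\<exists>f\<in>{lookup m \<kappa> | m \<kappa>. m \<in> ?M}. ?h f \<noteq> 0" by blast
qed

section \<open>Exactness up to powers of the chart element\<close>

section \<open>Exactness on the charts\<close>

lemma H_free_of:
  assumes "\<And>\<alpha>. \<alpha> \<in> gen_mons kl ab i j \<Longrightarrow> CV i j \<alpha> \<noteq> v"
  shows "H kl ab j i \<in> free_of v"
  unfolding H_single
proof (rule subring_set_sum[OF subring_free_of])
  fix \<alpha> assume "\<alpha> \<in> gen_mons kl ab i j"
  then show "single (single (CV i j \<alpha>) 1) (single \<alpha> 1) \<in> free_of v"
    by (intro free_of_single) (use assms in \<open>simp add: lookup_single when_def\<close>)
qed

lemma image_up_to_power: "image_up_to d E (q ^ k) z \<Longrightarrow> image_up_to d E q z"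
  unfolding image_up_to_def by (metis power_mult)

lemma cst_sum: "cst (sum f A) = (\<Sum>a\<in>A. cst (f a))"
  by (induction A rule: infinite_finite_induct) (auto simp: single_add)

lemma cst_dvd:
  fixes a b :: "'a::comm_ring_1"
  assumes "a dvd b"
  shows "cst a dvd (cst b :: ('v, 'a) mpoly)"
proof -
  obtain k where "b = a * k" using assms by (elim dvdE)
  then have "(cst b :: ('v, 'a) mpoly) = cst a * cst k" by (simp only: cst_mult)
  then show ?thesis by (rule dvdI)
qed

lemma koszul_regular_cong:
  assumes "\<And>i. i < 3 \<Longrightarrow> F i = F' i"
  shows "koszul_regular q F = koszul_regular q F'"
proof -
  have "F 0 = F' 0" "F 1 = F' 1" "F 2 = F' 2" by (rule assms, simp)+
  moreover have "(\<Sum>i<3. F i * t i) = (\<Sum>i<3. F' i * t i)" for t using assms by simp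
  ultimately show ?thesis unfolding koszul_regular_def by (simp only:)
qed

lemma linear_map_0: "linear_map d \<Longrightarrow> d 0 = 0"
  unfolding linear_map_def by (metis diff_self)

lemma image_up_to_zero: "linear_map d \<Longrightarrow> image_up_to d E 0 z"
  unfolding image_up_to_def
  by (rule exI[of _ 1], rule exI[of _ 0]) (simp add: linear_map_0 poly_mapping_eq_iff fun_eq_iff)

lemma generic_elem_linear:
  assumes r: "r < n" and \<alpha>: "\<alpha> \<in> gen_mons kl ab i r"
  shows "\<exists>F'. generic_elem n g kl ab i = cst (g r * single \<alpha> 1) * var (CV i r \<alpha>) + F' \<and> F' \<in> free_of (CV i r \<alpha>)"
proof -
  let ?t = "\<lambda>\<beta>. single (single (CV i r \<beta>) 1) (single \<beta> 1) :: 'a tpoly"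
  let ?F = "(\<Sum>\<beta>\<in>gen_mons kl ab i r - {\<alpha>}. ?t \<beta>) * cst (g r) + (\<Sum>j\<in>{..<n} - {r}. H kl ab j i * cst (g j))"
  have "generic_elem n g kl ab i = H kl ab r i * cst (g r) + (\<Sum>j\<in>{..<n} - {r}. H kl ab j i * cst (g j))"
    unfolding generic_elem_def emb_cst using r by (subst sum.remove[of _ r]) auto
  also have "H kl ab r i = ?t \<alpha> + (\<Sum>\<beta>\<in>gen_mons kl ab i r - {\<alpha>}. ?t \<beta>)"
    unfolding H_single by (rule sum.remove[OF finite_gen_mons \<alpha>])
  finally have "generic_elem n g kl ab i = ?t \<alpha> * cst (g r) + ?F" by (simp only: distrib_right add.assoc)
  moreover have "?t \<alpha> * cst (g r) = cst (g r * single \<alpha> 1) * var (CV i r \<alpha>)"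
    by (simp add: mult_single mult.commute)
  moreover have "?F \<in> free_of (CV i r \<alpha>)"
  proof (rule subring_setD(3)[OF subring_free_of])
    have "?t \<beta> \<in> free_of (CV i r \<alpha>)" if "\<beta> \<noteq> \<alpha>" for \<beta>
      using that by (intro free_of_single) (simp add: lookup_single when_def)
    then show "(\<Sum>\<beta>\<in>gen_mons kl ab i r - {\<alpha>}. ?t \<beta>) * cst (g r) \<in> free_of (CV i r \<alpha>)"
      by (intro subring_setD(5)[OF subring_free_of] subring_set_sum[OF subring_free_of] free_of_cst) simp
    have "H kl ab j i * cst (g j) \<in> free_of (CV i r \<alpha>)" if "j \<noteq> r" for j
      using that by (intro subring_setD(5)[OF subring_free_of] free_of_cst H_free_of) simp
    then show "(\<Sum>j\<in>{..<n} - {r}. H kl ab j i * cst (g j)) \<in> free_of (CV i r \<alpha>)"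
      by (intro subring_set_sum[OF subring_free_of]) simp
  qed
  ultimately show ?thesis by (intro exI[of _ ?F] conjI) (simp only:)
qed

lemma generic_elem_free_of: "i \<noteq> i' \<Longrightarrow> generic_elem n g kl ab i \<in> free_of (CV i' r \<alpha>)"
  unfolding generic_elem_def emb_cst
  by (intro subring_setD(5)[OF subring_free_of] subring_set_sum[OF subring_free_of] free_of_cst H_free_of) auto

lemma hilbert_burch_syzygy:
  assumes hb: "hilbert_burch n \<phi> g kl cd" and i: "i < n - 1"
  shows "(\<Sum>j<n. g j * \<phi> $$ (j, i)) = 0"
proof -
  let ?v = "vec (n - 1) (\<lambda>k. if k = i then 1 else 0)"
  have dim: "\<phi> \<in> carrier_mat n (n - 1)" using hb by (simp add: hilbert_burch_def)
  have ex: "\<forall>w\<in>carrier_vec n. (\<Sum>j<n. g j * w $ j) = 0 \<longleftrightarrow> (\<exists>v\<in>carrier_vec (n - 1). w = \<phi> *\<^sub>v v)"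
    using hb[unfolded hilbert_burch_def] by (elim conjE)
  have "\<phi> *\<^sub>v ?v \<in> carrier_vec n" using dim by auto
  then have "(\<Sum>j<n. g j * (\<phi> *\<^sub>v ?v) $ j) = 0 \<longleftrightarrow> (\<exists>v\<in>carrier_vec (n - 1). \<phi> *\<^sub>v ?v = \<phi> *\<^sub>v v)" by (rule bspec[OF ex])
  moreover have "\<exists>v\<in>carrier_vec (n - 1). \<phi> *\<^sub>v ?v = \<phi> *\<^sub>v v" by (rule bexI[of _ ?v]) simp_all
  ultimately have "(\<Sum>j<n. g j * (\<phi> *\<^sub>v ?v) $ j) = 0" by (simp only:)
  moreover have "(\<phi> *\<^sub>v ?v) $ j = \<phi> $$ (j, i)" if "j < n" for j
    using that i dim by (auto simp: scalar_prod_def if_distrib[of "\<lambda>x. _ * x"] cong: if_cong)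
  ultimately show ?thesis by simp
qed

lemma hilbert_burch_grade_two:
  fixes \<phi> :: "'k::idom rpoly mat"
  assumes hb: "hilbert_burch n \<phi> g kl cd"
  shows "grade_two n g"
proof -
  have "\<exists>p<n. g p \<noteq> 0" using hilbert_burch_dvd[OF hb, of 0 1] by force
  then show ?thesis using hilbert_burch_dvd[OF hb] unfolding grade_two_def by blast
qed

text \<open>Among the monomials of \<open>H kl ab r i\<close> there is one in \<open>x\<close> and
  \<open>y\<close> alone, because \<open>ab i\<close> dominates \<open>kl r\<close>. Its
  indeterminate occurs in no other generic element, and in its own it has the coefficient
  \<open>g r * X x ^ a i * X y ^ b i\<close>, a divisor of a power of
  \<open>g r * (X x * X y)\<close>.\<close>

lemma generic_koszul_regular:
  fixes \<phi> :: "'k::idom rpoly mat"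
  assumes ch: "chart_vars x x' y y'" and r: "r < n" "g r \<noteq> 0"
    and le: "\<And>i. i < 3 \<Longrightarrow> fst (kl r) \<le> fst (ab i) \<and> snd (kl r) \<le> snd (ab i)"
  shows "\<exists>E>0. koszul_regular (cst ((g r * (X x * X y)) ^ E) :: 'k tpoly) (generic_elem n g kl ab)"
proof -
  define a b where "a i = fst (ab i) - fst (kl r)" and "b i = snd (ab i) - snd (kl r)" for i
  define \<alpha> where "\<alpha> i = single x (a i) + single y (b i)" for i
  \<comment> \<open>One more than the sum of all exponents: it bounds each of them and is positive,
    so that the power is divisible by \<open>g r\<close> as well.\<close>
  define E where "E = Suc (\<Sum>i<3. a i + b i)"
  have mono: "single (\<alpha> i) (1 :: 'k) = X x ^ a i * X y ^ b i" for i
  proof -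
    have "monv var (\<alpha> i) = (var x ^ a i * var y ^ b i :: 'k rpoly)"
      unfolding \<alpha>_def monv_add monv_single ..
    then show ?thesis unfolding X_eq_var using monv_var[of "\<alpha> i", where 'a = 'k] by simp
  qed
  have mem: "\<alpha> i \<in> gen_mons kl ab i r" if "i < 3" for i
    using le[OF that] chart_vars_neq[OF ch]
    by (auto simp: gen_mons_def chart_varsD(3)[OF ch] \<alpha>_def a_def b_def lookup_add lookup_single zdeg_def of_nat_diff)
  have "\<forall>i\<in>{..<3}. \<exists>F'. generic_elem n g kl ab i = cst (g r * single (\<alpha> i) 1) * var (CV i r (\<alpha> i)) + F'
      \<and> F' \<in> free_of (CV i r (\<alpha> i))"
    using generic_elem_linear[OF r(1) mem] by auto
  from bchoice[OF this] obtain F' where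
    F': "\<And>i. i < 3 \<Longrightarrow> generic_elem n g kl ab i = cst (g r * single (\<alpha> i) 1) * var (CV i r (\<alpha> i)) + F' i"
      "\<And>i. i < 3 \<Longrightarrow> F' i \<in> free_of (CV i r (\<alpha> i))" by auto
  have "koszul_regular (cst ((g r * (X x * X y)) ^ E) :: 'k tpoly) (generic_elem n g kl ab)"
  proof (rule koszul_regular_linear[OF F'])
    fix i :: nat assume i: "i < 3"
    have "a i + b i \<le> (\<Sum>i<3. a i + b i)" using i by (intro member_le_sum) auto
    then have le: "a i \<le> E" "b i \<le> E" "1 \<le> E" by (auto simp: E_def)
    have "g r ^ 1 * (X x ^ a i * X y ^ b i) dvd g r ^ E * (X x ^ E * X y ^ E)"
      by (intro mult_dvd_mono le_imp_power_dvd le)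
    then show "g r * single (\<alpha> i) 1 dvd (g r * (X x * X y)) ^ E"
      unfolding mono by (simp add: power_mult_distrib)
    have "single (\<alpha> i) (1 :: 'k) \<noteq> 0" by (metis lookup_single_eq lookup_zero one_neq_zero)
    then show "g r * single (\<alpha> i) 1 \<noteq> 0" using r(2) by simp
  qed (use generic_elem_free_of in auto)
  moreover have "E > 0" by (simp add: E_def)
  ultimately show ?thesis by blast
qed

context
  fixes n c :: nat and \<phi> :: "'k::alg_closed_field rpoly mat" and g :: "nat \<Rightarrow> 'k rpoly"
    and kl ab :: "nat \<Rightarrow> nat \<times> nat" and cd \<xi> \<eta> :: "nat \<Rightarrow> bideg" and x x' y y' :: rvar
  assumes hb: "hilbert_burch n \<phi> g kl cd" and n: "n = Suc c" and ch: "chart_vars x x' y y'"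
    and le: "\<And>i j. i < 3 \<Longrightarrow> j < n \<Longrightarrow> fst (kl j) \<le> fst (ab i) \<and> snd (kl j) \<le> snd (ab i)"
    and content: "\<exists>N. (X x * X y) ^ N \<in> lin_combs {lookup m \<kappa> | m \<kappa>.
      m \<in> max_minor (phi_Psi n \<phi> kl ab) ` {I. I \<subseteq> {..<c + 3} \<and> card I = n}}"
begin

private abbreviation "\<Phi> \<equiv> phi_Psi n \<phi> kl ab"
private abbreviation "dC \<equiv> differential (EN \<Phi> \<xi> \<eta>)"
private abbreviation "C1 \<equiv> en_gens \<Phi> (Suc 0)"
private abbreviation "C2 \<equiv> en_gens \<Phi> (Suc (Suc 0))"
private abbreviation "C3 \<equiv> en_gens \<Phi> (Suc (Suc (Suc 0)))"
private abbreviation "f \<equiv> X x * X y :: 'k rpoly"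

private lemmas N_dims = phi_Psi_dims(1,2)[OF hb n, of ab]

lemma chart_elem_nonzero: "f \<noteq> 0"
proof -
  have "X z \<noteq> (0 :: 'k rpoly)" for z unfolding X_def by (metis lookup_single_eq lookup_zero one_neq_zero)
  then show ?thesis by simp
qed

text \<open>If all maximal minors vanished, their coefficients could not generate a power of the
  nonzero element \<open>f\<close>; one nonzero minor suffices for injectivity.\<close>

lemma EN_third_exact:
  assumes z: "keys z \<subseteq> C3" "dC (Suc (Suc (Suc 0))) z = 0"
  shows "z = 0"
proof -
  have "\<exists>I. I \<subseteq> {..<c + 3} \<and> card I = n \<and> max_minor \<Phi> I \<noteq> 0"
  proof (rule ccontr)
    assume no: "\<not> ?thesis"
    obtain N where N: "f ^ N \<in> lin_combs {lookup m \<kappa> | m \<kappa>. m \<in> max_minor \<Phi> ` {I. I \<subseteq> {..<c + 3} \<and> card I = n}}"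
      using content by blast
    have *: "a = 0" if "a \<in> lin_combs {lookup m \<kappa> | m \<kappa>. m \<in> max_minor \<Phi> ` {I. I \<subseteq> {..<c + 3} \<and> card I = n}}" for a
      using that by (induction) (use no in auto)
    show False using *[OF N] chart_elem_nonzero by simp
  qed
  then obtain I where I: "I \<subseteq> {..<c + 3}" "card I = n" "max_minor \<Phi> I \<noteq> 0" by blast
  show ?thesis
    by (rule EN_H3[OF N_dims n z I(1,2)]) (use I(3) in \<open>simp only: max_minor_props(1)[OF hb n I(1,2)]\<close>, simp)
qed

lemma EN_row_torsion:
  assumes r: "r < n"
  shows "keys z \<subseteq> C2 \<Longrightarrow> dC (Suc (Suc 0)) z = 0 \<Longrightarrow> image_up_to (dC (Suc (Suc (Suc 0)))) C3 (cst (g r * f)) z"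
    "keys z \<subseteq> C1 \<Longrightarrow> dC (Suc 0) z = 0 \<Longrightarrow> image_up_to (dC (Suc (Suc 0))) C2 (cst (g r * f)) z"
proof -
  \<comment> \<open>For \<open>g r = 0\<close> the multiplier is zero, and the exponent one makes
    the claim trivial.\<close>
  have "image_up_to (dC (Suc (Suc (Suc 0)))) C3 (cst (g r * f)) z" if z: "keys z \<subseteq> C2" "dC (Suc (Suc 0)) z = 0" "g r = 0"
    using image_up_to_zero[OF linear_differential] z(3) by simp
  moreover have "image_up_to (dC (Suc (Suc 0))) C2 (cst (g r * f)) z" if z: "keys z \<subseteq> C1" "dC (Suc 0) z = 0" "g r = 0"
    using image_up_to_zero[OF linear_differential] z(3) by simp
  moreover {
    assume gr: "g r \<noteq> 0"
    let ?\<delta> = "det (submatrix \<phi> (- {r}) UNIV)"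
    have \<phi>: "\<phi> \<in> carrier_mat (Suc c) c" using hb n by (simp add: hilbert_burch_def)
    obtain E where E: "E > 0" "koszul_regular (cst ((g r * f) ^ E) :: 'k tpoly) (generic_elem n g kl ab)"
      using generic_koszul_regular[where ab = ab and kl = kl and g = g and n = n, OF ch r gr] le r by blast
    let ?q = "cst ((g r * f) ^ E) :: 'k tpoly"
    obtain v where v: "\<And>j k. j < n \<Longrightarrow> k < n \<Longrightarrow> j \<noteq> r \<Longrightarrow> k \<noteq> r \<Longrightarrow> (\<Sum>i<c. \<phi> $$ (j, i) * v k i) = (if j = k then ?\<delta> else 0)"
      using dual_vectors_other_rows[OF \<phi> r[unfolded n]] unfolding n by blast
    \<comment> \<open>The dual vectors for \<open>\<phi>\<close> without row \<open>r\<close>,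
      extended by zero to the columns of \<open>\<Psi>\<close>, so that they do not see the generic
      entries.\<close>
    define v' :: "nat \<Rightarrow> nat \<Rightarrow> 'k tpoly" where "v' k i = (if i < c then cst (v k i) else 0)" for k i
    have split: "(\<Sum>i<c + 3. h i) = (\<Sum>i<c. h i) + (h c + h (c + 1) + h (c + 2))" for h :: "nat \<Rightarrow> 'k tpoly"
      by (simp add: eval_nat_numeral)
    have dual: "(\<Sum>i<c + 3. \<Phi> $$ (j, i) * v' k i) = (if j = k then cst ?\<delta> else 0)" if jk: "j < n" "k < n" "j \<noteq> r" "k \<noteq> r" for j k
    proof -
      have "(\<Sum>i<c + 3. \<Phi> $$ (j, i) * v' k i) = (\<Sum>i<c. cst (\<phi> $$ (j, i) * v k i))"
        unfolding split using jk(1) by (simp add: v'_def phi_Psi_dims(3)[OF hb n] cst_mult)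
      also have "\<dots> = cst (\<Sum>i<c. \<phi> $$ (j, i) * v k i)"
        by (rule cst_sum[symmetric])
      finally show ?thesis unfolding v[OF jk] by simp
    qed
    have v0: "v' k i = 0" if "k < n" "c \<le> i" "i < c + 3" for k i using that by (simp add: v'_def)
    have b0: "(\<Sum>j<n. cst (g j) * \<Phi> $$ (j, i)) = 0" if i: "i < c" for i
    proof -
      have "(\<Sum>j<n. cst (g j) * \<Phi> $$ (j, i)) = (\<Sum>j<n. cst (g j * \<phi> $$ (j, i)))"
        using i by (intro sum.cong refl) (simp add: phi_Psi_dims(3)[OF hb n] cst_mult)
      also have "\<dots> = cst (\<Sum>j<n. g j * \<phi> $$ (j, i))"
        by (rule cst_sum[symmetric])
      finally show ?thesis using hilbert_burch_syzygy[OF hb] i by (simp add: n)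
    qed
    have "(\<Sum>j<n. cst (g j) * \<Phi> $$ (j, c + i)) = generic_elem n g kl ab i" if "i < 3" for i
      unfolding generic_elem_def emb_cst using that by (intro sum.cong refl) (simp add: phi_Psi_dims(4)[OF hb n] mult.commute)
    then have "koszul_regular ?q (\<lambda>i. \<Sum>j<n. cst (g j) * \<Phi> $$ (j, c + i)) = koszul_regular ?q (generic_elem n g kl ab)"
      by (rule koszul_regular_cong)
    then have reg: "koszul_regular ?q (\<lambda>i. \<Sum>j<n. cst (g j) * \<Phi> $$ (j, c + i))" using E(2) by (simp only:)
    have gq: "g r dvd (g r * f) ^ E" using E(1) by (metis dvd_power dvd_trans dvd_triv_left)
    have dg: "?\<delta> dvd g r"
    proof -
      have "\<exists>e. e dvd 1 \<and> (\<forall>j<n. \<exists>\<epsilon>\<in>{1, -1}. g j = \<epsilon> * e * det (submatrix \<phi> (- {j}) UNIV))"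
        using hb[unfolded hilbert_burch_def] by (elim conjE)
      then show ?thesis using r by (metis dvd_triv_right)
    qed
    note dvd = cst_dvd[OF dvd_trans[OF dg gq]] cst_dvd[OF gq]
    have q0: "?q \<noteq> 0" using gr chart_elem_nonzero by simp
    have "image_up_to (dC (Suc (Suc (Suc 0)))) C3 (cst (g r * f)) z" if "keys z \<subseteq> C2" "dC (Suc (Suc 0)) z = 0"
      by (rule image_up_to_power[where k = E], unfold cst_power[symmetric], rule EN_H2_torsion[OF N_dims n that r dual v0 b0 reg dvd q0])
    moreover have "image_up_to (dC (Suc (Suc 0))) C2 (cst (g r * f)) z" if "keys z \<subseteq> C1" "dC (Suc 0) z = 0"
      by (rule image_up_to_power[where k = E], unfold cst_power[symmetric], rule EN_H1_torsion[OF N_dims n that r dual v0 b0 reg dvd(1)])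
    ultimately have "keys z \<subseteq> C2 \<Longrightarrow> dC (Suc (Suc 0)) z = 0 \<Longrightarrow> image_up_to (dC (Suc (Suc (Suc 0)))) C3 (cst (g r * f)) z"
      "keys z \<subseteq> C1 \<Longrightarrow> dC (Suc 0) z = 0 \<Longrightarrow> image_up_to (dC (Suc (Suc 0))) C2 (cst (g r * f)) z"
      by blast+
  }
  ultimately show "keys z \<subseteq> C2 \<Longrightarrow> dC (Suc (Suc 0)) z = 0 \<Longrightarrow> image_up_to (dC (Suc (Suc (Suc 0)))) C3 (cst (g r * f)) z"
    "keys z \<subseteq> C1 \<Longrightarrow> dC (Suc 0) z = 0 \<Longrightarrow> image_up_to (dC (Suc (Suc 0))) C2 (cst (g r * f)) z" by blast+
qed

lemma EN_second_exact:
  assumes z: "keys z \<subseteq> C2" "dC (Suc (Suc 0)) z = 0"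
  shows "image_up_to (dC (Suc (Suc (Suc 0)))) C3 (cst f) z"
  by (rule chase_second[OF linear_differential EN_third_exact hilbert_burch_grade_two[OF hb] chart_elem_nonzero
      EN_row_torsion(1)[OF _ z]])

lemma EN_first_exact:
  assumes z: "keys z \<subseteq> C1" "dC (Suc 0) z = 0"
  shows "image_up_to (dC (Suc (Suc 0))) C2 (cst f) z"
proof -
  obtain N where N: "f ^ N \<in> lin_combs {lookup m \<kappa> | m \<kappa>. m \<in> max_minor \<Phi> ` {I. I \<subseteq> {..<c + 3} \<and> card I = n}}"
    using content by blast
  show ?thesis
  proof (rule chase_first[OF linear_differential linear_differential EN_third_exact finite_en_gens(3)[OF N_dims] EN_second_exact
      dEN_complex[OF N_dims] keys_dEN[OF N_dims] hilbert_burch_grade_two[OF hb] chart_elem_nonzero EN_row_torsion(2)[OF _ z] _ N])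
    fix m assume "m \<in> max_minor \<Phi> ` {I. I \<subseteq> {..<c + 3} \<and> card I = n}"
    then obtain I where I: "I \<subseteq> {..<c + 3}" "card I = n" "m = max_minor \<Phi> I" by blast
    show "image_up_to (dC (Suc (Suc 0))) C2 m z"
      unfolding I(3) max_minor_props(1)[OF hb n I(1,2)] by (rule EN_H1_minor[OF N_dims n z I(1,2)])
  qed
qed

end

section \<open>Descent to \<open>T\<close> and uniform exponents\<close>

section \<open>The ascending chain condition\<close>

definition ideal_in :: "'a::comm_ring_1 set \<Rightarrow> 'a set \<Rightarrow> bool" where
  "ideal_in K J \<longleftrightarrow> J \<subseteq> K \<and> 0 \<in> J \<and> (\<forall>x\<in>J. \<forall>y\<in>J. x + y \<in> J) \<and> (\<forall>c\<in>K. \<forall>x\<in>J. c * x \<in> J)"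

definition stationary :: "(nat \<Rightarrow> 'a set) \<Rightarrow> bool" where
  "stationary J \<longleftrightarrow> (\<exists>N. \<forall>i\<ge>N. J i = J N)"

text \<open>The chain condition is used directly, since uniform exponents come from stationary
  chains; it is stated for sets because \<open>T\<close> is a subring of a type.\<close>

definition noetherian :: "'a::comm_ring_1 set \<Rightarrow> bool" where
  "noetherian K \<longleftrightarrow> (\<forall>J. (\<forall>i. ideal_in K (J i)) \<and> (\<forall>i. J i \<subseteq> J (Suc i)) \<longrightarrow> stationary J)"

lemma ideal_inD:
  assumes "ideal_in K J"
  shows "J \<subseteq> K" "0 \<in> J" "x \<in> J \<Longrightarrow> y \<in> J \<Longrightarrow> x + y \<in> J" "c \<in> K \<Longrightarrow> x \<in> J \<Longrightarrow> c * x \<in> J"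
  using assms by (auto simp: ideal_in_def)

lemma ideal_in_diff:
  assumes "subring_set K" "ideal_in K J" "x \<in> J" "y \<in> J"
  shows "x - y \<in> J"
proof -
  have "- 1 * y \<in> J" by (rule ideal_inD(4)[OF assms(2) subring_set_uminus[OF assms(1) subring_setD(2)[OF assms(1)]] assms(4)])
  then show ?thesis using ideal_inD(3)[OF assms(2,3)] by fastforce
qed

lemma stationaryI_max: "(\<And>i. i \<ge> N \<Longrightarrow> J i \<subseteq> J N) \<Longrightarrow> (\<And>i. J i \<subseteq> J (Suc i)) \<Longrightarrow> stationary J"
  unfolding stationary_def by (metis lift_Suc_mono_le subset_antisym)

lemma noetherian_image:
  fixes h :: "'a::comm_ring_1 \<Rightarrow> 'b::comm_ring_1"
  assumes K: "noetherian K" "subring_set K" and h: "comm_ring_hom h"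
  shows "noetherian (h ` K)"
  unfolding noetherian_def
proof (intro allI impI, elim conjE)
  fix J assume J: "\<forall>i. ideal_in (h ` K) (J i)" "\<forall>i. J i \<subseteq> J (Suc i)"
  interpret comm_ring_hom h by fact
  note J' = ideal_inD[OF spec[OF J(1)]] and K' = subring_setD[OF K(2)]
  define I where "I i = {x \<in> K. h x \<in> J i}" for i
  have "\<forall>i. ideal_in K (I i)"
    unfolding ideal_in_def I_def using J' K' by (auto simp: hom_add hom_mult)
  moreover have "\<forall>i. I i \<subseteq> I (Suc i)" using J(2) by (auto simp: I_def)
  ultimately have "stationary I" using K(1) by (simp add: noetherian_def)
  moreover have "J i = h ` I i" for i using J'(1)[of i] by (auto simp: I_def)
  ultimately show "stationary J" unfolding stationary_def by metis
qed

lemma noetherian_field: "noetherian (UNIV :: 'k::field set)"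
  unfolding noetherian_def
proof (intro allI impI, elim conjE)
  fix J :: "nat \<Rightarrow> 'k set" assume J: "\<forall>i. ideal_in UNIV (J i)" "\<forall>i. J i \<subseteq> J (Suc i)"
  show "stationary J"
  proof (cases "\<exists>i. J i \<noteq> {0}")
    case True
    then obtain i x where x: "x \<in> J i" "x \<noteq> 0" using ideal_inD(2)[OF spec[OF J(1)]] by blast
    have "z \<in> J i" for z using ideal_inD(4)[OF spec[OF J(1)] UNIV_I x(1), of "z / x"] x(2) by simp
    then have "J k \<subseteq> J i" for k by blast
    then show ?thesis using J(2) by (intro stationaryI_max) simp_all
  next
    case False
    then show ?thesis by (auto simp: stationary_def)
  qed
qed

text \<open>\<open>L i d\<close> collects the coefficients at \<open>d\<close> of the members of
  \<open>J i\<close> of degree at most \<open>d\<close>, and it grows in both indices. The diagonal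
  chain settles all degrees from \<open>s\<close> on, finitely many further chains settle those
  below \<open>s\<close>. A member of a later ideal is then reduced to \<open>J N\<close>
  coefficient by coefficient, from the top.\<close>

lemma hilbert_basis:
  fixes K :: "'a::comm_ring_1 set"
  assumes K: "noetherian K" "subring_set K"
  shows "noetherian (polys_over K)"
  unfolding noetherian_def
proof (intro allI impI, elim conjE)
  fix J assume J: "\<forall>i. ideal_in (polys_over K) (J i)" "\<forall>i. J i \<subseteq> J (Suc i)"
  note J' = ideal_inD[OF spec[OF J(1)]] and K' = subring_setD[OF K(2)]
  have mono: "J i \<subseteq> J k" if "i \<le> k" for i k by (rule lift_Suc_mono_le[of J, OF _ that]) (use J(2) in simp)
  define L where "L i d = {coeff p d | p. p \<in> J i \<and> degree p \<le> d}" for i d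
  have L_ideal: "ideal_in K (L i d)" for i d
    unfolding ideal_in_def
  proof (intro conjI ballI)
    show "L i d \<subseteq> K" using J'(1)[of i] by (auto simp: L_def polys_over_def)
    show "0 \<in> L i d" unfolding L_def using J'(2)[of i] by (intro CollectI exI[of _ 0]) simp
  next
    fix x y assume "x \<in> L i d" "y \<in> L i d"
    then obtain p q where "x = coeff p d" "p \<in> J i" "degree p \<le> d" "y = coeff q d" "q \<in> J i" "degree q \<le> d"
      by (auto simp: L_def)
    then show "x + y \<in> L i d"
      unfolding L_def using J'(3)[of p i q] by (intro CollectI exI[of _ "p + q"]) (auto intro: degree_add_le)
  next
    fix a x assume "a \<in> K" "x \<in> L i d"
    then obtain p where p: "x = coeff p d" "p \<in> J i" "degree p \<le> d" by (auto simp: L_def)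
    have "[:a:] \<in> polys_over K" using \<open>a \<in> K\<close> K'(1) by (auto simp: polys_over_def coeff_pCons split: nat.split)
    then have "smult a p \<in> J i" using J'(4)[of "[:a:]" p i] p by simp
    then show "a * x \<in> L i d"
      unfolding L_def using p by (intro CollectI exI[of _ "smult a p"]) (auto intro: order.trans[OF degree_smult_le])
  qed
  have L_i: "L i d \<subseteq> L k d" if "i \<le> k" for i k d using mono[OF that] by (auto simp: L_def)
  have L_Suc: "L i d \<subseteq> L i (Suc d)" for i d
  proof
    fix x assume "x \<in> L i d"
    then obtain p where p: "x = coeff p d" "p \<in> J i" "degree p \<le> d" by (auto simp: L_def)
    have "[:0, 1:] \<in> polys_over K" using K' by (auto simp: polys_over_def coeff_pCons split: nat.split)
    then have "[:0, 1:] * p \<in> J i" using J'(4)[of "[:0, 1:]" p i] p by blast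
    then have "pCons 0 p \<in> J i" by simp
    then show "x \<in> L i (Suc d)"
      unfolding L_def using p by (intro CollectI exI[of _ "pCons 0 p"]) (auto intro: order.trans[OF degree_pCons_le])
  qed
  have L_mono: "L i d \<subseteq> L k e" if "i \<le> k" "d \<le> e" for i k d e
    using L_i[OF that(1), of d] lift_Suc_mono_le[of "L k", OF L_Suc that(2)] by blast
  have stat: "stationary F" if "\<And>i. ideal_in K (F i)" "\<And>i. F i \<subseteq> F (Suc i)" for F
    using K(1) that by (auto simp: noetherian_def)
  have "L i i \<subseteq> L (Suc i) (Suc i)" for i by (rule L_mono) auto
  from stat[of "\<lambda>i. L i i", OF L_ideal this] have "stationary (\<lambda>i. L i i)" .
  then obtain s where s: "\<And>i. i \<ge> s \<Longrightarrow> L i i = L s s" by (auto simp: stationary_def)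
  have "\<forall>d. \<exists>N. \<forall>i\<ge>N. L i d = L N d"
    using stat[of "\<lambda>i. L i d" for d] L_ideal L_i by (auto simp: stationary_def)
  from choice[OF this] obtain M where M: "\<And>d i. i \<ge> M d \<Longrightarrow> L i d = L (M d) d" by blast
  define N where "N = s + (\<Sum>d<s. M d)"
  have L_N: "L i d = L N d" if i: "i \<ge> N" for i d
  proof (cases "d < s")
    case True
    then have "M d \<le> (\<Sum>d<s. M d)" by (intro member_le_sum) auto
    then show ?thesis using M[of d i] M[of d N] i by (simp add: N_def)
  next
    case False
    have "L i d \<subseteq> L (i + d) (i + d)" by (rule L_mono) auto
    also have "\<dots> = L s s" using i by (intro s) (simp add: N_def)
    also have "\<dots> \<subseteq> L N d" using False by (intro L_mono) (auto simp: N_def)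
    finally show ?thesis using L_i[OF i, of d] by blast
  qed
  have "J i \<subseteq> J N" if i: "i \<ge> N" for i
  proof -
    have "p \<in> J N" if "p \<in> J i" "degree p \<le> d" for p d
      using that
    proof (induction d arbitrary: p)
      case (0 p)
      have "coeff p 0 \<in> L i 0" using 0 by (auto simp: L_def)
      then have "coeff p 0 \<in> L N 0" using L_N[OF i, of 0] by simp
      then obtain q where q: "coeff p 0 = coeff q 0" "q \<in> J N" "degree q \<le> 0" by (auto simp: L_def)
      have "p = q" using q 0 by (metis degree_0_id le_zero_eq)
      then show ?case using q by simp
    next
      case (Suc d p)
      have "coeff p (Suc d) \<in> L i (Suc d)" using Suc.prems by (auto simp: L_def)
      then have "coeff p (Suc d) \<in> L N (Suc d)" using L_N[OF i, of "Suc d"] by simp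
      then obtain q where q: "coeff p (Suc d) = coeff q (Suc d)" "q \<in> J N" "degree q \<le> Suc d" by (auto simp: L_def)
      have "degree (p - q) \<le> d"
      proof (rule degree_le, intro allI impI)
        fix k assume k: "d < k"
        show "coeff (p - q) k = 0"
        proof (cases "k = Suc d")
          case False
          then show ?thesis using k q(3) Suc.prems(2) by (simp add: coeff_eq_0)
        qed (use q in simp)
      qed
      moreover have "p - q \<in> J i"
        using Suc.prems(1) q(2) mono[OF i] by (intro ideal_in_diff[OF subring_polys_over[OF K(2)] spec[OF J(1)]]) auto
      ultimately have "p - q \<in> J N" by (intro Suc.IH)
      then show ?case using J'(3)[of "p - q" N q] q(2) by simp
    qed
    then show ?thesis by blast
  qed
  then show "stationary J" using J(2) by (intro stationaryI_max[of N]) auto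
qed

definition polys_in :: "'v set \<Rightarrow> (('v, 'a::comm_ring_1) mpoly) set" where
  "polys_in V = {f. \<forall>m\<in>keys f. keys m \<subseteq> V}"

lemma subring_polys_in: "subring_set (polys_in V)"
proof -
  have eq: "polys_in V = {f. keys f \<subseteq> {m. keys m \<subseteq> V}}" by (auto simp: polys_in_def)
  show ?thesis unfolding eq by (rule subring_keys) (auto dest!: subsetD[OF Poly_Mapping.keys_add])
qed

text \<open>Adjoining one variable is thus taking the image of a univariate polynomial ring under
  evaluation, to which the Hilbert basis theorem and \<open>noetherian_image\<close> apply.\<close>

lemma polys_in_insert:
  "(polys_in (insert v V) :: (('v, 'a::comm_ring_1) mpoly) set) = (\<lambda>p. poly p (var v)) ` polys_over (polys_in V)"
proof (intro equalityI subsetI)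
  fix f :: "('v, 'a) mpoly" assume f: "f \<in> polys_in (insert v V)"
  note S = subring_polys_over[OF subring_polys_in[of V]]
  have "to_poly v f \<in> polys_over (polys_in V)"
    unfolding to_poly_def evalm_def monv_def
  proof (rule subring_set_sum[OF S], rule subring_setD(5)[OF S], goal_cases)
    case (1 m)
    then show ?case by (auto simp: polys_over_def polys_in_def coeff_pCons split: nat.split)
  next
    case (2 m)
    have "(if x = v then [:0, 1:] else [:var x:]) \<in> (polys_over (polys_in V) :: (('v, 'a) mpoly) poly set)"
      if "x \<in> keys m" for x
      using that 2 f by (auto simp: polys_over_def polys_in_def coeff_pCons split: nat.split)
    then show ?case by (intro subring_set_prod[OF S] subring_set_power[OF S])
  qed
  then show "f \<in> (\<lambda>p. poly p (var v)) ` polys_over (polys_in V)" by (rule image_eqI[where f = "\<lambda>p. poly p (var v)", OF poly_to_poly[symmetric]])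
next
  fix f :: "('v, 'a) mpoly" assume "f \<in> (\<lambda>p. poly p (var v)) ` polys_over (polys_in V)"
  then obtain p where p: "f = poly p (var v)" "p \<in> polys_over (polys_in V)" by blast
  note S = subring_polys_in[of "insert v V"]
  have "coeff p i \<in> polys_in (insert v V)" for i using p(2) by (auto simp: polys_over_def polys_in_def)
  moreover have "var v \<in> (polys_in (insert v V) :: (('v, 'a) mpoly) set)" by (simp add: polys_in_def)
  ultimately show "f \<in> polys_in (insert v V)"
    unfolding p(1) poly_altdef by (intro subring_set_sum[OF S] subring_setD(5)[OF S] subring_set_power[OF S])
qed

lemma noetherian_polys_in:
  fixes V :: "'v set"
  assumes "noetherian (UNIV :: 'a::comm_ring_1 set)" "finite V"
  shows "noetherian (polys_in V :: (('v, 'a) mpoly) set)"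
  using assms(2)
proof induction
  case empty
  have "f \<in> range cst" if "f \<in> polys_in {}" for f :: "('v, 'a) mpoly"
  proof -
    have "keys f \<subseteq> {0}" using that by (auto simp: polys_in_def)
    then have "f = cst (lookup f 0)"
      by (intro poly_mapping_eqI) (auto simp: lookup_single when_def in_keys_iff)
    then show ?thesis by blast
  qed
  moreover have "cst c \<in> polys_in {}" for c :: 'a by (simp add: polys_in_def)
  ultimately have "(polys_in {} :: (('v, 'a) mpoly) set) = range cst" by blast
  then show ?case using noetherian_image[OF assms(1) _ cst_hom] by (simp add: subring_set_def)
next
  case (insert v V)
  have "comm_ring_hom (\<lambda>p :: (('v, 'a) mpoly) poly. poly p (var v))" by standard auto
  then show ?case unfolding polys_in_insert
    by (intro noetherian_image hilbert_basis insert.IH subring_polys_over subring_polys_in)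
qed

lemma noetherian_T: "noetherian (T_carrier n kl ab :: 'k::field tpoly set)"
proof -
  have "(polys_in UNIV :: 'k rpoly set) = UNIV" by (simp add: polys_in_def)
  moreover have "finite (UNIV :: rvar set)" by (subst UNIV_rvar) simp
  ultimately have "noetherian (UNIV :: 'k rpoly set)" using noetherian_polys_in[OF noetherian_field, of "UNIV :: rvar set"] by metis
  moreover have "finite (T_vars n kl ab)"
  proof -
    have "T_vars n kl ab = (\<Union>i<3. \<Union>j<n. CV i j ` gen_mons kl ab i j)" by (auto simp: T_vars_def)
    then show ?thesis by (simp add: finite_gen_mons)
  qed
  ultimately have "noetherian (polys_in (T_vars n kl ab) :: 'k tpoly set)" by (rule noetherian_polys_in)
  then show ?thesis by (simp add: polys_in_def T_carrier_def)
qed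

definition submodule_in :: "'a::comm_ring_1 set \<Rightarrow> 'e set \<Rightarrow> ('e \<Rightarrow> 'a) set \<Rightarrow> bool" where
  "submodule_in K E M \<longleftrightarrow> (\<forall>x\<in>M. \<forall>e. x e \<in> K \<and> (e \<notin> E \<longrightarrow> x e = 0)) \<and> (\<lambda>_. 0) \<in> M
    \<and> (\<forall>x\<in>M. \<forall>y\<in>M. (\<lambda>e. x e + y e) \<in> M) \<and> (\<forall>c\<in>K. \<forall>x\<in>M. (\<lambda>e. c * x e) \<in> M)"

text \<open>Induction on \<open>E\<close>: along a chain, a submodule is determined by its
  projection to one coordinate, an ideal, and by the kernel of that projection.\<close>

lemma submodule_chain_stationary:
  assumes K: "noetherian K" "subring_set K" and E: "finite E"
    and M: "\<And>i. submodule_in K E (M i)" "\<And>i. M i \<subseteq> M (Suc i)"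
  shows "stationary M"
  using E M
proof (induction E arbitrary: M)
  case empty
  have "x = (\<lambda>_. 0)" if "x \<in> M i" for x i using empty(1)[of i] that unfolding submodule_in_def by blast
  moreover have "(\<lambda>_. 0) \<in> M i" for i using empty(1)[of i] by (simp add: submodule_in_def)
  ultimately have "M i = {\<lambda>_. 0}" for i by blast
  then show ?case by (simp add: stationary_def)
next
  case (insert e E)
  note M = insert.prems(1)[unfolded submodule_in_def]
  have mono: "M i \<subseteq> M k" if "i \<le> k" for i k by (rule lift_Suc_mono_le[of M, OF insert.prems(2) that])
  have M_add: "(\<lambda>e. x e + y e) \<in> M i" if "x \<in> M i" "y \<in> M i" for x y i using M[of i] that by blast
  define J where "J i = (\<lambda>x. x e) ` M i" for i
  define L where "L i = {x \<in> M i. x e = 0}" for i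
  have "ideal_in K (J i)" for i
    unfolding ideal_in_def
  proof (intro conjI ballI)
    show "J i \<subseteq> K" "0 \<in> J i" using M[of i] by (force simp: J_def)+
    show "x + y \<in> J i" if "x \<in> J i" "y \<in> J i" for x y using that M[of i] by (force simp: J_def)
    show "c * x \<in> J i" if "c \<in> K" "x \<in> J i" for c x using that M[of i] by (force simp: J_def)
  qed
  moreover have "J i \<subseteq> J (Suc i)" for i using insert.prems(2)[of i] by (auto simp: J_def)
  ultimately have "stationary J" using K(1) by (simp add: noetherian_def)
  moreover have "stationary L"
  proof (rule insert.IH)
    show "submodule_in K E (L i)" for i using M[of i] by (auto simp: submodule_in_def L_def)
    show "L i \<subseteq> L (Suc i)" for i using insert.prems(2)[of i] by (auto simp: L_def)
  qed
  ultimately obtain a b where ab: "\<And>i. i \<ge> a \<Longrightarrow> J i = J a" "\<And>i. i \<ge> b \<Longrightarrow> L i = L b" by (auto simp: stationary_def)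
  have "M i \<subseteq> M (a + b)" if i: "i \<ge> a + b" for i
  proof
    fix x assume x: "x \<in> M i"
    then have "x e \<in> J (a + b)" using ab(1)[of i] ab(1)[of "a + b"] i by (auto simp: J_def)
    then obtain y where y: "y \<in> M (a + b)" "x e = y e" by (auto simp: J_def)
    have "y \<in> M i" using y(1) mono[OF i] by blast
    moreover have "- 1 \<in> K" by (rule subring_set_uminus[OF K(2) subring_setD(2)[OF K(2)]])
    ultimately have "(\<lambda>e. - 1 * y e) \<in> M i" using M[of i] by blast
    then have "(\<lambda>e. x e + - 1 * y e) \<in> M i" by (rule M_add[OF x])
    then have "(\<lambda>e. x e + - 1 * y e) \<in> L i" using y(2) by (simp add: L_def)
    then have "(\<lambda>e. x e + - 1 * y e) \<in> L (a + b)" using ab(2)[of i] ab(2)[of "a + b"] i by simp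
    then have "(\<lambda>e. x e + - 1 * y e) \<in> M (a + b)" by (simp add: L_def)
    then have "(\<lambda>e. (x e + - 1 * y e) + y e) \<in> M (a + b)" using y(1) by (rule M_add)
    then show "x \<in> M (a + b)" by simp
  qed
  then show ?case using insert.prems(2) by (rule stationaryI_max)
qed

section \<open>Retraction onto \<open>T\<close>\<close>

text \<open>A ring homomorphism onto the polynomials in \<open>V\<close> that fixes them. As the
  entries of the differentials are fixed, it carries preimages found in the full polynomial ring to
  preimages over \<open>T\<close>.\<close>

definition retract :: "'v set \<Rightarrow> (('v, 'a::comm_ring_1) mpoly) \<Rightarrow> (('v, 'a) mpoly)" where
  "retract V = evalm cst (\<lambda>v. if v \<in> V then var v else 0)"

lemma retract_hom: "comm_ring_hom (retract V)"
  unfolding retract_def by (rule evalm_hom[OF cst_hom])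

lemma retract_in: "retract V f \<in> polys_in V"
proof -
  note S = subring_polys_in[of V]
  have "(if v \<in> V then var v else 0) \<in> polys_in V" for v by (simp add: polys_in_def)
  moreover have "cst c \<in> polys_in V" for c :: 'b by (simp add: polys_in_def)
  ultimately show ?thesis unfolding retract_def evalm_def monv_def
    by (intro subring_set_sum[OF S] subring_setD(5)[OF S] subring_set_prod[OF S] subring_set_power[OF S])
qed

lemma retract_id:
  fixes f :: "('v, 'a::comm_ring_1) mpoly"
  assumes f: "f \<in> polys_in V"
  shows "retract V f = f"
proof -
  have "cst (lookup f m) * monv (\<lambda>v. if v \<in> V then var v else 0) m = single m (lookup f m)"
    if "m \<in> keys f" for m
  proof -
    have "monv (\<lambda>v. if v \<in> V then var v else 0) m = (monv var m :: ('v, 'a) mpoly)"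
      unfolding monv_def using f that by (intro prod.cong refl) (auto simp: polys_in_def)
    then show ?thesis unfolding monv_var by (simp add: mult_single)
  qed
  then have "retract V f = (\<Sum>m\<in>keys f. single m (lookup f m))"
    unfolding retract_def evalm_def by (intro sum.cong refl)
  then show ?thesis unfolding poly_mapping_sum_singles[of f, symmetric] .
qed

lemma lookup_map_hom: "h 0 = 0 \<Longrightarrow> lookup (Poly_Mapping.map h x) e = h (lookup x e)"
  by (simp add: Poly_Mapping.map.rep_eq when_def)

lemma keys_map_hom: "h 0 = 0 \<Longrightarrow> keys (Poly_Mapping.map h x) \<subseteq> keys x"
  by (auto simp: in_keys_iff lookup_map_hom)

lemma lookup_differential:
  assumes "finite S" "keys x \<subseteq> S" "p \<noteq> 0"
  shows "lookup (differential F p x) k = (\<Sum>e\<in>S. lookup x e * lookup (bd F p e) k)"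
  unfolding differential_superset[OF assms] by (simp add: lookup_sum)

lemma differential_map:
  assumes h: "comm_ring_hom h" and p: "p \<noteq> 0"
    and bd: "\<And>e k. e \<in> keys x \<Longrightarrow> h (lookup (bd F p e) k) = lookup (bd F p e) k"
  shows "differential F p (Poly_Mapping.map h x) = Poly_Mapping.map h (differential F p x)"
proof (rule poly_mapping_eqI)
  interpret comm_ring_hom h by fact
  fix k
  have "lookup (differential F p (Poly_Mapping.map h x)) k
      = (\<Sum>e\<in>keys x. h (lookup x e) * lookup (bd F p e) k)"
    by (subst lookup_differential[OF finite_keys keys_map_hom p]) (simp_all add: lookup_map_hom)
  also have "\<dots> = (\<Sum>e\<in>keys x. h (lookup x e) * h (lookup (bd F p e) k))"
    using bd by (intro sum.cong refl) simp
  also have "\<dots> = h (lookup (differential F p x) k)"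
    by (subst lookup_differential[OF finite_keys order_refl p]) (simp add: hom_sum hom_mult)
  finally show "lookup (differential F p (Poly_Mapping.map h x)) k = lookup (Poly_Mapping.map h (differential F p x)) k"
    by (simp add: lookup_map_hom)
qed

section \<open>Uniform exponents and powers of ideals\<close>

definition submodule_pm :: "'a::comm_ring_1 set \<Rightarrow> 'e set \<Rightarrow> ('e \<Rightarrow>\<^sub>0 'a) set \<Rightarrow> bool" where
  "submodule_pm K E Z \<longleftrightarrow> (\<forall>z\<in>Z. keys z \<subseteq> E \<and> (\<forall>e. lookup z e \<in> K)) \<and> 0 \<in> Z
    \<and> (\<forall>x\<in>Z. \<forall>y\<in>Z. x + y \<in> Z) \<and> (\<forall>c\<in>K. \<forall>x\<in>Z. scale c x \<in> Z)"

lemma submodule_pmD: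
  assumes "submodule_pm K E Z"
  shows "z \<in> Z \<Longrightarrow> keys z \<subseteq> E" "z \<in> Z \<Longrightarrow> lookup z e \<in> K" "0 \<in> Z"
    "x \<in> Z \<Longrightarrow> y \<in> Z \<Longrightarrow> x + y \<in> Z" "c \<in> K \<Longrightarrow> x \<in> Z \<Longrightarrow> scale c x \<in> Z"
  using assms by (auto simp: submodule_pm_def)

lemma scale_add_left: "scale (a + b) x = scale a x + scale b x"
  by (rule poly_mapping_eqI) (simp add: lookup_add distrib_right)

text \<open>The submodules of those \<open>z\<close> for which \<open>scale (c ^ i) z\<close> lies
  in \<open>B\<close> ascend with \<open>i\<close> and exhaust \<open>Z\<close>, so one of them is
  all of \<open>Z\<close>.\<close>

lemma uniform_exponent:
  fixes K :: "'a::comm_ring_1 set" and E :: "'e set"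
  assumes K: "noetherian K" "subring_set K" and E: "finite E" and Z: "submodule_pm K E Z" and B: "submodule_pm K E' B"
    and c: "c \<in> K" and ex: "\<And>z. z \<in> Z \<Longrightarrow> \<exists>i. scale (c ^ i) z \<in> B"
  shows "\<exists>N. \<forall>z\<in>Z. scale (c ^ N) z \<in> B"
proof -
  note Z' = submodule_pmD[OF Z] and B' = submodule_pmD[OF B]
  define Y where "Y i = {z \<in> Z. scale (c ^ i) z \<in> B}" for i
  define M where "M i = lookup ` Y i" for i
  have "submodule_in K E (M i)" for i
    unfolding submodule_in_def
  proof (intro conjI ballI allI impI)
    fix f e assume "f \<in> M i"
    then obtain z where z: "f = lookup z" "z \<in> Z" by (auto simp: M_def Y_def)
    show "f e \<in> K" using Z'(2)[OF z(2)] z(1) by simp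
    show "f e = 0" if "e \<notin> E" using Z'(1)[OF z(2)] that z(1) by (auto simp: in_keys_iff)
  next
    have "0 \<in> Y i" using Z'(3) B'(3) by (simp add: Y_def) (metis scale_right_diff diff_self)
    then show "(\<lambda>_. 0) \<in> M i" unfolding M_def by (intro image_eqI[of _ _ 0]) auto
  next
    fix f f' assume "f \<in> M i" "f' \<in> M i"
    then obtain z z' where z: "f = lookup z" "z \<in> Y i" "f' = lookup z'" "z' \<in> Y i" by (auto simp: M_def)
    then have "z + z' \<in> Y i" using Z'(4) B'(4) by (auto simp: Y_def scale_right_add)
    then show "(\<lambda>e. f e + f' e) \<in> M i" unfolding M_def z by (intro image_eqI[of _ _ "z + z'"]) (auto simp: lookup_add)
  next
    fix a f assume a: "a \<in> K" "f \<in> M i"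
    then obtain z where z: "f = lookup z" "z \<in> Y i" by (auto simp: M_def)
    have "scale (c ^ i) (scale a z) = scale a (scale (c ^ i) z)" by (simp add: scale_scale mult.commute)
    then have "scale a z \<in> Y i" using Z'(5)[OF a(1)] B'(5)[OF a(1)] z(2) by (simp add: Y_def)
    then show "(\<lambda>e. a * f e) \<in> M i" unfolding M_def z by (intro image_eqI[of _ _ "scale a z"]) auto
  qed
  moreover have "M i \<subseteq> M (Suc i)" for i
  proof -
    have "scale (c ^ Suc i) z = scale c (scale (c ^ i) z)" for z :: "'e \<Rightarrow>\<^sub>0 'a" by (simp add: scale_scale)
    then have "Y i \<subseteq> Y (Suc i)" using B'(5)[OF c] by (auto simp: Y_def simp del: power_Suc)
    then show ?thesis by (auto simp: M_def)
  qed
  ultimately have "stationary M" by (rule submodule_chain_stationary[OF K E])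
  then obtain N where N: "\<And>i. i \<ge> N \<Longrightarrow> M i = M N" by (auto simp: stationary_def)
  have "scale (c ^ N) z \<in> B" if z: "z \<in> Z" for z
  proof -
    obtain i where i: "scale (c ^ i) z \<in> B" using ex[OF z] by blast
    have "c ^ N \<in> K" by (rule subring_set_power[OF K(2) c])
    then have "scale (c ^ (N + i)) z \<in> B" using B'(5)[OF _ i, of "c ^ N"] by (simp add: scale_scale power_add)
    then have "lookup z \<in> M (N + i)" using z by (auto simp: M_def Y_def)
    then have "lookup z \<in> M N" using N[of "N + i"] by simp
    then obtain z' where "z' \<in> Y N" "lookup z = lookup z'" by (auto simp: M_def)
    then show ?thesis by (simp add: Y_def lookup_inject)
  qed
  then show ?thesis by blast
qed

text \<open>A pigeonhole argument by induction on \<open>M\<close>: splitting off a generator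
  \<open>f e\<close> replaces \<open>I\<close> by the elements that \<open>f e\<close> multiplies
  into \<open>I\<close>, and there the exponent required at \<open>e\<close> is smaller by
  one.\<close>

lemma ideal_pow_subset:
  fixes A :: "('a::comm_ring_1, 'z) ring_scheme" and f :: "'e \<Rightarrow> 'a"
  assumes K: "subring_set (carrier A)" and ops: "monoid.mult A = (*)" "add A = (+)"
    and S: "finite S" "\<And>e. e \<in> S \<Longrightarrow> f e \<in> carrier A" "S \<noteq> {}"
    and J: "\<And>x. x \<in> J \<Longrightarrow> \<exists>c. (\<forall>e\<in>S. c e \<in> carrier A) \<and> x = (\<Sum>e\<in>S. c e * f e)"
    and I: "ideal_in (carrier A) I" "\<And>e. e \<in> S \<Longrightarrow> f e ^ N e \<in> I" "sum N S \<le> M"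
  shows "ideal_pow A J M \<subseteq> I"
  using I
proof (induction M arbitrary: I N)
  case (0 I N)
  obtain e where e: "e \<in> S" using S(3) by blast
  then have "N e = 0" using 0(3) S(1) by simp
  then have "1 \<in> I" using 0(2)[OF e] by simp
  then show ?case using ideal_inD(4)[OF 0(1), of _ 1] by (auto simp: ideal_pow_def)
next
  case (Suc M I N)
  note I = ideal_inD[OF Suc.prems(1)] and K' = subring_setD[OF K]
  have step: "f e * b \<in> I" if e: "e \<in> S" and b: "b \<in> ideal_pow A J M" for e b
  proof (cases "N e")
    case 0
    then have "1 \<in> I" using Suc.prems(2)[OF e] by simp
    then have "b \<in> I" using Suc.IH[of I "\<lambda>_. 0"] Suc.prems(1) b by auto
    then show ?thesis using I(4) S(2)[OF e] by blast
  next
    case k: (Suc k)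
    define I' where "I' = {x \<in> carrier A. f e * x \<in> I}"
    have "ideal_in (carrier A) I'"
      unfolding ideal_in_def I'_def using I K' S(2)[OF e] by (auto simp: distrib_left mult.left_commute[of "f e"])
    moreover have "f e' ^ (N(e := k)) e' \<in> I'" if e': "e' \<in> S" for e'
    proof (cases "e' = e")
      case True
      then show ?thesis
        using Suc.prems(2)[OF e] k subring_set_power[OF K S(2)[OF e], of k] by (simp add: I'_def)
    next
      case False
      then show ?thesis
        using Suc.prems(2)[OF e'] subring_set_power[OF K S(2)[OF e'], of "N e'"] I(4)[OF S(2)[OF e]] by (simp add: I'_def)
    qed
    moreover have "sum (N(e := k)) S \<le> M"
    proof -
      have "sum N S = Suc k + sum N (S - {e})" using S(1) e k by (simp add: sum.remove)
      moreover have "sum (N(e := k)) S = k + sum (N(e := k)) (S - {e})" using S(1) e by (simp add: sum.remove)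
      moreover have "sum (N(e := k)) (S - {e}) = sum N (S - {e})" by (rule sum.cong) auto
      ultimately show ?thesis using Suc.prems(3) by simp
    qed
    ultimately have "b \<in> I'" using Suc.IH b by blast
    then show ?thesis by (simp add: I'_def)
  qed
  have "x \<in> I" if "x \<in> ideal_prod A J (ideal_pow A J M)" for x
    using that
  proof induction
    case (prod a b)
    obtain c where c: "\<And>e. e \<in> S \<Longrightarrow> c e \<in> carrier A" "a = (\<Sum>e\<in>S. c e * f e)" using J[OF prod(1)] by blast
    have "a * b = (\<Sum>e\<in>S. c e * (f e * b))" by (simp add: c(2) sum_distrib_right mult.assoc)
    moreover have "sum h T \<in> I" if "\<And>e. e \<in> T \<Longrightarrow> h e \<in> I" for h and T :: "'e set"
      using that by (induction T rule: infinite_finite_induct) (auto intro: I)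
    ultimately show ?case using I(4) c(1) step prod(2) by (simp add: ops)
  qed (use I in \<open>simp add: ops\<close>)
  then show ?case by (auto simp: ideal_pow_def)
qed

lemma T_piece: "piece (T_ring n kl ab) d = T_carrier n kl ab \<inter> T_hom d"
  by (auto simp: T_ring_def T_hom_def)

lemma sum_closed:
  assumes "0 \<in> J" "\<And>x y. x \<in> J \<Longrightarrow> y \<in> J \<Longrightarrow> x + y \<in> J" "\<And>i. i \<in> A \<Longrightarrow> h i \<in> J"
  shows "sum h A \<in> J"
  using assms(3) by (induction A rule: infinite_finite_induct) (auto intro: assms(1,2))

text \<open>Both intersected ideals are monomial, so every monomial of \<open>f\<close> contains a
  variable from each of the two pairs.\<close>

lemma B_ideal_mem:
  assumes "f \<in> B_ideal" "m \<in> keys f"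
  shows "\<exists>e\<in>charts. 0 < lookup m (fst e) \<and> 0 < lookup m (snd e)"
proof -
  interpret R: cring "R_ring :: ('a rpoly, 'a rpoly) bg_module" by (rule cring_of_subring[OF subring_UNIV R_ops(2-5)])
  have "\<exists>x\<in>W. 0 < lookup m x" if f: "f \<in> genideal R_ring (X ` W)" "m \<in> keys f"
    for f :: "'a rpoly" and W m
  proof -
    let ?I = "{f :: 'a rpoly. \<forall>m\<in>keys f. \<exists>x\<in>W. 0 < lookup m x}"
    have "ideal ?I R_ring"
    proof (rule ideal_of_set[OF subring_UNIV R_ops(2-5)])
      fix c f :: "'a rpoly" assume f: "f \<in> ?I"
      show "c * f \<in> ?I"
      proof (rule CollectI, rule ballI)
        fix m assume "m \<in> keys (c * f)"
        then obtain a b where ab: "m = a + b" "b \<in> keys f" using keys_mult[of c f] by auto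
        then obtain x where "x \<in> W" "0 < lookup b x" using f by blast
        then show "\<exists>x\<in>W. 0 < lookup m x" by (intro bexI[of _ x]) (simp_all add: ab lookup_add)
      qed
    next
      fix f g :: "'a rpoly" assume "f \<in> ?I" "g \<in> ?I"
      then show "f + g \<in> ?I" using Poly_Mapping.keys_add[of f g] by blast
    qed (simp_all add: R_ops)
    moreover have "X ` W \<subseteq> ?I"
    proof (rule image_subsetI)
      fix x assume "x \<in> W"
      then show "X x \<in> ?I" by (auto simp: X_def intro!: bexI[of _ x])
    qed
    ultimately have "genideal R_ring (X ` W) \<subseteq> ?I" by (rule R.genideal_minimal)
    then show ?thesis using f by blast
  qed
  from this[of f "{Vs, Vt}" m] this[of f "{Vu, Vv}" m] assms show ?thesis
    by (auto simp: B_ideal_def charts_def)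
qed

lemma ext_B_ideal_mem:
  fixes b :: "'k::comm_ring_1 tpoly"
  assumes "b \<in> ext_ideal (T_ring n kl ab) B_ideal"
  shows "\<exists>c. (\<forall>e\<in>charts. c e \<in> T_carrier n kl ab) \<and> b = (\<Sum>e\<in>charts. c e * chart_elem e)"
proof -
  interpret T: cring "T_ring n kl ab :: ('k tpoly, 'k tpoly) bg_module" by (rule cring_T)
  note K = subring_setD[OF subring_T_carrier[where 'a = 'k and n = n and kl = kl and ab = ab]]
  let ?I = "{b :: 'k tpoly. \<exists>c. (\<forall>e\<in>charts. c e \<in> T_carrier n kl ab) \<and> b = (\<Sum>e\<in>charts. c e * chart_elem e)}"
  have fin: "finite charts" by (simp add: charts_def)
  have id: "ideal ?I (T_ring n kl ab)"
  proof (rule ideal_of_set)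
    show "?I \<subseteq> carrier (T_ring n kl ab)"
      by (auto simp: T_ops chart_elem_def emb_cst intro!: subring_set_sum[OF subring_T_carrier] K(5) cst_T)
    show "0 \<in> ?I" using K(1) by (intro CollectI exI[of _ "\<lambda>_. 0"]) simp
  next
    fix x y :: "'k tpoly" assume "x \<in> ?I" "y \<in> ?I"
    then obtain c c' where "\<forall>e\<in>charts. c e \<in> T_carrier n kl ab" "x = (\<Sum>e\<in>charts. c e * chart_elem e)"
      "\<forall>e\<in>charts. c' e \<in> T_carrier n kl ab" "y = (\<Sum>e\<in>charts. c' e * chart_elem e)" by blast
    then show "x + y \<in> ?I" by (intro CollectI exI[of _ "\<lambda>e. c e + c' e"]) (auto simp: K distrib_right sum.distrib)
  next
    fix a x :: "'k tpoly" assume "a \<in> carrier (T_ring n kl ab)" "x \<in> ?I"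
    then obtain c where "a \<in> T_carrier n kl ab" "\<forall>e\<in>charts. c e \<in> T_carrier n kl ab" "x = (\<Sum>e\<in>charts. c e * chart_elem e)"
      by (auto simp: T_ops)
    then show "a * x \<in> ?I" by (intro CollectI exI[of _ "\<lambda>e. a * c e"]) (auto simp: K sum_distrib_left mult.assoc)
  qed (simp_all add: T_ops subring_T_carrier)
  note I = set_of_ideal[OF T_ops(2-5) id]
  have "emb f \<in> ?I" if f: "f \<in> B_ideal" for f :: "'k rpoly"
  proof -
    have "emb (single m (lookup f m)) \<in> ?I" if m: "m \<in> keys f" for m
    proof -
      obtain x y where xy: "(x, y) \<in> charts" "0 < lookup m x" "0 < lookup m y"
        using B_ideal_mem[OF f m] by auto
      have "x \<noteq> y" using xy(1) by (auto simp: charts_def)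
      define m' where "m' = m - (single x 1 + single y 1)"
      have "m = m' + (single x 1 + single y 1)"
        by (rule poly_mapping_eqI) (use xy \<open>x \<noteq> y\<close> in \<open>auto simp: m'_def lookup_add lookup_minus lookup_single when_def\<close>)
      then have "single m (lookup f m) = single m' (lookup f m) * (X x * X y)"
        by (simp add: X_def mult_single del: One_nat_def)
      then have eq: "emb (single m (lookup f m)) = cst (single m' (lookup f m)) * chart_elem (x, y)"
        by (simp add: chart_elem_def emb_cst cst_mult)
      have "chart_elem (x, y) = (\<Sum>e\<in>charts. (if e = (x, y) then 1 else 0) * chart_elem e :: 'k tpoly)"
        using xy(1) fin by (simp add: if_distrib[of "\<lambda>t. t * _"] cong: if_cong)
      then have "chart_elem (x, y) \<in> ?I" using K(1,2) by (intro CollectI exI[of _ "\<lambda>e. if e = (x, y) then 1 else 0"]) simp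
      then show ?thesis unfolding eq by (intro I(4)) (simp_all add: T_ops cst_T)
    qed
    then have "(\<Sum>m\<in>keys f. emb (single m (lookup f m))) \<in> ?I"
      by (intro sum_closed[where J = ?I] I(2,3))
    then show ?thesis unfolding emb_cst cst_sum[symmetric] poly_mapping_sum_singles[of f, symmetric] .
  qed
  then have "ext_ideal (T_ring n kl ab) B_ideal \<subseteq> ?I" unfolding ext_ideal_def by (intro T.genideal_minimal[OF id]) blast
  then show ?thesis using assms by blast
qed

section \<open>Bidegrees, saturation and homology\<close>

section \<open>The Eagon--Northcott complex is bigraded\<close>

text \<open>The inner sum of \<open>en_deg\<close> adds \<open>\<eta> j\<close> once more than the
  exponent says; lowering the exponent at \<open>j\<close> removes exactly one copy.\<close>

lemma en_deg_step:
  assumes "finite I" "i \<in> I" "j \<in> keys \<nu>" "j < dim_row \<alpha>"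
  shows "en_deg \<alpha> \<xi> \<eta> (Suc (Suc p)) (I, \<nu>) - en_deg \<alpha> \<xi> \<eta> (Suc p) (I - {i}, \<nu> - pm1 j) = \<xi> i - \<eta> j"
proof -
  let ?S = "\<lambda>\<nu> j. \<Sum>_\<le>lookup \<nu> j. \<eta> j"
  have fin: "finite {..<dim_row \<alpha>}" and j: "j \<in> {..<dim_row \<alpha>}" using assms by auto
  have 1: "sum \<xi> I = \<xi> i + sum \<xi> (I - {i})" using assms by (simp add: sum.remove)
  have "lookup \<nu> j = Suc (lookup (\<nu> - pm1 j) j)"
    using assms(3) by (simp add: lookup_minus in_keys_iff)
  then have 2: "?S \<nu> j = ?S (\<nu> - pm1 j) j + \<eta> j" by simp
  have "(\<Sum>k\<in>{..<dim_row \<alpha>} - {j}. ?S \<nu> k) = (\<Sum>k\<in>{..<dim_row \<alpha>} - {j}. ?S (\<nu> - pm1 j) k)"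
    by (rule sum.cong) (auto simp: lookup_minus lookup_single when_def)
  then have "(\<Sum>k<dim_row \<alpha>. ?S \<nu> k) = (\<Sum>k<dim_row \<alpha>. ?S (\<nu> - pm1 j) k) + \<eta> j"
    unfolding sum.remove[OF fin j] using 2 by simp
  then show ?thesis using 1 by (simp add: en_deg_def)
qed

section \<open>Quotient modules and saturation\<close>

definition coset :: "'m::ab_group_add set \<Rightarrow> 'm \<Rightarrow> 'm set" where
  "coset N x = (\<lambda>h. h + x) ` N"

lemma coset_eq_iff:
  assumes N: "0 \<in> N" "\<And>x y. x \<in> N \<Longrightarrow> y \<in> N \<Longrightarrow> x + y \<in> N" "\<And>x. x \<in> N \<Longrightarrow> - x \<in> N"
  shows "coset N x = coset N y \<longleftrightarrow> x - y \<in> N"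
proof
  assume "coset N x = coset N y"
  moreover have "x \<in> coset N x" unfolding coset_def using N(1) by (intro image_eqI[of _ _ 0]) simp_all
  ultimately show "x - y \<in> N" by (auto simp: coset_def)
next
  assume d: "x - y \<in> N"
  then have "y - x \<in> N" using N(3)[OF d] by simp
  moreover have "coset N a \<subseteq> coset N b" if "a - b \<in> N" for a b
    unfolding coset_def using N(2) that by (auto intro!: image_eqI[of _ _ "_ + (a - b)"])
  ultimately show "coset N x = coset N y" using d by blast
qed

context
  fixes M :: "('a, 'm::ab_group_add) bg_module" and N :: "'m set" and K :: "'a set"
  assumes add: "add M = (+)"
    and N: "0 \<in> N" "\<And>x y. x \<in> N \<Longrightarrow> y \<in> N \<Longrightarrow> x + y \<in> N" "\<And>x. x \<in> N \<Longrightarrow> - x \<in> N"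
    and sm: "\<And>r x y. r \<in> K \<Longrightarrow> r \<odot>\<^bsub>M\<^esub> (x + y) = r \<odot>\<^bsub>M\<^esub> x + r \<odot>\<^bsub>M\<^esub> y" "\<And>r x. r \<in> K \<Longrightarrow> x \<in> N \<Longrightarrow> r \<odot>\<^bsub>M\<^esub> x \<in> N"
begin

lemma a_r_coset_eq: "N +>\<^bsub>M\<^esub> x = coset N x"
  by (auto simp: a_r_coset_def' add coset_def)

lemma quot_mod_simps:
  "carrier (quot_mod M N) = coset N ` carrier M" "zero (quot_mod M N) = N" "coset N 0 = N"
  "piece (quot_mod M N) d = coset N ` piece M d"
  by (auto simp: quot_mod_def A_RCOSETS_def' a_r_coset_eq coset_def)

lemma quot_mod_add: "coset N x \<oplus>\<^bsub>quot_mod M N\<^esub> coset N y = coset N (x + y)"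
proof -
  have "coset N x \<oplus>\<^bsub>quot_mod M N\<^esub> coset N y = {(h + x) + (k + y) | h k. h \<in> N \<and> k \<in> N}"
    by (auto simp: quot_mod_def set_add_def' add coset_def)
  also have "\<dots> = coset N (x + y)"
  proof (intro equalityI subsetI)
    fix z assume "z \<in> {(h + x) + (k + y) | h k. h \<in> N \<and> k \<in> N}"
    then obtain h k where "z = (h + k) + (x + y)" "h \<in> N" "k \<in> N" by (auto simp: algebra_simps)
    then show "z \<in> coset N (x + y)" using N(2) by (auto simp: coset_def)
  next
    fix z assume "z \<in> coset N (x + y)"
    then obtain h where "z = (h + x) + (0 + y)" "h \<in> N" by (auto simp: coset_def algebra_simps)
    then show "z \<in> {(h + x) + (k + y) | h k. h \<in> N \<and> k \<in> N}" using N(1) by blast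
  qed
  finally show ?thesis .
qed

lemma quot_mod_smult: "r \<in> K \<Longrightarrow> r \<odot>\<^bsub>quot_mod M N\<^esub> coset N x = coset N (r \<odot>\<^bsub>M\<^esub> x)"
proof -
  assume r: "r \<in> K"
  have "coset N (r \<odot>\<^bsub>M\<^esub> x') = coset N (r \<odot>\<^bsub>M\<^esub> x)" if x': "x' \<in> coset N x" for x'
  proof -
    obtain h where "x' = h + x" "h \<in> N" using x' by (auto simp: coset_def)
    then have "r \<odot>\<^bsub>M\<^esub> x' - r \<odot>\<^bsub>M\<^esub> x \<in> N" using sm[OF r] by simp
    then show ?thesis by (simp only: coset_eq_iff[OF N])
  qed
  moreover have "coset N x \<noteq> {}" using N(1) by (auto simp: coset_def)
  ultimately show ?thesis by (auto simp: quot_mod_def a_r_coset_eq)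
qed

end

lemma quot_mod_iso:
  fixes M :: "('a, 'm::ab_group_add) bg_module" and M' :: "('a, 'n::ab_group_add) bg_module"
  assumes add: "add M = (+)" "add M' = (+)"
    and N: "0 \<in> N" "\<And>x y. x \<in> N \<Longrightarrow> y \<in> N \<Longrightarrow> x + y \<in> N" "\<And>x. x \<in> N \<Longrightarrow> - x \<in> N" "N \<subseteq> carrier M"
    and sm: "\<And>r x y. r \<in> carrier A \<Longrightarrow> r \<odot>\<^bsub>M\<^esub> (x + y) = r \<odot>\<^bsub>M\<^esub> x + r \<odot>\<^bsub>M\<^esub> y" "\<And>r x. r \<in> carrier A \<Longrightarrow> x \<in> N \<Longrightarrow> r \<odot>\<^bsub>M\<^esub> x \<in> N"
      "\<And>r x y. r \<in> carrier A \<Longrightarrow> r \<odot>\<^bsub>M'\<^esub> (x + y) = r \<odot>\<^bsub>M'\<^esub> x + r \<odot>\<^bsub>M'\<^esub> y"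
    and car: "\<And>x y. x \<in> carrier M \<Longrightarrow> y \<in> carrier M \<Longrightarrow> x - y \<in> carrier M"
    and \<theta>: "\<And>x y. \<theta> (x + y) = \<theta> x + \<theta> y" "\<And>r x. \<theta> (r \<odot>\<^bsub>M\<^esub> x) = r \<odot>\<^bsub>M'\<^esub> \<theta> x" "bij_betw \<theta> (carrier M) (carrier M')"
      "\<And>d. \<theta> ` piece M d = piece M' d"
  shows "bg_iso A (quot_mod M N) (quot_mod M' (\<theta> ` N))"
proof -
  have \<theta>0: "\<theta> 0 = 0" using \<theta>(1)[of 0 0] by simp
  have \<theta>m: "\<theta> (- x) = - \<theta> x" for x using \<theta>(1)[of x "- x"] \<theta>0 by (simp add: minus_unique)
  have N': "0 \<in> \<theta> ` N" "\<And>x y. x \<in> \<theta> ` N \<Longrightarrow> y \<in> \<theta> ` N \<Longrightarrow> x + y \<in> \<theta> ` N" "\<And>x. x \<in> \<theta> ` N \<Longrightarrow> - x \<in> \<theta> ` N"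
    using N \<theta>0 by (force simp flip: \<theta>(1) \<theta>m)+
  have smN': "\<And>r x. r \<in> carrier A \<Longrightarrow> x \<in> \<theta> ` N \<Longrightarrow> r \<odot>\<^bsub>M'\<^esub> x \<in> \<theta> ` N"
    using sm(2) by (auto simp flip: \<theta>(2))
  have Q: "carrier (quot_mod M N) = coset N ` carrier M" "piece (quot_mod M N) d = coset N ` piece M d"
    "coset N x \<oplus>\<^bsub>quot_mod M N\<^esub> coset N y = coset N (x + y)"
    "r \<in> carrier A \<Longrightarrow> r \<odot>\<^bsub>quot_mod M N\<^esub> coset N x = coset N (r \<odot>\<^bsub>M\<^esub> x)"
    "coset N x = coset N y \<longleftrightarrow> x - y \<in> N" for d x y r
    by (rule quot_mod_simps[where K = "carrier A", OF add(1) N(1-3) sm(1,2)] quot_mod_add[where K = "carrier A", OF add(1) N(1-3) sm(1,2)]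
      quot_mod_smult[where K = "carrier A", OF add(1) N(1-3) sm(1,2)] coset_eq_iff[OF N(1-3)]; assumption)+
  have Q': "carrier (quot_mod M' (\<theta> ` N)) = coset (\<theta> ` N) ` carrier M'" "piece (quot_mod M' (\<theta> ` N)) d = coset (\<theta> ` N) ` piece M' d"
    "coset (\<theta> ` N) a \<oplus>\<^bsub>quot_mod M' (\<theta> ` N)\<^esub> coset (\<theta> ` N) b = coset (\<theta> ` N) (a + b)"
    "r \<in> carrier A \<Longrightarrow> r \<odot>\<^bsub>quot_mod M' (\<theta> ` N)\<^esub> coset (\<theta> ` N) a = coset (\<theta> ` N) (r \<odot>\<^bsub>M'\<^esub> a)"
    "coset (\<theta> ` N) a = coset (\<theta> ` N) b \<longleftrightarrow> a - b \<in> \<theta> ` N" for d a b r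
    by (rule quot_mod_simps[where K = "carrier A", OF add(2) N' sm(3) smN'] quot_mod_add[where K = "carrier A", OF add(2) N' sm(3) smN']
      quot_mod_smult[where K = "carrier A", OF add(2) N' sm(3) smN'] coset_eq_iff[OF N']; assumption)+
  have im: "(`) \<theta> (coset N x) = coset (\<theta> ` N) (\<theta> x)" for x
    by (simp add: coset_def image_image \<theta>(1))
  show ?thesis
    unfolding bg_iso_def
  proof (intro exI[of _ "(`) \<theta>"] conjI ballI allI)
    show "bij_betw ((`) \<theta>) (carrier (quot_mod M N)) (carrier (quot_mod M' (\<theta> ` N)))"
      unfolding bij_betw_def
    proof
      show "inj_on ((`) \<theta>) (carrier (quot_mod M N))"
      proof (rule inj_onI)
        fix X Y assume "X \<in> carrier (quot_mod M N)" "Y \<in> carrier (quot_mod M N)" and eq: "\<theta> ` X = \<theta> ` Y"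
        then obtain x y where xy: "x \<in> carrier M" "X = coset N x" "y \<in> carrier M" "Y = coset N y" by (auto simp: Q(1))
        have "coset (\<theta> ` N) (\<theta> x) = coset (\<theta> ` N) (\<theta> y)" using eq unfolding xy im .
        then have "\<theta> x - \<theta> y \<in> \<theta> ` N" by (rule iffD1[OF Q'(5)])
        moreover have "\<theta> x - \<theta> y = \<theta> (x - y)" using \<theta>(1)[of x "- y"] \<theta>m by simp
        ultimately obtain h where h: "h \<in> N" "\<theta> (x - y) = \<theta> h" by auto
        then have "x - y = h" using \<theta>(3) car[OF xy(1,3)] N(4) by (auto simp: bij_betw_def inj_on_def)
        then have "x - y \<in> N" using h by simp
        then have "coset N x = coset N y" by (rule iffD2[OF Q(5)])
        then show "X = Y" by (simp only: xy)
      qed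
      have "carrier M' = \<theta> ` carrier M" using \<theta>(3) by (simp add: bij_betw_def)
      then show "(`) \<theta> ` carrier (quot_mod M N) = carrier (quot_mod M' (\<theta> ` N))"
        unfolding Q(1) Q'(1) by (simp only: image_image im)
    qed
    show "\<theta> ` (X \<oplus>\<^bsub>quot_mod M N\<^esub> Y) = \<theta> ` X \<oplus>\<^bsub>quot_mod M' (\<theta> ` N)\<^esub> \<theta> ` Y"
      if XY: "X \<in> carrier (quot_mod M N)" "Y \<in> carrier (quot_mod M N)" for X Y
    proof -
      obtain x y where xy: "X = coset N x" "Y = coset N y" using XY by (auto simp: Q(1))
      show ?thesis unfolding xy Q(3) im Q'(3) \<theta>(1) ..
    qed
    show "\<theta> ` (r \<odot>\<^bsub>quot_mod M N\<^esub> X) = r \<odot>\<^bsub>quot_mod M' (\<theta> ` N)\<^esub> \<theta> ` X"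
      if r: "r \<in> carrier A" and X: "X \<in> carrier (quot_mod M N)" for r X
    proof -
      obtain x where x: "X = coset N x" using X by (auto simp: Q(1))
      show ?thesis unfolding x Q(4)[OF r] im Q'(4)[OF r] \<theta>(2) ..
    qed
    show "(`) \<theta> ` piece (quot_mod M N) d = piece (quot_mod M' (\<theta> ` N)) d" for d
      unfolding Q(2) Q'(2) \<theta>(4)[symmetric] by (simp only: image_image im)
  qed
qed

text \<open>A fraction is a set of pairs, so an isomorphism \<open>h\<close> acts on fractions by
  taking images under \<open>map_prod h id\<close>. All the sets concerned lie in
  \<open>carrier P \<times> carrier A\<close>, where this is injective; hence it respects the
  charts, the operations and the gluing condition.\<close>

lemma sat_mod_iso:
  fixes P :: "('k::comm_ring_1 tpoly, 'm) bg_module" and Q :: "('k tpoly, 'n) bg_module"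
  assumes iso: "bg_iso A P Q"
    and P: "\<And>x y. x \<in> carrier P \<Longrightarrow> y \<in> carrier P \<Longrightarrow> x \<oplus>\<^bsub>P\<^esub> y \<in> carrier P"
      "\<And>r x. r \<in> carrier A \<Longrightarrow> x \<in> carrier P \<Longrightarrow> r \<odot>\<^bsub>P\<^esub> x \<in> carrier P" "\<And>d. piece P d \<subseteq> carrier P"
    and A: "\<And>x y. x \<in> carrier A \<Longrightarrow> y \<in> carrier A \<Longrightarrow> x \<otimes>\<^bsub>A\<^esub> y \<in> carrier A" "\<And>e. powers A (chart_elem e) \<subseteq> carrier A"
  shows "bg_iso A (sat_mod A P) (sat_mod A Q)"
proof -
  obtain h where h: "bij_betw h (carrier P) (carrier Q)"
    "\<And>x y. x \<in> carrier P \<Longrightarrow> y \<in> carrier P \<Longrightarrow> h (x \<oplus>\<^bsub>P\<^esub> y) = h x \<oplus>\<^bsub>Q\<^esub> h y"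
    "\<And>r x. r \<in> carrier A \<Longrightarrow> x \<in> carrier P \<Longrightarrow> h (r \<odot>\<^bsub>P\<^esub> x) = r \<odot>\<^bsub>Q\<^esub> h x"
    "\<And>d. h ` piece P d = piece Q d"
    using iso by (auto simp: bg_iso_def)
  have inj: "h x = h y \<longleftrightarrow> x = y" if "x \<in> carrier P" "y \<in> carrier P" for x y
    using h(1) that by (auto simp: bij_betw_def inj_on_def)
  have car_Q: "carrier Q = h ` carrier P" using h(1) by (simp add: bij_betw_def)
  define \<Phi> where "\<Phi> = (`) (map_prod h (id :: 'k tpoly \<Rightarrow> _))"
  let ?U = "\<lambda>X. X \<subseteq> carrier P \<times> carrier A"
  have \<Phi>_inj: "X = Y" if "?U X" "?U Y" "\<Phi> X = \<Phi> Y" for X Y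
  proof -
    have "inj_on (map_prod h (id :: 'k tpoly \<Rightarrow> _)) (carrier P \<times> carrier A)" by (auto simp: inj_on_def inj)
    then show ?thesis using that unfolding \<Phi>_def by (simp only: inj_on_image_eq_iff)
  qed
  have frU: "?U (fraction A S P m s)" if "S \<subseteq> carrier A" for S m s using that by (auto simp: fraction_def)
  have fr: "\<Phi> (fraction A S P m s) = fraction A S Q (h m) s" if "S \<subseteq> carrier A" "m \<in> carrier P" "s \<in> carrier A" for S m s
  proof -
    have eq: "w \<odot>\<^bsub>Q\<^esub> (s' \<odot>\<^bsub>Q\<^esub> h m) = w \<odot>\<^bsub>Q\<^esub> (s \<odot>\<^bsub>Q\<^esub> h m') \<longleftrightarrow> w \<odot>\<^bsub>P\<^esub> (s' \<odot>\<^bsub>P\<^esub> m) = w \<odot>\<^bsub>P\<^esub> (s \<odot>\<^bsub>P\<^esub> m')"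
      if "w \<in> S" "s' \<in> S" "m' \<in> carrier P" for w s' m'
    proof -
      have c: "w \<in> carrier A" "s' \<in> carrier A" using that \<open>S \<subseteq> carrier A\<close> by auto
      show ?thesis using inj[of "w \<odot>\<^bsub>P\<^esub> (s' \<odot>\<^bsub>P\<^esub> m)" "w \<odot>\<^bsub>P\<^esub> (s \<odot>\<^bsub>P\<^esub> m')"] c that(3) \<open>m \<in> carrier P\<close> \<open>s \<in> carrier A\<close>
        by (simp add: h(3) P(2))
    qed
    show ?thesis
    proof (intro equalityI subsetI)
      fix z assume "z \<in> \<Phi> (fraction A S P m s)"
      then show "z \<in> fraction A S Q (h m) s" using eq by (fastforce simp: \<Phi>_def fraction_def car_Q)
    next
      fix z assume "z \<in> fraction A S Q (h m) s"
      then obtain m' s' w where z: "z = (h m', s')" "m' \<in> carrier P" "s' \<in> S" "w \<in> S"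
        "w \<odot>\<^bsub>Q\<^esub> (s' \<odot>\<^bsub>Q\<^esub> h m) = w \<odot>\<^bsub>Q\<^esub> (s \<odot>\<^bsub>Q\<^esub> h m')" by (auto simp: fraction_def car_Q)
      then have "(m', s') \<in> fraction A S P m s" using eq by (auto simp: fraction_def)
      then show "z \<in> \<Phi> (fraction A S P m s)" unfolding \<Phi>_def z by (intro image_eqI[of _ _ "(m', s')"]) auto
    qed
  qed
  let ?S = "\<lambda>e. powers A (chart_elem e)"
  let ?LP = "\<lambda>e. loc_elem A (chart_elem e) P" and ?LQ = "\<lambda>e. loc_elem A (chart_elem e) Q"
  have UP: "?U X" if "X \<in> carrier (?LP e)" for X e using that frU[OF A(2)[of e]] by (fastforce simp: loc_elem_def Let_def)
  have carL: "carrier (?LQ e) = \<Phi> ` carrier (?LP e)" for e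
  proof -
    have "carrier (?LQ e) = {fraction A (?S e) Q (h m) s | m s. m \<in> carrier P \<and> s \<in> ?S e}"
      by (auto simp: loc_elem_def Let_def car_Q)
    also have "\<dots> = {\<Phi> (fraction A (?S e) P m s) | m s. m \<in> carrier P \<and> s \<in> ?S e}"
      using fr[OF A(2)] A(2) by (metis (no_types, opaque_lifting) subsetD)
    finally show ?thesis by (auto simp: loc_elem_def Let_def)
  qed
  have pieceL: "piece (?LQ e) d = \<Phi> ` piece (?LP e) d" for e d
  proof -
    have pw: "chart_elem e [^]\<^bsub>A\<^esub> (k :: nat) \<in> carrier A" for k using A(2)[of e] by (auto simp: powers_def)
    have "piece (?LQ e) d = {fraction A (?S e) Q (h m) (chart_elem e [^]\<^bsub>A\<^esub> k) | m (k :: nat). m \<in> piece P (d + (int k, int k))}"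
      by (auto simp: loc_elem_def Let_def h(4)[symmetric])
    also have "\<dots> = {\<Phi> (fraction A (?S e) P m (chart_elem e [^]\<^bsub>A\<^esub> k)) | m (k :: nat). m \<in> piece P (d + (int k, int k))}"
    proof -
      have "fraction A (?S e) Q (h m) (chart_elem e [^]\<^bsub>A\<^esub> k) = \<Phi> (fraction A (?S e) P m (chart_elem e [^]\<^bsub>A\<^esub> k))"
        if "m \<in> piece P (d + (int k, int k))" for m and k :: nat
        by (rule fr[OF A(2) subsetD[OF P(3) that] pw, symmetric])
      then show ?thesis by (intro Collect_cong ex_cong1) auto
    qed
    finally show ?thesis by (auto simp: loc_elem_def Let_def)
  qed
  have addL: "\<Phi> (X \<oplus>\<^bsub>?LP e\<^esub> Y) = \<Phi> X \<oplus>\<^bsub>?LQ e\<^esub> \<Phi> Y" if "?U X" "?U Y" for X Y e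
  proof -
    have "\<Phi> (X \<oplus>\<^bsub>?LP e\<^esub> Y) = (\<Union>(m, s)\<in>X. \<Union>(m', s')\<in>Y. \<Phi> (fraction A (?S e) P (s' \<odot>\<^bsub>P\<^esub> m \<oplus>\<^bsub>P\<^esub> s \<odot>\<^bsub>P\<^esub> m') (s \<otimes>\<^bsub>A\<^esub> s')))"
      by (simp add: loc_elem_def Let_def fraction_add_def \<Phi>_def image_UN split_beta)
    also have "\<dots> = (\<Union>(m, s)\<in>X. \<Union>(m', s')\<in>Y. fraction A (?S e) Q (s' \<odot>\<^bsub>Q\<^esub> h m \<oplus>\<^bsub>Q\<^esub> s \<odot>\<^bsub>Q\<^esub> h m') (s \<otimes>\<^bsub>A\<^esub> s'))"
    proof (intro SUP_cong refl, clarify)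
      fix m s assume ms: "(m, s) \<in> X"
      have "(\<Union>(m', s')\<in>Y. \<Phi> (fraction A (?S e) P (s' \<odot>\<^bsub>P\<^esub> m \<oplus>\<^bsub>P\<^esub> s \<odot>\<^bsub>P\<^esub> m') (s \<otimes>\<^bsub>A\<^esub> s')))
          = (\<Union>(m', s')\<in>Y. fraction A (?S e) Q (s' \<odot>\<^bsub>Q\<^esub> h m \<oplus>\<^bsub>Q\<^esub> s \<odot>\<^bsub>Q\<^esub> h m') (s \<otimes>\<^bsub>A\<^esub> s'))"
      proof (intro SUP_cong refl, clarify)
        fix m' s' assume "(m', s') \<in> Y"
        then have c: "m \<in> carrier P" "s \<in> carrier A" "m' \<in> carrier P" "s' \<in> carrier A" using ms that by auto
        then show "\<Phi> (fraction A (?S e) P (s' \<odot>\<^bsub>P\<^esub> m \<oplus>\<^bsub>P\<^esub> s \<odot>\<^bsub>P\<^esub> m') (s \<otimes>\<^bsub>A\<^esub> s'))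
            = fraction A (?S e) Q (s' \<odot>\<^bsub>Q\<^esub> h m \<oplus>\<^bsub>Q\<^esub> s \<odot>\<^bsub>Q\<^esub> h m') (s \<otimes>\<^bsub>A\<^esub> s')"
          by (subst fr[OF A(2)]) (auto intro: P A(1) simp: h(2,3) P)
      qed
      then show "(\<Union>(m', s')\<in>Y. \<Phi> (fraction A (?S e) P (s' \<odot>\<^bsub>P\<^esub> m \<oplus>\<^bsub>P\<^esub> s \<odot>\<^bsub>P\<^esub> m') (s \<otimes>\<^bsub>A\<^esub> s')))
          = (\<Union>(m', s')\<in>Y. fraction A (?S e) Q (s' \<odot>\<^bsub>Q\<^esub> h m \<oplus>\<^bsub>Q\<^esub> s \<odot>\<^bsub>Q\<^esub> h m') (s \<otimes>\<^bsub>A\<^esub> s'))" .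
    qed
    also have "\<dots> = \<Phi> X \<oplus>\<^bsub>?LQ e\<^esub> \<Phi> Y"
      by (simp add: loc_elem_def Let_def fraction_add_def \<Phi>_def split_beta)
    finally show ?thesis .
  qed
  have smL: "\<Phi> (r \<odot>\<^bsub>?LP e\<^esub> X) = r \<odot>\<^bsub>?LQ e\<^esub> \<Phi> X" if r: "r \<in> carrier A" and X: "?U X" for r X e
  proof -
    have "\<Phi> (r \<odot>\<^bsub>?LP e\<^esub> X) = (\<Union>(m, s)\<in>X. \<Phi> (fraction A (?S e) P (r \<odot>\<^bsub>P\<^esub> m) s))"
      by (simp add: loc_elem_def Let_def \<Phi>_def image_UN split_beta)
    also have "\<dots> = (\<Union>(m, s)\<in>X. fraction A (?S e) Q (r \<odot>\<^bsub>Q\<^esub> h m) s)"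
    proof (intro SUP_cong refl, clarify)
      fix m s assume "(m, s) \<in> X"
      then have c: "m \<in> carrier P" "s \<in> carrier A" using X by auto
      show "\<Phi> (fraction A (?S e) P (r \<odot>\<^bsub>P\<^esub> m) s) = fraction A (?S e) Q (r \<odot>\<^bsub>Q\<^esub> h m) s"
        by (subst fr[OF A(2)]) (use r c in \<open>auto intro: P simp: h(3)\<close>)
    qed
    also have "\<dots> = r \<odot>\<^bsub>?LQ e\<^esub> \<Phi> X" by (simp add: loc_elem_def Let_def \<Phi>_def split_beta)
    finally show ?thesis .
  qed
  have ov: "overlap A e e' \<subseteq> carrier A" for e e' using A(2)[of e] A(2)[of e'] A(1) by (auto simp: overlap_def)
  define \<Psi> where "\<Psi> \<sigma> = (\<lambda>e\<in>charts. \<Phi> (\<sigma> e))" for \<sigma> :: "rvar \<times> rvar \<Rightarrow> ('m \<times> 'k tpoly) set"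
  \<comment> \<open>Overlaps are multiplicative sets inside \<open>carrier A\<close> too, so the
    same translation of fractions applies to them.\<close>
  have glue_iff: "(\<forall>e\<in>charts. \<forall>e'\<in>charts. \<forall>(m, s)\<in>\<Psi> \<sigma> e. \<forall>(m', s')\<in>\<Psi> \<sigma> e'.
        fraction A (overlap A e e') Q m s = fraction A (overlap A e e') Q m' s')
      \<longleftrightarrow> (\<forall>e\<in>charts. \<forall>e'\<in>charts. \<forall>(m, s)\<in>\<sigma> e. \<forall>(m', s')\<in>\<sigma> e'.
        fraction A (overlap A e e') P m s = fraction A (overlap A e e') P m' s')"
    if \<sigma>: "\<And>e. e \<in> charts \<Longrightarrow> ?U (\<sigma> e)" for \<sigma>
  proof -
    have "fraction A (overlap A e e') Q (h m) s = fraction A (overlap A e e') Q (h m') s'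
        \<longleftrightarrow> fraction A (overlap A e e') P m s = fraction A (overlap A e e') P m' s'"
      if "e \<in> charts" "e' \<in> charts" "(m, s) \<in> \<sigma> e" "(m', s') \<in> \<sigma> e'" for e e' m s m' s'
    proof -
      have c: "m \<in> carrier P" "s \<in> carrier A" "m' \<in> carrier P" "s' \<in> carrier A" using that \<sigma> by blast+
      show ?thesis unfolding fr[OF ov c(1,2), symmetric] fr[OF ov c(3,4), symmetric]
        by (intro iffI arg_cong[where f = \<Phi>]) (rule \<Phi>_inj[OF frU[OF ov] frU[OF ov]])
    qed
    then show ?thesis unfolding \<Psi>_def \<Phi>_def by (simp add: split_beta ball_simps)
  qed
  have carP: "\<sigma> \<in> carrier (sat_mod A P) \<longleftrightarrow> \<sigma> \<in> (\<Pi>\<^sub>E e\<in>charts. carrier (?LP e)) \<and> (\<forall>e\<in>charts. \<forall>e'\<in>charts. \<forall>(m, s)\<in>\<sigma> e. \<forall>(m', s')\<in>\<sigma> e'.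
        fraction A (overlap A e e') P m s = fraction A (overlap A e e') P m' s')" for \<sigma>
    by (simp add: sat_mod_def Let_def)
  have carQ: "\<sigma> \<in> carrier (sat_mod A Q) \<longleftrightarrow> \<sigma> \<in> (\<Pi>\<^sub>E e\<in>charts. carrier (?LQ e)) \<and> (\<forall>e\<in>charts. \<forall>e'\<in>charts. \<forall>(m, s)\<in>\<sigma> e. \<forall>(m', s')\<in>\<sigma> e'.
        fraction A (overlap A e e') Q m s = fraction A (overlap A e e') Q m' s')" for \<sigma>
    by (simp add: sat_mod_def Let_def)
  have \<sigma>U: "?U (\<sigma> e)" if "\<sigma> \<in> carrier (sat_mod A P)" "e \<in> charts" for \<sigma> e
    using that UP unfolding carP by blast
  have \<Psi>_mem: "\<Psi> \<sigma> \<in> carrier (sat_mod A Q)" if "\<sigma> \<in> carrier (sat_mod A P)" for \<sigma>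
    using that glue_iff[OF \<sigma>U[OF that]] unfolding carP carQ by (auto simp: \<Psi>_def carL)
  \<comment> \<open>The last clause records uniqueness on each chart; it is what allows
    bihomogeneous sections to be lifted to bihomogeneous ones.\<close>
  have \<Psi>_surj: "\<exists>\<sigma>\<in>carrier (sat_mod A P). \<Psi> \<sigma> = \<tau> \<and> (\<forall>e\<in>charts. \<forall>Y\<in>carrier (?LP e). \<tau> e = \<Phi> Y \<longrightarrow> \<sigma> e = Y)" if \<tau>: "\<tau> \<in> carrier (sat_mod A Q)" for \<tau>
  proof -
    have "\<forall>e\<in>charts. \<exists>Y. Y \<in> carrier (?LP e) \<and> \<tau> e = \<Phi> Y" using \<tau> unfolding carQ carL by blast
    from bchoice[OF this] obtain \<rho> where \<rho>: "\<And>e. e \<in> charts \<Longrightarrow> \<rho> e \<in> carrier (?LP e)" "\<And>e. e \<in> charts \<Longrightarrow> \<tau> e = \<Phi> (\<rho> e)" by blast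
    define \<sigma> where "\<sigma> = restrict \<rho> charts"
    have \<sigma>: "\<And>e. e \<in> charts \<Longrightarrow> ?U (\<sigma> e)" using UP[OF \<rho>(1)] by (simp add: \<sigma>_def)
    have "\<tau> \<in> extensional charts" using \<tau> unfolding carQ by (auto simp: PiE_def)
    then have eq: "\<Psi> \<sigma> = \<tau>" using \<rho>(2) by (auto simp: \<Psi>_def \<sigma>_def extensional_def restrict_def fun_eq_iff)
    have "\<sigma> \<in> (\<Pi>\<^sub>E e\<in>charts. carrier (?LP e))" using \<rho>(1) by (auto simp: \<sigma>_def)
    then have "\<sigma> \<in> carrier (sat_mod A P)" using \<tau> glue_iff[of \<sigma>, OF \<sigma>] unfolding eq carP carQ by blast
    moreover have "\<sigma> e = Y" if "e \<in> charts" "Y \<in> carrier (?LP e)" "\<tau> e = \<Phi> Y" for e Y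
      using \<Phi>_inj[OF \<sigma>[OF that(1)] UP[OF that(2)]] that(1,3) \<rho>(2) by (simp add: \<sigma>_def)
    ultimately show ?thesis using eq by blast
  qed
  show ?thesis
    unfolding bg_iso_def
  proof (intro exI[of _ \<Psi>] conjI ballI allI)
    show "bij_betw \<Psi> (carrier (sat_mod A P)) (carrier (sat_mod A Q))"
      unfolding bij_betw_def
    proof
      show "inj_on \<Psi> (carrier (sat_mod A P))"
      proof (rule inj_onI)
        fix \<sigma> \<tau> assume st: "\<sigma> \<in> carrier (sat_mod A P)" "\<tau> \<in> carrier (sat_mod A P)" "\<Psi> \<sigma> = \<Psi> \<tau>"
        show "\<sigma> = \<tau>"
        proof (rule PiE_ext)
          show "\<sigma> \<in> (\<Pi>\<^sub>E e\<in>charts. carrier (?LP e))" "\<tau> \<in> (\<Pi>\<^sub>E e\<in>charts. carrier (?LP e))" using st unfolding carP by auto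
          show "\<sigma> e = \<tau> e" if "e \<in> charts" for e
            using fun_cong[OF st(3), of e] that by (intro \<Phi>_inj \<sigma>U st) (simp_all add: \<Psi>_def)
        qed
      qed
      show "\<Psi> ` carrier (sat_mod A P) = carrier (sat_mod A Q)" using \<Psi>_mem \<Psi>_surj by blast
    qed
    show "\<Psi> (\<sigma> \<oplus>\<^bsub>sat_mod A P\<^esub> \<tau>) = \<Psi> \<sigma> \<oplus>\<^bsub>sat_mod A Q\<^esub> \<Psi> \<tau>"
      if "\<sigma> \<in> carrier (sat_mod A P)" "\<tau> \<in> carrier (sat_mod A P)" for \<sigma> \<tau>
    proof -
      have "\<Phi> (\<sigma> e \<oplus>\<^bsub>?LP e\<^esub> \<tau> e) = \<Phi> (\<sigma> e) \<oplus>\<^bsub>?LQ e\<^esub> \<Phi> (\<tau> e)" if "e \<in> charts" for e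
        by (rule addL[OF \<sigma>U \<sigma>U]) fact+
      then show ?thesis by (simp add: sat_mod_def Let_def \<Psi>_def fun_eq_iff restrict_def)
    qed
    show "\<Psi> (r \<odot>\<^bsub>sat_mod A P\<^esub> \<sigma>) = r \<odot>\<^bsub>sat_mod A Q\<^esub> \<Psi> \<sigma>"
      if "r \<in> carrier A" "\<sigma> \<in> carrier (sat_mod A P)" for r \<sigma>
    proof -
      have "\<Phi> (r \<odot>\<^bsub>?LP e\<^esub> \<sigma> e) = r \<odot>\<^bsub>?LQ e\<^esub> \<Phi> (\<sigma> e)" if "e \<in> charts" for e
        by (rule smL[OF _ \<sigma>U]) fact+
      then show ?thesis by (simp add: sat_mod_def Let_def \<Psi>_def fun_eq_iff restrict_def)
    qed
    show "\<Psi> ` piece (sat_mod A P) d = piece (sat_mod A Q) d" for d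
    proof -
      have pP: "\<sigma> \<in> piece (sat_mod A P) d \<longleftrightarrow> \<sigma> \<in> carrier (sat_mod A P) \<and> (\<forall>e\<in>charts. \<sigma> e \<in> piece (?LP e) d)" for \<sigma>
        by (simp add: sat_mod_def Let_def)
      have pQ: "\<sigma> \<in> piece (sat_mod A Q) d \<longleftrightarrow> \<sigma> \<in> carrier (sat_mod A Q) \<and> (\<forall>e\<in>charts. \<sigma> e \<in> piece (?LQ e) d)" for \<sigma>
        by (simp add: sat_mod_def Let_def)
      have sub: "piece (?LP e) d \<subseteq> carrier (?LP e)" for e
      proof
        fix Y assume "Y \<in> piece (?LP e) d"
        then obtain m and k :: nat where "Y = fraction A (?S e) P m (chart_elem e [^]\<^bsub>A\<^esub> k)" "m \<in> piece P (d + (int k, int k))"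
          by (auto simp: loc_elem_def Let_def)
        moreover have "chart_elem e [^]\<^bsub>A\<^esub> k \<in> ?S e" by (auto simp: powers_def)
        moreover have "m \<in> carrier P" using P(3) calculation(2) by (rule subsetD)
        ultimately show "Y \<in> carrier (?LP e)" unfolding loc_elem_def Let_def by auto
      qed
      show ?thesis
      proof (intro equalityI subsetI)
        fix \<tau> assume "\<tau> \<in> \<Psi> ` piece (sat_mod A P) d"
        then show "\<tau> \<in> piece (sat_mod A Q) d" unfolding pQ pieceL using \<Psi>_mem by (auto simp: pP \<Psi>_def)
      next
        fix \<tau> assume \<tau>: "\<tau> \<in> piece (sat_mod A Q) d"
        obtain \<sigma> where \<sigma>: "\<sigma> \<in> carrier (sat_mod A P)" "\<Psi> \<sigma> = \<tau>" "\<And>e Y. e \<in> charts \<Longrightarrow> Y \<in> carrier (?LP e) \<Longrightarrow> \<tau> e = \<Phi> Y \<Longrightarrow> \<sigma> e = Y"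
          using \<Psi>_surj[OF conjunct1[OF iffD1[OF pQ \<tau>]]] by meson
        have "\<sigma> e \<in> piece (?LP e) d" if "e \<in> charts" for e
        proof -
          have "\<tau> e \<in> \<Phi> ` piece (?LP e) d" using iffD1[OF pQ \<tau>] that unfolding pieceL by simp
          then obtain Y where Y: "\<tau> e = \<Phi> Y" "Y \<in> piece (?LP e) d" by (rule imageE)
          have "\<sigma> e = Y" by (rule \<sigma>(3)[OF that subsetD[OF sub Y(2)] Y(1)])
          then show ?thesis using Y(2) by simp
        qed
        then show "\<tau> \<in> \<Psi> ` piece (sat_mod A P) d" using \<sigma>(1,2) pP by blast
      qed
    qed
  qed
qed

section \<open>Homology of the Eagon--Northcott complex\<close>

lemma linear_map_add: "linear_map d \<Longrightarrow> d (x + y) = d x + d y"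
  by (metis add_diff_cancel_right' diff_add_cancel linear_map_def)

context
  fixes n c :: nat and \<phi> :: "'k::alg_closed_field rpoly mat" and g :: "nat \<Rightarrow> 'k rpoly"
    and kl ab :: "nat \<Rightarrow> nat \<times> nat" and cd :: "nat \<Rightarrow> bideg"
  assumes hb: "hilbert_burch n \<phi> g kl cd" and n: "n = Suc c"
    and le: "\<And>i j. i < 3 \<Longrightarrow> j < n \<Longrightarrow> fst (kl j) \<le> fst (ab i) \<and> snd (kl j) \<le> snd (ab i)"
    and loc: "\<And>\<pp>. primeideal \<pp> (R_ring :: ('k rpoly, 'k rpoly) bg_module) \<Longrightarrow> \<not> B_ideal \<subseteq> \<pp>
      \<Longrightarrow> ht (R_ring :: ('k rpoly, 'k rpoly) bg_module) \<pp> = 2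
      \<Longrightarrow> loc_ideal (T_ring n kl ab) (ext_ideal (T_ring n kl ab) \<pp>) (FF_ideal n g kl ab)
        = loc_ideal (T_ring n kl ab) (ext_ideal (T_ring n kl ab) \<pp>) (emb ` G_ideal n g)"
begin

private abbreviation "\<alpha> \<equiv> phi_Psi n \<phi> kl ab"
private abbreviation "\<xi> \<equiv> phi_Psi_deg n cd ab"
private abbreviation "\<eta> \<equiv> \<lambda>j. zdeg (kl j)"
private abbreviation "T \<equiv> T_ring n kl ab :: ('k tpoly, 'k tpoly) bg_module"
private abbreviation "K \<equiv> T_carrier n kl ab :: 'k tpoly set"
private abbreviation "F \<equiv> EN \<alpha> \<xi> \<eta>"
private abbreviation "d \<equiv> differential F"
private abbreviation "cycles p \<equiv> {z \<in> carrier (term_mod T F p). d p z = 0}"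
private abbreviation "boundaries p \<equiv> d (Suc p) ` carrier (term_mod T F (Suc p))"

private lemmas dims = phi_Psi_dims(1,2)[OF hb n, of ab]
private lemmas sK = subring_T_carrier[where 'a = 'k and n = n and kl = kl and ab = ab]
private lemmas K = subring_setD[OF sK]

lemma en_bd_mem:
  assumes e: "e \<in> en_gens \<alpha> (Suc p)"
  shows "keys (en_bd \<alpha> (Suc p) e) \<subseteq> en_gens \<alpha> p"
    "lookup (en_bd \<alpha> (Suc p) e) e' \<in> T_carrier n kl ab \<inter> T_hom (en_deg \<alpha> \<xi> \<eta> (Suc p) e - en_deg \<alpha> \<xi> \<eta> p e')"
proof -
  obtain I \<nu> where e_eq: "e = (I, \<nu>)" by (cases e)
  note K = subring_setD[OF subring_T_carrier[where 'a = 'k and n = n and kl = kl and ab = ab]]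
  have I: "I \<subseteq> {..<c + 3}" "card I = n + p" "keys \<nu> \<subseteq> {..<n}" using e en_gens_Suc[OF dims] e_eq by auto
  then have fin: "finite I" using finite_subset by blast
  show "keys (en_bd \<alpha> (Suc p) e) \<subseteq> en_gens \<alpha> p"
  proof (cases p)
    case 0
    then show ?thesis by (auto simp: e_eq en_bd_def en_gens_def)
  next
    case (Suc p')
    have "differential F (Suc p) (single e 1) = en_bd \<alpha> (Suc p) e"
      by (simp add: differential_def EN_def)
    then show ?thesis using keys_dEN[OF dims, of "single e 1" p' \<xi> \<eta>] e Suc by simp
  qed
  show "lookup (en_bd \<alpha> (Suc p) e) e' \<in> T_carrier n kl ab \<inter> T_hom (en_deg \<alpha> \<xi> \<eta> (Suc p) e - en_deg \<alpha> \<xi> \<eta> p e')"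
  proof (cases p)
    case 0
    then have "\<nu> = 0" using e en_gens_1[OF dims] e_eq by auto
    moreover have "en_deg \<alpha> \<xi> \<eta> (Suc 0) (I, 0) = sum \<xi> I - (\<Sum>j<n. \<eta> j)" by (simp add: en_deg_def dims)
    ultimately show ?thesis using 0 max_minor_props(2,3)[OF hb n I(1)] I(2) K(1)
      by (auto simp: e_eq en_bd_def lookup_single when_def en_deg_def[of _ _ _ 0])
  next
    case (Suc p')
    let ?s = "\<lambda>j i. lookup (single (I - {i}, \<nu> - pm1 j) ((-1) ^ card {i'\<in>I. i' < i} * \<alpha> $$ (j, i))) e'"
    let ?d = "en_deg \<alpha> \<xi> \<eta> (Suc p) e - en_deg \<alpha> \<xi> \<eta> p e'"
    have s: "?s j i \<in> T_carrier n kl ab \<inter> T_hom ?d" if ji: "j \<in> keys \<nu>" "i \<in> I" for j i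
    proof (cases "e' = (I - {i}, \<nu> - pm1 j)")
      case True
      have lt: "j < n" "i < c + 3" using ji I by auto
      have "?d = \<xi> i - \<eta> j" unfolding True e_eq Suc by (rule en_deg_step[OF fin ji(2,1)]) (simp add: dims lt)
      moreover have "?s j i = \<alpha> $$ (j, i) \<or> ?s j i = - \<alpha> $$ (j, i)"
        unfolding True lookup_single_eq by (cases "even (card {i'\<in>I. i' < i})") auto
      moreover have "- \<alpha> $$ (j, i) \<in> T_hom (\<xi> i - \<eta> j)"
        using T_hom_of_int[OF phi_Psi_entries(2)[OF hb n lt, of ab], of "- 1"] by simp
      moreover note phi_Psi_entries[OF hb n lt, of ab] subring_set_uminus[OF subring_T_carrier phi_Psi_entries(1)[OF hb n lt, of ab]]
      ultimately show ?thesis by fastforce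
    next
      case False
      then show ?thesis using K(1) by (simp add: lookup_single when_def)
    qed
    have "lookup (en_bd \<alpha> (Suc p) e) e' = (\<Sum>j\<in>keys \<nu>. \<Sum>i\<in>I. ?s j i)"
      by (simp add: e_eq en_bd_def Suc lookup_sum)
    moreover have "(\<Sum>j\<in>keys \<nu>. \<Sum>i\<in>I. ?s j i) \<in> T_carrier n kl ab"
      using s by (intro subring_set_sum[OF subring_T_carrier]) blast
    moreover have "(\<Sum>j\<in>keys \<nu>. \<Sum>i\<in>I. ?s j i) \<in> T_hom ?d" using s by (intro T_hom_sum) blast
    ultimately show ?thesis by simp
  qed
qed

lemma bg_free_complex_EN: "bg_free_complex T F"
  unfolding bg_free_complex_def
proof (intro conjI allI ballI)
  fix p e assume e: "e \<in> gens F (Suc p)"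
  then have e': "e \<in> en_gens \<alpha> (Suc p)" by (simp add: EN_def)
  show "bd F (Suc p) e \<in> piece (term_mod T F p) (gdeg F (Suc p) e)"
    using en_bd_mem[OF e'] by (auto simp: term_mod_def free_mod_def EN_def T_piece T_ops)
next
  fix p x assume "x \<in> carrier (term_mod T F (Suc p))"
  then have "keys x \<subseteq> en_gens \<alpha> (Suc p)" by (simp add: term_mod_def free_mod_def EN_def)
  then show "differential F p (differential F (Suc p) x) = 0" by (rule dEN_complex[OF dims])
qed

lemma carrier_term: "carrier (term_mod T F p) = {x. keys x \<subseteq> en_gens \<alpha> p \<and> (\<forall>e. lookup x e \<in> K)}"
  by (simp add: term_mod_def free_mod_def EN_def T_ops)

lemma en_gens_empty: "en_gens \<alpha> (Suc (Suc (Suc (Suc p)))) = {}"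
proof -
  have "card I \<le> c + 3" if "I \<subseteq> {..<c + 3}" for I using card_mono[OF _ that] by simp
  note card_le = this
  have *: "(I, \<nu>) \<notin> en_gens \<alpha> (Suc (Suc (Suc (Suc p))))" for I \<nu>
  proof
    assume "(I, \<nu>) \<in> en_gens \<alpha> (Suc (Suc (Suc (Suc p))))"
    then have "I \<subseteq> {..<c + 3}" "card I = n + Suc (Suc (Suc p))" by (simp_all only: en_gens_Suc[OF dims])
    then show False using card_le[of I] n by simp
  qed
  show ?thesis
  proof (rule equals0I)
    fix e assume "e \<in> en_gens \<alpha> (Suc (Suc (Suc (Suc p))))"
    then show False using * by (cases e) blast
  qed
qed

lemma nat_cases_4: "p = 0 \<or> p = Suc 0 \<or> p = Suc (Suc 0) \<or> p = Suc (Suc (Suc 0)) \<or> (\<exists>q. p = Suc (Suc (Suc (Suc q))))"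
  by presburger

lemma finite_gens: "finite (en_gens \<alpha> p)"
proof -
  consider "p = 0" | "p = Suc 0" | "p = Suc (Suc 0)" | "p = Suc (Suc (Suc 0))" | q where "p = Suc (Suc (Suc (Suc q)))"
    using nat_cases_4[of p] by blast
  then show ?thesis
  proof cases
    case 1
    then show ?thesis by (simp add: en_gens_def)
  qed (simp_all only: finite_en_gens[OF dims] en_gens_empty finite.emptyI)
qed

lemma EN_exact_up_to:
  assumes e: "e \<in> charts" and p: "p \<noteq> 0" and z: "keys z \<subseteq> en_gens \<alpha> p" "d p z = 0"
  shows "image_up_to (d (Suc p)) (en_gens \<alpha> (Suc p)) (chart_elem e) z"
proof -
  obtain x x' y y' where ch: "chart_vars x x' y y'" and xy: "e = (x, y)"
    using e by (fastforce simp: charts_def chart_vars_def)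
  have ce: "chart_elem e = (cst (X x * X y) :: 'k tpoly)" by (simp add: chart_elem_def emb_cst xy)
  have content: "\<exists>N. (X x * X y) ^ N \<in> lin_combs {lookup m \<kappa> | m \<kappa>.
      m \<in> max_minor \<alpha> ` {I. I \<subseteq> {..<c + 3} \<and> card I = n}}"
    by (rule minors_content[OF hb n ch]) (rule loc)
  have zero: ?thesis if "z = 0"
    unfolding image_up_to_def
    by (intro exI[of _ 0] conjI) (simp_all add: that linear_map_0[OF linear_differential])
  consider "p = Suc 0" | "p = Suc (Suc 0)" | "p = Suc (Suc (Suc 0))" | q where "p = Suc (Suc (Suc (Suc q)))"
    using p nat_cases_4[of p] by blast
  then show ?thesis
  proof cases
    case 1
    show ?thesis unfolding 1 ce by (rule EN_first_exact[OF hb n ch le content]) (use z in \<open>simp_all only: 1\<close>)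
  next
    case 2
    show ?thesis unfolding 2 ce by (rule EN_second_exact[OF hb n ch le content]) (use z in \<open>simp_all only: 2\<close>)
  next
    case 3
    have "z = 0" by (rule EN_third_exact[OF hb n ch le content]) (use z in \<open>simp_all only: 3\<close>)
    then show ?thesis by (rule zero)
  next
    case 4
    have "z = 0" using z(1) unfolding 4 en_gens_empty by simp
    then show ?thesis by (rule zero)
  qed
qed

lemma bd_mem:
  assumes "e \<in> en_gens \<alpha> (Suc p)"
  shows "keys (bd F (Suc p) e) \<subseteq> en_gens \<alpha> p" "lookup (bd F (Suc p) e) k \<in> K"
  using en_bd_mem[OF assms] by (auto simp: EN_def)

lemma submodule_cycles: "submodule_pm K (en_gens \<alpha> p) (cycles p)"
  unfolding submodule_pm_def carrier_term
proof (intro conjI ballI allI)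
  note lin = linear_differential[of F p]
  show "0 \<in> {z \<in> {x. keys x \<subseteq> en_gens \<alpha> p \<and> (\<forall>e. lookup x e \<in> K)}. d p z = 0}"
    using K(1) linear_map_0[OF lin] by simp
  fix x assume x: "x \<in> {z \<in> {x. keys x \<subseteq> en_gens \<alpha> p \<and> (\<forall>e. lookup x e \<in> K)}. d p z = 0}"
  then show "keys x \<subseteq> en_gens \<alpha> p" "lookup x e \<in> K" for e by blast+
  fix y assume y: "y \<in> {z \<in> {x. keys x \<subseteq> en_gens \<alpha> p \<and> (\<forall>e. lookup x e \<in> K)}. d p z = 0}"
  have "keys (x + y) \<subseteq> en_gens \<alpha> p" using x y Poly_Mapping.keys_add[of x y] by blast
  then show "x + y \<in> {z \<in> {x. keys x \<subseteq> en_gens \<alpha> p \<and> (\<forall>e. lookup x e \<in> K)}. d p z = 0}"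
    using x y K(3) linear_map_add[OF lin, of x y] by (simp add: lookup_add)
next
  note lin = linear_differential[of F p]
  fix r x assume r: "r \<in> K" and x: "x \<in> {z \<in> {x. keys x \<subseteq> en_gens \<alpha> p \<and> (\<forall>e. lookup x e \<in> K)}. d p z = 0}"
  have "d p (scale r x) = scale r (d p x)" using lin by (simp add: linear_map_def)
  also have "\<dots> = 0" using x by (intro poly_mapping_eqI) simp
  finally have "d p (scale r x) = 0" .
  moreover have "keys (scale r x) \<subseteq> en_gens \<alpha> p" using x keys_scale[of r x] by blast
  ultimately show "scale r x \<in> {z \<in> {x. keys x \<subseteq> en_gens \<alpha> p \<and> (\<forall>e. lookup x e \<in> K)}. d p z = 0}"
    using x K(5)[OF r] by simp
qed

lemma submodule_boundaries: "submodule_pm K (en_gens \<alpha> p) (boundaries p)"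
  unfolding submodule_pm_def
proof (intro conjI ballI allI)
  note lin = linear_differential[of F "Suc p"]
  fix z assume "z \<in> boundaries p"
  then obtain x where x: "z = d (Suc p) x" "keys x \<subseteq> en_gens \<alpha> (Suc p)" "\<And>e. lookup x e \<in> K"
    by (auto simp: carrier_term)
  have lk: "lookup z k = (\<Sum>e\<in>keys x. lookup x e * lookup (bd F (Suc p) e) k)" for k
    unfolding x(1) by (rule lookup_differential) simp_all
  show "lookup z k \<in> K" for k
    unfolding lk using x(2,3) bd_mem(2) by (intro subring_set_sum[OF sK] K(5)) blast+
  show "keys z \<subseteq> en_gens \<alpha> p"
  proof
    fix k assume "k \<in> keys z"
    then have "(\<Sum>e\<in>keys x. lookup x e * lookup (bd F (Suc p) e) k) \<noteq> 0"
      by (simp add: in_keys_iff lk)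
    then obtain e where "e \<in> keys x" "lookup x e * lookup (bd F (Suc p) e) k \<noteq> 0"
      by (rule sum.not_neutral_contains_not_neutral)
    then have "e \<in> en_gens \<alpha> (Suc p)" "k \<in> keys (bd F (Suc p) e)" using x(2) by (auto simp: in_keys_iff)
    then show "k \<in> en_gens \<alpha> p" using bd_mem(1) by blast
  qed
next
  note lin = linear_differential[of F "Suc p"] and Z = submodule_pmD[OF submodule_cycles[of "Suc p"]]
  have "0 \<in> carrier (term_mod T F (Suc p))" using Z(3) by simp
  then show "0 \<in> boundaries p" using linear_map_0[OF lin] by (metis imageI)
  show "x + y \<in> boundaries p" if xy: "x \<in> boundaries p" "y \<in> boundaries p" for x y
  proof -
    obtain a b where ab: "x = d (Suc p) a" "a \<in> carrier (term_mod T F (Suc p))" "y = d (Suc p) b" "b \<in> carrier (term_mod T F (Suc p))"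
      using xy by blast
    have "a + b \<in> carrier (term_mod T F (Suc p))"
      using ab(2,4) Poly_Mapping.keys_add[of a b] K(3) by (auto simp: carrier_term lookup_add)
    then show ?thesis unfolding ab using linear_map_add[OF lin] by (metis imageI)
  qed
  show "scale r x \<in> boundaries p" if r: "r \<in> K" and xB: "x \<in> boundaries p" for r x
  proof -
    obtain a where a: "x = d (Suc p) a" "a \<in> carrier (term_mod T F (Suc p))" using xB by blast
    have "scale r a \<in> carrier (term_mod T F (Suc p))"
      using a(2) keys_scale[of r a] K(5)[OF r] by (auto simp: carrier_term)
    moreover have "d (Suc p) (scale r a) = scale r x" using lin by (simp add: linear_map_def a)
    ultimately show ?thesis by (metis imageI)
  qed
qed

lemma retract_T: "retract (T_vars n kl ab) f \<in> K" "f \<in> K \<Longrightarrow> retract (T_vars n kl ab) f = f"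
  using retract_in[of "T_vars n kl ab" f] retract_id[of f "T_vars n kl ab"] by (auto simp: polys_in_def T_carrier_def)

lemma boundary_up_to_power:
  assumes e: "e \<in> charts" and p: "p \<noteq> 0" and z: "z \<in> cycles p"
  shows "\<exists>i. scale (chart_elem e ^ i) z \<in> boundaries p"
proof -
  let ?h = "retract (T_vars n kl ab) :: 'k tpoly \<Rightarrow> 'k tpoly"
  interpret h: comm_ring_hom ?h by (rule retract_hom)
  have "keys z \<subseteq> en_gens \<alpha> p" using z by (auto simp: carrier_term)
  from EN_exact_up_to[OF e p this] z obtain i y where
    y: "keys y \<subseteq> en_gens \<alpha> (Suc p)" "scale (chart_elem e ^ i) z = d (Suc p) y"
    unfolding image_up_to_def by blast
  have "chart_elem e ^ i \<in> K" unfolding chart_elem_def emb_cst by (rule subring_set_power[OF sK cst_T])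
  then have lk: "lookup (scale (chart_elem e ^ i) z) k \<in> K" for k
  proof -
    have "lookup z k \<in> K" using z unfolding carrier_term by blast
    then show ?thesis unfolding lookup_scale using \<open>chart_elem e ^ i \<in> K\<close> by (intro K(5))
  qed
  \<comment> \<open>The chain \<open>y\<close> may involve foreign indeterminates, while the cycle
    and the differential do not; so the retraction of \<open>y\<close> bounds the same multiple of
    \<open>z\<close>.\<close>
  have "d (Suc p) (Poly_Mapping.map ?h y) = Poly_Mapping.map ?h (d (Suc p) y)"
    by (rule differential_map[OF retract_hom]) (use y(1) bd_mem(2) retract_T(2) in auto)
  also have "\<dots> = scale (chart_elem e ^ i) z"
    unfolding y(2)[symmetric] by (rule poly_mapping_eqI) (simp only: lookup_map_hom[where h = ?h, OF h.hom_zero] retract_T(2)[OF lk])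
  finally have "scale (chart_elem e ^ i) z = d (Suc p) (Poly_Mapping.map ?h y)" by simp
  moreover have "Poly_Mapping.map ?h y \<in> carrier (term_mod T F (Suc p))"
    using keys_map_hom[where h = ?h and x = y, OF h.hom_zero] y(1) retract_T(1) unfolding carrier_term
    by (auto simp: lookup_map_hom)
  ultimately show ?thesis by blast
qed

text \<open>The elements of \<open>T\<close> that multiply cycles into boundaries form an ideal, and
  it contains a power of each of the four chart elements. Every element of the extension of
  \<open>B\<close> is a combination of these, so a high power of the extension is contained in that
  ideal.\<close>

lemma homology_annihilated:
  assumes p: "p \<noteq> 0"
  shows "\<exists>M. \<forall>b\<in>ideal_pow T (ext_ideal T B_ideal) M. b \<in> K \<and> (\<forall>z\<in>cycles p. scale b z \<in> boundaries p)"
proof -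
  note B = submodule_pmD[OF submodule_boundaries[of p]] and Z = submodule_pmD[OF submodule_cycles[of p]]
  have ceK: "chart_elem e \<in> K" for e by (simp add: chart_elem_def emb_cst cst_T)
  have "\<forall>e\<in>charts. \<exists>N. \<forall>z\<in>cycles p. scale (chart_elem e ^ N) z \<in> boundaries p"
    using uniform_exponent[OF noetherian_T sK finite_gens submodule_cycles submodule_boundaries ceK boundary_up_to_power[OF _ p]] by blast
  from bchoice[OF this] obtain N where N: "\<And>e z. e \<in> charts \<Longrightarrow> z \<in> cycles p \<Longrightarrow> scale (chart_elem e ^ N e) z \<in> boundaries p" by blast
  let ?I = "{b \<in> K. \<forall>z\<in>cycles p. scale b z \<in> boundaries p}"
  have "ideal_pow T (ext_ideal T B_ideal) (sum N charts) \<subseteq> ?I"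
  proof (rule ideal_pow_subset[where S = charts and f = chart_elem and N = N])
    have "ideal_in K ?I"
      unfolding ideal_in_def
    proof (intro conjI ballI)
      have "scale 0 z = 0" for z :: "en_basis \<Rightarrow>\<^sub>0 'k tpoly" by (rule poly_mapping_eqI) simp
      then show "0 \<in> ?I" using K(1) B(3) by simp
      show "x + y \<in> ?I" if "x \<in> ?I" "y \<in> ?I" for x y using that K(3) B(4) by (simp add: scale_add_left)
      show "r * x \<in> ?I" if "r \<in> K" "x \<in> ?I" for r x using that K(5) B(5) by (simp add: scale_scale[symmetric])
    qed auto
    then show "ideal_in (carrier T) ?I" by (simp add: T_ops)
    show "chart_elem e ^ N e \<in> ?I" if "e \<in> charts" for e
      using N[OF that] subring_set_power[OF sK ceK] by blast
    show "\<exists>a. (\<forall>e\<in>charts. a e \<in> carrier T) \<and> x = (\<Sum>e\<in>charts. a e * chart_elem e)" if "x \<in> ext_ideal T B_ideal" for x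
      using ext_B_ideal_mem[OF that] by (simp add: T_ops)
  qed (simp_all add: T_ops sK ceK charts_def)
  then show ?thesis by blast
qed

private abbreviation "cycle_mod p \<equiv> (term_mod T F p)\<lparr>carrier := cycles p, piece := (\<lambda>t. piece (term_mod T F p) t \<inter> cycles p)\<rparr>"

lemma homology_eq: "homology T F p = quot_mod (cycle_mod p) (boundaries p)"
  by (simp add: homology_def Let_def)

lemma cycle_mod_ops: "add (cycle_mod p) = (+)" "r \<odot>\<^bsub>cycle_mod p\<^esub> x = scale r x" "carrier (cycle_mod p) = cycles p"
  "piece (cycle_mod p) t = piece (term_mod T F p) t \<inter> cycles p"
  by (simp_all add: term_mod_def free_mod_def)

lemma boundaries_closed: "0 \<in> boundaries p" "\<And>x y. x \<in> boundaries p \<Longrightarrow> y \<in> boundaries p \<Longrightarrow> x + y \<in> boundaries p"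
  "\<And>x. x \<in> boundaries p \<Longrightarrow> - x \<in> boundaries p" "\<And>r x. r \<in> K \<Longrightarrow> x \<in> boundaries p \<Longrightarrow> scale r x \<in> boundaries p"
proof -
  note B = submodule_pmD[OF submodule_boundaries[of p]]
  show "0 \<in> boundaries p" "\<And>x y. x \<in> boundaries p \<Longrightarrow> y \<in> boundaries p \<Longrightarrow> x + y \<in> boundaries p"
    "\<And>r x. r \<in> K \<Longrightarrow> x \<in> boundaries p \<Longrightarrow> scale r x \<in> boundaries p" by (fact B(3), fact B(4), fact B(5))
  fix x assume "x \<in> boundaries p"
  then have "scale (- 1) x \<in> boundaries p" by (rule B(5)[OF subring_set_uminus[OF sK K(2)]])
  moreover have "scale (- 1) x = - x" by (rule poly_mapping_eqI) simp
  ultimately show "- x \<in> boundaries p" by simp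
qed

lemma homology_simps:
  "carrier (homology T F p) = coset (boundaries p) ` cycles p" "zero (homology T F p) = boundaries p"
  "coset (boundaries p) 0 = boundaries p"
  "piece (homology T F p) t = coset (boundaries p) ` (piece (term_mod T F p) t \<inter> cycles p)"
  "coset (boundaries p) x \<oplus>\<^bsub>homology T F p\<^esub> coset (boundaries p) y = coset (boundaries p) (x + y)"
  "r \<in> K \<Longrightarrow> r \<odot>\<^bsub>homology T F p\<^esub> coset (boundaries p) x = coset (boundaries p) (scale r x)"
  "coset (boundaries p) x = coset (boundaries p) y \<longleftrightarrow> x - y \<in> boundaries p"
proof -
  have sm: "r \<odot>\<^bsub>cycle_mod p\<^esub> (x + y) = r \<odot>\<^bsub>cycle_mod p\<^esub> x + r \<odot>\<^bsub>cycle_mod p\<^esub> y" for r x y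
    unfolding cycle_mod_ops by (rule scale_right_add)
  have smB: "r \<odot>\<^bsub>cycle_mod p\<^esub> x \<in> boundaries p" if "r \<in> K" "x \<in> boundaries p" for r x
    unfolding cycle_mod_ops using that by (rule boundaries_closed(4))
  note Q = cycle_mod_ops(1)[where p = p] boundaries_closed(1-3)[where p = p]
  have "carrier (quot_mod (cycle_mod p) (boundaries p)) = coset (boundaries p) ` carrier (cycle_mod p)"
    by (rule quot_mod_simps(1)[where K = K, OF Q sm smB])
  then show "carrier (homology T F p) = coset (boundaries p) ` cycles p" by (simp only: homology_eq cycle_mod_ops(3))
  show "zero (homology T F p) = boundaries p"
    unfolding homology_eq by (rule quot_mod_simps(2)[where K = K, OF Q sm smB])
  show "coset (boundaries p) 0 = boundaries p" by (simp add: coset_def)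
  have "piece (quot_mod (cycle_mod p) (boundaries p)) t = coset (boundaries p) ` piece (cycle_mod p) t"
    by (rule quot_mod_simps(4)[where K = K, OF Q sm smB])
  then show "piece (homology T F p) t = coset (boundaries p) ` (piece (term_mod T F p) t \<inter> cycles p)"
    by (simp only: homology_eq cycle_mod_ops(4))
  show "coset (boundaries p) x \<oplus>\<^bsub>homology T F p\<^esub> coset (boundaries p) y = coset (boundaries p) (x + y)"
    unfolding homology_eq by (rule quot_mod_add[where K = K, OF Q sm smB])
  show "r \<odot>\<^bsub>homology T F p\<^esub> coset (boundaries p) x = coset (boundaries p) (scale r x)" if "r \<in> K"
  proof -
    have "r \<odot>\<^bsub>quot_mod (cycle_mod p) (boundaries p)\<^esub> coset (boundaries p) x = coset (boundaries p) (r \<odot>\<^bsub>cycle_mod p\<^esub> x)"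
      by (rule quot_mod_smult[where K = K, OF Q sm smB that])
    then show ?thesis by (simp only: homology_eq cycle_mod_ops(2))
  qed
  show "coset (boundaries p) x = coset (boundaries p) y \<longleftrightarrow> x - y \<in> boundaries p"
    by (rule coset_eq_iff[OF boundaries_closed(1-3)])
qed

text \<open>The term of degree zero has the single basis element \<open>({}, 0)\<close>, whose
  coefficient identifies it with \<open>T\<close>; boundaries are then the combinations of the
  maximal minors.\<close>

lemma augmentation_boundaries:
  "(\<lambda>x. lookup x ({}, 0)) ` boundaries 0 = max_minors_ideal T \<alpha>"
proof -
  interpret T: cring T by (rule cring_T)
  let ?S = "{I. I \<subseteq> {..<c + 3} \<and> card I = n}"
  have fin: "finite ?S" by (rule finite_subset[of _ "Pow {..<c + 3}"]) auto
  have sub: "max_minor \<alpha> ` ?S \<subseteq> carrier T" using max_minor_props(2)[OF hb n] by (auto simp: T_ops)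
  have mi: "max_minors_ideal T \<alpha> = genideal T (max_minor \<alpha> ` ?S)" by (simp add: max_minors_ideal_def dims)
  have lk: "lookup (d (Suc 0) x) ({}, 0) = (\<Sum>I\<in>?S. lookup x (I, 0) * max_minor \<alpha> I)"
    if "x \<in> carrier (term_mod T F (Suc 0))" for x
  proof -
    have "lookup (d (Suc 0) x) ({}, 0) = (\<Sum>I\<in>?S. lookup x (I, 0) * minor (\<lambda>j i. \<alpha> $$ (j, i)) n I)"
      using dEN_1[OF dims, of x \<xi> \<eta>] that by (simp add: carrier_term)
    also have "\<dots> = (\<Sum>I\<in>?S. lookup x (I, 0) * max_minor \<alpha> I)"
      by (intro sum.cong refl) (simp add: max_minor_props(1)[OF hb n])
    finally show ?thesis .
  qed
  have id: "ideal (max_minors_ideal T \<alpha>) T" unfolding mi by (rule T.genideal_ideal[OF sub])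
  note I = set_of_ideal[OF T_ops(2-5) id]
  show ?thesis
  proof (intro equalityI subsetI)
    fix b assume "b \<in> (\<lambda>x. lookup x ({}, 0)) ` boundaries 0"
    then obtain x where x: "b = lookup (d (Suc 0) x) ({}, 0)" "x \<in> carrier (term_mod T F (Suc 0))" by auto
    have "lookup x (I, 0) * max_minor \<alpha> I \<in> max_minors_ideal T \<alpha>" if "I \<in> ?S" for I
    proof (rule I(4))
      show "lookup x (I, 0) \<in> carrier T" using x(2) by (simp add: carrier_term T_ops)
      show "max_minor \<alpha> I \<in> max_minors_ideal T \<alpha>" unfolding mi using T.genideal_self[OF sub] that by blast
    qed
    then show "b \<in> max_minors_ideal T \<alpha>" unfolding x(1) lk[OF x(2)] by (intro sum_closed[where J = "max_minors_ideal T \<alpha>"] I(2,3))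
  next
    let ?J = "(\<lambda>x. lookup x ({}, 0)) ` boundaries 0"
    have "ideal ?J T"
    proof (rule ideal_of_set)
      show "?J \<subseteq> carrier T" using submodule_pmD(2)[OF submodule_boundaries[of 0]] by (auto simp: T_ops)
      show "0 \<in> ?J" by (rule image_eqI[where x = 0]) (simp, rule boundaries_closed(1))
    next
      fix x y assume "x \<in> ?J" "y \<in> ?J"
      then obtain a b where ab: "x = lookup a ({}, 0)" "a \<in> boundaries 0" "y = lookup b ({}, 0)" "b \<in> boundaries 0" by blast
      have "a + b \<in> boundaries 0" by (rule boundaries_closed(2)[OF ab(2,4)])
      then show "x + y \<in> ?J" unfolding ab by (rule image_eqI[where x = "a + b", rotated]) (simp add: lookup_add)
    next
      fix r x assume r: "r \<in> carrier T" and "x \<in> ?J"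
      then obtain a where a: "x = lookup a ({}, 0)" "a \<in> boundaries 0" by blast
      have "scale r a \<in> boundaries 0" using r by (intro boundaries_closed(4)[OF _ a(2)]) (simp add: T_ops)
      then show "r * x \<in> ?J" unfolding a by (rule image_eqI[where x = "scale r a", rotated]) simp
    qed (simp_all add: T_ops sK)
    moreover have "max_minor \<alpha> ` ?S \<subseteq> ?J"
    proof (rule image_subsetI)
      fix I assume I: "I \<in> ?S"
      let ?x = "single (I, 0) 1 :: en_basis \<Rightarrow>\<^sub>0 'k tpoly"
      have x: "?x \<in> carrier (term_mod T F (Suc 0))"
        using I K(1,2) by (auto simp: carrier_term en_gens_1[OF dims] lookup_single when_def)
      have "lookup (d (Suc 0) ?x) ({}, 0) = (\<Sum>J\<in>?S. if J = I then max_minor \<alpha> J else 0)"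
        unfolding lk[OF x] by (intro sum.cong refl) (auto simp: lookup_single when_def)
      then have "max_minor \<alpha> I = lookup (d (Suc 0) ?x) ({}, 0)" using I fin by simp
      then show "max_minor \<alpha> I \<in> ?J" using x by blast
    qed
    ultimately have "max_minors_ideal T \<alpha> \<subseteq> ?J" unfolding mi by (rule T.genideal_minimal)
    then show "b \<in> ?J" if "b \<in> max_minors_ideal T \<alpha>" for b using that by blast
  qed
qed

lemma homology_0_iso: "bg_iso T (homology T F 0) (quot_mod T (max_minors_ideal T \<alpha>))"
  unfolding homology_eq augmentation_boundaries[symmetric]
proof (rule quot_mod_iso)
  let ?\<theta> = "\<lambda>x :: en_basis \<Rightarrow>\<^sub>0 'k tpoly. lookup x ({}, 0)"
  have g0: "en_gens \<alpha> 0 = {({}, 0)}" by (simp add: en_gens_def)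
  have cyc: "cycles 0 = carrier (term_mod T F 0)" by (simp add: differential_def)
  have car0: "carrier (cycle_mod 0) = carrier (term_mod T F 0)" by (rule trans[OF cycle_mod_ops(3) cyc])
  have sing: "single ({}, 0) (?\<theta> x) = x" if "keys x \<subseteq> {({}, 0)}" for x
  proof (rule poly_mapping_eqI)
    fix k
    show "lookup (single ({}, 0) (?\<theta> x)) k = lookup x k"
    proof (cases "k = ({}, 0)")
      case True
      then show ?thesis by (simp only: lookup_single_eq)
    next
      case False
      then have "k \<notin> keys x" using that by blast
      then have "lookup x k = 0" by (simp only: in_keys_iff not_not)
      moreover have "lookup (single ({}, 0) (?\<theta> x)) k = 0"
        by (rule lookup_single_not_eq[OF False[symmetric]])
      ultimately show ?thesis by (simp only:)
    qed
  qed
  have mem: "single ({}, 0) a \<in> carrier (term_mod T F 0)" if "a \<in> K" for a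
    using that K(1) by (auto simp: carrier_term g0 lookup_single when_def)
  have "boundaries 0 \<subseteq> carrier (term_mod T F 0)"
  proof (rule subsetI)
    fix x assume x: "x \<in> boundaries 0"
    show "x \<in> carrier (term_mod T F 0)"
      unfolding carrier_term[of 0] using submodule_pmD(1,2)[OF submodule_boundaries[of 0] x] by blast
  qed
  then show "boundaries 0 \<subseteq> carrier (cycle_mod 0)" by (simp only: car0)
  show "x - y \<in> carrier (cycle_mod 0)" if "x \<in> carrier (cycle_mod 0)" "y \<in> carrier (cycle_mod 0)" for x y
    using that keys_diff[of x y] K(4) unfolding car0 by (auto simp: carrier_term lookup_minus)
  show "bij_betw ?\<theta> (carrier (cycle_mod 0)) (carrier T)"
    unfolding car0
  proof (rule bij_betw_byWitness[where f' = "single ({}, 0)"])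
    show "\<forall>x\<in>carrier (term_mod T F 0). single ({}, 0) (?\<theta> x) = x"
      using sing unfolding carrier_term g0 by blast
    show "?\<theta> ` carrier (term_mod T F 0) \<subseteq> carrier T" unfolding carrier_term T_ops by blast
    show "single ({}, 0) ` carrier T \<subseteq> carrier (term_mod T F 0)" unfolding T_ops using mem by blast
  qed simp
  show "?\<theta> ` piece (cycle_mod 0) t = piece T t" for t
  proof -
    have pc: "x \<in> piece (cycle_mod 0) t \<longleftrightarrow> x \<in> carrier (term_mod T F 0) \<and> ?\<theta> x \<in> piece T t" for x
      unfolding cycle_mod_ops(4) cyc carrier_term
      by (auto simp: term_mod_def free_mod_def EN_def T_ops g0 en_deg_def differential_def)
    show ?thesis
    proof (intro equalityI subsetI)
      fix a assume a: "a \<in> piece T t"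
      then have "a \<in> K" by (simp add: T_piece)
      then have "single ({}, 0) a \<in> piece (cycle_mod 0) t"
        by (intro iffD2[OF pc] conjI mem) (simp_all only: lookup_single_eq a)
      then show "a \<in> ?\<theta> ` piece (cycle_mod 0) t" by (rule rev_image_eqI) simp
    next
      fix a assume "a \<in> ?\<theta> ` piece (cycle_mod 0) t"
      then show "a \<in> piece T t" using pc by blast
    qed
  qed
qed (simp_all only: cycle_mod_ops T_ops boundaries_closed scale_right_add lookup_add lookup_scale distrib_left)

lemma virtual_resolution_EN: "virtual_resolution T F (quot_mod T (max_minors_ideal T \<alpha>))"
  unfolding virtual_resolution_def
proof (intro conjI allI impI)
  show "bg_free_complex T F" by (rule bg_free_complex_EN)
  interpret T: cring T by (rule cring_T)
  show "bg_iso T (sat_mod T (homology T F 0)) (sat_mod T (quot_mod T (max_minors_ideal T \<alpha>)))"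
  \<comment> \<open>The homology in degree zero is isomorphic to the quotient before any saturation,
    so only the invariance of saturation under isomorphism is needed.\<close>
  proof (rule sat_mod_iso[OF homology_0_iso])
    note Z = submodule_pmD[OF submodule_cycles[of 0]]
    show "x \<oplus>\<^bsub>homology T F 0\<^esub> y \<in> carrier (homology T F 0)"
      if "x \<in> carrier (homology T F 0)" "y \<in> carrier (homology T F 0)" for x y
      using that Z(4) unfolding homology_simps(1) by (auto simp only: homology_simps(5) image_iff) blast
    show "r \<odot>\<^bsub>homology T F 0\<^esub> x \<in> carrier (homology T F 0)" if r: "r \<in> carrier T" and x: "x \<in> carrier (homology T F 0)" for r x
    proof -
      have rK: "r \<in> K" using r by (simp add: T_ops)
      obtain z where z: "x = coset (boundaries 0) z" "z \<in> cycles 0" using x unfolding homology_simps(1) by blast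
      show ?thesis unfolding z homology_simps(6)[OF rK] homology_simps(1) by (rule imageI) (rule Z(5)[OF rK z(2)])
    qed
    show "piece (homology T F 0) t \<subseteq> carrier (homology T F 0)" for t unfolding homology_simps by blast
    show "x \<otimes>\<^bsub>T\<^esub> y \<in> carrier T" if "x \<in> carrier T" "y \<in> carrier T" for x y using that by (rule T.m_closed)
    show "powers T (chart_elem e) \<subseteq> carrier T" for e
      unfolding powers_def using T.nat_pow_closed[of "chart_elem e"] by (auto simp: T_ops chart_elem_def emb_cst cst_T)
  qed
next
  fix p :: nat assume "p > 0"
  then obtain M where M: "\<And>b z. b \<in> ideal_pow T (ext_ideal T B_ideal) M \<Longrightarrow> b \<in> K"
    "\<And>b z. b \<in> ideal_pow T (ext_ideal T B_ideal) M \<Longrightarrow> z \<in> cycles p \<Longrightarrow> scale b z \<in> boundaries p"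
    using homology_annihilated[of p] by blast
  have "b \<odot>\<^bsub>homology T F p\<^esub> coset (boundaries p) z = \<zero>\<^bsub>homology T F p\<^esub>"
    if b: "b \<in> ideal_pow T (ext_ideal T B_ideal) M" and z: "z \<in> cycles p" for b z
  proof -
    have "coset (boundaries p) (scale b z) = coset (boundaries p) 0"
      unfolding homology_simps(7) using M(2)[OF b z] by simp
    then show ?thesis unfolding homology_simps(6)[OF M(1)[OF b]] homology_simps(2,3) .
  qed
  then show "\<exists>N. \<forall>b\<in>ideal_pow T (ext_ideal T B_ideal) N. \<forall>z\<in>carrier (homology T F p).
      b \<odot>\<^bsub>homology T F p\<^esub> z = \<zero>\<^bsub>homology T F p\<^esub>"
    unfolding homology_simps(1) by (intro exI[of _ M] ballI) blast
qed

end

theorem proposition4p4: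
  fixes n :: nat
    and \<phi> :: "'k::alg_closed_field rpoly mat"
    and g :: "nat \<Rightarrow> 'k rpoly"
    and kl ab :: "nat \<Rightarrow> nat \<times> nat"
    and cd :: "nat \<Rightarrow> int \<times> int"
  assumes "hilbert_burch n \<phi> g kl cd"
    and "\<And>i j. i < 3 \<Longrightarrow> j < n \<Longrightarrow> fst (kl j) \<le> fst (ab i) \<and> snd (kl j) \<le> snd (ab i)"
    and "\<And>\<pp>. primeideal \<pp> (R_ring :: ('k rpoly, 'k rpoly) bg_module) \<Longrightarrow> \<not> B_ideal \<subseteq> \<pp>
      \<Longrightarrow> ht (R_ring :: ('k rpoly, 'k rpoly) bg_module) \<pp> = 2
      \<Longrightarrow> loc_ideal (T_ring n kl ab) (ext_ideal (T_ring n kl ab) \<pp>) (FF_ideal n g kl ab)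
        = loc_ideal (T_ring n kl ab) (ext_ideal (T_ring n kl ab) \<pp>) (emb ` G_ideal n g)"
  shows "virtual_resolution (T_ring n kl ab)
    (EN (phi_Psi n \<phi> kl ab) (phi_Psi_deg n cd ab) (\<lambda>j. zdeg (kl j)))
    (quot_mod (T_ring n kl ab)
      (max_minors_ideal (T_ring n kl ab) (phi_Psi n \<phi> kl ab)))"
proof -
  have "n = Suc (n - 1)" using assms(1) by (simp add: hilbert_burch_def)
  from virtual_resolution_EN[OF assms(1) this assms(2,3)] show ?thesis .
qed

end
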